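(* For $d\in\mathbb N$ let $\mathcal L_{\mathcal N}:M(d,d)\to\mathbb R$ be $$\mathcal L_{\mathcal N}(W)=\mathbb E_{x\sim\mathcal N(0,I_d)}\Big[\Big\langle \sum_{i=1}^d w_i^{\otimes 3}-\sum_{i=1}^d e_i^{\otimes 3},\,x^{\otimes 3}\Big\rangle_F^2\Big],$$ where $w_1,\dots,w_d$ are the rows of $W$. The following families consist of critical points of $\mathcal L_{\mathcal N}$ (family 3 exists for all sufficiently large $d$), with the stated loss (value of $\mathcal L_{\mathcal N}$), orbit length $|(S_d\times S_d)W|$, and Hessian spectrum (the Hessian $\nabla^2\mathcal L_{\mathcal N}$ being a self-adjoint operator on $M(d,d)$; eigenvalues are given modulo $o(d^{-2/3})$ as $d\to\infty$, with multiplicities). 1. $\mathfrak D_1(d)=\sqrt[3]{\tfrac{3}{5d^3}\left(d+\tfrac23\right)}\;\mathcal I_{d,d}$, with isotropy group $S_d\times S_d$. Loss $\frac{48d}{5}-\frac{36}{5}-\frac{12}{5d}$; orbit length $1$. Hessian: - on the trivial component: $\frac{162\cdot 75^{1/3}}{5}d^{1/3}+\frac{144\cdot 75^{1/3}}{5}d^{-2/3}$, multiplicity $1$; - on the two components that are the standard representation of one factor of $S_d\times S_d$ tensored with the trivial representation of the other: $0$ and $\frac{18\cdot 75^{1/3}}{5}d^{1/3}-\frac{32\cdot 75^{1/3}}{5}d^{-2/3}$, each of multiplicity $d-1$; - on the component $\mathfrak s_d\otimes\mathfrak s_d$: $-\frac{72\cdot 75^{1/3}}{25}d^{1/3}-\frac{304\cdot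 75^{1/3}}{25}d^{-2/3}$, multiplicity $(d-1)^2$. 2. $\mathfrak D_I(d)=I_d$, with isotropy group $\Delta S_d$. Loss $0$; orbit length $d!$. Hessian: type $\mathfrak t$: $108$ and $18d+180$, each of multiplicity $1$; type $\mathfrak s_d$: $108$, $36$ and $18d+180$, each of multiplicity $d-1$; type $\mathfrak x_d$: $36$, multiplicity $(d-1)(d-2)/2$; type $\mathfrak y_d$: $36$, multiplicity $d(d-3)/2$. 3. A family $\mathfrak D_2(d)=\Xi_d(\xi_1(d),\dots,\xi_5(d))$ with isotropy group $\Delta(S_{d-1}\times S_1)$, where, modulo $o(d^{-4})$, $$\xi_1(d)=1-\tfrac{5}{3d^3}+\tfrac{9}{d^4},\quad \xi_2(d)=-\tfrac1{d^3}+\tfrac7{d^4},\quad \xi_3(d)=\tfrac1d-\tfrac1{d^2}+\tfrac2{d^3}+\tfrac{10}{3d^4},\quad \xi_4(d)=0,\quad \xi_5(d)=0.$$ Loss $6+\frac{18}{d}+o(d^{-1})$; orbit length $d\cdot d!$. Hessian, by isotypic components under $\Delta(S_{d-1}\times S_1)\cong S_{d-1}$: type $\mathfrak t$: $0$, $0$, $108$, $18d+18$, $18d+162$, each of multiplicity $1$; type $\mathfrak s_{d-1}$: $0$, $36$, $36$, $108$, $18d+162$, each of multiplicity $d-2$; type $\mathfrak x_{d-1}$: $36$, multiplicity $(d-2)(d-3)/2$; type $\mathfrak y_{d-1}$: $36$, multiplicity $(d-1)(d-4)/2$.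
   Context: $M(k,d)$ is the space of real $k\times d$ matrices with the Euclidean inner product, $e_i$ is the $i$-th unit vector of $\mathbb R^d$, $\mathcal I_{d,d}$ is the $d\times d$ matrix with all entries $1$, and $\langle S,T\rangle_F=\sum_{i,j,k}S_{ijk}T_{ijk}$ for order-$3$ tensors; $\mathcal N(0,I_d)$ is the standard Gaussian distribution on $\mathbb R^d$. $S_d\times S_d$ acts on $M(d,d)$ by $((\sigma_1,\sigma_2)A)_{ij}=A_{\sigma_1^{-1}(i),\sigma_2^{-1}(j)}$. The function $\mathcal L_{\mathcal N}$ is invariant under this action. The isotropy group of $A$ is its stabilizer in $S_d\times S_d$. For a subgroup $G\subseteq S_d$, $\Delta G=\{(g,g):g\in G\}$. The subgroup $S_{d-1}\times S_1\subseteq S_d$ is the stabilizer of the index $d$. Parametrization of the fixed point space $M(d,d)^{\Delta(S_{d-1}\times S_1)}$: $\Xi_d(\xi_1,\dots,\xi_5)$ is the matrix whose upper-left $(d-1)\times(d-1)$ block has diagonal entries $\xi_1$ and off-diagonal entries $\xi_2$, whose entries $(i,d)$, $i<d$, equal $\xi_3$, whose entries $(d,j)$, $j<d$, equal $\xi_4$, and whose $(d,d)$ entry equals $\xi_5$. Irreducible $S_m$-representations: $\mathfrak t$ trivial (degree $1$); $\mathfrak s_m$ standard (degree $m-1$); $\mathfrak x_m=\wedge^2\mathfrak s_m$ (degree $(m-1)(m-2)/2$); $\mathfrak y_m$ associated with the partition $(m-2,2)$ (degree $m(m-3)/2$). Under $\Delta S_d\cong S_d$, $M(d,d)\cong 2\mathfrak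 t\oplus 3\mathfrak s_d\oplus\mathfrak x_d\oplus\mathfrak y_d$; under $\Delta(S_{d-1}\times S_1)\cong S_{d-1}$, $M(d,d)\cong 5\mathfrak t\oplus 5\mathfrak s_{d-1}\oplus\mathfrak x_{d-1}\oplus\mathfrak y_{d-1}$. Under $S_d\times S_d$, $M(d,d)$ is the sum of the trivial representation, the two representations given by the standard representation of one factor and the trivial representation of the other, and the external tensor product $\mathfrak s_d\otimes\mathfrak s_d$. The Hessian at a point commutes with the isotropy group of that point and so preserves isotypic components. "Modulo $o(d^{-2/3})$" means that each eigenvalue equals the listed value plus an $o(d^{-2/3})$ term. *)

theory Defs
  imports
    "HOL-Probability.Probability"
    "HOL-Combinatorics.Permutations"
    "HOL-Library.Function_Algebras"
    "HOL-Library.Landau_Symbols"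
begin

text \<open>
  The dimension \<open>d\<close> varies inside the statement, so vectors and matrices are functions on
  natural numbers with explicit bounds. Indices run over \<open>0, \<dots>, d - 1\<close>; the last index is
  \<open>d - 1\<close>. With the pointwise vector space structure below, \<^const>\<open>span\<close>, \<^const>\<open>dim\<close>,
  \<^const>\<open>subspace\<close> and \<^const>\<open>linear\<close> are available for these functions.
\<close>

instantiation "fun" :: (type, real_vector) real_vector
begin

definition scaleR_fun :: "real \<Rightarrow> ('a \<Rightarrow> 'b) \<Rightarrow> 'a \<Rightarrow> 'b"
  where "scaleR_fun c f = (\<lambda>x. c *\<^sub>R f x)"

instance
  by standard (simp_all add: scaleR_fun_def fun_eq_iff algebra_simps)

end

type_synonym rvec = "nat \<Rightarrow> real"
type_synonym rmat = "nat \<Rightarrow> nat \<Rightarrow> real"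
type_synonym tensor3 = "nat \<Rightarrow> nat \<Rightarrow> nat \<Rightarrow> real"

text \<open>
  Entries outside the index range are \<open>0\<close>, so that equality, spans and dimensions are the
  intended ones.
\<close>

definition Mat :: "nat \<Rightarrow> nat \<Rightarrow> rmat set"
  where "Mat k d = {A. \<forall>i j. \<not> (i < k \<and> j < d) \<longrightarrow> A i j = 0}"

definition frob :: "nat \<Rightarrow> rmat \<Rightarrow> rmat \<Rightarrow> real"
  where "frob d A B = (\<Sum>i<d. \<Sum>j<d. A i j * B i j)"

definition matrix_unit :: "nat \<Rightarrow> nat \<Rightarrow> rmat"
  where "matrix_unit k l = (\<lambda>i j. if i = k \<and> j = l then 1 else 0)"

section \<open>The loss\<close>

definition unit_vec :: "nat \<Rightarrow> rvec"
  where "unit_vec i = (\<lambda>j. if j = i then 1 else 0)"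

definition tensor_cube :: "rvec \<Rightarrow> tensor3"
  where "tensor_cube w = (\<lambda>i j k. w i * w j * w k)"

definition frob3 :: "nat \<Rightarrow> tensor3 \<Rightarrow> tensor3 \<Rightarrow> real"
  where "frob3 d S T = (\<Sum>i<d. \<Sum>j<d. \<Sum>k<d. S i j k * T i j k)"

definition std_gaussian :: "nat \<Rightarrow> rvec measure"
  where "std_gaussian d = (\<Pi>\<^sub>M i\<in>{..<d}. density lborel std_normal_density)"

definition loss :: "nat \<Rightarrow> rmat \<Rightarrow> real"
  where "loss d W =
    (LINT x|std_gaussian d.
      (frob3 d ((\<Sum>i<d. tensor_cube (W i)) - (\<Sum>i<d. tensor_cube (unit_vec i)))
        (tensor_cube x))\<^sup>2)"

section \<open>Critical points and the Hessian\<close>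

definition critical_point :: "nat \<Rightarrow> (rmat \<Rightarrow> real) \<Rightarrow> rmat \<Rightarrow> bool"
  where "critical_point d f W \<longleftrightarrow>
    W \<in> Mat d d \<and>
    (\<forall>V\<in>Mat d d. ((\<lambda>t. f (W + t *\<^sub>R V)) has_real_derivative 0) (at 0))"

text \<open>
  The loss is a polynomial in the entries of the matrix, so all the derivatives below exist.
\<close>

definition partial_deriv :: "nat \<Rightarrow> nat \<Rightarrow> (rmat \<Rightarrow> real) \<Rightarrow> rmat \<Rightarrow> real"
  where "partial_deriv i j f W = deriv (\<lambda>t. f (W + t *\<^sub>R matrix_unit i j)) 0"

definition hessian :: "nat \<Rightarrow> (rmat \<Rightarrow> real) \<Rightarrow> rmat \<Rightarrow> rmat \<Rightarrow> rmat"
  where "hessian d f W V = (\<lambda>i j.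
    if i < d \<and> j < d
    then \<Sum>k<d. \<Sum>l<d. partial_deriv i j (partial_deriv k l f) W * V k l
    else 0)"

section \<open>The action of pairs of permutations\<close>

definition Sym :: "nat \<Rightarrow> (nat \<Rightarrow> nat) set"
  where "Sym d = {p. p permutes {..<d}}"

text \<open>
  No bound is needed here: permutations in \<open>Sym d\<close> fix every index outside \<open>{..<d}\<close>.
\<close>

definition act :: "(nat \<Rightarrow> nat) \<times> (nat \<Rightarrow> nat) \<Rightarrow> rmat \<Rightarrow> rmat"
  where "act g A = (\<lambda>i j. A (inv (fst g) i) (inv (snd g) j))"

definition isotropy :: "nat \<Rightarrow> rmat \<Rightarrow> ((nat \<Rightarrow> nat) \<times> (nat \<Rightarrow> nat)) set"
  where "isotropy d A = {g \<in> Sym d \<times> Sym d. act g A = A}"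

definition orbit :: "nat \<Rightarrow> rmat \<Rightarrow> rmat set"
  where "orbit d A = (\<lambda>g. act g A) ` (Sym d \<times> Sym d)"

definition Diag :: "(nat \<Rightarrow> nat) set \<Rightarrow> ((nat \<Rightarrow> nat) \<times> (nat \<Rightarrow> nat)) set"
  where "Diag G = (\<lambda>g. (g, g)) ` G"

definition Sym_fix_last :: "nat \<Rightarrow> (nat \<Rightarrow> nat) set"
  where "Sym_fix_last d = {p \<in> Sym d. p (d - 1) = d - 1}"

lemma Sym_fix_last_eq:
  assumes "d \<ge> 1"
  shows "Sym_fix_last d = Sym (d - 1)"
proof -
  have "p permutes {..<d} \<and> p (d - 1) = d - 1 \<longleftrightarrow> p permutes {..<d - 1}" for p
  proof
    assume p: "p permutes {..<d} \<and> p (d - 1) = d - 1"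
    show "p permutes {..<d - 1}"
    proof (rule permutes_superset)
      show "p permutes {..<d}" using p by simp
      show "p x = x" if "x \<in> {..<d} - {..<d - 1}" for x
      proof -
        have "x = d - 1" using that by auto
        then show ?thesis using p by simp
      qed
    qed
  next
    assume p: "p permutes {..<d - 1}"
    then have "p permutes {..<d}" by (rule permutes_subset) auto
    moreover have "p (d - 1) = d - 1" using p by (rule permutes_not_in) simp
    ultimately show "p permutes {..<d} \<and> p (d - 1) = d - 1" by simp
  qed
  then show ?thesis by (simp add: Sym_fix_last_def Sym_def)
qed

section \<open>Isotypic components\<close>

definition subrep :: "'g set \<Rightarrow> ('g \<Rightarrow> 'v \<Rightarrow> 'v) \<Rightarrow> 'v::real_vector set \<Rightarrow> 'v set \<Rightarrow> bool"
  where "subrep G a V W \<longleftrightarrow> subspace W \<and> W \<subseteq> V \<and> (\<forall>g\<in>G. a g ` W \<subseteq> W)"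

definition rep_iso ::
  "'g set \<Rightarrow> ('g \<Rightarrow> 'u \<Rightarrow> 'u) \<Rightarrow> 'u::real_vector set \<Rightarrow>
    ('g \<Rightarrow> 'v \<Rightarrow> 'v) \<Rightarrow> 'v::real_vector set \<Rightarrow> bool"
  where "rep_iso G b U a W \<longleftrightarrow>
    (\<exists>f. linear f \<and> bij_betw f U W \<and> (\<forall>g\<in>G. \<forall>u\<in>U. f (b g u) = a g (f u)))"

text \<open>
  The sum of all subrepresentations of \<open>V\<close> (with action \<open>a\<close>) isomorphic to the
  representation \<open>U\<close> (with action \<open>b\<close>).
\<close>

definition isotypic ::
  "'g set \<Rightarrow> ('g \<Rightarrow> 'v \<Rightarrow> 'v) \<Rightarrow> 'v::real_vector set \<Rightarrow>
    ('g \<Rightarrow> 'u \<Rightarrow> 'u) \<Rightarrow> 'u::real_vector set \<Rightarrow> 'v set"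
  where "isotypic G a V b U = span (\<Union>{W. subrep G a V W \<and> rep_iso G b U a W})"

definition perm_vec :: "(nat \<Rightarrow> nat) \<Rightarrow> rvec \<Rightarrow> rvec"
  where "perm_vec g u = (\<lambda>i. u (inv g i))"

definition std_rep :: "nat \<Rightarrow> rvec set"
  where "std_rep m = {u. (\<forall>i\<ge>m. u i = 0) \<and> (\<Sum>i<m. u i) = 0}"

text \<open>
  The tensor product of two spaces of vectors is realised inside the matrices,
  \<open>u \<otimes> v\<close> being the matrix with entries \<open>u i * v j\<close>; accordingly
  \<open>u \<and> v\<close> is \<open>u \<otimes> v - v \<otimes> u\<close>.
\<close>

definition outer :: "rvec \<Rightarrow> rvec \<Rightarrow> rmat"
  where "outer u v = (\<lambda>i j. u i * v j)"

definition ext_square_rep :: "nat \<Rightarrow> rmat set"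
  where "ext_square_rep m = span {outer u v - outer v u |u v. u \<in> std_rep m \<and> v \<in> std_rep m}"

definition std_tensor_std_rep :: "nat \<Rightarrow> rmat set"
  where "std_tensor_std_rep m = span {outer u v |u v. u \<in> std_rep m \<and> v \<in> std_rep m}"

text \<open>
  The Specht module of the partition \<open>(m - 2, 2)\<close>, spanned by the polytabloids. A tabloid of
  this shape is determined by its second row, the two-element set \<open>{a, b}\<close>, and is encoded as the
  symmetric matrix with entries \<open>1\<close> at \<open>(a, b)\<close> and \<open>(b, a)\<close>. The tableau with
  first row \<open>a, b, \<dots>\<close> and second row \<open>c, e\<close> has column group generated by the
  transpositions \<open>(a c)\<close> and \<open>(b e)\<close>.
\<close>

definition tabloid2 :: "nat \<Rightarrow> nat \<Rightarrow> rmat"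
  where "tabloid2 a b = matrix_unit a b + matrix_unit b a"

definition polytabloid2 :: "nat \<Rightarrow> nat \<Rightarrow> nat \<Rightarrow> nat \<Rightarrow> rmat"
  where "polytabloid2 a b c e = tabloid2 c e - tabloid2 a e - tabloid2 c b + tabloid2 a b"

definition specht2_rep :: "nat \<Rightarrow> rmat set"
  where "specht2_rep m =
    span {polytabloid2 a b c e |a b c e. {a, b, c, e} \<subseteq> {..<m} \<and> distinct [a, b, c, e]}"

text \<open>
  Components of \<open>Mat d d\<close> under the whole group \<open>Sym d \<times> Sym d\<close>. In \<open>prod_comp_st\<close> the
  first factor (permuting rows) acts by the standard representation and the second trivially,
  in \<open>prod_comp_ts\<close> it is the other way round.
\<close>

definition prod_comp_t :: "nat \<Rightarrow> rmat set"
  where "prod_comp_t d = isotypic (Sym d \<times> Sym d) act (Mat d d) (\<lambda>g x. x) (UNIV :: real set)"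

definition prod_comp_st :: "nat \<Rightarrow> rmat set"
  where "prod_comp_st d =
    isotypic (Sym d \<times> Sym d) act (Mat d d) (\<lambda>g. perm_vec (fst g)) (std_rep d)"

definition prod_comp_ts :: "nat \<Rightarrow> rmat set"
  where "prod_comp_ts d =
    isotypic (Sym d \<times> Sym d) act (Mat d d) (\<lambda>g. perm_vec (snd g)) (std_rep d)"

definition prod_comp_ss :: "nat \<Rightarrow> rmat set"
  where "prod_comp_ss d =
    isotypic (Sym d \<times> Sym d) act (Mat d d) act (std_tensor_std_rep d)"

text \<open>
  Components of \<open>Mat d d\<close> under the diagonal action of \<open>Sym m\<close>, used for \<open>m = d\<close> and for
  \<open>m = d - 1\<close>; in the latter case \<open>Sym (d - 1)\<close> is \<open>Sym_fix_last d\<close> by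
  \<open>Sym_fix_last_eq\<close>.
\<close>

definition diag_act :: "(nat \<Rightarrow> nat) \<Rightarrow> rmat \<Rightarrow> rmat"
  where "diag_act g = act (g, g)"

definition diag_comp_t :: "nat \<Rightarrow> nat \<Rightarrow> rmat set"
  where "diag_comp_t d m = isotypic (Sym m) diag_act (Mat d d) (\<lambda>g x. x) (UNIV :: real set)"

definition diag_comp_s :: "nat \<Rightarrow> nat \<Rightarrow> rmat set"
  where "diag_comp_s d m = isotypic (Sym m) diag_act (Mat d d) perm_vec (std_rep m)"

definition diag_comp_x :: "nat \<Rightarrow> nat \<Rightarrow> rmat set"
  where "diag_comp_x d m = isotypic (Sym m) diag_act (Mat d d) diag_act (ext_square_rep m)"

definition diag_comp_y :: "nat \<Rightarrow> nat \<Rightarrow> rmat set"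
  where "diag_comp_y d m = isotypic (Sym m) diag_act (Mat d d) diag_act (specht2_rep m)"

section \<open>Spectra\<close>

text \<open>
  \<open>C\<close> is invariant under \<open>H\<close>, and \<open>H\<close> restricted to \<open>C\<close> is diagonalisable with the listed
  eigenvalues and multiplicities; eigenvalues in the list may coincide, in which case their
  multiplicities add up.
\<close>

definition spectrum_on :: "(rmat \<Rightarrow> rmat) \<Rightarrow> rmat set \<Rightarrow> (real \<times> nat) list \<Rightarrow> bool"
  where "spectrum_on H C es \<longleftrightarrow>
    H ` C \<subseteq> C \<and>
    dim C = (\<Sum>(l, m)\<leftarrow>es. m) \<and>
    (\<forall>\<mu>. dim {A \<in> C. H A = \<mu> *\<^sub>R A} = (\<Sum>(l, m)\<leftarrow>es. if l = \<mu> then m else 0))"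

text \<open>
  For \<open>d \<ge> d0\<close> the spectrum of \<open>H d\<close> on \<open>C d\<close> consists of as many eigenvalues as there are
  entries in \<open>as\<close>, each of multiplicity \<open>m d\<close>, and they agree with these entries up to
  \<open>o(d powr (-2/3))\<close>.
\<close>

definition asymp_spectrum ::
  "nat \<Rightarrow> (nat \<Rightarrow> rmat \<Rightarrow> rmat) \<Rightarrow> (nat \<Rightarrow> rmat set) \<Rightarrow> (nat \<Rightarrow> nat) \<Rightarrow>
    (nat \<Rightarrow> real) list \<Rightarrow> bool"
  where "asymp_spectrum d0 H C m as \<longleftrightarrow>
    (\<exists>ls. list_all2 (\<lambda>l a. (\<lambda>d. l d - a d) \<in> o(\<lambda>d. real d powr (-2/3))) ls as \<and>
      (\<forall>d\<ge>d0. spectrum_on (H d) (C d) (map (\<lambda>l. (l d, m d)) ls)))"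

section \<open>The families\<close>

definition D1 :: "nat \<Rightarrow> rmat"
  where "D1 d = (\<lambda>i j. if i < d \<and> j < d
    then root 3 (3 / (5 * real d ^ 3) * (real d + 2/3)) else 0)"

definition DI :: "nat \<Rightarrow> rmat"
  where "DI d = (\<lambda>i j. if i < d \<and> j = i then 1 else 0)"

definition Xi :: "nat \<Rightarrow> real \<Rightarrow> real \<Rightarrow> real \<Rightarrow> real \<Rightarrow> real \<Rightarrow> rmat"
  where "Xi d x1 x2 x3 x4 x5 = (\<lambda>i j.
    if \<not> (i < d \<and> j < d) then 0
    else if i < d - 1 \<and> j < d - 1 then (if i = j then x1 else x2)
    else if i < d - 1 then x3
    else if j < d - 1 then x4
    else x5)"

end

theory Submission
  imports Defs "HOL-Real_Asymp.Real_Asymp"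
begin

text \<open>
  The Gaussian sixth moments give \<open>loss\<close> as a polynomial in the inner products of the rows of \<open>W\<close>
  with each other and with the unit vectors, namely a sum of terms
  \<open>6 (u \<bullet> v)\<^sup>3 + 9 |u|\<^sup>2 |v|\<^sup>2 (u \<bullet> v)\<close>; gradient and Hessian follow by differentiation.
  The isotypic components are found from the action of the sum of all transpositions, whose
  eigenvalues separate the irreducible representations that occur. On a component consisting of
  \<open>k\<close> copies of an irreducible representation the Hessian is a \<open>k\<close> by \<open>k\<close> matrix tensored with the
  identity. For the first two families this matrix has explicit eigenvalues.

  For the third family put \<open>e = 1 / d\<close>. After rescaling the unknowns, the critical point equations
  become a fixed point equation that depends continuously on \<open>e\<close> and is constant at \<open>e = 0\<close>, so
  Brouwer's theorem yields solutions for small \<open>e\<close>, and substituting their limits back into the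
  equations yields the expansions. The eigenvalues of the remaining 3 by 3 and 4 by 4 matrices are
  located by approximate eigenvectors: these matrices are self-adjoint for the Frobenius inner
  product, so a residual of relative size \<open>O(1 / d)\<close> forces an eigenvalue within \<open>O(1 / d)\<close>.
\<close>

section \<open>The loss in terms of inner products of the rows\<close>

text \<open>Two obstacles shape the argument. The representation theory runs inside function spaces
  whose dimension is a variable, so characters and Schur's lemma are replaced by one observation: an
  equivariant map preserves the eigenspaces of a central element of the group algebra, and solving
  the eigenvalue equation entry by entry bounds an isotypic component from above. The third family
  has no closed form. Its last row is exactly zero, which leaves three unknowns. Their exponents
  come from the equations: the last column balances at order 1/d, and this forces off-diagonal
  entries of order 1/d^3. Eliminating the unknowns in a suitable order makes the limiting map
  constant, so neither a Jacobian nor uniqueness of the branch enters; the expansions hold for every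
  solution tending to the limit point. In the spectrum of this family the eigenvalue 36 occurs twice
  in the limit within one type, so residuals of single vectors would not count multiplicities. They
  are bounded on spans of approximate eigenvectors instead, in an inner product whose weights depend
  on d.\<close>

definition dot :: "nat \<Rightarrow> rvec \<Rightarrow> rvec \<Rightarrow> real"
  where "dot d u v = (\<Sum>i<d. u i * v i)"

section \<open>Moments of linear forms in a standard Gaussian vector\<close>

lemma prob_space_std_normal: "prob_space (density lborel std_normal_density)"
  by (rule prob_space_normal_density) simp

lemma prob_space_std_gaussian: "prob_space (std_gaussian d)"
  unfolding std_gaussian_def by (rule prob_space_PiM) (rule prob_space_std_normal)

lemma distr_std_gaussian_component:
  assumes "i < d"
  shows "distr (std_gaussian d) borel (\<lambda>x. x i) = density lborel std_normal_density"
proof -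
  have "distr (std_gaussian d) (density lborel std_normal_density) (\<lambda>x. x i)
      = density lborel std_normal_density"
    unfolding std_gaussian_def
    by (rule distr_PiM_component) (use assms prob_space_std_normal in auto)
  moreover have "distr (std_gaussian d) borel (\<lambda>x. x i)
      = distr (std_gaussian d) (density lborel std_normal_density) (\<lambda>x. x i)"
    by (rule distr_cong) auto
  ultimately show ?thesis by simp
qed

lemma measurable_std_gaussian_component [measurable]:
  "i < d \<Longrightarrow> (\<lambda>x. x i) \<in> borel_measurable (std_gaussian d)"
  unfolding std_gaussian_def by measurable

lemma std_gaussian_component_distributed:
  assumes "i < d"
  shows "distributed (std_gaussian d) lborel (\<lambda>x. x i) std_normal_density"
  unfolding distributed_def
  using distr_std_gaussian_component[OF assms] assms
  by (auto cong: distr_cong)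

text \<open>The joint law of the coordinates is the product measure itself, which is the product of
  their marginal laws; this is the criterion for independence.\<close>

lemma indep_vars_std_gaussian:
  assumes "d > 0"
  shows "prob_space.indep_vars (std_gaussian d) (\<lambda>_. borel) (\<lambda>i x. x i) {..<d}"
proof -
  interpret prob_space "std_gaussian d" by (rule prob_space_std_gaussian)
  have "distr (std_gaussian d) (PiM {..<d} (\<lambda>_. borel)) (\<lambda>x. \<lambda>i\<in>{..<d}. x i)
      = distr (std_gaussian d) (std_gaussian d) (\<lambda>x. x)"
  proof (rule distr_cong)
    show "sets (PiM {..<d} (\<lambda>_. borel)) = sets (std_gaussian d)"
      unfolding std_gaussian_def by (rule sets_PiM_cong) auto
    show "(\<lambda>i\<in>{..<d}. x i) = x" if "x \<in> space (std_gaussian d)" for x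
      using that unfolding std_gaussian_def space_PiM by (auto simp: PiE_def extensional_def)
  qed simp
  also have "\<dots> = PiM {..<d} (\<lambda>i. distr (std_gaussian d) borel (\<lambda>x. x i))"
    unfolding distr_id std_gaussian_def
    by (rule PiM_cong) (use distr_std_gaussian_component in \<open>auto simp: std_gaussian_def\<close>)
  finally show ?thesis
    by (subst indep_vars_iff_distr_eq_PiM') (use assms in auto)
qed

text \<open>\<open>dot d u x\<close> is a sum of independent centred normal variables, hence normal
  with variance \<open>dot d u u\<close>, and the sixth moment of a centred normal variable is 15
  times the cube of its variance.\<close>

lemma std_gaussian_dot_sixth_moment:
  shows "integrable (std_gaussian d) (\<lambda>x. dot d u x ^ 6)" (is ?int)
    and "(LINT x|std_gaussian d. dot d u x ^ 6) = 15 * dot d u u ^ 3" (is ?eq)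
proof -
  interpret prob_space "std_gaussian d" by (rule prob_space_std_gaussian)
  \<comment> \<open>Zero coefficients are dropped because a degenerate summand has no normal
    density; if none remain, both sides vanish.\<close>
  define I where "I = {i. i < d \<and> u i \<noteq> 0}"
  have [simp]: "finite I" and Isub: "I \<subseteq> {..<d}" by (auto simp: I_def)
  have dot_I: "dot d u x = (\<Sum>i\<in>I. u i * x i)" for x
    unfolding dot_def by (rule sum.mono_neutral_right) (auto simp: I_def)
  have "?int \<and> ?eq"
  proof (cases "I = {}")
    case True
    then have "dot d u x = 0" for x by (simp add: dot_I)
    then show ?thesis by simp
  next
    case False
    then have "d > 0" by (auto simp: I_def)
    have ind: "indep_vars (\<lambda>_. borel) (\<lambda>i x. u i * x i) I"
      using indep_vars_compose2[OF indep_vars_std_gaussian[OF \<open>d > 0\<close>], of "\<lambda>i x. u i * x" "\<lambda>_. borel"]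
      by (auto intro: indep_vars_subset[OF _ Isub])
    define s where "s = sqrt (dot d u u)"
    have duu: "dot d u u = (\<Sum>i\<in>I. (u i)\<^sup>2)" by (simp add: dot_I power2_eq_square)
    have "dot d u u > 0"
      unfolding duu using False by (intro sum_pos) (auto simp: I_def)
    then have s: "s > 0" by (simp add: s_def)
    have "distributed (std_gaussian d) lborel (\<lambda>x. u i * x i) (normal_density 0 \<bar>u i\<bar>)"
      if "i \<in> I" for i
      using normal_density_affine[OF std_gaussian_component_distributed, where i1 = i and \<alpha> = "u i" and \<beta> = 0] that
      by (auto simp: I_def)
    then have "distributed (std_gaussian d) lborel (\<lambda>x. \<Sum>i\<in>I. u i * x i)
       (normal_density (\<Sum>i\<in>I. 0) (sqrt (\<Sum>i\<in>I. \<bar>u i\<bar>\<^sup>2)))"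
      by (intro sum_indep_normal ind) (use False in \<open>auto simp: I_def\<close>)
    then have D: "distributed (std_gaussian d) lborel (\<lambda>x. dot d u x) (normal_density 0 s)"
      by (simp add: s_def duu[unfolded dot_I] dot_I)
    \<comment> \<open>The number 15 is \<open>6! / (2^3 * 3!)\<close>.\<close>
    have mom: "has_bochner_integral lborel (\<lambda>x. normal_density 0 s x * x ^ 6) (15 * s ^ 6)"
      using normal_moment_even[OF s, of 0 3] s
      by (simp add: fact_numeral field_simps)
    have "?int"
      using distributed_integrable[OF D, of "\<lambda>x. x ^ 6"] integrable.intros[OF mom] by simp
    moreover have "?eq"
      using distributed_integral[OF D, of "\<lambda>x. x ^ 6"] has_bochner_integral_integral_eq[OF mom]
        \<open>dot d u u > 0\<close> power_mult[of s 2 3] by (simp add: s_def)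
    ultimately show ?thesis ..
  qed
  then show ?int ?eq by auto
qed

text \<open>The mixed moment is read off from sixth powers, since
  \<open>360 a\<^sup>3 b\<^sup>3 = 17 ((a + b)\<^sup>6 - (a - b)\<^sup>6) - ((a + 2 b)\<^sup>6 - (a - 2 b)\<^sup>6 + (2 a + b)\<^sup>6 - (2 a - b)\<^sup>6) / 2\<close>.\<close>

definition kern :: "nat \<Rightarrow> rvec \<Rightarrow> rvec \<Rightarrow> real"
  where "kern d u v = 6 * dot d u v ^ 3 + 9 * dot d u u * dot d v v * dot d u v"

lemma dot_commute: "dot d u v = dot d v u"
  by (simp add: dot_def mult.commute)

lemma dot_add_left: "dot d (u + v) w = dot d u w + dot d v w"
  by (simp add: dot_def distrib_right sum.distrib)

lemma dot_scale_left: "dot d (c *\<^sub>R u) w = c * dot d u w"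
  by (simp add: dot_def scaleR_fun_def sum_distrib_left mult.assoc)

lemma dot_add_right: "dot d w (u + v) = dot d w u + dot d w v"
  by (simp add: dot_def distrib_left sum.distrib)

lemma dot_scale_right: "dot d w (c *\<^sub>R u) = c * dot d w u"
  by (simp add: dot_def scaleR_fun_def sum_distrib_left mult.left_commute)

lemmas dot_linear = dot_add_left dot_scale_left dot_add_right dot_scale_right

text \<open>The two terms of \<open>kern\<close> are Wick's pairings of three factors
  \<open>dot d u x\<close> with three factors \<open>dot d v x\<close>: 6 of the 15 pairings join
  every \<open>u\<close> to a \<open>v\<close>, the other 9 consist of one pair of \<open>u\<close>,
  one pair of \<open>v\<close> and one mixed pair.\<close>

lemma std_gaussian_mixed_moment:
  shows "integrable (std_gaussian d) (\<lambda>x. dot d u x ^ 3 * dot d v x ^ 3)" (is ?int)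
    and "(LINT x|std_gaussian d. dot d u x ^ 3 * dot d v x ^ 3) = kern d u v" (is ?eq)
proof -
  define S where "S = (\<lambda>p q x. dot d (p *\<^sub>R u + q *\<^sub>R v) x ^ 6)"
  have S: "S p q x = (p * dot d u x + q * dot d v x) ^ 6" for p q x
    by (simp add: S_def dot_linear)
  \<comment> \<open>The differences of sixth powers keep only the terms \<open>a^5 b\<close>,
    \<open>a^3 b^3\<close> and \<open>a b^5\<close>; the weights 17 and 1/2 cancel the first and the
    last.\<close>
  have poly: "dot d u x ^ 3 * dot d v x ^ 3 =
      (17 * (S 1 1 x - S 1 (-1) x) - (S 1 2 x - S 1 (-2) x + S 2 1 x - S 2 (-1) x) / 2) / 360" for x
    unfolding S by algebra
  have int: "integrable (std_gaussian d) (S p q)" for p q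
    unfolding S_def by (rule std_gaussian_dot_sixth_moment)
  have val: "(LINT x|std_gaussian d. S p q x)
      = 15 * (p^2 * dot d u u + 2 * p * q * dot d u v + q^2 * dot d v v) ^ 3" for p q
    unfolding S_def std_gaussian_dot_sixth_moment
    by (simp add: dot_linear dot_commute[of d v u] power2_eq_square algebra_simps)
  show ?int
    unfolding poly by (intro integrable_divide_zero Bochner_Integration.integrable_diff
      Bochner_Integration.integrable_add integrable_mult_right int)
  have "(LINT x|std_gaussian d. dot d u x ^ 3 * dot d v x ^ 3) =
     (17 * (15 * (dot d u u + 2 * dot d u v + dot d v v) ^ 3 - 15 * (dot d u u - 2 * dot d u v + dot d v v) ^ 3)
      - (15 * (dot d u u + 4 * dot d u v + 4 * dot d v v) ^ 3 - 15 * (dot d u u - 4 * dot d u v + 4 * dot d v v) ^ 3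
       + 15 * (4 * dot d u u + 4 * dot d u v + dot d v v) ^ 3 - 15 * (4 * dot d u u - 4 * dot d u v + dot d v v) ^ 3) / 2) / 360"
    unfolding poly by (simp add: int val)
  also have "\<dots> = kern d u v"
    unfolding kern_def by algebra
  finally show ?eq .
qed

section \<open>Expansion of the squared tensor pairing into mixed moments\<close>

lemma frob3_tensor_cube: "frob3 d (tensor_cube w) (tensor_cube x) = dot d w x ^ 3"
  by (simp add: frob3_def tensor_cube_def dot_def power3_eq_cube sum_product sum_distrib_left
      sum_distrib_right mult_ac)

lemma frob3_sum: "frob3 d (sum F K) X = (\<Sum>i\<in>K. frob3 d (F i) X)"
proof -
  have add: "frob3 d (A + B) X = frob3 d A X + frob3 d B X" for A B
    by (simp add: frob3_def distrib_right sum.distrib)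
  have zero: "frob3 d 0 X = 0"
    by (simp add: frob3_def)
  show ?thesis
    by (induction K rule: infinite_finite_induct)
      (simp_all only: sum.insert sum.empty sum.infinite add zero simp_thms)
qed

lemma frob3_diff: "frob3 d (A - B) X = frob3 d A X - frob3 d B X"
  by (simp add: frob3_def left_diff_distrib sum_subtractf)

theorem loss_eq:
  "loss d W = (\<Sum>i<d. \<Sum>j<d. kern d (W i) (W j)) - 2 * (\<Sum>i<d. \<Sum>j<d. kern d (W i) (unit_vec j))
     + (\<Sum>i<d. \<Sum>j<d. kern d (unit_vec i) (unit_vec j))"
proof -
  define a where "a = (\<lambda>x i. dot d (W i) x ^ 3)"
  define e where "e = (\<lambda>x i. dot d (unit_vec i) x ^ 3)"
  have "(sum (a x) {..<d} - sum (e x) {..<d})\<^sup>2 = (\<Sum>i<d. \<Sum>j<d. a x i * a x j)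
      - 2 * (\<Sum>i<d. \<Sum>j<d. a x i * e x j) + (\<Sum>i<d. \<Sum>j<d. e x i * e x j)" for x
    by (simp add: power2_eq_square left_diff_distrib right_diff_distrib sum_product
        sum.swap[of "\<lambda>i j. e x i * a x j"]) (simp add: mult.commute)
  then have "loss d W = (LINT x|std_gaussian d. (\<Sum>i<d. \<Sum>j<d. a x i * a x j)
      - 2 * (\<Sum>i<d. \<Sum>j<d. a x i * e x j) + (\<Sum>i<d. \<Sum>j<d. e x i * e x j))"
    by (simp add: loss_def frob3_sum frob3_diff frob3_tensor_cube a_def e_def)
  also have "\<dots> = (\<Sum>i<d. \<Sum>j<d. kern d (W i) (W j)) - 2 * (\<Sum>i<d. \<Sum>j<d. kern d (W i) (unit_vec j))
     + (\<Sum>i<d. \<Sum>j<d. kern d (unit_vec i) (unit_vec j))"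
    by (simp add: a_def e_def std_gaussian_mixed_moment)
  finally show ?thesis .
qed

section \<open>Derivatives of the loss\<close>

lemma scaleR_fun_apply [simp]: "(c *\<^sub>R f) x = c *\<^sub>R f x"
  by (simp add: scaleR_fun_def)

lemma sum_fun_apply: "(\<Sum>i\<in>I. f i) x = (\<Sum>i\<in>I. f i x)"
  by (induction I rule: infinite_finite_induct) simp_all

text \<open>\<open>kern1 d u v h\<close> is the derivative of \<open>kern d u v\<close> in its first
  argument along \<open>h\<close>; \<open>kern11\<close> and \<open>kern12\<close> are the
  derivatives of \<open>kern1\<close> in the first and in the second argument. Symmetry of
  \<open>kern\<close> supplies the remaining ones.\<close>

definition kern1 :: "nat \<Rightarrow> rvec \<Rightarrow> rvec \<Rightarrow> rvec \<Rightarrow> real"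
  where "kern1 d u v h = 18 * (dot d u v)\<^sup>2 * dot d v h + 18 * dot d v v * dot d u v * dot d u h
    + 9 * dot d u u * dot d v v * dot d v h"

definition kern11 :: "nat \<Rightarrow> rvec \<Rightarrow> rvec \<Rightarrow> rvec \<Rightarrow> rvec \<Rightarrow> real"
  where "kern11 d u v h k = 36 * dot d u v * dot d v h * dot d v k
    + 18 * dot d v v * (dot d v k * dot d u h + dot d v h * dot d u k + dot d u v * dot d h k)"

definition kern12 :: "nat \<Rightarrow> rvec \<Rightarrow> rvec \<Rightarrow> rvec \<Rightarrow> rvec \<Rightarrow> real"
  where "kern12 d u v h k = 36 * dot d u v * dot d u k * dot d v h + 18 * (dot d u v)\<^sup>2 * dot d h k
    + 36 * dot d v k * dot d u v * dot d u h + 18 * dot d v v * dot d u k * dot d u h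
    + 18 * dot d u u * dot d v k * dot d v h + 9 * dot d u u * dot d v v * dot d h k"

lemma kern_has_derivative:
  "((\<lambda>t. kern d (u + t *\<^sub>R h) (v + t *\<^sub>R k)) has_real_derivative kern1 d u v h + kern1 d v u k) (at 0)"
  unfolding kern_def dot_linear
  by (rule derivative_eq_intros refl)+
    (simp add: kern1_def dot_commute[of d v u] dot_commute[of d h u] dot_commute[of d h v]
      dot_commute[of d k u] dot_commute[of d k v] power2_eq_square algebra_simps)

lemma kern1_has_derivative:
  "((\<lambda>t. kern1 d (u + t *\<^sub>R h') (v + t *\<^sub>R k') h) has_real_derivative
     kern11 d u v h h' + kern12 d u v h k') (at 0)"
  unfolding kern1_def dot_linear
  by (rule derivative_eq_intros refl)+
    (simp add: kern11_def kern12_def dot_commute[of d v u] dot_commute[of d h' u] dot_commute[of d h' v]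
      dot_commute[of d k' u] dot_commute[of d k' v] dot_commute[of d h' h] dot_commute[of d k' h]
      power2_eq_square algebra_simps)

text \<open>The factor 2 is common to both sums: in the first, a row occurs as either argument of
  the symmetric \<open>kern\<close>; in the second, 2 is the coefficient of the cross term of the
  loss.\<close>

definition dloss :: "nat \<Rightarrow> rmat \<Rightarrow> rmat \<Rightarrow> real"
  where "dloss d W X = 2 * ((\<Sum>i<d. \<Sum>j<d. kern1 d (W i) (W j) (X i))
    - (\<Sum>i<d. \<Sum>j<d. kern1 d (W i) (unit_vec j) (X i)))"

definition ddloss :: "nat \<Rightarrow> rmat \<Rightarrow> rmat \<Rightarrow> rmat \<Rightarrow> real"
  where "ddloss d W X Y = 2 * ((\<Sum>i<d. \<Sum>j<d. kern11 d (W i) (W j) (X i) (Y i) + kern12 d (W i) (W j) (X i) (Y j))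
    - (\<Sum>i<d. \<Sum>j<d. kern11 d (W i) (unit_vec j) (X i) (Y i)))"

lemma loss_has_derivative:
  "((\<lambda>t. loss d (W + t *\<^sub>R X)) has_real_derivative dloss d W X) (at 0)"
proof -
  have k0: "((\<lambda>t. kern d (u + t *\<^sub>R h) v) has_real_derivative kern1 d u v h) (at 0)" for u h v
  proof -
    have "(\<lambda>t. kern d (u + t *\<^sub>R h) v) = (\<lambda>t. kern d (u + t *\<^sub>R h) (v + t *\<^sub>R 0))"
      by simp
    then show ?thesis
      using kern_has_derivative[of d u h v 0] by (simp add: kern1_def dot_def)
  qed
  have "((\<lambda>t. (\<Sum>i<d. \<Sum>j<d. kern d (W i + t *\<^sub>R X i) (W j + t *\<^sub>R X j))
        - 2 * (\<Sum>i<d. \<Sum>j<d. kern d (W i + t *\<^sub>R X i) (unit_vec j))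
        + (\<Sum>i<d. \<Sum>j<d. kern d (unit_vec i) (unit_vec j))) has_real_derivative
      (\<Sum>i<d. \<Sum>j<d. kern1 d (W i) (W j) (X i) + kern1 d (W j) (W i) (X j))
        - 2 * (\<Sum>i<d. \<Sum>j<d. kern1 d (W i) (unit_vec j) (X i)) + 0) (at 0)"
    by (intro DERIV_add DERIV_diff DERIV_cmult DERIV_sum kern_has_derivative k0 DERIV_const)
  moreover have "(\<Sum>i<d. \<Sum>j<d. kern1 d (W i) (W j) (X i) + kern1 d (W j) (W i) (X j))
      = 2 * (\<Sum>i<d. \<Sum>j<d. kern1 d (W i) (W j) (X i))"
    using sum.swap[of "\<lambda>i j. kern1 d (W j) (W i) (X j)" "{..<d}" "{..<d}"]
    by (simp add: sum.distrib)
  ultimately show ?thesis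
    by (simp only: loss_eq plus_fun_apply scaleR_fun_apply dloss_def right_diff_distrib add_0_right)
qed

lemma dloss_has_derivative:
  "((\<lambda>t. dloss d (W + t *\<^sub>R Y) X) has_real_derivative ddloss d W X Y) (at 0)"
proof -
  have k0: "((\<lambda>t. kern1 d (u + t *\<^sub>R h) v k) has_real_derivative kern11 d u v k h) (at 0)" for u h v k
  proof -
    have "(\<lambda>t. kern1 d (u + t *\<^sub>R h) v k) = (\<lambda>t. kern1 d (u + t *\<^sub>R h) (v + t *\<^sub>R 0) k)"
      by simp
    then show ?thesis
      using kern1_has_derivative[of d u h v 0] by (simp add: kern12_def dot_def)
  qed
  have "((\<lambda>t. 2 * ((\<Sum>i<d. \<Sum>j<d. kern1 d (W i + t *\<^sub>R Y i) (W j + t *\<^sub>R Y j) (X i))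
        - (\<Sum>i<d. \<Sum>j<d. kern1 d (W i + t *\<^sub>R Y i) (unit_vec j) (X i)))) has_real_derivative
      ddloss d W X Y) (at 0)"
    unfolding ddloss_def
    by (intro DERIV_diff DERIV_cmult DERIV_sum kern1_has_derivative k0)
  then show ?thesis
    by (simp only: dloss_def plus_fun_apply scaleR_fun_apply)
qed

lemma critical_point_loss_iff:
  "critical_point d (loss d) W \<longleftrightarrow> W \<in> Mat d d \<and> (\<forall>V\<in>Mat d d. dloss d W V = 0)"
  unfolding critical_point_def using loss_has_derivative DERIV_unique by metis

lemma partial_deriv_loss: "partial_deriv k l (loss d) W = dloss d W (matrix_unit k l)"
  unfolding partial_deriv_def by (rule DERIV_imp_deriv) (rule loss_has_derivative)

lemma partial_deriv_partial_deriv_loss: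
  "partial_deriv i j (partial_deriv k l (loss d)) W = ddloss d W (matrix_unit k l) (matrix_unit i j)"
  unfolding partial_deriv_def[of i j] partial_deriv_loss
  by (rule DERIV_imp_deriv) (rule dloss_has_derivative)

lemma matrix_unit_row: "matrix_unit k l i = (if i = k then unit_vec l else 0)"
  by (auto simp: matrix_unit_def unit_vec_def)

lemma dot_zero [simp]: "dot d 0 v = 0" "dot d v 0 = 0"
  by (simp_all add: dot_def)

lemma dot_unit_vec_left: "dot d (unit_vec j) v = (if j < d then v j else 0)"
proof -
  have "dot d (unit_vec j) v = (\<Sum>i<d. if i = j then v i else 0)"
    unfolding dot_def unit_vec_def by (rule sum.cong) auto
  then show ?thesis by simp
qed

lemma dot_unit_vec_right: "dot d v (unit_vec j) = (if j < d then v j else 0)"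
  by (simp add: dot_commute[of d v] dot_unit_vec_left)

lemma kern11_zero [simp]: "kern11 d u v 0 k = 0" "kern11 d u v h 0 = 0"
  by (simp_all add: kern11_def)

lemma kern12_zero [simp]: "kern12 d u v 0 k = 0" "kern12 d u v h 0 = 0"
  by (simp_all add: kern12_def)

lemma kern11_commute: "kern11 d u v h k = kern11 d u v k h"
  by (simp add: kern11_def dot_commute[of d h k])

lemma kern12_commute: "kern12 d u v h k = kern12 d v u k h"
  by (simp add: kern12_def dot_commute[of d h k] dot_commute[of d u v])

lemma ddloss_commute: "ddloss d W X Y = ddloss d W Y X"
proof -
  have "(\<Sum>i<d. \<Sum>j<d. kern12 d (W i) (W j) (X i) (Y j)) = (\<Sum>i<d. \<Sum>j<d. kern12 d (W i) (W j) (Y i) (X j))"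
    by (subst sum.swap) (simp add: kern12_commute[of d "W _" "W _" "X _"])
  then show ?thesis
    by (simp add: ddloss_def sum.distrib kern11_commute[of d "W _" _ "X _"])
qed

lemma ddloss_add: "ddloss d W (X + X') Y = ddloss d W X Y + ddloss d W X' Y"
proof -
  have "kern11 d u v (h + h') k = kern11 d u v h k + kern11 d u v h' k"
    "kern12 d u v (h + h') k = kern12 d u v h k + kern12 d u v h' k" for u v h h' k
    by (simp_all only: kern11_def kern12_def dot_linear) (simp_all add: algebra_simps)
  then show ?thesis
    unfolding ddloss_def plus_fun_apply by (simp add: sum.distrib algebra_simps)
qed

lemma ddloss_scaleR: "ddloss d W (c *\<^sub>R X) Y = c * ddloss d W X Y"
proof -
  have "kern11 d u v (c *\<^sub>R h) k = c * kern11 d u v h k"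
    "kern12 d u v (c *\<^sub>R h) k = c * kern12 d u v h k" for u v h k
    by (simp_all only: kern11_def kern12_def dot_linear) (simp_all add: algebra_simps)
  then show ?thesis
    by (simp only: ddloss_def scaleR_fun_apply distrib_left[symmetric] sum_distrib_left[symmetric]
        right_diff_distrib[symmetric] mult.left_commute[of 2 c])
qed

lemma ddloss_sum: "ddloss d W (\<Sum>i\<in>I. F i) Y = (\<Sum>i\<in>I. ddloss d W (F i) Y)"
proof -
  have "ddloss d W 0 Y = 0"
    using ddloss_scaleR[of d W 0 0 Y] by simp
  then show ?thesis
    by (induction I rule: infinite_finite_induct) (simp_all only: sum.insert sum.empty sum.infinite ddloss_add simp_thms)
qed

text \<open>Only entries with both indices below \<open>d\<close> enter the inner products, so a
  matrix may be replaced by its expansion in matrix units even if it has entries outside the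
  range.\<close>

lemma ddloss_cong:
  assumes "\<And>i j. i < d \<Longrightarrow> j < d \<Longrightarrow> X i j = X' i j"
  shows "ddloss d W X Y = ddloss d W X' Y"
proof -
  have "dot d v (X i) = dot d v (X' i)" if "i < d" for v i
    unfolding dot_def by (rule sum.cong) (use assms that in auto)
  moreover from this have "dot d (X i) v = dot d (X' i) v" if "i < d" for v i
    using that by (simp add: dot_commute[of d _ v])
  ultimately show ?thesis
    unfolding ddloss_def kern11_def kern12_def by simp
qed

lemma hessian_loss:
  assumes "i < d" "j < d"
  shows "hessian d (loss d) W V i j = ddloss d W V (matrix_unit i j)"
proof -
  define V' where "V' = (\<Sum>k<d. \<Sum>l<d. V k l *\<^sub>R matrix_unit k l)"
  have V': "V' i j = V i j" if "i < d" "j < d" for i j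
  proof -
    have "V' i j = (\<Sum>k<d. \<Sum>l<d. V k l * matrix_unit k l i j)"
      unfolding V'_def by (simp add: sum_fun_apply)
    also have "\<dots> = (\<Sum>k<d. \<Sum>l<d. if l = j then (if k = i then V k l else 0) else 0)"
      by (intro sum.cong) (auto simp: matrix_unit_def)
    finally show ?thesis using that by simp
  qed
  have "hessian d (loss d) W V i j
      = (\<Sum>k<d. \<Sum>l<d. ddloss d W (matrix_unit k l) (matrix_unit i j) * V k l)"
    using assms by (simp add: hessian_def partial_deriv_partial_deriv_loss)
  also have "\<dots> = ddloss d W V' (matrix_unit i j)"
    by (simp only: V'_def ddloss_sum ddloss_scaleR mult.commute)
  also have "\<dots> = ddloss d W V (matrix_unit i j)"
    by (rule ddloss_cong) (rule V')
  finally show ?thesis .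
qed

lemma frob_hessian_loss: "frob d (hessian d (loss d) W A) B = ddloss d W A B"
proof -
  have "frob d (hessian d (loss d) W A) B = (\<Sum>i<d. \<Sum>j<d. B i j * ddloss d W A (matrix_unit i j))"
    unfolding frob_def by (simp add: hessian_loss mult.commute)
  also have "\<dots> = (\<Sum>i<d. \<Sum>j<d. ddloss d W (matrix_unit i j) A * B i j)"
    by (simp add: ddloss_commute[of d W A] mult.commute)
  also have "\<dots> = ddloss d W (\<Sum>i<d. \<Sum>j<d. B i j *\<^sub>R matrix_unit i j) A"
    by (simp only: ddloss_sum ddloss_scaleR mult.commute)
  also have "\<dots> = ddloss d W B A"
  proof (rule ddloss_cong)
    fix i j assume "i < d" "j < d"
    have "(\<Sum>k<d. \<Sum>l<d. B k l *\<^sub>R matrix_unit k l) i j = (\<Sum>k<d. \<Sum>l<d. B k l * matrix_unit k l i j)"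
      by (simp add: sum_fun_apply)
    also have "\<dots> = (\<Sum>k<d. \<Sum>l<d. if l = j then (if k = i then B k l else 0) else 0)"
      by (intro sum.cong) (auto simp: matrix_unit_def)
    finally show "(\<Sum>k<d. \<Sum>l<d. B k l *\<^sub>R matrix_unit k l) i j = B i j"
      using \<open>i < d\<close> \<open>j < d\<close> by simp
  qed
  finally show ?thesis by (simp add: ddloss_commute)
qed

lemma hessian_loss_self_adjoint:
  "frob d (hessian d (loss d) W A) B = frob d A (hessian d (loss d) W B)"
proof -
  have "frob d A B = frob d B A" for A B
    by (simp add: frob_def mult.commute)
  then show ?thesis
    by (metis frob_hessian_loss ddloss_commute)
qed

text \<open>Testing against \<open>matrix_unit i j\<close> leaves one nonzero row in the second
  direction: terms that differentiate one row twice survive for row \<open>i\<close> only, and in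
  the mixed terms the second row is fixed to \<open>i\<close>, so each double sum collapses to a
  single one.\<close>

lemma hessian_loss_entry:
  assumes "i < d" "j < d"
  shows "hessian d (loss d) W V i j = 2 * ((\<Sum>b<d. kern11 d (W i) (W b) (V i) (unit_vec j))
     + (\<Sum>b<d. kern12 d (W b) (W i) (V b) (unit_vec j))
     - (\<Sum>b<d. kern11 d (W i) (unit_vec b) (V i) (unit_vec j)))"
proof -
  have *: "(\<Sum>a<d. \<Sum>b<d. F a b (matrix_unit i j a)) = (\<Sum>b<d. F i b (unit_vec j))"
    if "\<And>a b. F a b 0 = 0" for F :: "nat \<Rightarrow> nat \<Rightarrow> rvec \<Rightarrow> real"
  proof -
    have "(\<Sum>a<d. \<Sum>b<d. F a b (matrix_unit i j a)) = (\<Sum>a<d. if a = i then \<Sum>b<d. F a b (unit_vec j) else 0)"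
      by (intro sum.cong) (auto simp: matrix_unit_row that)
    then show ?thesis using assms by simp
  qed
  have "(\<Sum>a<d. \<Sum>b<d. kern12 d (W a) (W b) (V a) (matrix_unit i j b))
      = (\<Sum>b<d. kern12 d (W b) (W i) (V b) (unit_vec j))"
    by (subst sum.swap) (rule *[where F = "\<lambda>b a k. kern12 d (W a) (W b) (V a) k"], simp)
  then show ?thesis
    using assms *[of "\<lambda>a b k. kern11 d (W a) (W b) (V a) k"]
      *[of "\<lambda>a b k. kern11 d (W a) (unit_vec b) (V a) k"]
    by (simp add: hessian_loss ddloss_def sum.distrib)
qed

section \<open>Spectra on isotypic components\<close>

text \<open>Independence is stated for a family and not for its image: a repeated vector makes the
  family dependent, so the size of the index set is the dimension of the span.\<close>

definition independent_family :: "'i set \<Rightarrow> ('i \<Rightarrow> 'a::real_vector) \<Rightarrow> bool"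
  where "independent_family I b \<longleftrightarrow>
    (\<forall>c. (\<Sum>i\<in>I. c i *\<^sub>R b i) = 0 \<longrightarrow> (\<forall>i\<in>I. c i = 0))"

lemma independent_familyD:
  "independent_family I b \<Longrightarrow> (\<Sum>i\<in>I. c i *\<^sub>R b i) = 0 \<Longrightarrow> i \<in> I \<Longrightarrow> c i = 0"
  by (auto simp: independent_family_def)

lemma independent_family_imp:
  assumes "finite I" "independent_family I b"
  shows "inj_on b I" "independent (b ` I)"
proof -
  show inj: "inj_on b I"
  proof (rule inj_onI, rule ccontr)
    fix i j assume ij: "i \<in> I" "j \<in> I" "b i = b j" "i \<noteq> j"
    have "(\<Sum>k\<in>I. (if k = i then 1 else if k = j then -1 else 0) *\<^sub>R b k) = b i - b j"
    proof -
      have "(\<Sum>k\<in>I. (if k = i then 1 else if k = j then -1 else 0) *\<^sub>R b k)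
          = (\<Sum>k\<in>I. (if k = i then b k else 0) - (if k = j then b k else 0))"
        by (rule sum.cong) (use ij in auto)
      then show ?thesis using assms(1) ij by (simp add: sum_subtractf)
    qed
    then have "(1::real) = 0"
      using independent_familyD[OF assms(2), of "\<lambda>k. if k = i then 1 else if k = j then -1 else 0" i] ij
      by simp
    then show False by simp
  qed
  show "independent (b ` I)"
  proof
    assume "dependent (b ` I)"
    then obtain u v where u: "v \<in> b ` I" "u v \<noteq> 0" "(\<Sum>v\<in>b ` I. u v *\<^sub>R v) = 0"
      using assms(1) by (auto simp: dependent_finite)
    then have "(\<Sum>i\<in>I. u (b i) *\<^sub>R b i) = 0"
      by (simp add: sum.reindex[OF inj])
    then show False
      using independent_familyD[OF assms(2), of "\<lambda>i. u (b i)"] u(1,2) by auto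
  qed
qed

lemma independent_family_subset:
  assumes "finite I" "independent_family I b" "J \<subseteq> I"
  shows "independent_family J b"
  unfolding independent_family_def
proof (intro allI impI ballI)
  fix c i assume c: "(\<Sum>i\<in>J. c i *\<^sub>R b i) = 0" and i: "i \<in> J"
  have "(\<Sum>i\<in>I. (if i \<in> J then c i else 0) *\<^sub>R b i) = (\<Sum>i\<in>J. c i *\<^sub>R b i)"
    by (rule sum.mono_neutral_cong_right) (use assms in auto)
  then show "c i = 0"
    using independent_familyD[OF assms(2), of "\<lambda>i. if i \<in> J then c i else 0" i] c i assms(3) by auto
qed

lemma span_family:
  assumes "finite I" "x \<in> span (b ` I)"
  obtains c where "x = (\<Sum>i\<in>I. c i *\<^sub>R b i)"
proof -
  have "x \<in> {y. \<exists>c. y = (\<Sum>i\<in>I. c i *\<^sub>R b i)}"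
  proof (rule span_induct_alt[OF assms(2)], goal_cases)
    case 1
    show ?case by (auto intro!: exI[of _ "\<lambda>_. 0"])
  next
    case (2 a x y)
    then obtain i c where i: "i \<in> I" "x = b i" and y: "y = (\<Sum>i\<in>I. c i *\<^sub>R b i)"
      by auto
    have "(\<Sum>j\<in>I. (c j + (if j = i then a else 0)) *\<^sub>R b j)
        = y + (\<Sum>j\<in>I. if j = i then a *\<^sub>R b j else 0)"
      by (simp add: y scaleR_add_left sum.distrib if_distrib[of "\<lambda>a. a *\<^sub>R _"] cong: if_cong)
    then have "a *\<^sub>R x + y = (\<Sum>j\<in>I. (c j + (if j = i then a else 0)) *\<^sub>R b j)"
      using assms(1) i by simp
    then show ?case by (auto intro!: exI[of _ "\<lambda>j. c j + (if j = i then a else 0)"])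
  qed
  then show thesis using that by blast
qed

lemma span_family_sum: "(\<Sum>i\<in>I. c i *\<^sub>R b i) \<in> span (b ` I)"
  by (intro span_sum span_scale span_base) auto

lemma dim_span_independent_family:
  assumes "finite I" "independent_family I b"
  shows "dim (span (b ` I)) = card I"
  using independent_family_imp[OF assms] by (simp add: dim_eq_card_independent card_image)

text \<open>A vector of \<open>span T\<close> outside the smaller span would extend the family to
  more independent vectors than \<open>T\<close> has elements.\<close>

lemma span_independent_family_eq:
  assumes "finite I" "independent_family I b" "b ` I \<subseteq> span T" "finite T" "card T \<le> card I"
  shows "span (b ` I) = span T"
proof
  show "span (b ` I) \<subseteq> span T"
    using assms(3) by (simp add: span_minimal)
  show "span T \<subseteq> span (b ` I)"
  proof
    fix x assume x: "x \<in> span T"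
    show "x \<in> span (b ` I)"
    proof (rule ccontr)
      assume nx: "x \<notin> span (b ` I)"
      then have "independent (insert x (b ` I))"
        using independent_family_imp[OF assms(1,2)] by (simp add: independent_insert)
      then have "card (insert x (b ` I)) \<le> card T"
        using independent_span_bound[OF assms(4), of "insert x (b ` I)"] assms(3) x by auto
      moreover have "card (insert x (b ` I)) = card I + 1"
        using assms(1) nx span_base[of x "b ` I"] independent_family_imp(1)[OF assms(1,2)]
        by (subst card_insert_disjoint) (auto simp: card_image)
      ultimately show False using assms(5) by simp
    qed
  qed
qed

lemma independent_family_dual:
  assumes "finite I" "\<And>i. i \<in> I \<Longrightarrow> linear (\<phi> i)"
    and "\<And>i j. i \<in> I \<Longrightarrow> j \<in> I \<Longrightarrow> \<phi> i (b j) = (if i = j then 1 else (0::real))"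
  shows "independent_family I b"
  unfolding independent_family_def
proof (intro allI impI ballI)
  fix c i assume c: "(\<Sum>i\<in>I. c i *\<^sub>R b i) = 0" and i: "i \<in> I"
  have "0 = \<phi> i (\<Sum>j\<in>I. c j *\<^sub>R b j)"
    using assms(2)[OF i] c by (simp add: linear_0)
  also have "\<dots> = (\<Sum>j\<in>I. c j * \<phi> i (b j))"
    using assms(2)[OF i] by (simp add: linear_sum linear_scale)
  also have "\<dots> = (\<Sum>j\<in>I. if j = i then c j else 0)"
    by (rule sum.cong) (use assms(3) i in auto)
  finally show "c i = 0" using i assms(1) by simp
qed

text \<open>The functionals read off coordinates: \<open>x\<close> minus the combination with
  coefficients \<open>\<phi> j x\<close> lies in \<open>S\<close> and is annihilated by all of them,
  hence vanishes.\<close>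

lemma span_dual:
  assumes "finite I" "subspace S" "b ` I \<subseteq> S" "\<And>i. i \<in> I \<Longrightarrow> linear (\<phi> i)"
    and "\<And>i j. i \<in> I \<Longrightarrow> j \<in> I \<Longrightarrow> \<phi> i (b j) = (if i = j then 1 else (0::real))"
    and "\<And>x. x \<in> S \<Longrightarrow> (\<And>i. i \<in> I \<Longrightarrow> \<phi> i x = 0) \<Longrightarrow> x = 0"
  shows "span (b ` I) = S"
proof
  show "span (b ` I) \<subseteq> S" using assms(2,3) by (simp add: span_minimal)
  show "S \<subseteq> span (b ` I)"
  proof
    fix x assume x: "x \<in> S"
    define y where "y = (\<Sum>j\<in>I. \<phi> j x *\<^sub>R b j)"
    have y: "y \<in> span (b ` I)" unfolding y_def by (rule span_family_sum)
    have "x - y = 0"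
    proof (rule assms(6))
      show "x - y \<in> S"
        using x y \<open>span (b ` I) \<subseteq> S\<close> assms(2) by (auto intro: subspace_diff)
      fix i assume i: "i \<in> I"
      have "\<phi> i y = (\<Sum>j\<in>I. \<phi> j x * \<phi> i (b j))"
        using assms(4)[OF i] by (simp add: y_def linear_sum linear_scale)
      also have "\<dots> = (\<Sum>j\<in>I. if j = i then \<phi> j x else 0)"
        by (rule sum.cong) (use assms(5) i in auto)
      also have "\<dots> = \<phi> i x" using i assms(1) by simp
      finally show "\<phi> i (x - y) = 0"
        using assms(4)[OF i] by (simp add: linear_diff)
    qed
    then show "x \<in> span (b ` I)" using y by simp
  qed
qed

text \<open>Comparing coefficients in \<open>H A = \<mu> *\<^sub>R A\<close> kills every coordinate
  whose eigenvalue differs from \<mu>, so the eigenspace is spanned by the remaining basis vectors.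
  The hypothesis \<open>mult\<close> sums over list entries because equal eigenvalues may be listed
  separately.\<close>

lemma spectrum_on_eigenbasis:
  assumes "linear H" "finite X" "independent_family X b" "C = span (b ` X)"
    and eig: "\<And>x. x \<in> X \<Longrightarrow> H (b x) = l x *\<^sub>R b x"
    and total: "card X = (\<Sum>(l, m)\<leftarrow>es. m)"
    and mult: "\<And>\<mu>. card {x \<in> X. l x = \<mu>} = (\<Sum>(l, m)\<leftarrow>es. if l = \<mu> then m else 0)"
  shows "spectrum_on H C es"
  unfolding spectrum_on_def
proof (intro conjI allI)
  have H_sum: "H (\<Sum>x\<in>X. c x *\<^sub>R b x) = (\<Sum>x\<in>X. (c x * l x) *\<^sub>R b x)" for c
    using assms(1) by (simp add: linear_sum linear_scale eig)
  show "H ` C \<subseteq> C"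
  proof (rule image_subsetI)
    fix A assume "A \<in> C"
    then obtain c where "A = (\<Sum>x\<in>X. c x *\<^sub>R b x)"
      using span_family assms(2,4) by metis
    then show "H A \<in> C" by (simp add: H_sum assms(4) span_family_sum)
  qed
  show "dim C = (\<Sum>(l, m)\<leftarrow>es. m)"
    unfolding assms(4) using dim_span_independent_family[OF assms(2,3)] total by simp
  fix \<mu>
  define Y where "Y = {x \<in> X. l x = \<mu>}"
  have Y: "finite Y" "Y \<subseteq> X" using assms(2) by (auto simp: Y_def)
  have "{A \<in> C. H A = \<mu> *\<^sub>R A} = span (b ` Y)"
  proof (intro equalityI subsetI)
    fix A assume "A \<in> {A \<in> C. H A = \<mu> *\<^sub>R A}"
    then have A: "A \<in> C" "H A = \<mu> *\<^sub>R A" by auto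
    obtain c where c: "A = (\<Sum>x\<in>X. c x *\<^sub>R b x)"
      using span_family assms(2,4) A(1) by metis
    have "(\<Sum>x\<in>X. (c x * l x - \<mu> * c x) *\<^sub>R b x) = H A - \<mu> *\<^sub>R A"
      unfolding c H_sum by (simp add: scaleR_diff_left sum_subtractf scaleR_sum_right)
    then have z: "c x * l x - \<mu> * c x = 0" if "x \<in> X" for x
      using independent_familyD[OF assms(3), of "\<lambda>x. c x * l x - \<mu> * c x"] A(2) that by simp
    have "A = (\<Sum>x\<in>Y. c x *\<^sub>R b x)"
      unfolding c by (rule sum.mono_neutral_right) (use assms(2) Y z in \<open>auto simp: Y_def algebra_simps\<close>)
    then show "A \<in> span (b ` Y)" by (simp add: span_family_sum)
  next
    fix A assume "A \<in> span (b ` Y)"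
    then obtain c where c: "A = (\<Sum>x\<in>Y. c x *\<^sub>R b x)"
      using span_family Y(1) by metis
    have "H A = \<mu> *\<^sub>R A"
      unfolding c using assms(1) Y(2) eig
      by (simp add: linear_sum linear_scale scaleR_sum_right Y_def mult.commute)
    moreover have "A \<in> C"
      using span_mono[of "b ` Y" "b ` X"] Y(2) \<open>A \<in> span (b ` Y)\<close> assms(4) by auto
    ultimately show "A \<in> {A \<in> C. H A = \<mu> *\<^sub>R A}" by simp
  qed
  then show "dim {A \<in> C. H A = \<mu> *\<^sub>R A} = (\<Sum>(l, m)\<leftarrow>es. if l = \<mu> then m else 0)"
    using dim_span_independent_family[OF Y(1) independent_family_subset[OF assms(2,3) Y(2)]]
      mult[of \<mu>] by (simp add: Y_def)
qed

lemma subspace_copies: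
  assumes "\<And>j. j < k \<Longrightarrow> linear (\<Phi> j)" "subspace U"
  shows "subspace {\<Sum>j<(k::nat). \<Phi> j (u j) |u. \<forall>j<k. u j \<in> U}" (is "subspace ?C")
proof (rule subspaceI)
  show "0 \<in> ?C" using assms by (auto intro!: exI[of _ "\<lambda>_. 0"] simp: subspace_0 linear_0)
  fix A B assume "A \<in> ?C" "B \<in> ?C"
  then obtain u u' where "\<forall>j<k. u j \<in> U" "A = (\<Sum>j<k. \<Phi> j (u j))" "\<forall>j<k. u' j \<in> U" "B = (\<Sum>j<k. \<Phi> j (u' j))"
    by auto
  then show "A + B \<in> ?C"
    using assms by (auto intro!: exI[of _ "\<lambda>j. u j + u' j"] simp: subspace_add linear_add sum.distrib)
next
  fix c A assume "A \<in> ?C"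
  then obtain u where "\<forall>j<k. u j \<in> U" "A = (\<Sum>j<k. \<Phi> j (u j))"
    by auto
  then show "c *\<^sub>R A \<in> ?C"
    using assms by (auto intro!: exI[of _ "\<lambda>j. c *\<^sub>R u j"] simp: subspace_scale linear_scale scaleR_sum_right)
qed

text \<open>\<open>C\<close> consists of \<open>k\<close> copies \<open>\<Phi> j ` U\<close> of a representation \<open>U\<close>, and each coordinate vector \<open>v l\<close>
  singles out a copy of \<open>U\<close> on which \<open>H\<close> acts as the scalar \<open>lam l\<close>.\<close>

lemma spectrum_on_copies:
  fixes \<Phi> :: "nat \<Rightarrow> 'u::real_vector \<Rightarrow> rmat"
  assumes H: "linear H" and \<Phi>: "\<And>j. j < k \<Longrightarrow> linear (\<Phi> j)"
    and I: "finite I" "independent_family I b" "U = span (b ` I)"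
    and inj: "\<And>u. (\<And>j. j < k \<Longrightarrow> u j \<in> U) \<Longrightarrow> (\<Sum>j<k. \<Phi> j (u j)) = 0 \<Longrightarrow> (\<And>j. j < k \<Longrightarrow> u j = 0)"
    and C: "C = {\<Sum>j<k. \<Phi> j (u j) |u. \<forall>j<k. u j \<in> U}"
    and eig: "\<And>l u. l < k \<Longrightarrow> u \<in> U \<Longrightarrow>
      H (\<Sum>j<k. v l j *\<^sub>R \<Phi> j u) = lam l *\<^sub>R (\<Sum>j<k. v l j *\<^sub>R \<Phi> j u)"
    and v: "\<And>c. (\<And>j. j < k \<Longrightarrow> (\<Sum>l<k. c l * v l j) = 0) \<Longrightarrow> (\<And>l. l < k \<Longrightarrow> c l = (0::real))"
    and m: "m = card I"
  shows "spectrum_on H C (map (\<lambda>l. (lam l, m)) [0..<k])"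
proof (rule spectrum_on_eigenbasis[OF H, where X = "{..<k} \<times> I"])
  define \<Psi> where "\<Psi> = (\<lambda>l u. \<Sum>j<k. v l j *\<^sub>R \<Phi> j u)"
  let ?b = "\<lambda>(l, i). \<Psi> l (b i)"
  have bU: "b i \<in> U" if "i \<in> I" for i using I that by (auto intro: span_base)
  have U: "subspace U" using I by simp
  show "finite ({..<k} \<times> I)" using I by simp
  show ind: "independent_family ({..<k} \<times> I) ?b"
    unfolding independent_family_def
  proof (intro allI impI ballI)
    fix c x assume c: "(\<Sum>x\<in>{..<k} \<times> I. c x *\<^sub>R ?b x) = 0" and x: "x \<in> {..<k} \<times> I"
    \<comment> \<open>The relation is regrouped by copies, \<open>w j\<close> being the component in
      copy \<open>j\<close>. Injectivity of the sum kills each \<open>w j\<close>, independence of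
      \<open>b\<close> kills its coefficients, and independence of the coordinate vectors
      \<open>v\<close> kills \<open>c\<close>.\<close>
    define w where "w = (\<lambda>j. \<Sum>i\<in>I. (\<Sum>l<k. c (l, i) * v l j) *\<^sub>R b i)"
    have "(\<Sum>j<k. \<Phi> j (w j)) = (\<Sum>j<k. \<Sum>i\<in>I. \<Sum>l<k. (c (l, i) * v l j) *\<^sub>R \<Phi> j (b i))"
      by (simp add: w_def linear_sum[OF \<Phi>] linear_scale[OF \<Phi>] scaleR_sum_left)
    also have "\<dots> = (\<Sum>l<k. \<Sum>i\<in>I. \<Sum>j<k. (c (l, i) * v l j) *\<^sub>R \<Phi> j (b i))"
      by (subst sum.swap, subst sum.swap[of _ "{..<k}" "{..<k}"], subst sum.swap) simp
    also have "\<dots> = (\<Sum>l<k. \<Sum>i\<in>I. c (l, i) *\<^sub>R \<Psi> l (b i))"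
      by (simp add: \<Psi>_def scaleR_sum_right)
    also have "\<dots> = (\<Sum>x\<in>{..<k} \<times> I. c x *\<^sub>R ?b x)"
      by (subst sum.cartesian_product) (rule sum.cong, auto)
    finally have "(\<Sum>j<k. \<Phi> j (w j)) = 0" using c by simp
    moreover have "w j \<in> U" for j
      by (simp add: w_def I span_family_sum)
    ultimately have "w j = 0" if "j < k" for j
      using inj[of w j] that by simp
    then have "(\<Sum>l<k. c (l, i) * v l j) = 0" if "j < k" "i \<in> I" for i j
      using independent_familyD[OF I(2), of "\<lambda>i. \<Sum>l<k. c (l, i) * v l j"] that
      unfolding w_def by simp
    then show "c x = 0" using v[of "\<lambda>l. c (l, snd x)" "fst x"] x by auto
  qed
  let ?T = "(\<lambda>(j, i). \<Phi> j (b i)) ` ({..<k} \<times> I)"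
  have CT: "C \<subseteq> span ?T"
  proof
    fix A assume "A \<in> C"
    then obtain u where u: "\<And>j. j < k \<Longrightarrow> u j \<in> U" "A = (\<Sum>j<k. \<Phi> j (u j))"
      using C by auto
    show "A \<in> span ?T"
      unfolding u(2)
    proof (rule span_sum)
      fix j assume j: "j \<in> {..<k}"
      obtain c where "u j = (\<Sum>i\<in>I. c i *\<^sub>R b i)"
        using span_family[OF I(1)] u(1) I(3) j by (metis lessThan_iff)
      then have "\<Phi> j (u j) = (\<Sum>i\<in>I. c i *\<^sub>R \<Phi> j (b i))"
        using \<Phi> j by (simp add: linear_sum linear_scale)
      also have "\<dots> \<in> span ?T"
        using j by (intro span_sum span_scale span_base) auto
      finally show "\<Phi> j (u j) \<in> span ?T" .
    qed
  qed
  have bC: "?b x \<in> C" if "x \<in> {..<k} \<times> I" for x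
  proof -
    have "?b x = (\<Sum>j<k. \<Phi> j (v (fst x) j *\<^sub>R b (snd x)))"
      by (simp add: \<Psi>_def case_prod_beta linear_scale[OF \<Phi>])
    then show ?thesis
      unfolding C using that bU U by (auto intro!: subspace_scale)
  qed
  \<comment> \<open>Both families are indexed by the same set, so counting replaces an inversion of
    the matrix \<open>v\<close>.\<close>
  have "span (?b ` ({..<k} \<times> I)) = span ?T"
  proof (rule span_independent_family_eq[OF _ ind])
    show "?b ` ({..<k} \<times> I) \<subseteq> span ?T" using bC CT by blast
    show "card ?T \<le> card ({..<k} \<times> I)" using I by (intro card_image_le) simp
  qed (use I in auto)
  moreover have "subspace C"
    unfolding C using \<Phi> U by (rule subspace_copies)
  then have "span (?b ` ({..<k} \<times> I)) \<subseteq> C"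
    by (intro span_minimal) (use bC in blast)
  ultimately show "C = span (?b ` ({..<k} \<times> I))"
    using CT by simp
  show "H (?b x) = lam (fst x) *\<^sub>R ?b x" if xX: "x \<in> {..<k} \<times> I" for x
  proof -
    obtain l i where x: "x = (l, i)" "l < k" "i \<in> I" using xX by (cases x) auto
    then show ?thesis using eig[of l "b i"] bU by (simp add: \<Psi>_def)
  qed
  show "card ({..<k} \<times> I) = (\<Sum>(l, m)\<leftarrow>map (\<lambda>l. (lam l, m)) [0..<k]. m)"
    by (simp add: m card_cartesian_product sum_list_triv o_def)
  show "card {x \<in> {..<k} \<times> I. lam (fst x) = \<mu>} = (\<Sum>(l, m)\<leftarrow>map (\<lambda>l. (lam l, m)) [0..<k]. if l = \<mu> then m else 0)" for \<mu>
  proof -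
    have "{x \<in> {..<k} \<times> I. lam (fst x) = \<mu>} = {l \<in> {..<k}. lam l = \<mu>} \<times> I" by auto
    moreover have "(\<Sum>(l, m)\<leftarrow>map (\<lambda>l. (lam l, m)) [0..<k]. if l = \<mu> then m else 0)
      = (\<Sum>l<k. if lam l = \<mu> then m else 0)"
      by (simp add: o_def sum_list_sum_nth atLeast0LessThan)
    ultimately show ?thesis
      by (simp add: m card_cartesian_product sum.If_cases Int_def)
  qed
qed

text \<open>The hypothesis \<open>upper\<close> takes the place of Schur's lemma: every equivariant
  linear map from \<open>U\<close> into \<open>V\<close> lands in \<open>C\<close>, so each
  subrepresentation isomorphic to \<open>U\<close> does. Conversely each \<open>\<Phi> j\<close> is
  an isomorphism of \<open>U\<close> onto a subrepresentation, and these images span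
  \<open>C\<close>.\<close>

lemma isotypic_copies:
  fixes \<Phi> :: "nat \<Rightarrow> 'u::real_vector \<Rightarrow> 'v::real_vector"
  assumes U: "subspace U" "\<And>g u. g \<in> G \<Longrightarrow> u \<in> U \<Longrightarrow> b g u \<in> U"
    and \<Phi>: "\<And>j. j < k \<Longrightarrow> linear (\<Phi> j)" "\<And>j u. j < k \<Longrightarrow> u \<in> U \<Longrightarrow> \<Phi> j u \<in> V"
    and equi: "\<And>j g u. j < k \<Longrightarrow> g \<in> G \<Longrightarrow> u \<in> U \<Longrightarrow> \<Phi> j (b g u) = a g (\<Phi> j u)"
    and inj: "\<And>u. (\<And>j. j < k \<Longrightarrow> u j \<in> U) \<Longrightarrow> (\<Sum>j<k. \<Phi> j (u j)) = 0 \<Longrightarrow> (\<And>j. j < k \<Longrightarrow> u j = 0)"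
    and C: "C = {\<Sum>j<k. \<Phi> j (u j) |u. \<forall>j<k. u j \<in> U}"
    and upper: "\<And>f u. linear f \<Longrightarrow> (\<And>g u. g \<in> G \<Longrightarrow> u \<in> U \<Longrightarrow> f (b g u) = a g (f u)) \<Longrightarrow>
      (\<And>u. u \<in> U \<Longrightarrow> f u \<in> V) \<Longrightarrow> u \<in> U \<Longrightarrow> f u \<in> C"
  shows "isotypic G a V b U = C"
proof
  have subC: "subspace C"
    unfolding C using \<Phi>(1) U(1) by (rule subspace_copies)
  have "W \<subseteq> C" if "subrep G a V W" "rep_iso G b U a W" for W
  proof -
    obtain f where f: "linear f" "bij_betw f U W" "\<And>g u. g \<in> G \<Longrightarrow> u \<in> U \<Longrightarrow> f (b g u) = a g (f u)"
      using \<open>rep_iso G b U a W\<close> unfolding rep_iso_def by blast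
    have W: "W = f ` U" using f(2) by (simp add: bij_betw_def)
    moreover have "W \<subseteq> V" using \<open>subrep G a V W\<close> by (simp add: subrep_def)
    ultimately show "W \<subseteq> C" using upper[OF f(1,3)] by blast
  qed
  then show "isotypic G a V b U \<subseteq> C"
    unfolding isotypic_def by (intro span_minimal subC) auto
  have "\<Phi> j u \<in> isotypic G a V b U" if j: "j < k" and u: "u \<in> U" for j u
  proof -
    have "inj_on (\<Phi> j) U"
    proof (rule inj_onI)
      fix x y assume xy: "x \<in> U" "y \<in> U" "\<Phi> j x = \<Phi> j y"
      \<comment> \<open>Injectivity of a single \<open>\<Phi> j\<close> is injectivity of the sum,
        applied to \<open>x - y\<close> in slot \<open>j\<close> and zero elsewhere.\<close>
      define w where "w = (\<lambda>i. if i = j then x - y else 0)"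
      have "(\<Sum>i<k. \<Phi> i (w i)) = (\<Sum>i<k. if i = j then \<Phi> j (x - y) else 0)"
        using \<Phi>(1) by (intro sum.cong) (auto simp: w_def linear_0)
      then have "(\<Sum>i<k. \<Phi> i (w i)) = 0"
        using xy \<Phi>(1)[OF j] j by (simp add: linear_diff)
      moreover have "w i \<in> U" for i
        using xy U by (simp add: w_def subspace_diff subspace_0)
      ultimately show "x = y" using inj[of w j] j by (simp add: w_def)
    qed
    then have "rep_iso G b U a (\<Phi> j ` U)"
      unfolding rep_iso_def using \<Phi>(1)[OF j] equi[OF j] by (auto simp: bij_betw_def)
    moreover have "subrep G a V (\<Phi> j ` U)"
      unfolding subrep_def
    proof (intro conjI ballI)
      show "subspace (\<Phi> j ` U)" using \<Phi>(1)[OF j] U(1) by (simp add: linear_subspace_image)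
      show "\<Phi> j ` U \<subseteq> V" using \<Phi>(2)[OF j] by auto
      show "a g ` \<Phi> j ` U \<subseteq> \<Phi> j ` U" if "g \<in> G" for g
        using equi[OF j that, symmetric] U(2)[OF that] by auto
    qed
    ultimately show ?thesis
      unfolding isotypic_def using u by (intro span_base) auto
  qed
  then show "C \<subseteq> isotypic G a V b U"
    unfolding C by (auto simp: isotypic_def intro!: span_sum)
qed

section \<open>Bases of the irreducible representations\<close>

abbreviation swap :: "nat \<Rightarrow> nat \<Rightarrow> nat \<Rightarrow> nat"
  where "swap \<equiv> Transposition.transpose"

text \<open>The sum runs over ordered pairs including \<open>a = b\<close>, so in the group algebra
  it is \<open>m\<close> times the identity plus twice the sum of all transpositions, a central
  element. By the content formula it acts as \<open>m^2\<close> on the trivial representation,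
  \<open>m^2 - 2 m\<close> on the standard one, \<open>m^2 - 4 m\<close> on its exterior square and
  \<open>m^2 - 4 m + 4\<close> on the partition \<open>(m - 2, 2)\<close>; these values are distinct
  for \<open>m \<ge> 3\<close>.\<close>

definition orbit_sum_vec :: "nat \<Rightarrow> rvec \<Rightarrow> rvec"
  where "orbit_sum_vec m u = (\<Sum>a<m. \<Sum>b<m. perm_vec (swap a b) u)"

definition orbit_sum :: "nat \<Rightarrow> rmat \<Rightarrow> rmat"
  where "orbit_sum m A = (\<Sum>a<m. \<Sum>b<m. diag_act (swap a b) A)"

section \<open>The sum over transpositions on entries of vectors and matrices\<close>

lemma transpose_in_Sym: "a < m \<Longrightarrow> b < m \<Longrightarrow> swap a b \<in> Sym m"
  by (simp add: Sym_def permutes_swap_id)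

lemma sum_if_eq: "i < m \<Longrightarrow> (\<Sum>a<m. if a = i then x else f a) = (\<Sum>a<m. f a) - f i + (x::real)" for i m :: nat
  by (simp add: sum.remove[of "{..<m}" i])

lemma sum_if_eq2:
  assumes "i < m" "j < m" "i \<noteq> (j::nat)"
  shows "(\<Sum>a<m. if a = i then x else if a = j then y else f a) = (\<Sum>a<m. f a) - f i - f j + x + (y::real)"
  using assms by (subst sum_if_eq) (simp_all add: sum_if_eq)

text \<open>The value changes only for pairs that contain \<open>i\<close>: the part with
  \<open>a = i\<close> of the double sum runs through all entries, and for every other
  \<open>a\<close> exactly one summand is moved, the one at \<open>b = i\<close>.\<close>

lemma sum_transpose_apply:
  fixes u :: rvec
  assumes "i < m"
  shows "(\<Sum>a<m. \<Sum>b<m. u (swap a b i)) = 2 * (\<Sum>a<m. u a) + (real m ^ 2 - 2 * real m) * u i"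
proof -
  have "(\<Sum>b<m. u (swap a b i)) = (if a = i then \<Sum>b<m. u b else u a + (real m - 1) * u i)" for a
  proof -
    have "(\<Sum>b<m. u (swap a b i)) = (\<Sum>b<m. if b = i then u a else u i)" if "a \<noteq> i"
      using that by (intro sum.cong) (auto simp: Transposition.transpose_def)
    moreover have "(\<Sum>b<m. u (swap i b i)) = (\<Sum>b<m. u b)"
      by (intro sum.cong) auto
    ultimately show ?thesis
      using assms by (simp add: sum_if_eq algebra_simps)
  qed
  then show ?thesis
    using assms by (simp add: sum_if_eq sum.distrib sum_subtractf power2_eq_square algebra_simps)
qed

text \<open>For \<open>a\<close> outside \<open>{i, j}\<close> one transposition moves
  \<open>i\<close> to \<open>a\<close> and one moves \<open>j\<close> to \<open>a\<close>; the
  exchange of \<open>i\<close> and \<open>j\<close> themselves contributes \<open>A j i\<close> and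
  causes the diagonal corrections to the row and column sums.\<close>

lemma sum_transpose_apply2:
  fixes A :: rmat
  assumes "i < m" "j < m" "i \<noteq> j"
  shows "(\<Sum>a<m. \<Sum>b<m. A (swap a b i) (swap a b j)) =
    2 * (\<Sum>a<m. A a j) + 2 * (\<Sum>a<m. A i a) - 2 * A i i - 2 * A j j + 2 * A j i
      + (real m ^ 2 - 4 * real m + 2) * A i j"
proof -
  have i: "(\<Sum>b<m. A (swap i b i) (swap i b j)) = (\<Sum>b<m. A b j) - A j j + A j i"
  proof -
    have "(\<Sum>b<m. A (swap i b i) (swap i b j)) = (\<Sum>b<m. if b = j then A j i else A b j)"
      using assms by (intro sum.cong) (auto simp: Transposition.transpose_def)
    then show ?thesis using assms by (simp add: sum_if_eq)
  qed
  have j: "(\<Sum>b<m. A (swap j b i) (swap j b j)) = (\<Sum>b<m. A i b) - A i i + A j i"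
  proof -
    have "(\<Sum>b<m. A (swap j b i) (swap j b j)) = (\<Sum>b<m. if b = i then A j i else A i b)"
      using assms by (intro sum.cong) (auto simp: Transposition.transpose_def)
    then show ?thesis using assms by (simp add: sum_if_eq)
  qed
  have o: "(\<Sum>b<m. A (swap a b i) (swap a b j)) = A a j + A i a + (real m - 2) * A i j"
    if "a \<noteq> i" "a \<noteq> j" for a
  proof -
    have "(\<Sum>b<m. A (swap a b i) (swap a b j)) = (\<Sum>b<m. if b = i then A a j else if b = j then A i a else A i j)"
      using assms that by (intro sum.cong) (auto simp: Transposition.transpose_def)
    then show ?thesis using assms by (simp add: sum_if_eq2 algebra_simps)
  qed
  have "(\<Sum>a<m. \<Sum>b<m. A (swap a b i) (swap a b j)) =
     (\<Sum>a<m. if a = i then (\<Sum>b<m. A b j) - A j j + A j i else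
        if a = j then (\<Sum>b<m. A i b) - A i i + A j i else A a j + A i a + (real m - 2) * A i j)"
    by (rule sum.cong) (use i j o in auto)
  also have "\<dots> = 2 * (\<Sum>a<m. A a j) + 2 * (\<Sum>a<m. A i a) - 2 * A i i - 2 * A j j + 2 * A j i
      + (real m ^ 2 - 4 * real m + 2) * A i j"
    by (subst sum_if_eq2[OF assms]) (simp add: sum.distrib sum_subtractf power2_eq_square algebra_simps)
  finally show ?thesis .
qed

lemma orbit_sum_vec_std_rep:
  assumes "u \<in> std_rep m"
  shows "orbit_sum_vec m u = (real m ^ 2 - 2 * real m) *\<^sub>R u"
proof
  fix i
  have "orbit_sum_vec m u i = (\<Sum>a<m. \<Sum>b<m. u (swap a b i))"
    by (simp add: orbit_sum_vec_def sum_fun_apply perm_vec_def)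
  also have "\<dots> = (real m ^ 2 - 2 * real m) * u i"
  proof (cases "i < m")
    case True
    then show ?thesis using assms by (simp add: sum_transpose_apply std_rep_def)
  next
    case False
    have "(\<Sum>a<m. \<Sum>b<m. u (swap a b i)) = (\<Sum>a<m. \<Sum>b<m. u i)"
      using False by (intro sum.cong) (auto simp: Transposition.transpose_def)
    then show ?thesis using assms False by (simp add: std_rep_def)
  qed
  finally show "orbit_sum_vec m u i = ((real m ^ 2 - 2 * real m) *\<^sub>R u) i" by simp
qed

lemma orbit_sum_apply: "orbit_sum m A i j = (\<Sum>a<m. \<Sum>b<m. A (swap a b i) (swap a b j))"
  by (simp add: orbit_sum_def sum_fun_apply diag_act_def act_def)

lemma orbit_sum_diag:
  "i < m \<Longrightarrow> orbit_sum m A i i = 2 * (\<Sum>a<m. A a a) + (real m ^ 2 - 2 * real m) * A i i"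
  unfolding orbit_sum_apply using sum_transpose_apply[of i m "\<lambda>i. A i i"] by simp

lemma orbit_sum_offdiag:
  "i < m \<Longrightarrow> j < m \<Longrightarrow> i \<noteq> j \<Longrightarrow> orbit_sum m A i j =
    2 * (\<Sum>a<m. A a j) + 2 * (\<Sum>a<m. A i a) - 2 * A i i - 2 * A j j + 2 * A j i
      + (real m ^ 2 - 4 * real m + 2) * A i j"
  unfolding orbit_sum_apply by (rule sum_transpose_apply2)

lemma orbit_sum_col:
  assumes "i < m" "m \<le> j"
  shows "orbit_sum m A i j = 2 * (\<Sum>a<m. A a j) + (real m ^ 2 - 2 * real m) * A i j"
proof -
  have "orbit_sum m A i j = (\<Sum>a<m. \<Sum>b<m. A (swap a b i) j)"
    unfolding orbit_sum_apply using assms by (intro sum.cong) (auto simp: Transposition.transpose_def)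
  then show ?thesis using sum_transpose_apply[OF assms(1), of "\<lambda>i. A i j"] by simp
qed

lemma orbit_sum_row:
  assumes "m \<le> i" "j < m"
  shows "orbit_sum m A i j = 2 * (\<Sum>a<m. A i a) + (real m ^ 2 - 2 * real m) * A i j"
proof -
  have "orbit_sum m A i j = (\<Sum>a<m. \<Sum>b<m. A i (swap a b j))"
    unfolding orbit_sum_apply using assms by (intro sum.cong) (auto simp: Transposition.transpose_def)
  then show ?thesis using sum_transpose_apply[OF assms(2), of "\<lambda>j. A i j"] by simp
qed

lemma orbit_sum_corner:
  assumes "m \<le> i" "m \<le> j"
  shows "orbit_sum m A i j = real m ^ 2 * A i j"
proof -
  have "orbit_sum m A i j = (\<Sum>a<m. \<Sum>b<m. A i j)"
    unfolding orbit_sum_apply using assms by (intro sum.cong) (auto simp: Transposition.transpose_def)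
  then show ?thesis by (simp add: power2_eq_square)
qed

text \<open>An equivariant map commutes with the sum over transpositions, so the scalar by which
  this sum acts on \<open>U\<close> reappears on the image. This confines the image of
  \<open>U\<close> to an eigenspace of \<open>orbit_sum\<close>.\<close>

lemma orbit_sum_equivariant:
  assumes "linear f" "\<And>g u. g \<in> Sym m \<Longrightarrow> u \<in> U \<Longrightarrow> f (b g u) = diag_act g (f u)" "u \<in> U"
    and "(\<Sum>a<m. \<Sum>a'<m. b (swap a a') u) = c *\<^sub>R u"
  shows "orbit_sum m (f u) = c *\<^sub>R f u"
proof -
  have "orbit_sum m (f u) = (\<Sum>a<m. \<Sum>a'<m. f (b (swap a a') u))"
    unfolding orbit_sum_def by (intro sum.cong refl) (simp add: assms(2,3) transpose_in_Sym)
  also have "\<dots> = f (\<Sum>a<m. \<Sum>a'<m. b (swap a a') u)"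
    by (simp add: linear_sum[OF assms(1)])
  finally show ?thesis using assms(1,4) by (simp add: linear_scale)
qed

section \<open>The standard representation, its tensor and exterior squares, and the Specht
  module\<close>

lemma linear_fun_apply: "linear (\<lambda>u. (u::'a \<Rightarrow> real) i)"
  by (rule linearI) simp_all

lemma linear_fun_apply2: "linear (\<lambda>A. (A::'a \<Rightarrow> 'b \<Rightarrow> real) i j)"
  by (rule linearI) simp_all

lemma subspace_std_rep: "subspace (std_rep m)"
  by (rule subspaceI) (auto simp: std_rep_def sum.distrib sum_distrib_left[symmetric])

text \<open>With the index 0 as common reference, the coordinates \<open>u i\<close> for
  \<open>i \<ge> 1\<close> are dual to these vectors.\<close>

definition std_basis :: "nat \<Rightarrow> rvec"
  where "std_basis i = unit_vec i - unit_vec 0"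

lemma sum_unit_vec: "(\<Sum>i<m. unit_vec a i) = (if a < m then 1 else 0)"
proof -
  have "(\<Sum>i<m. unit_vec a i) = (\<Sum>i<m. if i = a then 1 else 0)"
    by (rule sum.cong) (auto simp: unit_vec_def)
  then show ?thesis by simp
qed

lemma std_basis_in_std_rep: "i < m \<Longrightarrow> std_basis i \<in> std_rep m"
  by (auto simp: std_rep_def std_basis_def sum_subtractf sum_unit_vec) (auto simp: unit_vec_def)

lemma std_rep_basis:
  assumes "m \<ge> 1"
  shows "independent_family {1..<m} std_basis" "std_rep m = span (std_basis ` {1..<m})"
proof -
  have dual: "std_basis j i = (if i = j then 1 else 0)" if "i \<in> {1..<m}" "j \<in> {1..<m}" for i j
    using that by (auto simp: std_basis_def unit_vec_def)
  show "independent_family {1..<m} std_basis"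
    by (rule independent_family_dual[where \<phi> = "\<lambda>i u. u i"]) (auto simp: linear_fun_apply dual)
  have "x = 0" if x: "x \<in> std_rep m" "\<And>i. i \<in> {1..<m} \<Longrightarrow> x i = 0" for x
  proof -
    have "(\<Sum>i<m. x i) = (\<Sum>i\<in>{0}. x i)"
      by (rule sum.mono_neutral_right) (use assms x(2) in auto)
    then have "x 0 = 0" using x(1) by (simp add: std_rep_def)
    then have "x i = 0" for i
      using x by (cases "i = 0 \<or> m \<le> i") (auto simp: std_rep_def)
    then show ?thesis by auto
  qed
  then have "span (std_basis ` {1..<m}) = std_rep m"
    by (intro span_dual[where \<phi> = "\<lambda>i u. u i"])
      (auto simp: linear_fun_apply dual subspace_std_rep intro!: std_basis_in_std_rep)
  then show "std_rep m = span (std_basis ` {1..<m})" by simp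
qed

lemma perm_vec_std_rep:
  assumes "g \<in> Sym m" "u \<in> std_rep m"
  shows "perm_vec g u \<in> std_rep m"
proof -
  have g: "inv g permutes {..<m}" using assms(1) by (simp add: Sym_def permutes_inv)
  have "(\<Sum>i<m. u (inv g i)) = (\<Sum>i<m. u i)"
    using sum.permute[OF g, of u] by (simp add: o_def)
  moreover have "inv g i = i" if "m \<le> i" for i
    using g that by (auto intro: permutes_not_in)
  ultimately show ?thesis
    using assms(2) by (auto simp: std_rep_def perm_vec_def)
qed

text \<open>The concrete form of the tensor square of the standard representation. Antisymmetry cuts
  out the exterior square; symmetry together with a zero diagonal cuts out, for
  \<open>m \<ge> 3\<close>, the Specht module of \<open>(m - 2, 2)\<close>.\<close>

definition zero_sums :: "nat \<Rightarrow> rmat \<Rightarrow> bool"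
  where "zero_sums m A \<longleftrightarrow> A \<in> Mat m m \<and> (\<forall>i<m. (\<Sum>j<m. A i j) = 0) \<and> (\<forall>j<m. (\<Sum>i<m. A i j) = 0)"

lemma subspace_zero_sums: "subspace {A. zero_sums m A}"
  by (rule subspaceI) (auto simp: zero_sums_def Mat_def sum.distrib sum_distrib_left[symmetric])

lemma subspace_ext_square: "subspace {A. zero_sums m A \<and> (\<forall>i j. A i j + A j i = 0)}"
proof -
  have "subspace {A::rmat. \<forall>i j. A i j + A j i = 0}"
    by (rule subspaceI) (simp_all add: algebra_simps distrib_left[symmetric])
  then show ?thesis
    using subspace_inter[OF subspace_zero_sums] by (simp add: Collect_conj_eq)
qed

lemma subspace_specht2: "subspace {A. zero_sums m A \<and> (\<forall>i j. A j i = A i j) \<and> (\<forall>i. A i i = 0)}"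
proof -
  have "subspace {A::rmat. (\<forall>i j. A j i = A i j) \<and> (\<forall>i. A i i = 0)}"
    by (rule subspaceI) simp_all
  then show ?thesis
    using subspace_inter[OF subspace_zero_sums] by (simp add: Collect_conj_eq)
qed

lemma outer_std_rep_zero_sums:
  assumes "u \<in> std_rep m" "v \<in> std_rep m"
  shows "zero_sums m (outer u v)"
proof -
  have "u i = 0" "v i = 0" if "m \<le> i" for i
    using that assms by (auto simp: std_rep_def)
  moreover have "(\<Sum>j<m. u i * v j) = 0" "(\<Sum>j<m. u j * v i) = 0" for i
    using assms by (simp_all add: std_rep_def sum_distrib_left[symmetric] sum_distrib_right[symmetric])
  ultimately show ?thesis
    by (auto simp: zero_sums_def Mat_def outer_def not_less)
qed

text \<open>Row sums recover column 0 from the remaining entries, and column sums then recover row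
  0.\<close>

lemma zero_sums_eq_0:
  assumes "zero_sums m A" "\<And>i j. 1 \<le> i \<Longrightarrow> i < m \<Longrightarrow> 1 \<le> j \<Longrightarrow> j < m \<Longrightarrow> A i j = 0"
  shows "A = 0"
proof (cases "m = 0")
  case True
  then show ?thesis using assms by (auto simp: zero_sums_def Mat_def fun_eq_iff)
next
  case False
  have i0: "A i 0 = 0" if "1 \<le> i" "i < m" for i
  proof -
    have "(\<Sum>j<m. A i j) = (\<Sum>j\<in>{0}. A i j)"
      by (rule sum.mono_neutral_right) (use assms(2) that False in auto)
    then show ?thesis using assms(1) that by (simp add: zero_sums_def)
  qed
  have j0: "A 0 j = 0" if "j < m" for j
  proof -
    have "(\<Sum>i<m. A i j) = (\<Sum>i\<in>{0}. A i j)"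
      by (rule sum.mono_neutral_right) (use assms(2) i0 that False in \<open>auto simp: Suc_le_eq\<close>, metis One_nat_def Suc_le_eq gr0I i0)
    then show ?thesis using assms(1) that by (simp add: zero_sums_def)
  qed
  have "A i j = 0" for i j
    using assms i0 j0 by (cases "i < m \<and> j < m"; cases "i = 0"; cases "j = 0")
      (auto simp: zero_sums_def Mat_def)
  then show ?thesis by (simp add: fun_eq_iff)
qed

text \<open>The tensor of two basis vectors has the entry 1 at \<open>(i, j)\<close> and 0 at every
  other position with positive indices, so the entries with positive indices are dual
  coordinates.\<close>

lemma std_tensor_std_rep_basis:
  "independent_family ({1..<m} \<times> {1..<m}) (\<lambda>(i, j). outer (std_basis i) (std_basis j))"
  "{A. zero_sums m A} = span ((\<lambda>(i, j). outer (std_basis i) (std_basis j)) ` ({1..<m} \<times> {1..<m}))"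
  "std_tensor_std_rep m = {A. zero_sums m A}"
proof -
  let ?I = "{1..<m} \<times> {1..<m}"
  let ?b = "\<lambda>(i, j). outer (std_basis i) (std_basis j)"
  have dual: "?b y (fst x) (snd x) = (if x = y then 1 else 0)" if "x \<in> ?I" "y \<in> ?I" for x y
    using that by (auto simp: std_basis_def unit_vec_def outer_def split: if_splits)
  show "independent_family ?I ?b"
    by (rule independent_family_dual[where \<phi> = "\<lambda>x A. A (fst x) (snd x)"]) (auto simp: linear_fun_apply2 dual simp del: split_paired_All)
  have bz: "?b ` ?I \<subseteq> {A. zero_sums m A}"
    by (auto intro!: outer_std_rep_zero_sums std_basis_in_std_rep)
  have "span (?b ` ?I) = {A. zero_sums m A}"
  proof (rule span_dual[where \<phi> = "\<lambda>x A. A (fst x) (snd x)"])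
    fix A assume "A \<in> {A. zero_sums m A}" and "\<And>i. i \<in> ?I \<Longrightarrow> A (fst i) (snd i) = 0"
    then show "A = 0" by (intro zero_sums_eq_0[of m]) auto
  qed (use bz in \<open>auto simp: linear_fun_apply2 dual subspace_zero_sums simp del: split_paired_All\<close>)
  then show eq: "{A. zero_sums m A} = span (?b ` ?I)" by simp
  show "std_tensor_std_rep m = {A. zero_sums m A}"
  proof
    show "std_tensor_std_rep m \<subseteq> {A. zero_sums m A}"
      unfolding std_tensor_std_rep_def
      by (rule span_minimal) (auto intro: outer_std_rep_zero_sums subspace_zero_sums)
    show "{A. zero_sums m A} \<subseteq> std_tensor_std_rep m"
      unfolding eq std_tensor_std_rep_def
    proof (rule span_mono, rule image_subsetI)
      fix x assume "x \<in> ?I"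
      then show "?b x \<in> {outer u v |u v. u \<in> std_rep m \<and> v \<in> std_rep m}"
        using std_basis_in_std_rep[of "fst x" m] std_basis_in_std_rep[of "snd x" m]
        by (cases x) auto
    qed
  qed
qed

definition wedge_basis :: "nat \<times> nat \<Rightarrow> rmat"
  where "wedge_basis x = outer (std_basis (fst x)) (std_basis (snd x)) - outer (std_basis (snd x)) (std_basis (fst x))"

text \<open>Index 0 is left out because row 0 and column 0 are determined by the vanishing
  sums.\<close>

definition upper_pairs :: "nat \<Rightarrow> (nat \<times> nat) set"
  where "upper_pairs m = {(i, j). 1 \<le> i \<and> i < j \<and> j < m}"

lemma finite_upper_pairs [simp]: "finite (upper_pairs m)"
  by (rule finite_subset[of _ "{..<m} \<times> {..<m}"]) (auto simp: upper_pairs_def)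

lemma card_upper_pairs: "card (upper_pairs m) = (m - 1) * (m - 2) div 2"
proof (induction m)
  case (Suc m)
  have "upper_pairs (Suc m) = upper_pairs m \<union> (\<lambda>i. (i, m)) ` {1..<m}"
    by (auto simp: upper_pairs_def less_Suc_eq)
  moreover have "card ((\<lambda>i. (i, m)) ` {1..<m}) = m - 1"
    by (subst card_image) (auto simp: inj_on_def)
  moreover have "upper_pairs m \<inter> (\<lambda>i. (i, m)) ` {1..<m} = {}"
    by (auto simp: upper_pairs_def)
  ultimately have "card (upper_pairs (Suc m)) = (m - 1) * (m - 2) div 2 + (m - 1)"
    using Suc by (simp add: card_Un_disjoint)
  also have "\<dots> = (Suc m - 1) * (Suc m - 2) div 2"
  proof (cases "m < 2")
    case False
    then obtain k where "m = Suc (Suc k)"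
      by (metis add_2_eq_Suc le_Suc_ex not_less)
    then show ?thesis by simp
  qed (auto simp: less_2_cases_iff)
  finally show ?case .
qed (simp add: upper_pairs_def)

lemma ext_square_rep_basis:
  shows "independent_family (upper_pairs m) wedge_basis"
    and "ext_square_rep m = span (wedge_basis ` upper_pairs m)"
    and "ext_square_rep m = {A. zero_sums m A \<and> (\<forall>i j. A i j + A j i = 0)}" (is "_ = ?S")
proof -
  have dual: "wedge_basis y (fst x) (snd x) = (if x = y then 1 else 0)"
    if "x \<in> upper_pairs m" "y \<in> upper_pairs m" for x y
    using that by (auto simp: upper_pairs_def wedge_basis_def std_basis_def unit_vec_def outer_def split: if_splits)
  show "independent_family (upper_pairs m) wedge_basis"
    by (rule independent_family_dual[where \<phi> = "\<lambda>x A. A (fst x) (snd x)"])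
      (auto simp: linear_fun_apply2 dual simp del: split_paired_All)
  have gen: "outer u v - outer v u \<in> ?S" if "u \<in> std_rep m" "v \<in> std_rep m" for u v
    using outer_std_rep_zero_sums[OF that] outer_std_rep_zero_sums[OF that(2,1)]
      subspace_diff[OF subspace_zero_sums] by (auto simp: outer_def)
  have basis: "wedge_basis x \<in> {outer u v - outer v u |u v. u \<in> std_rep m \<and> v \<in> std_rep m}"
    if "x \<in> upper_pairs m" for x
  proof -
    have "std_basis (fst x) \<in> std_rep m" "std_basis (snd x) \<in> std_rep m"
      using that by (auto simp: upper_pairs_def intro!: std_basis_in_std_rep)
    then show ?thesis
      unfolding wedge_basis_def by blast
  qed
  have wS: "wedge_basis x \<in> ?S" if "x \<in> upper_pairs m" for x
    unfolding wedge_basis_def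
    by (rule gen) (use that in \<open>auto simp: upper_pairs_def intro!: std_basis_in_std_rep\<close>)
  have S: "span (wedge_basis ` upper_pairs m) = ?S"
  proof (rule span_dual[where \<phi> = "\<lambda>x A. A (fst x) (snd x)"])
    fix A assume A: "A \<in> ?S" "\<And>x. x \<in> upper_pairs m \<Longrightarrow> A (fst x) (snd x) = 0"
    have up: "A i j = 0" if "1 \<le> i" "i < j" "j < m" for i j
      using A(2)[of "(i, j)"] that by (simp add: upper_pairs_def)
    have "A i j = 0" if "1 \<le> i" "i < m" "1 \<le> j" "j < m" for i j
    proof -
      have anti: "\<forall>i j. A i j + A j i = 0" using A(1) by simp
      consider "i < j" | "i = j" | "j < i" by linarith
      then show ?thesis
      proof cases
        case 1
        then show ?thesis using up that by simp
      next
        case 2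
        then show ?thesis using anti[rule_format, of i i] by simp
      next
        case 3
        then show ?thesis using up[of j i] anti[rule_format, of i j] that by simp
      qed
    qed
    then show "A = 0" using A(1) by (intro zero_sums_eq_0[of m]) auto
  next
    show "wedge_basis ` upper_pairs m \<subseteq> ?S"
      by (rule image_subsetI) (erule wS)
  qed (auto simp: linear_fun_apply2 dual subspace_ext_square simp del: split_paired_All)
  have "ext_square_rep m \<subseteq> ?S"
    unfolding ext_square_rep_def by (rule span_minimal) (use gen subspace_ext_square in blast)+
  moreover have "span (wedge_basis ` upper_pairs m) \<subseteq> ext_square_rep m"
    unfolding ext_square_rep_def by (rule span_mono) (use basis in blast)
  ultimately show "ext_square_rep m = span (wedge_basis ` upper_pairs m)" "ext_square_rep m = ?S"
    using S by auto
qed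

text \<open>The tabloid of \<open>{i, j}\<close> is corrected by tabloids through 0 and by that of
  \<open>{1, 2}\<close> so that all row sums vanish. Among the pairs of positive indices other than
  \<open>{1, 2}\<close> only \<open>{i, j}\<close> then carries an entry; these entries serve as
  coordinates, and \<open>(1, 2)\<close> drops out of the index set.\<close>

definition specht_basis :: "nat \<times> nat \<Rightarrow> rmat"
  where "specht_basis x = tabloid2 (fst x) (snd x) - tabloid2 1 2 - tabloid2 0 (fst x) - tabloid2 0 (snd x)
    + tabloid2 0 1 + tabloid2 0 2"

lemma tabloid2_apply: "tabloid2 a b i j = matrix_unit a b i j + matrix_unit b a i j"
  by (simp add: tabloid2_def)

lemma matrix_unit_apply: "matrix_unit k l i j = (if i = k \<and> j = l then 1 else 0)"
  by (simp add: matrix_unit_def)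

lemma tabloid2_commute: "tabloid2 a b = tabloid2 b a"
  by (simp add: tabloid2_def add.commute)

text \<open>If \<open>{i, j}\<close> contains 1 or 2, the corrected tabloid is a single polytabloid
  on 0, 1, 2 and the remaining index; if it is disjoint from \<open>{1, 2}\<close>, it is a sum of
  two polytabloids.\<close>

lemma specht_basis_in_specht2_rep:
  assumes x: "x \<in> upper_pairs m - {(1, 2)}"
  shows "specht_basis x \<in> specht2_rep m"
proof -
  obtain i j where ij: "x = (i, j)" "1 \<le> i" "i < j" "j < m" "(i, j) \<noteq> (1, 2)"
    using x by (cases x) (auto simp: upper_pairs_def)
  have gen: "polytabloid2 a b c e \<in> specht2_rep m" if "{a, b, c, e} \<subseteq> {..<m}" "distinct [a, b, c, e]" for a b c e
    unfolding specht2_rep_def using that by (intro span_base) blast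
  consider "i = 1" "j \<ge> 3" | "i = 2" "j \<ge> 3" | "i \<ge> 3"
    using ij by fastforce
  then show ?thesis
  proof cases
    case 1
    then have "specht_basis x = polytabloid2 0 2 1 j"
      using ij by (simp add: specht_basis_def polytabloid2_def algebra_simps)
    then show ?thesis using gen[of 0 2 1 j] 1 ij by simp
  next
    case 2
    then have "specht_basis x = polytabloid2 0 1 2 j"
      using ij tabloid2_commute[of 2 1] by (simp add: specht_basis_def polytabloid2_def algebra_simps)
    then show ?thesis using gen[of 0 1 2 j] 2 ij by simp
  next
    case 3
    then have "specht_basis x = polytabloid2 0 1 i j + polytabloid2 0 2 1 i"
      using ij tabloid2_commute[of i 1] by (simp add: specht_basis_def polytabloid2_def algebra_simps)
    moreover have "polytabloid2 0 1 i j \<in> specht2_rep m" "polytabloid2 0 2 1 i \<in> specht2_rep m"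
      using gen[of 0 1 i j] gen[of 0 2 1 i] 3 ij by auto
    ultimately show ?thesis
      unfolding specht2_rep_def by (simp add: span_add)
  qed
qed

lemma sum_tabloid2_row:
  "(\<Sum>j<m. tabloid2 a b i j) = (if b < m then unit_vec a i else 0) + (if a < m then unit_vec b i else 0)"
proof -
  have "tabloid2 a b i j = unit_vec a i * unit_vec b j + unit_vec b i * unit_vec a j" for j
    by (cases "i = a"; cases "i = b"; cases "j = a"; cases "j = b")
      (simp_all add: tabloid2_apply matrix_unit_apply unit_vec_def)
  then show ?thesis
    by (simp add: sum.distrib sum_distrib_left[symmetric] sum_unit_vec)
qed

lemma tabloid2_sym: "tabloid2 a b j i = tabloid2 a b i j"
  by (simp add: tabloid2_apply matrix_unit_apply conj_commute add.commute)

lemma tabloid2_diag: "a \<noteq> b \<Longrightarrow> tabloid2 a b i i = 0"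
  by (auto simp: tabloid2_apply matrix_unit_apply)

lemma tabloid2_outside:
  assumes "a < m" "b < m" "i < m \<longrightarrow> \<not> j < m"
  shows "tabloid2 a b i j = 0"
proof -
  have "matrix_unit a b i j = 0" "matrix_unit b a i j = 0"
    unfolding matrix_unit_apply by (rule if_not_P; use assms in auto)+
  then show ?thesis by (simp only: tabloid2_apply add_0_left)
qed

lemma tabloid2_upper:
  assumes "a < b" "i < j"
  shows "tabloid2 a b i j = (if i = a \<and> j = b then 1 else 0)"
proof -
  have "matrix_unit b a i j = 0"
    unfolding matrix_unit_apply by (rule if_not_P) (use assms in auto)
  then show ?thesis by (simp only: tabloid2_apply matrix_unit_apply[of a] add_0_right)
qed

lemma polytabloid2_specht2:
  assumes "{a, b, c, e} \<subseteq> {..<m}" "distinct [a, b, c, e]"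
  shows "polytabloid2 a b c e \<in> {A. zero_sums m A \<and> (\<forall>i j. A j i = A i j) \<and> (\<forall>i. A i i = 0)}"
proof -
  have "polytabloid2 a b c e j i = polytabloid2 a b c e i j" for i j
    by (simp add: polytabloid2_def tabloid2_sym)
  note sym = this
  have row: "(\<Sum>j<m. polytabloid2 a b c e i j) = 0" for i
    using assms by (simp add: polytabloid2_def sum.distrib sum_subtractf sum_tabloid2_row)
  have "(\<Sum>i<m. polytabloid2 a b c e i j) = (\<Sum>i<m. polytabloid2 a b c e j i)" for j
    by (intro sum.cong refl sym)
  then have "(\<Sum>i<m. polytabloid2 a b c e i j) = 0" for j
    by (simp only: row)
  moreover have "polytabloid2 a b c e \<in> Mat m m"
    unfolding Mat_def
  proof (intro CollectI allI impI)
    fix i j assume "\<not> (i < m \<and> j < m)"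
    then have h: "i < m \<longrightarrow> \<not> j < m" by blast
    show "polytabloid2 a b c e i j = 0"
      using assms(1) tabloid2_outside[OF _ _ h] by (simp add: polytabloid2_def)
  qed
  moreover have "polytabloid2 a b c e i i = 0" for i
    using assms(2) by (simp add: polytabloid2_def tabloid2_diag)
  ultimately show ?thesis using sym row by (auto simp: zero_sums_def)
qed

lemma specht2_rep_basis:
  assumes m: "m \<ge> 3"
  shows "independent_family (upper_pairs m - {(1, 2)}) specht_basis"
    and "specht2_rep m = span (specht_basis ` (upper_pairs m - {(1, 2)}))"
    and "specht2_rep m = {A. zero_sums m A \<and> (\<forall>i j. A j i = A i j) \<and> (\<forall>i. A i i = 0)}" (is "_ = ?S")
    and "card (upper_pairs m - {(1, 2)}) = m * (m - 3) div 2"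
proof -
  let ?I = "upper_pairs m - {(1, 2)}"
  have dual: "specht_basis y (fst x) (snd x) = (if x = y then 1 else 0)"
    if "x \<in> ?I" "y \<in> ?I" for x y
  proof -
    obtain i j k l where xy: "x = (i, j)" "y = (k, l)" by (cases x, cases y)
    then have "1 \<le> i" "i < j" "1 \<le> k" "k < l" "\<not> (i = 1 \<and> j = 2)"
      using that by (auto simp: upper_pairs_def)
    moreover from this have "tabloid2 1 2 i j = 0" "tabloid2 0 c i j = 0" if "1 \<le> c" for c
      using that by (simp_all add: tabloid2_upper)
    moreover have "specht_basis y (fst x) (snd x) = tabloid2 k l i j - tabloid2 1 2 i j - tabloid2 0 k i j
        - tabloid2 0 l i j + tabloid2 0 1 i j + tabloid2 0 2 i j"
      by (simp add: xy specht_basis_def)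
    ultimately show ?thesis
      by (auto simp: xy tabloid2_upper)
  qed
  show "independent_family ?I specht_basis"
    by (rule independent_family_dual[where \<phi> = "\<lambda>x A. A (fst x) (snd x)"])
      (auto simp: linear_fun_apply2 dual simp del: split_paired_All)
  have sub: "specht2_rep m \<subseteq> ?S"
    unfolding specht2_rep_def
  proof (rule span_minimal[OF subsetI subspace_specht2])
    fix x assume "x \<in> {polytabloid2 a b c e |a b c e. {a, b, c, e} \<subseteq> {..<m} \<and> distinct [a, b, c, e]}"
    then obtain a b c e where x: "x = polytabloid2 a b c e"
      and abce: "{a, b, c, e} \<subseteq> {..<m}" "distinct [a, b, c, e]" by blast
    show "x \<in> ?S" unfolding x by (rule polytabloid2_specht2[OF abce])
  qed
  have S: "span (specht_basis ` ?I) = ?S"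
  proof (rule span_dual[where \<phi> = "\<lambda>x A. A (fst x) (snd x)"])
    fix A assume A: "A \<in> ?S" "\<And>x. x \<in> ?I \<Longrightarrow> A (fst x) (snd x) = 0"
    then have A': "zero_sums m A" "\<And>i j. A j i = A i j" "\<And>i. A i i = 0" by auto
    have up: "A i j = 0" if "1 \<le> i" "i < j" "j < m" "(i, j) \<noteq> (1, 2)" for i j
      using A(2)[of "(i, j)"] that by (simp add: upper_pairs_def)
    have off: "A i j = 0" if "1 \<le> i" "i < m" "1 \<le> j" "j < m" "(i, j) \<noteq> (1, 2)" "(i, j) \<noteq> (2, 1)" for i j
      using up[of i j] up[of j i] A' that
      by (cases i j rule: linorder_cases) auto
    have row: "A i 0 = - (\<Sum>j\<in>{1..<m}. A i j)" if "i < m" for i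
    proof -
      have "{..<m} = insert 0 {1..<m}" using m by auto
      then show ?thesis using A'(1) that by (simp add: zero_sums_def eq_neg_iff_add_eq_0)
    qed
    \<comment> \<open>The entry at \<open>(1, 2)\<close> is not among the coordinates. Rows 1 and 2
      give \<open>A 1 0 = A 2 0 = - A 1 2\<close>, all later rows give \<open>A i 0 = 0\<close>, and
      row 0 then forces twice \<open>A 1 2\<close> to vanish.\<close>
    have r1: "A 1 0 = - A 1 2"
    proof -
      have "(\<Sum>j\<in>{1..<m}. A 1 j) = (\<Sum>j\<in>{2}. A 1 j)"
        by (rule sum.mono_neutral_right) (use m off in auto)
      then show ?thesis using row[of 1] m by simp
    qed
    have r2: "A 2 0 = - A 1 2"
    proof -
      have "(\<Sum>j\<in>{1..<m}. A 2 j) = (\<Sum>j\<in>{1}. A 2 j)"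
        by (rule sum.mono_neutral_right) (use m off in auto)
      then show ?thesis using row[of 2] m A'(2)[of 2 1] by simp
    qed
    have ri: "A i 0 = 0" if "3 \<le> i" "i < m" for i
      using row[of i] that off by (simp add: sum.neutral)
    have "(\<Sum>j\<in>{1..<m}. A 0 j) = (\<Sum>j\<in>{1, 2}. A 0 j)"
    proof (rule sum.mono_neutral_right)
      show "\<forall>j\<in>{1..<m} - {1, 2}. A 0 j = 0"
      proof
        fix j assume "j \<in> {1..<m} - {1, 2}"
        then have "3 \<le> j" "j < m" by auto
        then show "A 0 j = 0" using ri A'(2)[of 0 j] by simp
      qed
    qed (use m in auto)
    then have "A 1 2 = 0"
      using row[of 0] m A'(3)[of 0] A'(2)[of 0 1] A'(2)[of 0 2] r1 r2 by simp
    then have "A i j = 0" if "1 \<le> i" "i < m" "1 \<le> j" "j < m" for i j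
      using off[OF that] A'(2)[of 2 1] by auto
    then show "A = 0" using A'(1) by (intro zero_sums_eq_0[of m]) auto
  next
    show "specht_basis ` ?I \<subseteq> ?S"
      using specht_basis_in_specht2_rep sub by blast
  qed (auto simp: linear_fun_apply2 dual subspace_specht2 simp del: split_paired_All)
  have "span (specht_basis ` ?I) \<subseteq> specht2_rep m"
  proof (rule span_minimal)
    show "specht_basis ` ?I \<subseteq> specht2_rep m"
      by (rule image_subsetI) (erule specht_basis_in_specht2_rep)
    show "subspace (specht2_rep m)"
      unfolding specht2_rep_def by simp
  qed
  then show "specht2_rep m = span (specht_basis ` ?I)" "specht2_rep m = ?S"
    using S sub by auto
  have "(1, 2) \<in> upper_pairs m" using m by (simp add: upper_pairs_def)
  then have "card ?I = (m - 1) * (m - 2) div 2 - 1"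
    by (simp add: card_upper_pairs)
  also have "\<dots> = m * (m - 3) div 2"
  proof -
    obtain k where k: "m = k + 3" using m by (metis add.commute le_Suc_ex)
    have "(m - 1) * (m - 2) = m * (m - 3) + 2"
      by (simp add: k algebra_simps)
    then show ?thesis by simp
  qed
  finally show "card ?I = m * (m - 3) div 2" .
qed

section \<open>Isotypic components of the space of matrices\<close>

lemma Sym_inv:
  assumes "g \<in> Sym m"
  shows "inv g i < m \<longleftrightarrow> i < m" "m \<le> i \<Longrightarrow> inv g i = i" "inv g i = inv g j \<longleftrightarrow> i = j"
    "inv g i = m \<longleftrightarrow> i = m"
proof -
  have h: "inv g permutes {..<m}" using assms by (simp add: Sym_def permutes_inv)
  show lt: "inv g i < m \<longleftrightarrow> i < m" using permutes_in_image[OF h, of i] by simp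
  show eq: "m \<le> i \<Longrightarrow> inv g i = i" for i using permutes_not_in[OF h, of i] by simp
  show inj: "inv g i = inv g j \<longleftrightarrow> i = j" for i j using permutes_inj[OF h] by (auto simp: inj_def)
  show "inv g i = m \<longleftrightarrow> i = m" using inj[of i m] eq[of m] by simp
qed

lemma sum_Sym_inv: "g \<in> Sym m \<Longrightarrow> (\<Sum>i<m. F (inv g i)) = (\<Sum>i<m. F i :: real)"
  using sum.permute[of "inv g" "{..<m}" F] by (simp add: Sym_def permutes_inv o_def)

lemma zero_sums_act:
  assumes "zero_sums m A" "g \<in> Sym m" "h \<in> Sym m"
  shows "zero_sums m (act (g, h) A)"
proof -
  have "(\<Sum>j<m. A (inv g i) (inv h j)) = (\<Sum>j<m. A (inv g i) j)"
    "(\<Sum>j<m. A (inv g j) (inv h i)) = (\<Sum>j<m. A j (inv h i))" for i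
    using sum_Sym_inv[OF assms(3), of "A (inv g i)"] sum_Sym_inv[OF assms(2), of "\<lambda>j. A j (inv h i)"]
    by auto
  then show ?thesis
    using assms(1) Sym_inv[OF assms(2)] Sym_inv[OF assms(3)]
    by (simp add: zero_sums_def act_def Mat_def)
qed

lemma offdiag_sum_row:
  fixes F :: "nat \<Rightarrow> real"
  assumes "i < m" "\<And>j. j < m \<Longrightarrow> j \<noteq> i \<Longrightarrow> F j = 0"
  shows "(\<Sum>j<m. F j) = F i"
proof -
  have "(\<Sum>j<m. F j) = (\<Sum>j\<in>{i}. F j)"
    by (rule sum.mono_neutral_right) (use assms in auto)
  then show ?thesis by simp
qed

text \<open>Summing the hypothesis over \<open>i\<close> gives \<open>(m + k) * s = 0\<close> for
  the total \<open>s\<close>, and \<open>m + k\<close> is positive.\<close>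

lemma const_sum_imp_zero:
  fixes x :: "nat \<Rightarrow> real"
  assumes "\<And>i. i < m \<Longrightarrow> (\<Sum>i<m. x i) = - k * x i" "k > 0" "i < m"
  shows "x i = 0"
proof -
  let ?s = "\<Sum>i<m. x i"
  have "real m * ?s = (\<Sum>i<m. ?s)"
    by simp
  also have "\<dots> = (\<Sum>i<m. - k * x i)"
    by (rule sum.cong) (use assms(1) in auto)
  also have "\<dots> = - k * ?s" by (simp only: sum_distrib_left)
  finally have "(real m + k) * ?s = 0" by (simp add: algebra_simps)
  moreover have "real m + k > 0" using assms(2) by simp
  ultimately have "?s = 0" by simp
  then show ?thesis using assms(1)[OF assms(3)] assms(2) by simp
qed

text \<open>The copies of the standard representation: on the diagonal, constant along the rows and
  constant along the columns of the leading block, then in the extra column and in the extra row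
  \<open>m\<close>. The last two fit into \<open>Mat d d\<close> only for \<open>d = m + 1\<close>,
  which accounts for the multiplicities 3 and 5.\<close>

definition diag_s :: "nat \<Rightarrow> nat \<Rightarrow> rvec \<Rightarrow> rmat"
  where "diag_s m k u = (\<lambda>i j.
    if k = 0 then (if i = j \<and> i < m then u i else 0)
    else if k = 1 then (if i < m \<and> j < m then u i else 0)
    else if k = 2 then (if i < m \<and> j < m then u j else 0)
    else if k = 3 then (if i < m \<and> j = m then u i else 0)
    else (if i = m \<and> j < m then u j else 0))"

lemma diag_s_apply:
  "diag_s m 0 u i j = (if i = j \<and> i < m then u i else 0)"
  "diag_s m 1 u i j = (if i < m \<and> j < m then u i else 0)"
  "diag_s m (Suc 0) u i j = (if i < m \<and> j < m then u i else 0)"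
  "diag_s m 2 u i j = (if i < m \<and> j < m then u j else 0)"
  "diag_s m 3 u i j = (if i < m \<and> j = m then u i else 0)"
  "diag_s m 4 u i j = (if i = m \<and> j < m then u j else 0)"
  by (simp_all add: diag_s_def)

lemma linear_diag_s: "linear (diag_s m k)"
  by (rule linearI) (auto simp: diag_s_def fun_eq_iff)

lemma diag_s_equivariant:
  assumes "g \<in> Sym m"
  shows "diag_s m k (perm_vec g u) = diag_act g (diag_s m k u)"
  unfolding diag_s_def diag_act_def act_def perm_vec_def using Sym_inv[OF assms]
  by (intro ext) simp

lemma sum_lessThan_5: "(\<Sum>j<(5::nat). f j) = f 0 + f 1 + f 2 + f 3 + (f 4 :: 'a::comm_monoid_add)"
  by (simp add: eval_nat_numeral)

lemma sum_lessThan_3: "(\<Sum>j<(3::nat). f j) = f 0 + f 1 + (f 2 :: 'a::comm_monoid_add)"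
  by (simp add: eval_nat_numeral)

lemma less_5_cases: "j < (5::nat) \<longleftrightarrow> j = 0 \<or> j = 1 \<or> j = 2 \<or> j = 3 \<or> j = 4"
  by auto

lemma diag_s_inj:
  assumes m: "m \<ge> 3" and u: "\<And>j. j < 5 \<Longrightarrow> u j \<in> std_rep m"
    and z: "(\<Sum>j<5. diag_s m j (u j)) = 0" and j: "j < 5"
  shows "u j = 0"
proof -
  have e: "diag_s m 0 (u 0) i l + diag_s m 1 (u 1) i l + diag_s m 2 (u 2) i l + diag_s m 3 (u 3) i l
      + diag_s m 4 (u 4) i l = 0" for i l
    using fun_cong[OF fun_cong[OF z, of i], of l] by (simp add: sum_lessThan_5 sum_fun_apply)
  have out: "u j i = 0" if "m \<le> i" "j < 5" for i j
    using u[OF that(2)] that(1) by (simp add: std_rep_def)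
  have eq0: "u j = 0" if "\<And>i. i < m \<Longrightarrow> u j i = 0" "j < 5" for j
    using that out by (metis ext not_le zero_fun_apply)
  have off: "u 1 i + u 2 l = 0" if "i < m" "l < m" "i \<noteq> l" for i l
    using e[of i l] that unfolding diag_s_apply by simp
  \<comment> \<open>Off the diagonal of the block only copies 1 and 2 are present. A third index
    \<open>l\<close>, available since \<open>m \<ge> 3\<close>, compares \<open>u 1 i\<close> with
    \<open>u 1 i'\<close>, so \<open>u 1\<close> is constant and, having sum zero, vanishes.\<close>
  have third: "\<exists>l<m. l \<noteq> i \<and> l \<noteq> i'" for i i'
  proof -
    have "\<exists>l<3. l \<noteq> i \<and> l \<noteq> i'" by presburger
    then show ?thesis using m by (meson less_le_trans)
  qed
  have c: "u 1 i = u 1 i'" if "i < m" "i' < m" for i i'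
    using third[of i i'] off that by (metis add_right_imp_eq)
  have "u 1 i = 0" if "i < m" for i
  proof -
    have "(\<Sum>i'<m. u 1 i') = (\<Sum>i'<m. u 1 i)" by (intro sum.cong refl c) (use that in auto)
    then show ?thesis using u[of 1] m by (simp add: std_rep_def)
  qed
  then have u1: "u 1 = 0" by (intro eq0) auto
  have "u 2 i = 0" if "i < m" for i
    using third[of i i] off[of _ i] that u1 by auto
  then have u2: "u 2 = 0" by (intro eq0) auto
  have "u 0 i = 0" if "i < m" for i
    using e[of i i] that u1 u2 unfolding diag_s_apply by simp
  then have u0: "u 0 = 0" by (intro eq0) auto
  have "u 3 i = 0" if "i < m" for i
    using e[of i m] that unfolding diag_s_apply by simp
  then have u3: "u 3 = 0" by (intro eq0) auto
  have "u 4 i = 0" if "i < m" for i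
    using e[of m i] that unfolding diag_s_apply by simp
  then have u4: "u 4 = 0" by (intro eq0) auto
  show ?thesis using j u0 u1 u2 u3 u4 by (auto simp: less_5_cases)
qed

text \<open>Read entry by entry, the eigenvalue equation expresses each off-diagonal entry of the
  block through sums over its row and column. The diagonal, the last column and the last row only
  have to have sum zero, and the corner vanishes because \<open>m^2\<close> differs from
  \<open>m^2 - 2 m\<close>.\<close>

lemma diag_s_decompose:
  assumes m: "m \<ge> 3" and d: "d = m \<or> d = m + 1" and A: "A \<in> Mat d d"
    and Z: "orbit_sum m A = (real m ^ 2 - 2 * real m) *\<^sub>R A"
  shows "\<exists>u. (\<forall>j<5. u j \<in> std_rep m) \<and> (d = m \<longrightarrow> u 3 = 0 \<and> u 4 = 0) \<and> A = (\<Sum>j<5. diag_s m j (u j))"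
proof -
  \<comment> \<open>Row and column sums without the diagonal entry, the form in which they occur in
    the off-diagonal equation.\<close>
  define r where "r = (\<lambda>i. (\<Sum>b<m. A i b) - A i i)"
  define c where "c = (\<lambda>j. (\<Sum>a<m. A a j) - A j j)"
  have m': "real m \<ge> 3" using m by simp
  have Zij: "orbit_sum m A i j = (real m ^ 2 - 2 * real m) * A i j" for i j
    using Z by simp
  have tr: "(\<Sum>a<m. A a a) = 0"
    using Zij[of 0 0] orbit_sum_diag[of 0 m A] m by simp
  have E: "(real m - 1) * A i j - A j i - c j - r i = 0" if "i < m" "j < m" "i \<noteq> j" for i j
    using Zij[of i j] orbit_sum_offdiag[OF that, of A] unfolding r_def c_def
    by (simp add: power2_eq_square algebra_simps)
  \<comment> \<open>Equation \<open>E\<close> holds at all positions of a row except the diagonal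
    one, so its sum over the row equals that single term; this isolates the total of
    \<open>c\<close>.\<close>
  have T: "(\<Sum>j<m. c j) = 0"
  proof -
    have "(\<Sum>j<m. (real m - 1) * A 0 j - A j 0 - c j - r 0) = (real m - 1) * A 0 0 - A 0 0 - c 0 - r 0"
      by (rule offdiag_sum_row) (use E[of 0] m in auto)
    moreover have "(\<Sum>j<m. A 0 j) = r 0 + A 0 0" "(\<Sum>j<m. A j 0) = c 0 + A 0 0"
      by (simp_all add: r_def c_def)
    moreover have "(\<Sum>j<m. (real m - 1) * A 0 j - A j 0 - c j - r 0)
      = (real m - 1) * (\<Sum>j<m. A 0 j) - (\<Sum>j<m. A j 0) - (\<Sum>j<m. c j) - real m * r 0"
      by (simp add: sum_subtractf sum_distrib_left)
    ultimately show ?thesis by algebra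
  qed
  have T': "(\<Sum>i<m. r i) = 0"
  proof -
    have "(\<Sum>i<m. \<Sum>b<m. A i b) = (\<Sum>j<m. \<Sum>a<m. A a j)" by (rule sum.swap)
    then show ?thesis using T by (simp add: r_def c_def sum_subtractf)
  qed
  \<comment> \<open>The equations \<open>E\<close> for \<open>(i, j)\<close> and
    \<open>(j, i)\<close> form a two by two system for \<open>A i j\<close> and \<open>A j i\<close>
    with coefficients \<open>m - 1\<close> on the diagonal and \<open>- 1\<close> off it;
    \<open>K\<close> is its determinant.\<close>
  define K where "K = real m * (real m - 2)"
  have K: "K > 0" unfolding K_def using m' by (intro mult_pos_pos) auto
  define x where "x = (\<lambda>i. if i < m then ((real m - 1) * r i + c i) / K else 0)"
  define y where "y = (\<lambda>i. if i < m then ((real m - 1) * c i + r i) / K else 0)"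
  have xy: "A i j = x i + y j" if "i < m" "j < m" "i \<noteq> j" for i j
  proof -
    have "K * A i j = ((real m - 1) * r i + c i) + ((real m - 1) * c j + r j)"
      using E[OF that] E[OF that(2,1) that(3)[symmetric]] unfolding K_def by algebra
    then have "A i j = (((real m - 1) * r i + c i) + ((real m - 1) * c j + r j)) / K"
      using K by (simp add: eq_divide_eq mult.commute)
    then show ?thesis using that by (simp only: x_def y_def add_divide_distrib if_True)
  qed
  have x_std: "x \<in> std_rep m" and y_std: "y \<in> std_rep m"
    using T T' by (auto simp: std_rep_def x_def y_def sum_divide_distrib[symmetric] sum.distrib sum_distrib_left[symmetric])
  define u where "u = (\<lambda>k::nat. if k = 0 then (\<lambda>i. if i < m then A i i - x i - y i else 0)
    else if k = 1 then x else if k = 2 then y else if k = 3 then (\<lambda>i. if i < m then A i m else 0)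
    else (\<lambda>j. if j < m then A m j else 0))"
  have "(\<Sum>a<m. A a m) = 0" "(\<Sum>a<m. A m a) = 0"
    using Zij[of 0 m] orbit_sum_col[of 0 m m A] Zij[of m 0] orbit_sum_row[of m m 0 A] m by auto
  then have std: "u j \<in> std_rep m" if "j < 5" for j
    using that x_std y_std tr
    by (auto simp: u_def std_rep_def less_5_cases sum_subtractf)
  have corner: "A i j = 0" if "m \<le> i" "m \<le> j" for i j
    using Zij[of i j] orbit_sum_corner[OF that, of A] m by (simp add: algebra_simps)
  have out: "A i j = 0" if "m < i \<or> m < j" for i j
    using A d that by (auto simp: Mat_def)
  have out': "A i j = 0" if "d = m" "i = m \<or> j = m" for i j
    using A that by (auto simp: Mat_def)
  have "A i j = diag_s m 0 (u 0) i j + diag_s m 1 (u 1) i j + diag_s m 2 (u 2) i j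
    + diag_s m 3 (u 3) i j + diag_s m 4 (u 4) i j" for i j
  proof -
    consider "i < m" "j < m" "i \<noteq> j" | "i < m" "i = j" | "i < m" "j = m" | "i = m" "j < m"
      | "m < i \<or> m < j" | "i = m" "j = m" by linarith
    then show ?thesis
    proof cases
      case 5
      then show ?thesis by (elim disjE) (simp_all add: diag_s_apply out)
    next
      case 1
      then show ?thesis using xy[OF 1] by (simp add: diag_s_apply u_def)
    next
      case 6
      then show ?thesis using corner[of m m] by (simp add: diag_s_apply u_def)
    qed (simp_all add: diag_s_apply u_def)
  qed
  then have "A = (\<Sum>j<5. diag_s m j (u j))"
    by (intro ext) (simp add: sum_lessThan_5 sum_fun_apply)
  moreover have "u 3 = 0 \<and> u 4 = 0" if "d = m"
    using out'[OF that] by (auto simp: u_def fun_eq_iff)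
  ultimately show ?thesis using std by blast
qed

lemma diag_s_in_Mat:
  assumes "u \<in> std_rep m" "d = m \<and> k < 3 \<or> d = m + 1"
  shows "diag_s m k u \<in> Mat d d"
  using assms by (auto simp: Mat_def diag_s_def)

lemma diag_comp_s_eq:
  assumes m: "m \<ge> 3" and d: "d = m \<and> k = 3 \<or> d = m + 1 \<and> k = 5"
  shows "diag_comp_s d m = {\<Sum>j<k. diag_s m j (u j) |u. \<forall>j<k. u j \<in> std_rep m}"
    and "\<And>u j. (\<And>j. j < k \<Longrightarrow> u j \<in> std_rep m) \<Longrightarrow> (\<Sum>j<k. diag_s m j (u j)) = 0 \<Longrightarrow> j < k \<Longrightarrow> u j = 0"
proof -
  show inj: "u j = 0" if u: "\<And>j. j < k \<Longrightarrow> u j \<in> std_rep m" "(\<Sum>j<k. diag_s m j (u j)) = 0" "j < k" for u j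
  proof -
    \<comment> \<open>Padding with zeros embeds the case of three copies into that of five, so one
      injectivity statement serves both.\<close>
    define w where "w = (\<lambda>j. if j < k then u j else 0)"
    have "(\<Sum>j<5. diag_s m j (w j)) = (\<Sum>j<k. diag_s m j (u j))"
      by (rule sum.mono_neutral_cong_right) (use d in \<open>auto simp: w_def linear_0[OF linear_diag_s]\<close>)
    moreover have "w j \<in> std_rep m" for j
      using u(1) by (simp add: w_def subspace_0[OF subspace_std_rep])
    ultimately have "w j = 0"
      using u(2,3) d by (intro diag_s_inj[OF m]) auto
    then show ?thesis using u(3) by (simp add: w_def)
  qed
  show "diag_comp_s d m = {\<Sum>j<k. diag_s m j (u j) |u. \<forall>j<k. u j \<in> std_rep m}"
    unfolding diag_comp_s_def
  proof (rule isotypic_copies[where \<Phi> = "diag_s m"])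
    fix f :: "rvec \<Rightarrow> rmat" and u
    assume f: "linear f" "\<And>g u. g \<in> Sym m \<Longrightarrow> u \<in> std_rep m \<Longrightarrow> f (perm_vec g u) = diag_act g (f u)"
      "\<And>u. u \<in> std_rep m \<Longrightarrow> f u \<in> Mat d d" and u: "u \<in> std_rep m"
    have "orbit_sum m (f u) = (real m ^ 2 - 2 * real m) *\<^sub>R f u"
      using f(1,2) u orbit_sum_vec_std_rep[OF u, unfolded orbit_sum_vec_def] by (rule orbit_sum_equivariant)
    then obtain w where w: "\<forall>j<5. w j \<in> std_rep m" "d = m \<longrightarrow> w 3 = 0 \<and> w 4 = 0" "f u = (\<Sum>j<5. diag_s m j (w j))"
      using diag_s_decompose[OF m _ f(3)[OF u]] d by blast
    have "(\<Sum>j<5. diag_s m j (w j)) = (\<Sum>j<k. diag_s m j (w j))"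
      using d w(2) by (auto simp: sum_lessThan_5 sum_lessThan_3 linear_0[OF linear_diag_s])
    then show "f u \<in> {\<Sum>j<k. diag_s m j (u j) |u. \<forall>j<k. u j \<in> std_rep m}"
      using w d by auto
  next
    show "perm_vec g u \<in> std_rep m" if "g \<in> Sym m" "u \<in> std_rep m" for g u
      using that by (rule perm_vec_std_rep)
    show "diag_s m j u \<in> Mat d d" if "j < k" "u \<in> std_rep m" for j u
      using that d by (intro diag_s_in_Mat) auto
    show "diag_s m j (perm_vec g u) = diag_act g (diag_s m j u)" if "g \<in> Sym m" for j g u
      using that by (rule diag_s_equivariant)
    show "u j = 0" if "\<And>j. j < k \<Longrightarrow> u j \<in> std_rep m" "(\<Sum>j<k. diag_s m j (u j)) = 0" "j < k" for u j
      using that by (rule inj)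
  qed (rule subspace_std_rep linear_diag_s refl)+
qed

text \<open>All row and column sums drop out, and besides the multiple of \<open>A i j\<close> only
  the exchange term \<open>2 * A j i\<close> remains. The case \<open>\<epsilon> = 1\<close> is the
  Specht module, \<open>\<epsilon> = -1\<close> the exterior square.\<close>

lemma orbit_sum_zero_sums:
  assumes A: "zero_sums m A" and eps: "\<And>i j. A j i = \<epsilon> * A i j" and diag: "\<And>i. A i i = 0"
  shows "orbit_sum m A = (real m ^ 2 - 4 * real m + 2 + 2 * \<epsilon>) *\<^sub>R A"
proof (intro ext)
  fix i j
  have col: "(\<Sum>a<m. A a j) = 0" and row: "(\<Sum>a<m. A i a) = 0" for i j
    using A by (cases "j < m"; cases "i < m"; simp add: zero_sums_def Mat_def)+
  have out: "A i j = 0" if "m \<le> i \<or> m \<le> j" for i j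
    using A that by (auto simp: zero_sums_def Mat_def)
  consider "i < m" "i = j" | "i < m" "j < m" "i \<noteq> j" | "i < m" "m \<le> j" | "m \<le> i" "j < m" | "m \<le> i" "m \<le> j"
    by linarith
  then have "orbit_sum m A i j = (real m ^ 2 - 4 * real m + 2 + 2 * \<epsilon>) * A i j"
  proof cases
    case 1
    then show ?thesis by (simp add: orbit_sum_diag diag)
  next
    case 2
    then have "orbit_sum m A i j = 2 * A j i + (real m ^ 2 - 4 * real m + 2) * A i j"
      by (simp add: orbit_sum_offdiag diag col row)
    then show ?thesis unfolding eps[where i = i and j = j] by (simp add: algebra_simps)
  next
    case 3
    then show ?thesis by (simp add: orbit_sum_col col out)
  next
    case 4
    then show ?thesis by (simp add: orbit_sum_row row out)
  next
    case 5
    then show ?thesis by (simp add: orbit_sum_corner out)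
  qed
  then show "orbit_sum m A i j = ((real m ^ 2 - 4 * real m + 2 + 2 * \<epsilon>) *\<^sub>R A) i j" by simp
qed

text \<open>The diagonal, the last column and the last row each satisfy an equation in which the
  total is \<open>- k\<close> times every entry, and therefore vanish. In the block, summing the
  off-diagonal equation gives the same kind of equation for the row sums, and then the vanishing of
  the column sums; what is left of the equation is
  \<open>A j i = \<epsilon> * A i j\<close>.\<close>

lemma orbit_sum_eigen_zero_sums:
  assumes m: "m \<ge> 3" and d: "d = m \<or> d = m + 1" and A: "A \<in> Mat d d" and eps: "\<epsilon> = 1 \<or> \<epsilon> = -1"
    and Z: "orbit_sum m A = (real m ^ 2 - 4 * real m + 2 + 2 * \<epsilon>) *\<^sub>R A"
  shows "zero_sums m A \<and> (\<forall>i j. A j i = \<epsilon> * A i j) \<and> (\<forall>i. A i i = 0)"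
proof -
  have m': "real m \<ge> 3" using m by simp
  have Zij: "orbit_sum m A i j = (real m ^ 2 - 4 * real m + 2 + 2 * \<epsilon>) * A i j" for i j
    using Z by simp
  \<comment> \<open>Half the gap between \<open>m^2 - 2 m\<close> and the present eigenvalue; it is
    positive because \<open>m \<ge> 3\<close>.\<close>
  define k where "k = real m - 1 - \<epsilon>"
  have k: "k > 0" using eps m' by (auto simp: k_def)
  have diag: "A i i = 0" if "i < m" for i
  proof (rule const_sum_imp_zero[OF _ k that])
    show "(\<Sum>i<m. A i i) = - k * A i i" if "i < m" for i
      using Zij[of i i] orbit_sum_diag[OF that, of A] by (simp add: k_def algebra_simps)
  qed
  have col: "A i j = 0" if "i < m" "m \<le> j" for i j
  proof (rule const_sum_imp_zero[OF _ k that(1)])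
    show "(\<Sum>i<m. A i j) = - k * A i j" if "i < m" for i
      using Zij[of i j] orbit_sum_col[OF that \<open>m \<le> j\<close>, of A] by (simp add: k_def algebra_simps)
  qed
  have row: "A i j = 0" if "m \<le> i" "j < m" for i j
  proof (rule const_sum_imp_zero[OF _ k that(2)])
    show "(\<Sum>j<m. A i j) = - k * A i j" if "j < m" for j
      using Zij[of i j] orbit_sum_row[OF \<open>m \<le> i\<close> that, of A] by (simp add: k_def algebra_simps)
  qed
  have corner: "A i j = 0" if "m \<le> i" "m \<le> j" for i j
  proof -
    have "(4 * real m - 2 - 2 * \<epsilon>) * A i j = 0"
      using Zij[of i j] orbit_sum_corner[OF that, of A] by (simp add: algebra_simps)
    moreover have "4 * real m - 2 - 2 * \<epsilon> > 0" using eps m' by auto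
    ultimately show ?thesis by simp
  qed
  have out: "A i j = 0" if "\<not> (i < m \<and> j < m)" for i j
    using row[of i j] col[of i j] corner[of i j] that by (meson not_le)
  define R where "R = (\<lambda>i. \<Sum>a<m. A i a)"
  define C where "C = (\<lambda>j. \<Sum>a<m. A a j)"
  have E: "A j i - \<epsilon> * A i j + C j + R i = 0" if "i < m" "j < m" "i \<noteq> j" for i j
    using Zij[of i j] orbit_sum_offdiag[OF that, of A] diag that
    unfolding R_def C_def by (simp add: algebra_simps)
  have CR: "(\<Sum>j<m. C j) = (\<Sum>i<m. R i)"
    unfolding C_def R_def by (rule sum.swap)
  define T where "T = (\<Sum>i<m. R i)"
  have T: "(\<Sum>j<m. C j) = T"
    using CR by (simp only: T_def)
  have RC: "(\<Sum>j<m. A i j) = R i" "(\<Sum>j<m. A j i) = C i" for i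
    by (simp_all add: R_def C_def)
  have R: "T = - k * R i" if "i < m" for i
  proof -
    have "(\<Sum>j<m. A j i - \<epsilon> * A i j + C j + R i) = A i i - \<epsilon> * A i i + C i + R i"
      by (rule offdiag_sum_row) (use E[OF that] that in auto)
    moreover have "(\<Sum>j<m. A j i - \<epsilon> * A i j + C j + R i) = C i - \<epsilon> * R i + T + real m * R i"
      by (simp add: sum.distrib sum_subtractf sum_distrib_left[symmetric] T RC)
    ultimately show ?thesis using diag[OF that] by (simp add: k_def algebra_simps)
  qed
  have R0: "R i = 0" if "i < m" for i
    by (rule const_sum_imp_zero[OF _ k that]) (use R in \<open>simp add: T_def\<close>)
  then have T0: "T = 0" by (simp add: T_def)
  have C0: "C j = 0" if "j < m" for j
  proof -
    have "(\<Sum>i<m. A j i - \<epsilon> * A i j + C j + R i) = A j j - \<epsilon> * A j j + C j + R j"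
      by (rule offdiag_sum_row) (use E[OF _ that] that in auto)
    moreover have "(\<Sum>i<m. A j i - \<epsilon> * A i j + C j + R i) = R j - \<epsilon> * C j + real m * C j + T"
      by (simp add: sum.distrib sum_subtractf sum_distrib_left[symmetric] T_def[symmetric] RC)
    ultimately have "k * C j = 0" using diag[OF that] R0[OF that] T0 by (simp add: k_def algebra_simps)
    then show ?thesis using k by simp
  qed
  have "A j i = \<epsilon> * A i j" for i j
    using E[of i j] out[of i j] out[of j i] C0[of j] R0[of i] diag[of i] by (cases "i < m \<and> j < m"; cases "i = j") auto
  moreover have "A i i = 0" for i using diag[of i] out[of i i] by blast
  moreover have "zero_sums m A"
    using R0 C0 out by (auto simp: zero_sums_def Mat_def R_def C_def)
  ultimately show ?thesis by blast
qed

text \<open>The inclusion is the only copy: an equivariant image of \<open>U\<close> consists of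
  eigenmatrices of \<open>orbit_sum\<close>, and \<open>orbit_sum_eigen_zero_sums\<close> identifies
  this eigenspace within \<open>Mat d d\<close> with \<open>U\<close> itself.\<close>

lemma isotypic_self:
  assumes m: "m \<ge> 3" and d: "d = m \<or> d = m + 1" and eps: "\<epsilon> = 1 \<or> \<epsilon> = -1"
    and U: "U = {A. zero_sums m A \<and> (\<forall>i j. A j i = \<epsilon> * A i j) \<and> (\<forall>i. A i i = 0)}" "subspace U"
  shows "isotypic (Sym m) diag_act (Mat d d) diag_act U = {\<Sum>j<1. u j |u. \<forall>j<(1::nat). u j \<in> U}"
proof (rule isotypic_copies[where \<Phi> = "\<lambda>_ A. A" and k = 1])
  show "diag_act g u \<in> U" if g: "g \<in> Sym m" and u: "u \<in> U" for g u
  proof -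
    have "zero_sums m (diag_act g u)"
      unfolding diag_act_def using u g unfolding U(1) by (intro zero_sums_act) blast+
    moreover have "u j i = \<epsilon> * u i j" "u i i = 0" for i j
      using u unfolding U(1) by blast+
    then have "diag_act g u j i = \<epsilon> * diag_act g u i j" "diag_act g u i i = 0" for i j
      unfolding diag_act_def act_def fst_conv snd_conv by blast+
    ultimately show ?thesis unfolding U(1) by blast
  qed
  show "u \<in> Mat d d" if "u \<in> U" for u
  proof -
    have "zero_sums m u" using that unfolding U(1) by blast
    then show ?thesis using d by (auto simp: zero_sums_def Mat_def)
  qed
  fix f u
  assume f: "linear f" "\<And>g u. g \<in> Sym m \<Longrightarrow> u \<in> U \<Longrightarrow> f (diag_act g u) = diag_act g (f u)"
    "\<And>u. u \<in> U \<Longrightarrow> f u \<in> Mat d d" and u: "u \<in> U"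
  have "orbit_sum m u = (real m ^ 2 - 4 * real m + 2 + 2 * \<epsilon>) *\<^sub>R u"
    by (rule orbit_sum_zero_sums) (use u in \<open>unfold U(1), blast\<close>)+
  then have "orbit_sum m (f u) = (real m ^ 2 - 4 * real m + 2 + 2 * \<epsilon>) *\<^sub>R f u"
    using f(1,2) u unfolding orbit_sum_def[of m u] by (intro orbit_sum_equivariant[where f = f and U = U and b = diag_act])
  then have "f u \<in> U"
    using orbit_sum_eigen_zero_sums[OF m d f(3)[OF u] eps] unfolding U(1) by blast
  then show "f u \<in> {\<Sum>j<1. u j |u. \<forall>j<(1::nat). u j \<in> U}"
    by (auto intro!: exI[of _ "\<lambda>_. f u"])
qed (use U(2) in \<open>auto simp: linear_ident\<close>)

lemma diag_comp_x_eq: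
  assumes "m \<ge> 3" "d = m \<or> d = m + 1"
  shows "diag_comp_x d m = {\<Sum>j<1. u j |u. \<forall>j<(1::nat). u j \<in> ext_square_rep m}"
  unfolding diag_comp_x_def
proof (rule isotypic_self[OF assms])
  have "(\<forall>i j. A i j + A j i = 0) \<longleftrightarrow> (\<forall>i j. A j i = - 1 * A i j) \<and> (\<forall>i. A i i = 0)" for A :: rmat
  proof
    assume *: "\<forall>i j. A i j + A j i = 0"
    have "A j i = - 1 * A i j" for i j using *[rule_format, of i j] by linarith
    moreover have "A i i = 0" for i using *[rule_format, of i i] by linarith
    ultimately show "(\<forall>i j. A j i = - 1 * A i j) \<and> (\<forall>i. A i i = 0)" by blast
  next
    assume *: "(\<forall>i j. A j i = - 1 * A i j) \<and> (\<forall>i. A i i = 0)"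
    show "\<forall>i j. A i j + A j i = 0"
    proof (intro allI)
      fix i j
      show "A i j + A j i = 0" using *[THEN conjunct1, rule_format, of j i] by linarith
    qed
  qed
  then show "ext_square_rep m = {A. zero_sums m A \<and> (\<forall>i j. A j i = - 1 * A i j) \<and> (\<forall>i. A i i = 0)}"
    unfolding ext_square_rep_basis(3) by (simp only:)
qed (simp_all add: ext_square_rep_def)

lemma diag_comp_y_eq:
  assumes "m \<ge> 3" "d = m \<or> d = m + 1"
  shows "diag_comp_y d m = {\<Sum>j<1. u j |u. \<forall>j<(1::nat). u j \<in> specht2_rep m}"
  unfolding diag_comp_y_def
proof (rule isotypic_self[OF assms])
  show "specht2_rep m = {A. zero_sums m A \<and> (\<forall>i j. A j i = 1 * A i j) \<and> (\<forall>i. A i i = 0)}"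
    unfolding specht2_rep_basis(3)[OF assms(1)] by (simp only: mult_1_left)
qed (simp_all add: specht2_rep_def)

text \<open>Copy 1 fills the whole block, diagonal included, so its coefficient is the off-diagonal
  value and the sum of the first two coefficients is the diagonal value. Copies 2, 3 and 4 use the
  extra index \<open>m\<close>.\<close>

definition diag_t :: "nat \<Rightarrow> nat \<Rightarrow> real \<Rightarrow> rmat"
  where "diag_t m k c = (\<lambda>i j.
    if k = 0 then (if i = j \<and> i < m then c else 0)
    else if k = 1 then (if i < m \<and> j < m then c else 0)
    else if k = 2 then (if i < m \<and> j = m then c else 0)
    else if k = 3 then (if i = m \<and> j < m then c else 0)
    else (if i = m \<and> j = m then c else 0))"

lemma diag_t_apply:
  "diag_t m 0 c i j = (if i = j \<and> i < m then c else 0)"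
  "diag_t m 1 c i j = (if i < m \<and> j < m then c else 0)"
  "diag_t m (Suc 0) c i j = (if i < m \<and> j < m then c else 0)"
  "diag_t m 2 c i j = (if i < m \<and> j = m then c else 0)"
  "diag_t m 3 c i j = (if i = m \<and> j < m then c else 0)"
  "diag_t m 4 c i j = (if i = m \<and> j = m then c else 0)"
  by (simp_all add: diag_t_def)

lemma linear_diag_t: "linear (diag_t m k)"
  by (rule linearI) (auto simp: diag_t_def fun_eq_iff)

lemma diag_t_invariant:
  assumes "g \<in> Sym m"
  shows "diag_act g (diag_t m k c) = diag_t m k c"
  unfolding diag_t_def diag_act_def act_def fst_conv snd_conv
  by (intro ext) (simp only: Sym_inv(1,3,4)[OF assms])

lemma diag_t_in_Mat:
  assumes "d = m \<and> k < 2 \<or> d = m + 1"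
  shows "diag_t m k u \<in> Mat d d"
proof -
  have "diag_t m k u i j = 0" if "\<not> (i < d \<and> j < d)" for i j
    using assms
  proof
    assume *: "d = m \<and> k < 2"
    then have "k = 0 \<or> k = 1" by auto
    then show ?thesis using * that by (auto simp: diag_t_def)
  next
    assume "d = m + 1"
    then have "m < i \<or> m < j" using that by auto
    then show ?thesis by (elim disjE) (simp_all add: diag_t_def)
  qed
  then show ?thesis by (auto simp: Mat_def)
qed

lemma sum_lessThan_2: "(\<Sum>j<(2::nat). f j) = f 0 + (f 1 :: 'a::comm_monoid_add)"
  by (simp add: eval_nat_numeral)

lemma diag_comp_t_eq:
  assumes m: "m \<ge> 3" and d: "d = m \<and> k = 2 \<or> d = m + 1 \<and> k = 5"
  shows "diag_comp_t d m = {\<Sum>j<k. diag_t m j (u j) |u. \<forall>j<k. u j \<in> UNIV}"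
    and "\<And>u j. (\<Sum>j<k. diag_t m j (u j)) = 0 \<Longrightarrow> j < k \<Longrightarrow> u j = 0"
proof -
  show inj: "u j = 0" if u: "(\<Sum>j<k. diag_t m j (u j)) = 0" "j < k" for u j
  proof -
    define w where "w = (\<lambda>j. if j < k then u j else 0)"
    have "(\<Sum>j<5. diag_t m j (w j)) = (\<Sum>j<k. diag_t m j (u j))"
      by (rule sum.mono_neutral_cong_right) (use d in \<open>auto simp: w_def linear_0[OF linear_diag_t]\<close>)
    then have z: "(\<Sum>j<5. diag_t m j (w j)) = 0" using u by simp
    have e: "diag_t m 0 (w 0) i l + diag_t m 1 (w 1) i l + diag_t m 2 (w 2) i l + diag_t m 3 (w 3) i l
      + diag_t m 4 (w 4) i l = 0" for i l
      using fun_cong[OF fun_cong[OF z, of i], of l] by (simp add: sum_lessThan_5 sum_fun_apply)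
    have "w 1 = 0" using e[of 0 1] m unfolding diag_t_apply by simp
    moreover have "w 0 = 0" using e[of 0 0] m \<open>w 1 = 0\<close> unfolding diag_t_apply by simp
    moreover have "w 2 = 0" using e[of 0 m] m unfolding diag_t_apply by simp
    moreover have "w 3 = 0" using e[of m 0] m unfolding diag_t_apply by simp
    moreover have "w 4 = 0" using e[of m m] m unfolding diag_t_apply by simp
    moreover have "j < 5" using u d by auto
    ultimately have "w j = 0" by (auto simp: less_5_cases)
    then show ?thesis using u by (simp add: w_def)
  qed
  show "diag_comp_t d m = {\<Sum>j<k. diag_t m j (u j) |u. \<forall>j<k. u j \<in> UNIV}"
    unfolding diag_comp_t_def
  proof (rule isotypic_copies[where \<Phi> = "diag_t m"])
    fix f :: "real \<Rightarrow> rmat" and u :: real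
    assume f: "\<And>g u. g \<in> Sym m \<Longrightarrow> u \<in> UNIV \<Longrightarrow> f u = diag_act g (f u)"
      "\<And>u. u \<in> UNIV \<Longrightarrow> f u \<in> Mat d d"
    define A where "A = f u"
    \<comment> \<open>For the trivial representation equivariance means that the image is fixed by
      every transposition, so its entries are constant on orbits of index pairs.\<close>
    have inv: "A (swap a b i) (swap a b j) = A i j" if "a < m" "b < m" for a b i j
      using fun_cong[OF fun_cong[OF f(1)[OF transpose_in_Sym[OF that], of u], of i], of j]
      by (simp add: A_def diag_act_def act_def)
    have AM: "A \<in> Mat d d" using f(2) by (simp add: A_def)
    have dg: "A i i = A 0 0" if "i < m" for i
      using inv[of i 0 i i] that m by simp
    have lc: "A i m = A 0 m" "A m i = A m 0" if "i < m" for i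
      using inv[of i 0 i m] inv[of i 0 m i] that m by (auto simp: Transposition.transpose_def)
    have mv: "A i j = A i l" if "i < m" "j < m" "l < m" "i \<noteq> j" "i \<noteq> l" for i j l
      using inv[of j l i j] that by (simp add: Transposition.transpose_def)
    have mv': "A i j = A k j" if "i < m" "j < m" "k < m" "i \<noteq> j" "k \<noteq> j" for i j k
      using inv[of i k i j] that by (simp add: Transposition.transpose_def)
    \<comment> \<open>Each transposition moves one index and keeps the other. From row 1 the target
      \<open>(0, 1)\<close> is not reached in this way without meeting the diagonal at
      \<open>(1, 1)\<close>, whence the detour through column 2.\<close>
    have off: "A i j = A 0 1" if "i < m" "j < m" "i \<noteq> j" for i j
    proof (cases "i = 1")
      case True
      then have "A i j = A 1 2" using mv[of i j 2] that m by auto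
      also have "\<dots> = A 0 2" using mv'[of 1 2 0] m by auto
      also have "\<dots> = A 0 1" using mv[of 0 2 1] m by auto
      finally show ?thesis .
    next
      case False
      then have "A i j = A i 1" using mv[of i j 1] that m by auto
      also have "\<dots> = A 0 1" using mv'[of i 1 0] False that m by auto
      finally show ?thesis .
    qed
    define w where "w = (\<lambda>k::nat. if k = 0 then A 0 0 - A 0 1 else if k = 1 then A 0 1
      else if k = 2 then A 0 m else if k = 3 then A m 0 else A m m)"
    have out: "A i j = 0" if "m < i \<or> m < j" for i j
      using AM d that by (auto simp: Mat_def)
    have w0: "w k = 0" if "d = m" "k \<ge> 2" for k
      using AM that by (auto simp: Mat_def w_def)
    have "A i j = diag_t m 0 (w 0) i j + diag_t m 1 (w 1) i j + diag_t m 2 (w 2) i j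
      + diag_t m 3 (w 3) i j + diag_t m 4 (w 4) i j" for i j
    proof -
      consider "i < m" "j < m" "i \<noteq> j" | "i < m" "i = j" | "i < m" "j = m" | "i = m" "j < m"
        | "m < i \<or> m < j" | "i = m" "j = m" by linarith
      then show ?thesis
      proof cases
        case 1
        then show ?thesis using off[of i j] by (simp add: diag_t_apply w_def)
      next
        case 2
        then show ?thesis using dg[of i] by (simp add: diag_t_apply w_def)
      next
        case 3
        then show ?thesis using lc(1)[of i] by (simp add: diag_t_apply w_def)
      next
        case 4
        then show ?thesis using lc(2)[of j] by (simp add: diag_t_apply w_def)
      next
        case 5
        then show ?thesis by (elim disjE) (simp_all add: diag_t_apply out)
      next
        case 6
        then show ?thesis by (simp add: diag_t_apply w_def)
      qed
    qed
    then have "A = (\<Sum>j<5. diag_t m j (w j))"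
      by (intro ext) (simp add: sum_lessThan_5 sum_fun_apply)
    also have "\<dots> = (\<Sum>j<k. diag_t m j (w j))"
      using d w0 by (auto simp: sum_lessThan_5 sum_lessThan_2 linear_0[OF linear_diag_t])
    finally show "f u \<in> {\<Sum>j<k. diag_t m j (u j) |u. \<forall>j<k. u j \<in> UNIV}"
      by (auto simp: A_def)
  next
    show "diag_t m j u \<in> Mat d d" if "j < k" for j u
      using that d by (intro diag_t_in_Mat) auto
    show "diag_t m j u = diag_act g (diag_t m j u)" if "g \<in> Sym m" for j g u
      using diag_t_invariant[OF that] by simp
    show "u j = 0" if "(\<Sum>j<k. diag_t m j (u j)) = 0" "j < k" for u j
      using that by (rule inj)
  qed (rule subspace_UNIV linear_diag_t refl UNIV_I)+
qed

section \<open>Components under the full product group\<close>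

lemma act_swap_sums:
  assumes "(\<Sum>a<m. \<Sum>b<m. act (swap a b, id) A) = (real m ^ 2 - 2 * real m) *\<^sub>R A" "i < m"
  shows "(\<Sum>a<m. A a j) = 0"
proof -
  have "(\<Sum>a<m. \<Sum>b<m. act (swap a b, id) A) i j = (\<Sum>a<m. \<Sum>b<m. A (swap a b i) j)"
    by (simp add: sum_fun_apply act_def)
  then show ?thesis
    using sum_transpose_apply[OF assms(2), of "\<lambda>i. A i j"] assms(1) by simp
qed

lemma act_swap_sums':
  assumes "(\<Sum>a<m. \<Sum>b<m. act (id, swap a b) A) = (real m ^ 2 - 2 * real m) *\<^sub>R A" "j < m"
  shows "(\<Sum>a<m. A i a) = 0"
proof -
  have "(\<Sum>a<m. \<Sum>b<m. act (id, swap a b) A) i j = (\<Sum>a<m. \<Sum>b<m. A i (swap a b j))"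
    by (simp add: sum_fun_apply act_def)
  then show ?thesis
    using sum_transpose_apply[OF assms(2), of "\<lambda>j. A i j"] assms(1) by simp
qed

lemma id_in_Sym: "id \<in> Sym m"
  by (simp add: Sym_def permutes_id)

text \<open>The family \<open>h\<close> allows transpositions in one factor with the identity in the
  other, so that each factor has its own sum over transpositions.\<close>

lemma sum_equivariant:
  assumes "linear f" "\<And>g u. g \<in> G \<Longrightarrow> u \<in> U \<Longrightarrow> f (b g u) = a g (f u)" "u \<in> U"
    "\<And>x y. x < m \<Longrightarrow> y < m \<Longrightarrow> h x y \<in> G"
    "(\<Sum>x<m. \<Sum>y<m. b (h x y) u) = c *\<^sub>R u"
  shows "(\<Sum>x<m. \<Sum>y<(m::nat). a (h x y) (f u)) = c *\<^sub>R f u"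
proof -
  have "(\<Sum>x<m. \<Sum>y<m. a (h x y) (f u)) = (\<Sum>x<m. \<Sum>y<m. f (b (h x y) u))"
    by (intro sum.cong refl) (simp add: assms)
  also have "\<dots> = f (\<Sum>x<m. \<Sum>y<m. b (h x y) u)"
    by (simp add: linear_sum[OF assms(1)])
  finally show ?thesis using assms(1,5) by (simp add: linear_scale)
qed

definition const_mat :: "nat \<Rightarrow> real \<Rightarrow> rmat"
  where "const_mat d c = (\<lambda>i j. if i < d \<and> j < d then c else 0)"

definition row_mat :: "nat \<Rightarrow> rvec \<Rightarrow> rmat"
  where "row_mat d u = (\<lambda>i j. if i < d \<and> j < d then u i else 0)"

definition col_mat :: "nat \<Rightarrow> rvec \<Rightarrow> rmat"
  where "col_mat d u = (\<lambda>i j. if i < d \<and> j < d then u j else 0)"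

lemma linear_mats: "linear (const_mat d)" "linear (row_mat d)" "linear (col_mat d)"
  by (rule linearI; auto simp: const_mat_def row_mat_def col_mat_def fun_eq_iff)+

lemma mats_in_Mat: "const_mat d c \<in> Mat d d" "row_mat d u \<in> Mat d d" "col_mat d u \<in> Mat d d"
  by (auto simp: const_mat_def row_mat_def col_mat_def Mat_def)

lemma act_mats:
  assumes "g \<in> Sym d" "h \<in> Sym d"
  shows "act (g, h) (const_mat d c) = const_mat d c"
    "act (g, h) (row_mat d u) = row_mat d (perm_vec g u)"
    "act (g, h) (col_mat d u) = col_mat d (perm_vec h u)"
  unfolding const_mat_def row_mat_def col_mat_def act_def perm_vec_def
  using Sym_inv[OF assms(1)] Sym_inv[OF assms(2)] by (intro ext; simp)+

lemma row_mat_eq_0: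
  assumes "d \<ge> 1" "u \<in> std_rep d" "row_mat d u = 0 \<or> col_mat d u = 0"
  shows "u = 0"
proof
  fix i
  have "row_mat d u i 0 = 0 \<or> col_mat d u 0 i = 0"
    using assms(3) by auto
  then show "u i = 0 i"
    using assms(1,2) by (cases "i < d") (auto simp: row_mat_def col_mat_def std_rep_def)
qed

lemma prod_comp_t_eq:
  assumes d: "d \<ge> 1"
  shows "prod_comp_t d = {\<Sum>j<1. const_mat d (u j) |u. \<forall>j<(1::nat). u j \<in> UNIV}"
  unfolding prod_comp_t_def
proof (rule isotypic_copies[where \<Phi> = "\<lambda>_. const_mat d" and k = 1])
  fix f :: "real \<Rightarrow> rmat" and u :: real
  assume f: "\<And>g u. g \<in> Sym d \<times> Sym d \<Longrightarrow> u \<in> UNIV \<Longrightarrow> f u = act g (f u)"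
    "\<And>u. u \<in> UNIV \<Longrightarrow> f u \<in> Mat d d"
  define A where "A = f u"
  define c where "c = A 0 0"
  have "A i j = c" if "i < d" "j < d" for i j
  proof -
    have "A = act (swap i 0, swap j 0) A"
      unfolding A_def using that d by (intro f(1)) (auto intro!: transpose_in_Sym)
    then have "A i j = act (swap i 0, swap j 0) A i j" by (rule fun_cong[THEN fun_cong])
    also have "\<dots> = c" by (simp add: act_def c_def)
    finally show ?thesis .
  qed
  then have "A = const_mat d c"
    using f(2)[of u] by (intro ext) (auto simp: const_mat_def A_def Mat_def)
  then show "f u \<in> {\<Sum>j<1. const_mat d (u j) |u. \<forall>j<(1::nat). u j \<in> UNIV}"
    by (auto simp: A_def intro!: exI[of _ "\<lambda>_. c"])
next
  fix u :: "nat \<Rightarrow> real" and j :: nat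
  assume "(\<Sum>j<1. const_mat d (u j)) = 0" "j < 1"
  then have "const_mat d (u 0) 0 0 = 0" by simp
  then show "u j = 0"
    using d \<open>j < 1\<close> by (simp add: const_mat_def)
qed (auto simp: linear_mats mats_in_Mat act_mats)

text \<open>The second factor acts trivially on the source, so the image is constant along rows; the
  sum over transpositions of the first factor then forces its common column to have sum
  zero.\<close>

lemma prod_comp_st_eq:
  assumes d: "d \<ge> 1"
  shows "prod_comp_st d = {\<Sum>j<1. row_mat d (u j) |u. \<forall>j<(1::nat). u j \<in> std_rep d}"
  unfolding prod_comp_st_def
proof (rule isotypic_copies[where \<Phi> = "\<lambda>_. row_mat d" and k = 1])
  fix f :: "rvec \<Rightarrow> rmat" and u
  assume f: "linear f" "\<And>g u. g \<in> Sym d \<times> Sym d \<Longrightarrow> u \<in> std_rep d \<Longrightarrow> f (perm_vec (fst g) u) = act g (f u)"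
    "\<And>u. u \<in> std_rep d \<Longrightarrow> f u \<in> Mat d d" and u: "u \<in> std_rep d"
  define A where "A = f u"
  define v where "v = (\<lambda>i. A i 0)"
  have const: "A i j = v i" if "j < d" for i j
  proof -
    have "A = act (id, swap j 0) A"
      unfolding A_def using f(2)[of "(id, swap j 0)" u] that d u
      by (simp add: id_in_Sym transpose_in_Sym perm_vec_def)
    then have "A i j = act (id, swap j 0) A i j" by (rule fun_cong[THEN fun_cong])
    also have "\<dots> = v i" by (simp add: act_def v_def)
    finally show ?thesis .
  qed
  have "(\<Sum>a<d. \<Sum>b<d. act (swap a b, id) A) = (real d ^ 2 - 2 * real d) *\<^sub>R A"
    unfolding A_def using f(1,2) u
    by (rule sum_equivariant[where h = "\<lambda>a b. (swap a b, id)"])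
      (use orbit_sum_vec_std_rep[OF u] in \<open>auto simp: orbit_sum_vec_def id_in_Sym[unfolded id_def] transpose_in_Sym id_def\<close>)
  then have "(\<Sum>a<d. A a 0) = 0"
    by (rule act_swap_sums[where i = 0]) (use d in auto)
  moreover have out: "A i j = 0" if "\<not> (i < d \<and> j < d)" for i j
    using f(3)[OF u] that by (simp add: A_def Mat_def)
  ultimately have "v \<in> std_rep d"
    by (auto simp: std_rep_def v_def)
  moreover have "A = row_mat d v"
    using const out by (intro ext) (auto simp: row_mat_def)
  ultimately show "f u \<in> {\<Sum>j<1. row_mat d (u j) |u. \<forall>j<(1::nat). u j \<in> std_rep d}"
    by (auto simp: A_def intro!: exI[of _ "\<lambda>_. v"])
qed (use row_mat_eq_0[OF d] in \<open>auto simp: linear_mats mats_in_Mat act_mats subspace_std_rep perm_vec_std_rep\<close>)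

lemma prod_comp_ts_eq:
  assumes d: "d \<ge> 1"
  shows "prod_comp_ts d = {\<Sum>j<1. col_mat d (u j) |u. \<forall>j<(1::nat). u j \<in> std_rep d}"
  unfolding prod_comp_ts_def
proof (rule isotypic_copies[where \<Phi> = "\<lambda>_. col_mat d" and k = 1])
  fix f :: "rvec \<Rightarrow> rmat" and u
  assume f: "linear f" "\<And>g u. g \<in> Sym d \<times> Sym d \<Longrightarrow> u \<in> std_rep d \<Longrightarrow> f (perm_vec (snd g) u) = act g (f u)"
    "\<And>u. u \<in> std_rep d \<Longrightarrow> f u \<in> Mat d d" and u: "u \<in> std_rep d"
  define A where "A = f u"
  define v where "v = A 0"
  have const: "A i j = v j" if "i < d" for i j
  proof -
    have "A = act (swap i 0, id) A"
      unfolding A_def using f(2)[of "(swap i 0, id)" u] that d u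
      by (simp add: id_in_Sym transpose_in_Sym perm_vec_def)
    then have "A i j = act (swap i 0, id) A i j" by (rule fun_cong[THEN fun_cong])
    also have "\<dots> = v j" by (simp add: act_def v_def)
    finally show ?thesis .
  qed
  have "(\<Sum>a<d. \<Sum>b<d. act (id, swap a b) A) = (real d ^ 2 - 2 * real d) *\<^sub>R A"
    unfolding A_def using f(1,2) u
    by (rule sum_equivariant[where h = "\<lambda>a b. (id, swap a b)"])
      (use orbit_sum_vec_std_rep[OF u] in \<open>auto simp: orbit_sum_vec_def id_in_Sym[unfolded id_def] transpose_in_Sym id_def\<close>)
  then have "(\<Sum>a<d. A 0 a) = 0"
    by (rule act_swap_sums'[where j = 0]) (use d in auto)
  moreover have out: "A i j = 0" if "\<not> (i < d \<and> j < d)" for i j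
    using f(3)[OF u] that by (simp add: A_def Mat_def)
  ultimately have "v \<in> std_rep d"
    by (auto simp: std_rep_def v_def)
  moreover have "A = col_mat d v"
    using const out by (intro ext) (auto simp: col_mat_def)
  ultimately show "f u \<in> {\<Sum>j<1. col_mat d (u j) |u. \<forall>j<(1::nat). u j \<in> std_rep d}"
    by (auto simp: A_def intro!: exI[of _ "\<lambda>_. v"])
qed (use row_mat_eq_0[OF d] in \<open>auto simp: linear_mats mats_in_Mat act_mats subspace_std_rep perm_vec_std_rep\<close>)

lemma zero_sums_imp_Mat: "zero_sums m A \<Longrightarrow> A \<in> Mat m m"
  by (simp add: zero_sums_def)

text \<open>The sum over transpositions of either factor acts on the source by
  \<open>d^2 - 2 d\<close>; for one factor this makes the column sums of the image vanish, for the
  other the row sums.\<close>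

lemma prod_comp_ss_eq:
  assumes d: "d \<ge> 1"
  shows "prod_comp_ss d = {\<Sum>j<1. u j |u. \<forall>j<(1::nat). u j \<in> {A. zero_sums d A}}"
  unfolding prod_comp_ss_def std_tensor_std_rep_basis(3)
proof (rule isotypic_copies[where \<Phi> = "\<lambda>_ A. A" and k = 1])
  fix f :: "rmat \<Rightarrow> rmat" and u
  assume f: "linear f" "\<And>g u. g \<in> Sym d \<times> Sym d \<Longrightarrow> u \<in> {A. zero_sums d A} \<Longrightarrow> f (act g u) = act g (f u)"
    "\<And>u. u \<in> {A. zero_sums d A} \<Longrightarrow> f u \<in> Mat d d" and u: "u \<in> {A. zero_sums d A}"
  have z: "u i j = 0" if "d \<le> i \<or> d \<le> j" for i j
    using u that by (auto simp: zero_sums_def Mat_def)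
  have s: "(\<Sum>i<d. u i j) = 0" "(\<Sum>j<d. u i j) = 0" for i j
    using u by (cases "j < d"; cases "i < d"; simp add: zero_sums_def Mat_def)+
  have 1: "(\<Sum>a<d. \<Sum>b<d. act (swap a b, id) u) = (real d ^ 2 - 2 * real d) *\<^sub>R u"
  proof (intro ext)
    fix i j
    have "(\<Sum>a<d. \<Sum>b<d. u (swap a b i) j) = (real d ^ 2 - 2 * real d) * u i j"
    proof (cases "i < d")
      case True
      then show ?thesis using sum_transpose_apply[OF True, of "\<lambda>i. u i j"] s by simp
    next
      case False
      then have "(\<Sum>a<d. \<Sum>b<d. u (swap a b i) j) = (\<Sum>a<d. \<Sum>b<d. u i j)"
        by (intro sum.cong) (auto simp: Transposition.transpose_def)
      then show ?thesis using z False by simp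
    qed
    then show "(\<Sum>a<d. \<Sum>b<d. act (swap a b, id) u) i j = ((real d ^ 2 - 2 * real d) *\<^sub>R u) i j"
      by (simp add: sum_fun_apply act_def)
  qed
  have 2: "(\<Sum>a<d. \<Sum>b<d. act (id, swap a b) u) = (real d ^ 2 - 2 * real d) *\<^sub>R u"
  proof (intro ext)
    fix i j
    have "(\<Sum>a<d. \<Sum>b<d. u i (swap a b j)) = (real d ^ 2 - 2 * real d) * u i j"
    proof (cases "j < d")
      case True
      then show ?thesis using sum_transpose_apply[OF True, of "u i"] s by simp
    next
      case False
      then have "(\<Sum>a<d. \<Sum>b<d. u i (swap a b j)) = (\<Sum>a<d. \<Sum>b<d. u i j)"
        by (intro sum.cong) (auto simp: Transposition.transpose_def)
      then show ?thesis using z False by simp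
    qed
    then show "(\<Sum>a<d. \<Sum>b<d. act (id, swap a b) u) i j = ((real d ^ 2 - 2 * real d) *\<^sub>R u) i j"
      by (simp add: sum_fun_apply act_def)
  qed
  have "(\<Sum>a<d. \<Sum>b<d. act (swap a b, id) (f u)) = (real d ^ 2 - 2 * real d) *\<^sub>R f u"
    using f(1,2) u by (rule sum_equivariant[where h = "\<lambda>a b. (swap a b, id)"])
      (use 1 in \<open>auto simp: id_in_Sym[unfolded id_def] transpose_in_Sym id_def\<close>)
  from act_swap_sums[OF this, of 0] have "(\<Sum>a<d. f u a j) = 0" for j using d by simp
  moreover have "(\<Sum>a<d. \<Sum>b<d. act (id, swap a b) (f u)) = (real d ^ 2 - 2 * real d) *\<^sub>R f u"
    using f(1,2) u by (rule sum_equivariant[where h = "\<lambda>a b. (id, swap a b)"])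
      (use 2 in \<open>auto simp: id_in_Sym[unfolded id_def] transpose_in_Sym id_def\<close>)
  from act_swap_sums'[OF this, of 0] have "(\<Sum>a<d. f u i a) = 0" for i using d by simp
  ultimately have "zero_sums d (f u)"
    using f(3)[OF u] by (simp add: zero_sums_def)
  then show "f u \<in> {\<Sum>j<1. u j |u. \<forall>j<(1::nat). u j \<in> {A. zero_sums d A}}"
    by (auto intro!: exI[of _ "\<lambda>_. f u"])
qed (auto simp: linear_ident subspace_zero_sums zero_sums_imp_Mat intro!: zero_sums_act)

section \<open>Approximate eigenvectors of self-adjoint maps\<close>

text \<open>The form is a parameter because the Frobenius product, written in the coordinates of a
  component, is not the Euclidean inner product of these coordinates and changes with the size of
  the matrices. The Euclidean structure of the type supplies compactness and dimension.\<close>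

locale inner_form =
  fixes g :: "'a::euclidean_space \<Rightarrow> 'a \<Rightarrow> real"
  assumes bilinear: "bilinear g"
    and sym: "g x y = g y x"
    and pos: "x \<noteq> 0 \<Longrightarrow> g x x > 0"
begin

lemma add_left: "g (x + y) z = g x z + g y z"
  using bilinear by (simp add: bilinear_ladd)

lemma scale_left: "g (c *\<^sub>R x) z = c * g x z"
  using bilinear by (simp add: bilinear_lmul)

lemma add_right: "g z (x + y) = g z x + g z y"
  using bilinear by (simp add: bilinear_radd)

lemma scale_right: "g z (c *\<^sub>R x) = c * g z x"
  using bilinear by (simp add: bilinear_rmul)

lemma diff_left: "g (x - y) z = g x z - g y z"
  using bilinear by (simp add: bilinear_lsub)

lemma zero_left [simp]: "g 0 z = 0"
  using bilinear by (simp add: bilinear_lzero)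

lemma zero_right [simp]: "g z 0 = 0"
  using bilinear by (simp add: bilinear_rzero)

lemma sum_left: "g (\<Sum>i\<in>I. F i) z = (\<Sum>i\<in>I. g (F i) z)"
  by (induction I rule: infinite_finite_induct) (simp_all add: add_left)

lemma sum_right: "g z (\<Sum>i\<in>I. F i) = (\<Sum>i\<in>I. g z (F i))"
  by (induction I rule: infinite_finite_induct) (simp_all add: add_right)

lemma nonneg: "g x x \<ge> 0"
  using pos[of x] by (cases "x = 0") auto

definition self_adjoint :: "('a \<Rightarrow> 'a) \<Rightarrow> bool"
  where "self_adjoint f \<longleftrightarrow> linear f \<and> (\<forall>x y. g (f x) y = g x (f y))"

text \<open>A maximiser of the Rayleigh quotient \<open>g x (f x) / g x x\<close> over the Euclidean
  unit sphere of \<open>S\<close> is an eigenvector; the quotient is homogeneous of degree 0, so the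
  maximum bounds it on all of \<open>S\<close>.\<close>

lemma exists_eigenvector:
  assumes f: "self_adjoint f" and S: "subspace S" "f ` S \<subseteq> S" "x1 \<in> S" "x1 \<noteq> 0"
  shows "\<exists>x\<in>S. \<exists>l. g x x = 1 \<and> f x = l *\<^sub>R x"
proof -
  have lin: "linear f" and adj: "g (f x) y = g x (f y)" for x y
    using f by (auto simp: self_adjoint_def)
  interpret bb: bounded_bilinear g
    using bilinear by (simp add: bilinear_conv_bounded_bilinear)
  define K where "K = S \<inter> sphere 0 1"
  have "compact K"
    unfolding K_def using S(1) by (intro closed_Int_compact closed_subspace) auto
  moreover have "(1 / norm x1) *\<^sub>R x1 \<in> K"
    using S by (simp add: K_def subspace_scale)
  moreover have "continuous_on K (\<lambda>x. g x (f x) / g x x)"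
  proof (intro continuous_on_divide bb.continuous_on continuous_on_id)
    show "continuous_on K f" using lin by (simp add: linear_continuous_on linear_conv_bounded_linear)
    show "\<forall>x\<in>K. g x x \<noteq> 0"
    proof
      fix x assume "x \<in> K"
      then have "x \<noteq> 0" by (auto simp: K_def)
      then show "g x x \<noteq> 0" using pos[of x] by simp
    qed
  qed
  ultimately obtain x0 where x0: "x0 \<in> K" "\<And>y. y \<in> K \<Longrightarrow> g y (f y) / g y y \<le> g x0 (f x0) / g x0 x0"
    using continuous_attains_sup[of K "\<lambda>x. g x (f x) / g x x"] by blast
  define l where "l = g x0 (f x0) / g x0 x0"
  have x0S: "x0 \<in> S" "x0 \<noteq> 0" using x0(1) by (auto simp: K_def)
  have q: "g y (f y) \<le> l * g y y" if "y \<in> S" for y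
  proof (cases "y = 0")
    case False
    define z where "z = (1 / norm y) *\<^sub>R y"
    have "z \<in> K" using that False S(1) by (simp add: K_def z_def subspace_scale)
    then have "g z (f z) / g z z \<le> l" using x0(2) by (simp add: l_def)
    moreover have "g z (f z) = (1 / norm y)\<^sup>2 * g y (f y)" "g z z = (1 / norm y)\<^sup>2 * g y y"
      using lin by (simp_all add: z_def linear_scale scale_left scale_right power2_eq_square)
    ultimately have "g y (f y) / g y y \<le> l" using False by simp
    then show ?thesis using pos[OF False] by (simp add: field_simps)
  qed simp
  \<comment> \<open>\<open>b\<close> is nonnegative on \<open>S\<close> and vanishes at
    \<open>x0\<close>; a variation of \<open>x0\<close> in direction \<open>y\<close> shows that
    \<open>x0\<close> lies in its radical.\<close>
  define b where "b = (\<lambda>x y. l * g x y - g x (f y))"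
  have b00: "b x0 x0 = 0" using pos[OF x0S(2)] by (simp add: b_def l_def)
  have b0: "b x0 y = 0" if y: "y \<in> S" for y
  proof (rule ccontr)
    assume nz: "b x0 y \<noteq> 0"
    have ineq: "0 \<le> 2 * t * b x0 y + t\<^sup>2 * b y y" for t
    proof -
      have "x0 + t *\<^sub>R y \<in> S" using S(1) x0S y by (simp add: subspace_add subspace_scale)
      from q[OF this] have "0 \<le> b (x0 + t *\<^sub>R y) (x0 + t *\<^sub>R y)" by (simp add: b_def)
      also have "\<dots> = b x0 x0 + t * b x0 y + t * b y x0 + t\<^sup>2 * b y y"
        using lin by (simp add: b_def linear_add linear_scale add_left add_right scale_left scale_right
            power2_eq_square algebra_simps)
      also have "b y x0 = b x0 y"
        unfolding b_def using adj[of y x0] sym[of "f y" x0] sym[of y x0] by simp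
      finally show ?thesis using b00 by simp
    qed
    have byy: "b y y \<ge> 0" using q[OF y] by (simp add: b_def)
    define D where "D = b y y + 1"
    \<comment> \<open>Minimising the quadratic would divide by \<open>b y y\<close>, which may be 0;
      with \<open>D = b y y + 1\<close> the value is still negative.\<close>
    define t where "t = - b x0 y / D"
    have D: "D > 0" "b y y = D - 1" using byy by (auto simp: D_def)
    have "2 * t * b x0 y + t\<^sup>2 * b y y = (b x0 y)\<^sup>2 / D\<^sup>2 * (- D - 1)"
      using D(1) unfolding t_def D(2) by (simp add: divide_simps power2_eq_square) (simp add: algebra_simps)
    also have "\<dots> < 0"
      using D nz by (intro mult_pos_neg divide_pos_pos) auto
    finally show False using ineq[of t] by simp
  qed
  define v where "v = l *\<^sub>R x0 - f x0"
  have "v \<in> S" using S x0S by (auto simp: v_def intro!: subspace_diff subspace_scale)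
  then have "g v v = 0"
    using b0[of v] adj[of x0 v] by (simp add: b_def v_def[THEN arg_cong[where f = "\<lambda>w. g w v"]] diff_left scale_left)
  then have "f x0 = l *\<^sub>R x0" using pos[of v] by (force simp: v_def)
  moreover define c where "c = 1 / sqrt (g x0 x0)"
  moreover have "g (c *\<^sub>R x0) (c *\<^sub>R x0) = 1"
    using pos[OF x0S(2)] by (simp add: c_def scale_left scale_right)
  ultimately have "c *\<^sub>R x0 \<in> S \<and> g (c *\<^sub>R x0) (c *\<^sub>R x0) = 1 \<and> f (c *\<^sub>R x0) = l *\<^sub>R (c *\<^sub>R x0)"
    using S(1) x0S lin by (simp add: subspace_scale linear_scale mult.commute)
  then show ?thesis by blast
qed

definition orthonormal :: "nat \<Rightarrow> (nat \<Rightarrow> 'a) \<Rightarrow> bool"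
  where "orthonormal n e \<longleftrightarrow> (\<forall>i<n. \<forall>j<n. g (e i) (e j) = (if i = j then 1 else 0))"

lemma orthonormal_independent:
  assumes "orthonormal n e"
  shows "independent_family {..<n} e" "n \<le> DIM('a)"
proof -
  show ind: "independent_family {..<n} e"
    by (rule independent_family_dual[where \<phi> = "\<lambda>i x. g x (e i)"])
      (use assms in \<open>auto simp: orthonormal_def add_left scale_left intro!: linearI\<close>)
  show "n \<le> DIM('a)"
    using independent_bound[OF independent_family_imp(2)[OF _ ind]] independent_family_imp(1)[OF _ ind]
    by (simp add: card_image)
qed

lemma orthonormal_residual:
  assumes e: "orthonormal n e" and j: "j < n"
  shows "g (z - (\<Sum>i<n. g z (e i) *\<^sub>R e i)) (e j) = 0"
proof -
  have "(\<Sum>i<n. g z (e i) * g (e i) (e j)) = (\<Sum>i<n. if i = j then g z (e i) else 0)"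
    by (rule sum.cong) (use e j in \<open>auto simp: orthonormal_def\<close>)
  then show ?thesis using j by (simp add: diff_left sum_left scale_left)
qed

text \<open>A nonzero residual, normalised, would extend the orthonormal system beyond the
  dimension.\<close>

lemma orthonormal_expand:
  assumes e: "orthonormal (DIM('a)) e"
  shows "z = (\<Sum>i<DIM('a). g z (e i) *\<^sub>R e i)"
proof (rule ccontr)
  let ?n = "DIM('a)"
  define r where "r = z - (\<Sum>i<?n. g z (e i) *\<^sub>R e i)"
  assume "z \<noteq> (\<Sum>i<?n. g z (e i) *\<^sub>R e i)"
  then have "g r r > 0" by (intro pos) (simp add: r_def)
  define w where "w = (\<lambda>i. if i = ?n then (1 / sqrt (g r r)) *\<^sub>R r else e i)"
  have re: "g r (e j) = 0" "g (e j) r = 0" if "j < ?n" for j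
    using orthonormal_residual[OF e that, of z] sym[of r "e j"] by (auto simp: r_def)
  have "orthonormal (Suc ?n) w"
    unfolding orthonormal_def
  proof (intro allI impI)
    fix i j assume "i < Suc ?n" "j < Suc ?n"
    then show "g (w i) (w j) = (if i = j then 1 else 0)"
      using e re[of i] re[of j] \<open>g r r > 0\<close>
      by (cases "i = ?n"; cases "j = ?n") (auto simp: w_def orthonormal_def scale_left scale_right)
  qed
  then show False using orthonormal_independent(2) by fastforce
qed

text \<open>Eigenvectors are added one at a time: the orthogonal complement of those already found
  is invariant under a self-adjoint map and nonzero below full dimension.\<close>

lemma spectral_theorem:
  assumes f: "self_adjoint f"
  shows "\<exists>e l. orthonormal (DIM('a)) e \<and> (\<forall>i<DIM('a). f (e i) = l i *\<^sub>R e i)"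
proof -
  have lin: "linear f" and adj: "g (f x) y = g x (f y)" for x y
    using f by (auto simp: self_adjoint_def)
  have "\<exists>e l. orthonormal n e \<and> (\<forall>i<n. f (e i) = l i *\<^sub>R e i)" if "n \<le> DIM('a)" for n
    using that
  proof (induction n)
    case 0
    show ?case by (simp add: orthonormal_def)
  next
    case (Suc n)
    then obtain e l where e: "orthonormal n e" "\<And>i. i < n \<Longrightarrow> f (e i) = l i *\<^sub>R e i" by auto
    define S where "S = {x. \<forall>i<n. g x (e i) = 0}"
    have "subspace S" by (rule subspaceI) (auto simp: S_def add_left scale_left)
    moreover have "f ` S \<subseteq> S" using e(2) by (auto simp: S_def adj scale_right)
    moreover have "\<exists>x\<in>S. x \<noteq> 0"
    proof -
      have "dim (span (e ` {..<n})) \<le> n"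
        using dim_le_card[of "e ` {..<n}" "e ` {..<n}"] card_image_le[of "{..<n}" e] span_superset
        by fastforce
      then have "span (e ` {..<n}) \<noteq> UNIV" using Suc.prems by (metis dim_UNIV Suc_n_not_le_n le_trans)
      then obtain z where z: "z \<notin> span (e ` {..<n})" by auto
      define r where "r = z - (\<Sum>i<n. g z (e i) *\<^sub>R e i)"
      have "r \<in> S" using orthonormal_residual[OF e(1)] by (simp add: S_def r_def)
      moreover have "r \<noteq> 0" using z span_family_sum[of "\<lambda>i. g z (e i)" e "{..<n}"] by (auto simp: r_def)
      ultimately show ?thesis by blast
    qed
    ultimately obtain x m where x: "x \<in> S" "g x x = 1" "f x = m *\<^sub>R x"
      using exists_eigenvector[OF f] by blast
    have xe: "g x (e i) = 0" "g (e i) x = 0" if "i < n" for i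
      using x(1) that sym[of x "e i"] by (auto simp: S_def)
    have "orthonormal (Suc n) (\<lambda>i. if i = n then x else e i)"
      unfolding orthonormal_def
    proof (intro allI impI)
      fix i j assume "i < Suc n" "j < Suc n"
      then show "g (if i = n then x else e i) (if j = n then x else e j) = (if i = j then 1 else 0)"
        using e(1) xe[of i] xe[of j] x(2)
        by (cases "i = n"; cases "j = n") (auto simp: orthonormal_def)
    qed
    then show ?case
      using e(2) x(3)
      by (intro exI[of _ "\<lambda>i. if i = n then x else e i"] exI[of _ "\<lambda>i. if i = n then m else l i"])
        (auto simp: less_Suc_eq)
  qed
  then show ?thesis by blast
qed

text \<open>If \<open>f - c\<close> is at most \<open>\<delta>\<close> on a subspace of dimension \<open>card J\<close>, then a vector of that
  subspace orthogonal to all eigenvectors belonging to eigenvalues near \<open>c\<close> has to vanish.\<close>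

lemma count_eigenvalues:
  assumes e: "orthonormal (DIM('a)) e" "\<And>i. i < DIM('a) \<Longrightarrow> f (e i) = l i *\<^sub>R e i" and lin: "linear f"
    and J: "finite J" "independent_family J x" and \<delta>: "\<delta> \<ge> 0"
    and resid: "\<And>y. let z = (\<Sum>j\<in>J. y j *\<^sub>R x j) in
      g (f z - c *\<^sub>R z) (f z - c *\<^sub>R z) \<le> \<delta>\<^sup>2 * g z z"
  shows "card J \<le> card {i. i < DIM('a) \<and> \<bar>l i - c\<bar> \<le> \<delta>}"
proof (rule ccontr)
  let ?n = "DIM('a)"
  define N where "N = {i. i < ?n \<and> \<bar>l i - c\<bar> \<le> \<delta>}"
  have N: "finite N" "N \<subseteq> {..<?n}" by (auto simp: N_def)
  assume "\<not> card J \<le> card {i. i < ?n \<and> \<bar>l i - c\<bar> \<le> \<delta>}"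
  then have less: "card N < card J" by (simp add: N_def)
  \<comment> \<open>\<open>p j\<close> is the projection of \<open>x j\<close> to the eigenvectors
    with eigenvalues near \<open>c\<close>. There are fewer of these than indices in
    \<open>J\<close>, so the projections are dependent, and the dependence yields a nonzero
    \<open>z\<close> without components near \<open>c\<close>.\<close>
  define p where "p = (\<lambda>j. \<Sum>i\<in>N. g (x j) (e i) *\<^sub>R e i)"
  have "\<not> independent_family J p"
  proof
    assume "independent_family J p"
    then have "card J = dim (span (p ` J))" using dim_span_independent_family[OF J(1), of p] by simp
    also have "\<dots> \<le> card (e ` N)"
    proof (rule dim_le_card)
      show "span (p ` J) \<subseteq> span (e ` N)"
        by (intro span_minimal) (auto simp: p_def intro!: span_family_sum)
    qed (use N in auto)
    also have "\<dots> \<le> card N" using N by (simp add: card_image_le)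
    finally show False using less by simp
  qed
  then obtain y j0 where y: "(\<Sum>j\<in>J. y j *\<^sub>R p j) = 0" "j0 \<in> J" "y j0 \<noteq> 0"
    by (auto simp: independent_family_def)
  define z where "z = (\<Sum>j\<in>J. y j *\<^sub>R x j)"
  have "z \<noteq> 0" using independent_familyD[OF J(2), of y j0] y by (auto simp: z_def)
  have zN: "g z (e i) = 0" if "i \<in> N" for i
  proof -
    have pi: "g (p j) (e i) = g (x j) (e i)" for j
    proof -
      have "g (p j) (e i) = (\<Sum>i'\<in>N. if i' = i then g (x j) (e i') else 0)"
        unfolding p_def sum_left scale_left
        by (rule sum.cong) (use e(1) that N in \<open>auto simp: orthonormal_def subset_eq\<close>)
      then show ?thesis using that N by simp
    qed
    have "g z (e i) = g (\<Sum>j\<in>J. y j *\<^sub>R p j) (e i)"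
      by (simp add: z_def sum_left scale_left pi)
    then show ?thesis using y(1) by simp
  qed
  define a where "a = (\<lambda>i. g z (e i))"
  have z: "z = (\<Sum>i<?n. a i *\<^sub>R e i)"
    unfolding a_def by (rule orthonormal_expand[OF e(1)])
  have norm: "g (\<Sum>i<?n. b i *\<^sub>R e i) (\<Sum>i<?n. b i *\<^sub>R e i) = (\<Sum>i<?n. (b i)\<^sup>2)" for b
  proof -
    have "(\<Sum>j<?n. b j * g (e i) (e j)) = b i" if "i < ?n" for i
    proof -
      have "(\<Sum>j<?n. b j * g (e i) (e j)) = (\<Sum>j<?n. if j = i then b j else 0)"
        by (rule sum.cong) (use e(1) that in \<open>auto simp: orthonormal_def\<close>)
      then show ?thesis using that by simp
    qed
    moreover have "g (\<Sum>i<?n. b i *\<^sub>R e i) (\<Sum>i<?n. b i *\<^sub>R e i) = (\<Sum>i<?n. b i * (\<Sum>j<?n. b j * g (e i) (e j)))"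
      by (simp add: sum_left sum_right scale_left scale_right sum_distrib_left mult.left_commute)
        (intro sum.cong refl arg_cong2[where f = "(*)"] local.sym)
    ultimately show ?thesis by (simp add: power2_eq_square)
  qed
  have fz: "f z - c *\<^sub>R z = (\<Sum>i<?n. ((l i - c) * a i) *\<^sub>R e i)"
  proof -
    have "f z = (\<Sum>i<?n. (a i * l i) *\<^sub>R e i)"
      using lin e(2) by (subst z) (simp add: linear_sum linear_scale)
    moreover have "c *\<^sub>R z = (\<Sum>i<?n. (c * a i) *\<^sub>R e i)"
      by (subst z) (simp add: scaleR_sum_right)
    ultimately show ?thesis
      by (simp only: sum_subtractf[symmetric] scaleR_diff_left[symmetric])
        (simp add: right_diff_distrib mult.commute)
  qed
  have "\<exists>i<?n. a i \<noteq> 0"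
  proof (rule ccontr)
    assume "\<not> (\<exists>i<?n. a i \<noteq> 0)"
    then have "(\<Sum>i<?n. a i *\<^sub>R e i) = 0" by (intro sum.neutral) auto
    then show False using z \<open>z \<noteq> 0\<close> by metis
  qed
  then obtain i0 where i0: "i0 < ?n" "a i0 \<noteq> 0" by blast
  have big: "\<delta>\<^sup>2 < (l i - c)\<^sup>2" if "i < ?n" "a i \<noteq> 0" for i
  proof -
    have "i \<notin> N" using that zN by (auto simp: a_def)
    then have "\<delta> < \<bar>l i - c\<bar>" using that by (simp add: N_def)
    then show ?thesis using \<delta> by (metis abs_le_square_iff abs_of_nonneg linorder_not_le)
  qed
  have "\<delta>\<^sup>2 * g z z = (\<Sum>i<?n. \<delta>\<^sup>2 * (a i)\<^sup>2)"
    by (subst (1 2) z) (simp add: norm sum_distrib_left)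
  also have "\<dots> < (\<Sum>i<?n. ((l i - c) * a i)\<^sup>2)"
  proof (rule sum_strict_mono_ex1)
    show "\<forall>i\<in>{..<?n}. \<delta>\<^sup>2 * (a i)\<^sup>2 \<le> ((l i - c) * a i)\<^sup>2"
    proof
      fix i assume "i \<in> {..<?n}"
      then show "\<delta>\<^sup>2 * (a i)\<^sup>2 \<le> ((l i - c) * a i)\<^sup>2"
        using big[of i] by (cases "a i = 0") (auto simp: power_mult_distrib intro!: mult_right_mono)
    qed
    show "\<exists>i\<in>{..<?n}. \<delta>\<^sup>2 * (a i)\<^sup>2 < ((l i - c) * a i)\<^sup>2"
      using i0 big[of i0] by (auto simp: power_mult_distrib intro!: bexI[of _ i0])
  qed simp
  also have "\<dots> = g (f z - c *\<^sub>R z) (f z - c *\<^sub>R z)"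
    unfolding fz norm ..
  finally show False using resid[of y] by (simp add: Let_def z_def)
qed

text \<open>Near every value of \<open>a\<close> there are at least as many eigenvalues as indices
  with this value. Separation by more than \<open>2 * \<delta>\<close> makes the groups of
  eigenvalues disjoint, so injections chosen group by group reorder the whole eigenbasis. Residuals
  are required for all combinations within a group because nearly parallel approximate eigenvectors
  could count one eigenvalue twice.\<close>

theorem approximate_spectral_theorem:
  assumes f: "self_adjoint f" and \<delta>: "\<delta> \<ge> 0"
    and sep: "\<And>i j. i < DIM('a) \<Longrightarrow> j < DIM('a) \<Longrightarrow> a i \<noteq> a j \<Longrightarrow> \<bar>a i - a j\<bar> > 2 * \<delta>"
    and ind: "\<And>i. i < DIM('a) \<Longrightarrow> independent_family {j. j < DIM('a) \<and> a j = a i} x"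
    and resid: "\<And>i y. i < DIM('a) \<Longrightarrow> let z = (\<Sum>j | j < DIM('a) \<and> a j = a i. y j *\<^sub>R x j) in
      g (f z - a i *\<^sub>R z) (f z - a i *\<^sub>R z) \<le> \<delta>\<^sup>2 * g z z"
  shows "\<exists>e l. orthonormal (DIM('a)) e \<and> (\<forall>i<DIM('a). f (e i) = l i *\<^sub>R e i \<and> \<bar>l i - a i\<bar> \<le> \<delta>)"
proof -
  let ?n = "DIM('a)"
  have lin: "linear f" using f by (simp add: self_adjoint_def)
  obtain e l where e: "orthonormal ?n e" "\<And>i. i < ?n \<Longrightarrow> f (e i) = l i *\<^sub>R e i"
    using spectral_theorem[OF f] by blast
  define J where "J = (\<lambda>c. {j. j < ?n \<and> a j = c})"
  define N where "N = (\<lambda>c. {i. i < ?n \<and> \<bar>l i - c\<bar> \<le> \<delta>})"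
  have "card (J (a i)) \<le> card (N (a i))" if "i < ?n" for i
    unfolding J_def N_def
    by (rule count_eigenvalues[OF e lin _ ind[OF that] \<delta> resid[OF that]]) auto
  then have "\<exists>h. inj_on h (J (a i)) \<and> h ` J (a i) \<subseteq> N (a i)" if "i < ?n" for i
    using that card_le_inj[of "J (a i)" "N (a i)"] by (auto simp: J_def N_def)
  then have "\<forall>c\<in>a ` {..<?n}. \<exists>h. inj_on h (J c) \<and> h ` J c \<subseteq> N c" by auto
  then obtain h where h: "\<And>i. i < ?n \<Longrightarrow> inj_on (h (a i)) (J (a i)) \<and> h (a i) ` J (a i) \<subseteq> N (a i)"
    by (metis (no_types, lifting) imageI lessThan_iff)
  define s where "s = (\<lambda>i. h (a i) i)"
  have sN: "s i < ?n" "\<bar>l (s i) - a i\<bar> \<le> \<delta>" if "i < ?n" for i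
    using h[OF that] that by (auto simp: s_def J_def N_def image_subset_iff)
  have inj: "inj_on s {..<?n}"
  proof (rule inj_onI)
    fix i j assume ij: "i \<in> {..<?n}" "j \<in> {..<?n}" "s i = s j"
    show "i = j"
    proof (cases "a i = a j")
      case True
      then show ?thesis using h[of i] ij by (auto simp: s_def J_def inj_on_def)
    next
      case False
      then have "\<bar>a i - a j\<bar> > 2 * \<delta>" using sep ij by auto
      moreover have "\<bar>l (s i) - a i\<bar> \<le> \<delta>" "\<bar>l (s i) - a j\<bar> \<le> \<delta>" using sN[of i] sN[of j] ij by auto
      ultimately show ?thesis by linarith
    qed
  qed
  have "orthonormal ?n (e \<circ> s)"
    unfolding orthonormal_def
  proof (intro allI impI)
    fix i j assume "i < ?n" "j < ?n"
    then show "g ((e \<circ> s) i) ((e \<circ> s) j) = (if i = j then 1 else 0)"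
      using e(1) sN[of i] sN[of j] inj by (auto simp: orthonormal_def inj_on_def)
  qed
  moreover have "f ((e \<circ> s) i) = (l \<circ> s) i *\<^sub>R (e \<circ> s) i \<and> \<bar>(l \<circ> s) i - a i\<bar> \<le> \<delta>" if "i < ?n" for i
    using sN[OF that] e(2) by simp
  ultimately show ?thesis by blast
qed

end

section \<open>The constant matrix\<close>

lemma hessian_outside: "\<not> (i < d \<and> j < d) \<Longrightarrow> hessian d f W V i j = 0"
  by (auto simp: hessian_def)

lemma unit_vec_apply: "unit_vec i j = (if j = i then 1 else 0)"
  by (simp add: unit_vec_def)

lemma linear_hessian_loss: "linear (hessian d (loss d) W)"
proof (rule linearI)
  show "hessian d (loss d) W (x + y) = hessian d (loss d) W x + hessian d (loss d) W y" for x y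
  proof (intro ext)
    fix i j
    show "hessian d (loss d) W (x + y) i j = (hessian d (loss d) W x + hessian d (loss d) W y) i j"
      by (cases "i < d \<and> j < d") (simp_all add: hessian_loss ddloss_add hessian_outside)
  qed
  show "hessian d (loss d) W (c *\<^sub>R x) = c *\<^sub>R hessian d (loss d) W x" for c x
  proof (intro ext)
    fix i j
    show "hessian d (loss d) W (c *\<^sub>R x) i j = (c *\<^sub>R hessian d (loss d) W x) i j"
      by (cases "i < d \<and> j < d") (simp_all add: hessian_loss ddloss_scaleR hessian_outside)
  qed
qed

lemma sum_kern11_unit_vec:
  assumes "j < d"
  shows "(\<Sum>b<d. kern11 d u (unit_vec b) h (unit_vec j)) =
    36 * u j * h j + 18 * (dot d u h + (\<Sum>l<d. h l) * u j + (\<Sum>l<d. u l) * h j)"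
proof -
  have "kern11 d u (unit_vec b) h (unit_vec j) =
      (if b = j then 36 * u j * h j + 18 * dot d u h else 0) + 18 * (h b * u j + u b * h j)" if "b < d" for b
    using that assms by (simp add: kern11_def dot_unit_vec_left dot_unit_vec_right unit_vec_apply)
  then have "(\<Sum>b<d. kern11 d u (unit_vec b) h (unit_vec j)) =
      (\<Sum>b<d. (if b = j then 36 * u j * h j + 18 * dot d u h else 0) + 18 * (h b * u j + u b * h j))"
    by (intro sum.cong) auto
  also have "\<dots> = 36 * u j * h j + 18 * dot d u h + 18 * ((\<Sum>b<d. h b) * u j + (\<Sum>b<d. u b) * h j)"
    using assms by (simp add: sum.distrib sum_distrib_left sum_distrib_right distrib_left)
  finally show ?thesis by simp
qed

lemma kern1_unit_vec_sum:
  "(\<Sum>b<d. kern1 d u (unit_vec b) h) = (\<Sum>b<d. (18 * (u b)\<^sup>2 + 9 * dot d u u) * h b) + 18 * (\<Sum>b<d. u b) * dot d u h"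
proof -
  have "kern1 d u (unit_vec b) h = (18 * (u b)\<^sup>2 + 9 * dot d u u) * h b + 18 * u b * dot d u h" if "b < d" for b
    using that by (simp add: kern1_def dot_unit_vec_left dot_unit_vec_right unit_vec_apply algebra_simps)
  then have "(\<Sum>b<d. kern1 d u (unit_vec b) h) =
     (\<Sum>b<d. (18 * (u b)\<^sup>2 + 9 * dot d u u) * h b + 18 * u b * dot d u h)"
    by (intro sum.cong) auto
  then show ?thesis by (simp add: sum.distrib sum_distrib_left sum_distrib_right mult.assoc)
qed

lemma sum_kern_unit_vec:
  "(\<Sum>b<d. kern d u (unit_vec b)) = 6 * (\<Sum>b<d. u b ^ 3) + 9 * dot d u u * (\<Sum>b<d. u b)"
proof -
  have "kern d u (unit_vec b) = 6 * u b ^ 3 + 9 * dot d u u * u b" if "b < d" for b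
    using that by (simp add: kern_def dot_unit_vec_left dot_unit_vec_right unit_vec_apply)
  then have "(\<Sum>b<d. kern d u (unit_vec b)) = (\<Sum>b<d. 6 * u b ^ 3 + 9 * dot d u u * u b)"
    by (intro sum.cong) auto
  then show ?thesis by (simp add: sum.distrib sum_distrib_left)
qed

lemma sum_kern_unit_vec_unit_vec: "(\<Sum>i<d. \<Sum>j<d. kern d (unit_vec i) (unit_vec j)) = 15 * real d"
proof -
  have "(\<Sum>j<d. kern d (unit_vec i) (unit_vec j)) = 15" if "i < d" for i
  proof -
    have "(\<Sum>b<d. unit_vec i b ^ 3) = (\<Sum>b<d. if b = i then 1 else 0 :: real)"
      by (intro sum.cong) (auto simp: unit_vec_apply)
    then show ?thesis
      using that by (simp add: sum_kern_unit_vec sum_unit_vec dot_unit_vec_left) (simp add: unit_vec_apply)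
  qed
  then show ?thesis by simp
qed

lemma loss_eq':
  "loss d W = (\<Sum>i<d. \<Sum>j<d. kern d (W i) (W j))
     - 2 * (\<Sum>i<d. 6 * (\<Sum>b<d. W i b ^ 3) + 9 * dot d (W i) (W i) * (\<Sum>b<d. W i b)) + 15 * real d"
  unfolding loss_eq sum_kern_unit_vec_unit_vec unfolding sum_kern_unit_vec ..

definition d1c :: "nat \<Rightarrow> real"
  where "d1c d = root 3 (3 / (5 * real d ^ 3) * (real d + 2/3))"

lemma D1_eq: "D1 d = const_mat d (d1c d)"
  unfolding D1_def const_mat_def d1c_def ..

lemma d1c_cube: "d \<ge> 1 \<Longrightarrow> 5 * real d ^ 3 * d1c d ^ 3 = 3 * real d + 2"
  by (simp add: d1c_def field_simps)

lemma dot_const_mat: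
  assumes "i < d"
  shows "dot d (const_mat d c i) v = c * (\<Sum>j<d. v j)" "dot d v (const_mat d c i) = c * (\<Sum>j<d. v j)"
proof -
  show "dot d (const_mat d c i) v = c * (\<Sum>j<d. v j)"
    unfolding dot_def sum_distrib_left by (intro sum.cong) (use assms in \<open>auto simp: const_mat_def\<close>)
  then show "dot d v (const_mat d c i) = c * (\<Sum>j<d. v j)" by (simp add: dot_commute)
qed

lemma sum_const_mat: "i < d \<Longrightarrow> (\<Sum>j<d. const_mat d c i j) = real d * c"
  by (simp add: const_mat_def)

text \<open>Inner products with a constant row are multiples of sums, so an entry of the Hessian
  depends only on the entry of \<open>V\<close>, its row sum, its column sum and the total; on each
  isotypic component these reduce to a multiple of the entry.\<close>

lemma hessian_const_mat:
  assumes ij: "i < d" "j < d"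
  shows "hessian d (loss d) (const_mat d c) V i j =
    36 * ((c^4 * real d ^ 3 - 2 * c - c * real d) * V i j + (4 * c^4 * real d ^ 2 - 2 * c) * (\<Sum>l<d. V i l)
      + 6 * c^4 * real d * (\<Sum>b<d. \<Sum>l<d. V b l) + 3/2 * c^4 * real d ^ 2 * (\<Sum>b<d. V b j))"
proof -
  let ?W = "const_mat d c"
  let ?r = "\<lambda>b. \<Sum>l<d. V b l"
  have W: "?W b j = c" if "b < d" for b using that ij by (simp add: const_mat_def)
  have k11: "(\<Sum>b<d. kern11 d (?W i) (?W b) (V i) (unit_vec j)) =
     (\<Sum>b<d. 36 * (c * (real d * c)) * (c * ?r i) * c + 18 * (c * (real d * c)) * (c * (c * ?r i) + c * ?r i * c + c * (real d * c) * V i j))"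
    by (intro sum.cong refl)
      (simp add: kern11_def dot_const_mat sum_const_mat W ij dot_unit_vec_right)
  have k12: "(\<Sum>b<d. kern12 d (?W b) (?W i) (V b) (unit_vec j)) =
     (\<Sum>b<d. 36 * (c * (real d * c)) * c * (c * ?r b) + 18 * (c * (real d * c))\<^sup>2 * V b j
       + 36 * c * (c * (real d * c)) * (c * ?r b) + 18 * (c * (real d * c)) * c * (c * ?r b)
       + 18 * (c * (real d * c)) * c * (c * ?r b) + 9 * (c * (real d * c)) * (c * (real d * c)) * V b j)"
    by (intro sum.cong refl)
      (simp add: kern12_def dot_const_mat sum_const_mat W ij dot_unit_vec_right)
  have k12': "(\<Sum>b<d. kern12 d (?W b) (?W i) (V b) (unit_vec j)) =
     216 * c^4 * real d / 2 * (\<Sum>b<d. ?r b) + 27 * c^4 * real d ^ 2 * (\<Sum>b<d. V b j)"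
    unfolding k12 by (simp add: sum.distrib sum_distrib_left[symmetric] sum_distrib_right[symmetric])
      (simp add: algebra_simps power2_eq_square power4_eq_xxxx)
  show ?thesis
    unfolding hessian_loss_entry[OF ij] k11 k12' sum_kern11_unit_vec[OF ij(2)]
    by (simp add: dot_const_mat sum_const_mat W ij)
      (simp add: algebra_simps power2_eq_square power3_eq_cube power4_eq_xxxx)
qed

text \<open>The derivative is \<open>18 * c^2 * (5 * d^3 * c^3 - (3 * d + 2))\<close> times the sum
  of the entries of \<open>V\<close>; the entry \<open>d1c\<close> of the first family is the root
  of the bracket.\<close>

lemma critical_point_const_mat:
  assumes "5 * real d ^ 3 * c ^ 3 = 3 * real d + 2 \<or> c = 0" "d \<ge> 1"
  shows "critical_point d (loss d) (const_mat d c)"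
  unfolding critical_point_loss_iff
proof (intro conjI ballI mats_in_Mat)
  fix V :: rmat
  let ?W = "const_mat d c"
  let ?r = "\<lambda>b. \<Sum>l<d. V b l"
  have a: "(\<Sum>j<d. kern1 d (?W i) (?W j) (V i)) = 45 * c^5 * real d ^ 3 * ?r i" if "i < d" for i
  proof -
    have "(\<Sum>j<d. kern1 d (?W i) (?W j) (V i)) = (\<Sum>j<d. 18 * (c * (real d * c))\<^sup>2 * (c * ?r i)
       + 18 * (c * (real d * c)) * (c * (real d * c)) * (c * ?r i) + 9 * (c * (real d * c)) * (c * (real d * c)) * (c * ?r i))"
      by (intro sum.cong refl) (simp add: kern1_def dot_const_mat sum_const_mat that)
    then show ?thesis by (simp add: algebra_simps eval_nat_numeral)
  qed
  have b: "(\<Sum>j<d. kern1 d (?W i) (unit_vec j) (V i)) = (18 * c\<^sup>2 + 27 * c\<^sup>2 * real d) * ?r i" if "i < d" for i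
  proof -
    have "(\<Sum>b<d. (18 * (?W i b)\<^sup>2 + 9 * dot d (?W i) (?W i)) * V i b) = (\<Sum>b<d. (18 * c\<^sup>2 + 9 * (c * (real d * c))) * V i b)"
      by (intro sum.cong refl) (use that in \<open>simp add: dot_const_mat sum_const_mat\<close>, use that in \<open>simp add: const_mat_def\<close>)
    then show ?thesis
      using that by (simp add: kern1_unit_vec_sum dot_const_mat sum_const_mat sum_distrib_left[symmetric])
        (simp add: algebra_simps power2_eq_square)
  qed
  have "dloss d ?W V = (\<Sum>i<d. 2 * (45 * c^5 * real d ^ 3 * ?r i - (18 * c\<^sup>2 + 27 * c\<^sup>2 * real d) * ?r i))"
    by (simp add: dloss_def a b sum_subtractf sum_distrib_left right_diff_distrib)
  also have "\<dots> = (\<Sum>i<d. 18 * c\<^sup>2 * ?r i * (5 * real d ^ 3 * c ^ 3 - (3 * real d + 2)))"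
    by (intro sum.cong refl) (simp add: algebra_simps eval_nat_numeral)
  also have "\<dots> = 0" using assms(1) by (intro sum.neutral) auto
  finally show "dloss d ?W V = 0" .
qed

lemma loss_const_mat:
  "loss d (const_mat d c) = 15 * c^6 * real d ^ 5 - 2 * c^3 * real d ^ 2 * (6 + 9 * real d) + 15 * real d"
proof -
  let ?W = "const_mat d c"
  have "(\<Sum>i<d. \<Sum>j<d. kern d (?W i) (?W j)) = (\<Sum>i<d. \<Sum>j<d. 15 * c^6 * real d ^ 3)"
    by (intro sum.cong refl) (simp add: kern_def dot_const_mat sum_const_mat algebra_simps eval_nat_numeral)
  moreover have "(\<Sum>i<d. 6 * (\<Sum>b<d. ?W i b ^ 3) + 9 * dot d (?W i) (?W i) * (\<Sum>b<d. ?W i b))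
     = (\<Sum>i<d. c^3 * real d * (6 + 9 * real d))"
  proof (intro sum.cong refl)
    fix i assume i: "i \<in> {..<d}"
    have "(\<Sum>b<d. ?W i b ^ 3) = real d * c^3" using i by (simp add: const_mat_def)
    then show "6 * (\<Sum>b<d. ?W i b ^ 3) + 9 * dot d (?W i) (?W i) * (\<Sum>b<d. ?W i b) = c^3 * real d * (6 + 9 * real d)"
      using i by (simp add: dot_const_mat sum_const_mat algebra_simps eval_nat_numeral)
  qed
  ultimately show ?thesis
    unfolding loss_eq' by (simp add: algebra_simps eval_nat_numeral)
qed

lemma loss_D1: "d \<ge> 1 \<Longrightarrow> loss d (D1 d) = 48 * real d / 5 - 36 / 5 - 12 / (5 * real d)"
proof -
  assume d: "d \<ge> 1"
  \<comment> \<open>The loss involves the entry only through its cube, which is rational in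
    \<open>d\<close>.\<close>
  define x where "x = d1c d ^ 3"
  have x: "x = (3 * real d + 2) / (5 * real d ^ 3)"
    using d1c_cube[OF d] d by (simp add: x_def field_simps)
  have "loss d (D1 d) = 15 * x\<^sup>2 * real d ^ 5 - 2 * x * real d ^ 2 * (6 + 9 * real d) + 15 * real d"
    by (simp add: D1_eq loss_const_mat x_def flip: power_mult)
  also have "15 * x\<^sup>2 * real d ^ 5 = 15 * (x * real d ^ 3)\<^sup>2 / real d"
    using d by (simp add: field_simps eval_nat_numeral)
  also have "2 * x * real d ^ 2 * (6 + 9 * real d) = 2 * (x * real d ^ 3) * (6 + 9 * real d) / real d"
    using d by (simp add: field_simps eval_nat_numeral)
  also have "x * real d ^ 3 = (3 * real d + 2) / 5"
    using d by (simp add: x)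
  finally have L: "loss d (D1 d) = 15 * ((3 * real d + 2) / 5)\<^sup>2 / real d
      - 2 * ((3 * real d + 2) / 5) * (6 + 9 * real d) / real d + 15 * real d" .
  show ?thesis
    unfolding L using d by (simp add: field_simps power2_eq_square)
qed

lemma D1_invariant: "g \<in> Sym d \<times> Sym d \<Longrightarrow> act g (D1 d) = D1 d"
  unfolding D1_eq using act_mats(1)[of "fst g" d "snd g"] by (cases g) simp

lemma isotropy_D1: "isotropy d (D1 d) = Sym d \<times> Sym d"
  using D1_invariant by (auto simp: isotropy_def)

lemma card_orbit_D1: "card (orbit d (D1 d)) = 1"
proof -
  have "orbit d (D1 d) = {D1 d}"
    unfolding orbit_def using D1_invariant id_in_Sym by (force simp: image_iff)
  then show ?thesis by simp
qed

lemma spectrum_on_scalar: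
  fixes \<Phi> :: "'u::real_vector \<Rightarrow> rmat"
  assumes "linear H" "linear \<Phi>" "finite I" "independent_family I b" "U = span (b ` I)"
    "\<And>u. u \<in> U \<Longrightarrow> \<Phi> u = 0 \<Longrightarrow> u = 0" "C = {\<Sum>j<1. \<Phi> (u j) |u. \<forall>j<(1::nat). u j \<in> U}"
    "\<And>u. u \<in> U \<Longrightarrow> H (\<Phi> u) = l *\<^sub>R \<Phi> u" "m = card I"
  shows "spectrum_on H C [(l, m)]"
proof -
  have "spectrum_on H C (map (\<lambda>i. (l, m)) [0..<1])"
    by (rule spectrum_on_copies[where \<Phi> = "\<lambda>_. \<Phi>" and v = "\<lambda>_ _. 1"]) (use assms in auto)
  then show ?thesis by simp
qed

text \<open>Multiplied by \<open>c\<close>, the critical point equation replaces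
  \<open>5 * c^4 * d^3\<close> by \<open>c * (3 * d + 2)\<close>, so the eigenvalue becomes linear
  in \<open>c\<close>. The same substitution \<open>c4\<close> serves the other components.\<close>

lemma spectrum_D1_t:
  assumes "d \<ge> 1"
  shows "spectrum_on (hessian d (loss d) (D1 d)) (prod_comp_t d) [(d1c d * (162 * real d + 108), 1)]"
proof (rule spectrum_on_scalar[OF linear_hessian_loss linear_mats(1), where b = "\<lambda>_. 1" and I = "{0}"])
  let ?c = "d1c d"
  have c4: "5 * ?c^4 * real d ^ 3 = ?c * (3 * real d + 2)"
    using d1c_cube[OF assms] by (simp add: power_eq_if algebra_simps)
  fix u
  show "hessian d (loss d) (D1 d) (const_mat d u) = (?c * (162 * real d + 108)) *\<^sub>R const_mat d u"
  proof (intro ext)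
    fix i j
    show "hessian d (loss d) (D1 d) (const_mat d u) i j = ((?c * (162 * real d + 108)) *\<^sub>R const_mat d u) i j"
    proof (cases "i < d \<and> j < d")
      case True
      then have "(\<Sum>b<d. const_mat d u b j) = real d * u" by (simp add: const_mat_def)
      then have "hessian d (loss d) (D1 d) (const_mat d u) i j =
         36 * u * (5/2 * (5 * ?c^4 * real d ^ 3) - 2 * ?c - 3 * ?c * real d)"
        using True unfolding D1_eq
        by (simp add: hessian_const_mat sum_const_mat) (simp add: const_mat_def algebra_simps eval_nat_numeral)
      then show ?thesis unfolding c4 using True by (simp add: const_mat_def algebra_simps)
    next
      case False
      then show ?thesis by (auto simp: hessian_outside const_mat_def)
    qed
  qed
next
  show "prod_comp_t d = {\<Sum>j<1. const_mat d (u j) |u. \<forall>j<(1::nat). u j \<in> UNIV}"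
    by (rule prod_comp_t_eq[OF assms])
  show "u = 0" if "const_mat d u = 0" for u
    using fun_cong[OF fun_cong[OF that, of 0], of 0] assms by (simp add: const_mat_def)
  show "independent_family {0} (\<lambda>_. 1::real)" by (simp add: independent_family_def)
  show "(UNIV::real set) = span ((\<lambda>_. 1) ` {0})"
    by (auto simp: span_singleton)
qed simp_all

text \<open>The eigenvalue 0 comes from flat directions: if all rows are multiples
  \<open>c i\<close> of the all-ones vector, the loss depends only on the sum of the
  \<open>c i ^ 3\<close>, and the matrices of this component are tangent to its level set where all
  \<open>c i\<close> are equal.\<close>

lemma spectrum_D1_st:
  assumes "d \<ge> 1"
  shows "spectrum_on (hessian d (loss d) (D1 d)) (prod_comp_st d) [(0, d - 1)]"
proof (rule spectrum_on_scalar[OF linear_hessian_loss linear_mats(2) _ std_rep_basis[OF assms]])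
  let ?c = "d1c d"
  have c4: "5 * ?c^4 * real d ^ 3 = ?c * (3 * real d + 2)"
    using d1c_cube[OF assms] by (simp add: power_eq_if algebra_simps)
  fix u assume u: "u \<in> std_rep d"
  show "hessian d (loss d) (D1 d) (row_mat d u) = 0 *\<^sub>R row_mat d u"
  proof (intro ext)
    fix i j
    show "hessian d (loss d) (D1 d) (row_mat d u) i j = (0 *\<^sub>R row_mat d u) i j"
    proof (cases "i < d \<and> j < d")
      case True
      have r: "(\<Sum>l<d. row_mat d u b l) = real d * u b" if "b < d" for b
        using that by (simp add: row_mat_def)
      have t: "(\<Sum>b<d. real d * u b) = 0"
        using u by (simp add: std_rep_def sum_distrib_left[symmetric])
      have "(\<Sum>b<d. row_mat d u b j) = (\<Sum>b<d. u b)"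
        using True by (intro sum.cong) (auto simp: row_mat_def)
      then have "(\<Sum>b<d. row_mat d u b j) = 0" using u by (simp add: std_rep_def)
      then have "hessian d (loss d) (D1 d) (row_mat d u) i j =
         36 * u i * (5 * ?c^4 * real d ^ 3 - 2 * ?c - 3 * ?c * real d)"
        using True unfolding D1_eq
        by (simp add: hessian_const_mat r t) (simp add: row_mat_def algebra_simps eval_nat_numeral)
      then show ?thesis unfolding c4 using True by (simp add: algebra_simps)
    qed (simp add: hessian_outside)
  qed
qed (use assms row_mat_eq_0 prod_comp_st_eq in auto)

lemma spectrum_D1_ts:
  assumes "d \<ge> 1"
  shows "spectrum_on (hessian d (loss d) (D1 d)) (prod_comp_ts d) [(d1c d * (18 * real d - 36), d - 1)]"
proof (rule spectrum_on_scalar[OF linear_hessian_loss linear_mats(3) _ std_rep_basis[OF assms]])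
  let ?c = "d1c d"
  have c4: "5 * ?c^4 * real d ^ 3 = ?c * (3 * real d + 2)"
    using d1c_cube[OF assms] by (simp add: power_eq_if algebra_simps)
  fix u assume u: "u \<in> std_rep d"
  show "hessian d (loss d) (D1 d) (col_mat d u) = (?c * (18 * real d - 36)) *\<^sub>R col_mat d u"
  proof (intro ext)
    fix i j
    show "hessian d (loss d) (D1 d) (col_mat d u) i j = ((?c * (18 * real d - 36)) *\<^sub>R col_mat d u) i j"
    proof (cases "i < d \<and> j < d")
      case True
      have r: "(\<Sum>l<d. col_mat d u b l) = 0" if "b < d" for b
        using that u by (simp add: col_mat_def std_rep_def)
      have c: "(\<Sum>b<d. col_mat d u b j) = real d * u j"
        using True by (simp add: col_mat_def)
      have "hessian d (loss d) (D1 d) (col_mat d u) i j =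
         36 * u j * (1/2 * (5 * ?c^4 * real d ^ 3) - 2 * ?c - ?c * real d)"
        using True unfolding D1_eq
        by (simp add: hessian_const_mat r c) (simp add: col_mat_def algebra_simps eval_nat_numeral)
      then show ?thesis unfolding c4 using True by (simp add: col_mat_def algebra_simps)
    next
      case False
      then show ?thesis by (auto simp: hessian_outside col_mat_def)
    qed
  qed
qed (use assms row_mat_eq_0 prod_comp_ts_eq in auto)

lemma spectrum_D1_ss:
  assumes "d \<ge> 1"
  shows "spectrum_on (hessian d (loss d) (D1 d)) (prod_comp_ss d) [(- (d1c d * (72 * real d + 288) / 5), (d - 1)\<^sup>2)]"
proof (rule spectrum_on_scalar[where \<Phi> = "\<lambda>A. A" and U = "{A. zero_sums d A}"
      and I = "{1..<d} \<times> {1..<d}" and b = "\<lambda>(i, j). outer (std_basis i) (std_basis j)"])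
  let ?c = "d1c d"
  have c4: "5 * ?c^4 * real d ^ 3 = ?c * (3 * real d + 2)"
    using d1c_cube[OF assms] by (simp add: power_eq_if algebra_simps)
  fix u assume "u \<in> {A. zero_sums d A}"
  then have u: "u \<in> Mat d d" "\<And>i. i < d \<Longrightarrow> (\<Sum>l<d. u i l) = 0" "\<And>j. j < d \<Longrightarrow> (\<Sum>b<d. u b j) = 0"
    by (auto simp: zero_sums_def)
  show "hessian d (loss d) (D1 d) u = (- (?c * (72 * real d + 288) / 5)) *\<^sub>R u"
  proof (intro ext)
    fix i j
    show "hessian d (loss d) (D1 d) u i j = ((- (?c * (72 * real d + 288) / 5)) *\<^sub>R u) i j"
    proof (cases "i < d \<and> j < d")
      case True
      have "hessian d (loss d) (D1 d) u i j = 36 * u i j * (1/5 * (5 * ?c^4 * real d ^ 3) - 2 * ?c - ?c * real d)"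
        using True unfolding D1_eq by (simp add: hessian_const_mat u)
      then show ?thesis unfolding c4 by (simp add: field_simps)
    next
      case False
      then show ?thesis using u(1) by (auto simp: hessian_outside Mat_def)
    qed
  qed
next
  show "prod_comp_ss d = {\<Sum>j<1. u j |u. \<forall>j<(1::nat). u j \<in> {A. zero_sums d A}}"
    by (rule prod_comp_ss_eq[OF assms])
qed (rule linear_hessian_loss linear_ident std_tensor_std_rep_basis
    | simp add: power2_eq_square card_cartesian_product)+

section \<open>Solving the critical point equations\<close>

text \<open>By uniform continuity on a compact strip, \<open>\<Phi> e\<close> maps the unit ball
  around \<open>p0\<close> into any prescribed neighbourhood of \<open>p0\<close> once
  \<open>e\<close> is small. Hence it maps the ball to itself and Brouwer gives a fixed point. A
  fixed point is its own image, so it lies in that neighbourhood too, and an arbitrary choice of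
  fixed points converges to \<open>p0\<close>.\<close>

lemma continuous_family_fixed_points:
  fixes \<Phi> :: "real \<Rightarrow> 'a::euclidean_space \<Rightarrow> 'a"
  assumes cont: "continuous_on UNIV (\<lambda>x. \<Phi> (fst x) (snd x))" and zero: "\<And>p. \<Phi> 0 p = p0"
  shows "\<exists>P. (\<forall>\<^sub>F e in at_right 0. \<Phi> e (P e) = P e) \<and> (P \<longlongrightarrow> p0) (at_right 0)"
proof -
  let ?K = "cball p0 1"
  let ?S = "{0..1} \<times> ?K"
  have "uniformly_continuous_on ?S (\<lambda>x. \<Phi> (fst x) (snd x))"
    by (intro compact_uniformly_continuous continuous_on_subset[OF cont] compact_Times) auto
  then have close: "\<exists>e1>0. e1 \<le> 1 \<and> (\<forall>e p. 0 < e \<and> e < e1 \<and> p \<in> ?K \<longrightarrow> dist (\<Phi> e p) p0 < \<eta>)" if "\<eta> > 0" for \<eta>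
    using that unfolding uniformly_continuous_on_def
  proof -
    assume *: "\<forall>e>0. \<exists>d>0. \<forall>x\<in>?S. \<forall>x'\<in>?S. dist x' x < d \<longrightarrow>
      dist (\<Phi> (fst x') (snd x')) (\<Phi> (fst x) (snd x)) < e"
    obtain d where d: "d > 0" "\<And>x x'. x \<in> ?S \<Longrightarrow> x' \<in> ?S \<Longrightarrow> dist x' x < d \<Longrightarrow>
      dist (\<Phi> (fst x') (snd x')) (\<Phi> (fst x) (snd x)) < \<eta>"
      using *[rule_format, OF \<open>\<eta> > 0\<close>] by blast
    have "dist (\<Phi> e p) p0 < \<eta>" if "0 < e" "e < min d 1" "p \<in> ?K" for e p
      using d(2)[of "(0, p)" "(e, p)"] that by (simp add: dist_Pair_Pair zero)
    then show ?thesis using d(1) by (intro exI[of _ "min d 1"]) auto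
  qed
  obtain e1 where e1: "e1 > 0" "e1 \<le> 1" "\<And>e p. 0 < e \<Longrightarrow> e < e1 \<Longrightarrow> p \<in> ?K \<Longrightarrow> dist (\<Phi> e p) p0 < 1"
    using close[of 1] by auto
  have ex: "\<exists>p. p \<in> ?K \<and> \<Phi> e p = p" if "0 < e" "e < e1" for e
  proof -
    have "continuous_on ?K (\<lambda>p. \<Phi> e p)"
    proof -
      have "continuous_on ?K ((\<lambda>x. \<Phi> (fst x) (snd x)) \<circ> (\<lambda>p. (e, p)))"
        by (intro continuous_on_compose continuous_intros continuous_on_subset[OF cont]) auto
      then show ?thesis by (simp add: o_def)
    qed
    moreover have "\<Phi> e \<in> ?K \<rightarrow> ?K"
    proof (rule funcsetI)
      fix p assume "p \<in> ?K"
      then show "\<Phi> e p \<in> ?K" using e1(3)[OF that, of p] by (simp add: dist_commute[of p0])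
    qed
    ultimately show ?thesis using brouwer_ball[of 1 p0 "\<Phi> e"] by auto
  qed
  define P where "P = (\<lambda>e. SOME p. p \<in> ?K \<and> \<Phi> e p = p)"
  have P: "P e \<in> ?K" "\<Phi> e (P e) = P e" if "0 < e" "e < e1" for e
    using someI_ex[OF ex[OF that]] by (auto simp: P_def)
  have "\<forall>\<^sub>F e in at_right 0. \<Phi> e (P e) = P e"
    using e1(1) P(2) unfolding eventually_at_right_field by blast
  moreover have "(P \<longlongrightarrow> p0) (at_right 0)"
  proof (rule tendstoI)
    fix \<eta> :: real assume "\<eta> > 0"
    then obtain e2 where e2: "e2 > 0" "\<And>e p. 0 < e \<Longrightarrow> e < e2 \<Longrightarrow> p \<in> ?K \<Longrightarrow> dist (\<Phi> e p) p0 < \<eta>"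
      using close by meson
    have "dist (P e) p0 < \<eta>" if "0 < e" "e < min e1 e2" for e
      using e2(2)[of e "P e"] P[of e] that by auto
    then show "\<forall>\<^sub>F e in at_right 0. dist (P e) p0 < \<eta>"
      using e1(1) e2(1) unfolding eventually_at_right_field by (intro exI[of _ "min e1 e2"]) auto
  qed
  ultimately show ?thesis by blast
qed

text \<open>With \<open>e = 1 / d\<close> and \<open>\<xi>\<^sub>1 = 1 + e\<^sup>3 a\<close>, \<open>\<xi>\<^sub>2 = e\<^sup>3 b\<close>, \<open>\<xi>\<^sub>3 = e c\<close>, the first \<open>d - 1\<close> rows have
  squared length \<open>1 + e\<^sup>2 A2\<close> and mutual inner products \<open>e\<^sup>2 B2\<close>.\<close>

definition "A3 e a b = e * a\<^sup>2 + (1 - 2 * e) * (b::real)\<^sup>2"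
definition "B3 e a b = 2 * e * a * b + (1 - 3 * e) * (b::real)\<^sup>2"
definition "A2 e a b c = (c::real)\<^sup>2 + 2 * e * a + e ^ 3 * A3 e a b"
definition "B2 e a b c = (c::real)\<^sup>2 + 2 * e * b + e ^ 3 * B3 e a b"
definition "Z2 e a b c = (A2 e a b c)\<^sup>2 + 2 * (B2 e a b c)\<^sup>2"
definition "T2 e a b c = 2 * A2 e a b c + e\<^sup>2 * Z2 e a b c"
definition "X2 e a b c = 2 * c\<^sup>2 + A2 e a b c - T2 e a b c * (1 - e) * c - 2 * e\<^sup>2 * (a + b) * c"
definition "Y2 e a b c = Z2 e a b c + e * A3 e a b + 2 * e\<^sup>2 * a * b
  + T2 e a b c * (e * a + (1 - 2 * e) * b)"
definition "F2 e a b c = (- c * X2 e a b c + 3 * b - B2 e a b c * A2 e a b c * (1 - 2 * e)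
  - e * (2 * (A2 e a b c)\<^sup>2 - (B2 e a b c)\<^sup>2 + B3 e a b - Y2 e a b c)
  - e\<^sup>2 * (4 * A3 e a b - 2 * B3 e a b)) / 3"

lemmas D2_defs = A3_def B3_def A2_def B2_def Z2_def T2_def X2_def Y2_def F2_def

text \<open>The last three equations of \<open>reduced_system_imp\<close>, solved for the unknowns:
  the last one gives \<open>c\<close>, and the one before, divided by \<open>e^2\<close>, gives
  \<open>b\<close>. The remaining one merely repeats the equation for \<open>b\<close> at order
  \<open>e^2\<close>; with this subtracted and \<open>e^3\<close> divided out, it gives
  \<open>a\<close>.\<close>

definition reduced_system :: "real \<Rightarrow> real \<Rightarrow> real \<Rightarrow> real \<Rightarrow> bool"
  where "reduced_system e a b c \<longleftrightarrow>
    c = 1 + e * (- c + e * X2 e a b c) \<and> b = - c\<^sup>2 - 3 * e * a - e\<^sup>2 * Y2 e a b c \<and> a = F2 e a b c"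

lemma reduced_system_solution:
  "\<exists>a b c. (\<forall>\<^sub>F e in at_right 0. reduced_system e (a e) (b e) (c e)) \<and>
    (a \<longlongrightarrow> - 5 / 3) (at_right 0) \<and> (b \<longlongrightarrow> - 1) (at_right 0) \<and> (c \<longlongrightarrow> 1) (at_right 0)"
proof -
  \<comment> \<open>The unknowns are eliminated in the order \<open>c\<close>, \<open>b\<close>,
    \<open>a\<close>: the new \<open>b\<close> uses the new \<open>c\<close>, and the new
    \<open>a\<close> uses both. With the old values on the right the map at \<open>e = 0\<close>
    would not be constant.\<close>
  define C where "C = (\<lambda>e (p :: real \<times> real \<times> real). 1 + e * (- snd (snd p) + e * X2 e (fst p) (fst (snd p)) (snd (snd p))))"
  define D where "D = (\<lambda>e (p :: real \<times> real \<times> real). - (C e p)\<^sup>2 - 3 * e * fst p - e\<^sup>2 * Y2 e (fst p) (fst (snd p)) (C e p))"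
  define \<Phi> where "\<Phi> = (\<lambda>e (p :: real \<times> real \<times> real). (F2 e (fst p) (D e p) (C e p), D e p, C e p))"
  have "continuous_on UNIV (\<lambda>x. \<Phi> (fst x) (snd x))"
    unfolding \<Phi>_def D_def C_def D2_defs by (intro continuous_intros) auto
  moreover have "\<Phi> 0 p = (- 5 / 3, - 1, 1)" for p
    by (simp add: \<Phi>_def D_def C_def D2_defs)
  ultimately obtain P where P: "\<forall>\<^sub>F e in at_right 0. \<Phi> e (P e) = P e" "(P \<longlongrightarrow> (- 5 / 3, - 1, 1)) (at_right 0)"
    using continuous_family_fixed_points[of \<Phi> "(- 5 / 3, - 1, 1)"] by blast
  have "reduced_system e (fst (P e)) (fst (snd (P e))) (snd (snd (P e)))" if "\<Phi> e (P e) = P e" for e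
  proof -
    obtain a b c where p: "P e = (a, b, c)" by (cases "P e")
    then have "(F2 e a (D e (a, b, c)) (C e (a, b, c)), D e (a, b, c), C e (a, b, c)) = (a, b, c)"
      using that by (simp only: \<Phi>_def fst_conv snd_conv)
    then have F: "F2 e a (D e (a, b, c)) (C e (a, b, c)) = a" and D: "D e (a, b, c) = b" and C: "C e (a, b, c) = c"
      unfolding prod.inject by blast+
    have "a = F2 e a b c" using F unfolding C D ..
    moreover have "b = - c\<^sup>2 - 3 * e * a - e\<^sup>2 * Y2 e a b c"
      using D unfolding D_def C fst_conv snd_conv ..
    moreover have "c = 1 + e * (- c + e * X2 e a b c)"
      using C unfolding C_def fst_conv snd_conv ..
    ultimately show ?thesis unfolding reduced_system_def p fst_conv snd_conv by blast
  qed
  then have "\<forall>\<^sub>F e in at_right 0. reduced_system e (fst (P e)) (fst (snd (P e))) (snd (snd (P e)))"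
    by (intro eventually_mono[OF P(1)])
  moreover have "((\<lambda>e. fst (P e)) \<longlongrightarrow> - 5 / 3) (at_right 0)" "((\<lambda>e. fst (snd (P e))) \<longlongrightarrow> - 1) (at_right 0)"
    "((\<lambda>e. snd (snd (P e))) \<longlongrightarrow> 1) (at_right 0)"
    using tendsto_fst[OF P(2)] tendsto_fst[OF tendsto_snd[OF P(2)]] tendsto_snd[OF tendsto_snd[OF P(2)]] by simp_all
  ultimately show ?thesis
    by (intro exI[of _ "\<lambda>e. fst (P e)"] exI[of _ "\<lambda>e. fst (snd (P e))"] exI[of _ "\<lambda>e. snd (snd (P e))"] conjI)
qed

text \<open>\<open>n\<close> multiplies only quantities that contain a factor \<open>e\<close>, and
  \<open>n * e = 1 - e\<close> removes it. Afterwards all terms are polynomials in \<open>e\<close>,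
  and the difference of the two sides of each stationarity equation is a power of \<open>e\<close>
  times defects of the reduced equations.\<close>

lemma reduced_system_imp:
  fixes e a b c :: real
  assumes e: "e \<noteq> 0" and sys: "reduced_system e a b c"
  defines "n \<equiv> 1 / e - 1" and "x1 \<equiv> 1 + e ^ 3 * a" and "x2 \<equiv> e ^ 3 * b" and "x3 \<equiv> e * c"
    and "A \<equiv> 1 + e\<^sup>2 * A2 e a b c" and "B \<equiv> e\<^sup>2 * B2 e a b c"
  shows "A = x1\<^sup>2 + (n - 1) * x2\<^sup>2 + x3\<^sup>2" (is ?A) "B = 2 * x1 * x2 + (n - 2) * x2\<^sup>2 + x3\<^sup>2" (is ?B)
    "2 * A\<^sup>2 - B\<^sup>2 + A * B * (n - 1) = 2 * x1 + n * x2 + x3" (is ?E1)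
    "2 * x1 * x2 + (2 * B\<^sup>2 + A\<^sup>2) * (x1 + (n - 1) * x2) = A" (is ?E2)
    "2 * (x1 + x2) * x3 + (2 * B\<^sup>2 + A\<^sup>2) * n * x3 - 2 * x3\<^sup>2 = A" (is ?E3)
proof -
  define \<alpha> \<beta> where "\<alpha> = A2 e a b c" and "\<beta> = B2 e a b c"
  define \<alpha>3 \<beta>3 where "\<alpha>3 = A3 e a b" and "\<beta>3 = B3 e a b"
  define X Y where "X = X2 e a b c" and "Y = Y2 e a b c"
  define T where "T = T2 e a b c"
  have ne: "n * e = 1 - e" using e by (simp add: n_def field_simps)
  have nx2: "n * x2 = e\<^sup>2 * (1 - e) * b" unfolding x2_def using ne by algebra
  have nx3: "n * x3 = (1 - e) * c" unfolding x3_def using ne by algebra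
  have nB: "n * B = e * (1 - e) * \<beta>" unfolding B_def \<beta>_def[symmetric] using ne by algebra
  have a3: "\<alpha>3 = e * a\<^sup>2 + (1 - 2 * e) * b\<^sup>2" and b3: "\<beta>3 = 2 * e * a * b + (1 - 3 * e) * b\<^sup>2"
    and al: "\<alpha> = c\<^sup>2 + 2 * e * a + e ^ 3 * \<alpha>3" and be: "\<beta> = c\<^sup>2 + 2 * e * b + e ^ 3 * \<beta>3"
    and T: "T = 2 * \<alpha> + e\<^sup>2 * (\<alpha>\<^sup>2 + 2 * \<beta>\<^sup>2)"
    and X: "X = 2 * c\<^sup>2 + \<alpha> - T * (1 - e) * c - 2 * e\<^sup>2 * (a + b) * c"
    and Y: "Y = \<alpha>\<^sup>2 + 2 * \<beta>\<^sup>2 + e * \<alpha>3 + 2 * e\<^sup>2 * a * b + T * (e * a + (1 - 2 * e) * b)"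
    by (simp_all add: \<alpha>_def \<beta>_def \<alpha>3_def \<beta>3_def T_def X_def Y_def A2_def B2_def A3_def B3_def T2_def X2_def Y2_def Z2_def)
  have c: "c = 1 + e * (- c + e * X)" and b: "b = - c\<^sup>2 - 3 * e * a - e\<^sup>2 * Y"
    and a: "3 * a = - c * X + 3 * b - \<beta> * \<alpha> * (1 - 2 * e) - e * (2 * \<alpha>\<^sup>2 - \<beta>\<^sup>2 + \<beta>3 - Y) - e\<^sup>2 * (4 * \<alpha>3 - 2 * \<beta>3)"
    using sys by (simp_all add: reduced_system_def X_def Y_def F2_def \<alpha>_def \<beta>_def \<alpha>3_def \<beta>3_def)
  have A: "A = 1 + e\<^sup>2 * \<alpha>" and B: "B = e\<^sup>2 * \<beta>" by (simp_all add: A_def B_def \<alpha>_def \<beta>_def)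
  have nx2': "(n - 1) * x2\<^sup>2 = e ^ 5 * (1 - 2 * e) * b\<^sup>2" "(n - 2) * x2\<^sup>2 = e ^ 5 * (1 - 3 * e) * b\<^sup>2"
    using nx2 unfolding x2_def by algebra+
  show ?A unfolding nx2' A al a3 x1_def x3_def by algebra
  show ?B using nx2'(2) unfolding B be b3 x1_def x2_def x3_def by algebra
  have AB: "2 * B\<^sup>2 + A\<^sup>2 = 1 + e\<^sup>2 * T" unfolding A B T by algebra
  have "2 * (x1 + x2) * x3 + (2 * B\<^sup>2 + A\<^sup>2) * n * x3 - 2 * x3\<^sup>2 - A
      = 2 * (x1 + x2) * x3 + (1 + e\<^sup>2 * T) * ((1 - e) * c) - 2 * x3\<^sup>2 - A"
    unfolding AB nx3[symmetric] by algebra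
  also have "\<dots> = c - 1 + e * c - e\<^sup>2 * X"
    unfolding X A x1_def x2_def x3_def by algebra
  also have "\<dots> = 0" using c by algebra
  finally show ?E3 by simp
  have S: "x1 + (n - 1) * x2 = 1 + e ^ 3 * a + e\<^sup>2 * (1 - 2 * e) * b"
    using nx2 unfolding x1_def x2_def by algebra
  have "2 * x1 * x2 + (2 * B\<^sup>2 + A\<^sup>2) * (x1 + (n - 1) * x2) - A
     = 2 * x1 * x2 + (1 + e\<^sup>2 * T) * (1 + e ^ 3 * a + e\<^sup>2 * (1 - 2 * e) * b) - A"
    unfolding AB S ..
  also have "\<dots> = e\<^sup>2 * (b + e * a + 2 * e ^ 4 * a * b + T - \<alpha> + T * (e ^ 3 * a + e\<^sup>2 * (1 - 2 * e) * b))
      + e ^ 3 * 0"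
    unfolding A x1_def x2_def by algebra
  also have "\<dots> = e\<^sup>2 * (b + c\<^sup>2 + 3 * e * a + e\<^sup>2 * Y)"
    unfolding Y using T al by algebra
  also have "b + c\<^sup>2 + 3 * e * a + e\<^sup>2 * Y = 0" using b by algebra
  finally show ?E2 by simp
  have "2 * A\<^sup>2 - B\<^sup>2 + A * B * (n - 1) - (2 * x1 + n * x2 + x3)
    = 2 * A\<^sup>2 - B\<^sup>2 + A * (e * (1 - e) * \<beta>) - A * B - (2 * x1 + e\<^sup>2 * (1 - e) * b + x3)"
    unfolding nB[symmetric] nx2[symmetric] by algebra
  also have "\<dots> = e * (c\<^sup>2 - c + e * (4 * \<alpha> - 2 * \<beta> + b) + e\<^sup>2 * (b - 2 * a)
      + e\<^sup>2 * \<beta> * \<alpha> * (1 - 2 * e) + e ^ 3 * (2 * \<alpha>\<^sup>2 - \<beta>\<^sup>2 + \<beta>3))"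
  proof -
    have "\<beta> = c\<^sup>2 + 2 * e * b + e ^ 3 * \<beta>3" by (rule be)
    then show ?thesis unfolding A B x1_def x3_def by algebra
  qed
  also have "c\<^sup>2 - c = c * (e * (- c + e * X))" using c by algebra
  \<comment> \<open>The equation for \<open>c\<close> supplies the missing factor \<open>e\<close>:
    it expresses \<open>c - 1\<close> as a multiple of \<open>e\<close>.\<close>
  also have "c * (e * (- c + e * X)) + e * (4 * \<alpha> - 2 * \<beta> + b) + e\<^sup>2 * (b - 2 * a)
      + e\<^sup>2 * \<beta> * \<alpha> * (1 - 2 * e) + e ^ 3 * (2 * \<alpha>\<^sup>2 - \<beta>\<^sup>2 + \<beta>3)
     = e * ((b + c\<^sup>2 + 3 * e * a + e\<^sup>2 * Y) + e * (c * X + 3 * a - 3 * b + \<beta> * \<alpha> * (1 - 2 * e)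
         + e * (2 * \<alpha>\<^sup>2 - \<beta>\<^sup>2 + \<beta>3 - Y) + e\<^sup>2 * (4 * \<alpha>3 - 2 * \<beta>3)))"
  proof -
    have "4 * \<alpha> - 2 * \<beta> = 4 * (c\<^sup>2 + 2 * e * a + e ^ 3 * \<alpha>3) - 2 * (c\<^sup>2 + 2 * e * b + e ^ 3 * \<beta>3)"
      using al be by simp
    then show ?thesis by algebra
  qed
  also have "\<dots> = 0" using a \<open>b + c\<^sup>2 + 3 * e * a + e\<^sup>2 * Y = 0\<close> by algebra
  finally show ?E1 by simp
qed

lemma tendsto_one_over_nat: "((\<lambda>d. 1 / real d) \<longlongrightarrow> 0) sequentially"
  by (rule lim_1_over_n)

lemma filterlim_one_over_nat: "filterlim (\<lambda>d. 1 / real d) (at_right 0) sequentially"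
  by real_asymp

text \<open>\<open>w\<close> is the second-order remainder of \<open>c\<close>; since
  \<open>\<xi>\<^sub>3 = c / d\<close> is wanted to order 4, \<open>w\<close> itself is needed to
  first order. The limits of the differences multiplied by \<open>d\<close> are the coefficients 9,
  7 and 10/3 of the fourth-order terms.\<close>

definition branch :: "(nat \<Rightarrow> real) \<Rightarrow> (nat \<Rightarrow> real) \<Rightarrow> (nat \<Rightarrow> real) \<Rightarrow> (nat \<Rightarrow> real) \<Rightarrow> bool"
  where "branch a b c w \<longleftrightarrow>
    (\<forall>\<^sub>F d in sequentially. reduced_system (1 / real d) (a d) (b d) (c d)) \<and>
    (\<forall>\<^sub>F d in sequentially. c d = 1 - 1 / real d + (1 / real d)\<^sup>2 * w d) \<and>
    a \<longlonglongrightarrow> - 5 / 3 \<and> b \<longlonglongrightarrow> - 1 \<and> c \<longlonglongrightarrow> 1 \<and> w \<longlonglongrightarrow> 2 \<and>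
    (\<lambda>d. (a d + 5 / 3) * real d) \<longlonglongrightarrow> 9 \<and>
    (\<lambda>d. (b d + 1) * real d) \<longlonglongrightarrow> 7 \<and>
    (\<lambda>d. (w d - 2) * real d) \<longlonglongrightarrow> 10 / 3"

text \<open>From each equation of the reduced system its limit is subtracted and the rest divided by
  \<open>e\<close>; what remains contains only quantities with known limits, which gives one more
  coefficient at a time.\<close>

lemma branch_exists: "\<exists>a b c w. branch a b c w"
proof -
  obtain a' b' c' where sol: "\<forall>\<^sub>F e in at_right 0. reduced_system e (a' e) (b' e) (c' e)"
    "(a' \<longlongrightarrow> - 5 / 3) (at_right 0)" "(b' \<longlongrightarrow> - 1) (at_right 0)" "(c' \<longlongrightarrow> 1) (at_right 0)"
    using reduced_system_solution by blast
  define e where "e = (\<lambda>d::nat. 1 / real d)"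
  define a where "a = (\<lambda>d. a' (e d))"
  define b where "b = (\<lambda>d. b' (e d))"
  define c where "c = (\<lambda>d. c' (e d))"
  have elim: "filterlim e (at_right 0) sequentially"
    unfolding e_def by (rule filterlim_one_over_nat)
  have sys: "\<forall>\<^sub>F d in sequentially. reduced_system (e d) (a d) (b d) (c d)"
    unfolding a_def b_def c_def
    using eventually_compose_filterlim[OF sol(1) elim] by simp
  have a: "a \<longlonglongrightarrow> - 5 / 3" and b: "b \<longlonglongrightarrow> - 1" and c: "c \<longlonglongrightarrow> 1"
    unfolding a_def b_def c_def using sol(2-4) elim by (auto intro: filterlim_compose)
  have e0: "e \<longlonglongrightarrow> 0" unfolding e_def by (rule tendsto_one_over_nat)
  have epos: "\<forall>\<^sub>F d in sequentially. e d > 0"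
    unfolding e_def using eventually_gt_at_top[of 0] by eventually_elim simp
  define \<alpha>3 where "\<alpha>3 = (\<lambda>d. A3 (e d) (a d) (b d))"
  define \<beta>3 where "\<beta>3 = (\<lambda>d. B3 (e d) (a d) (b d))"
  define \<alpha> where "\<alpha> = (\<lambda>d. A2 (e d) (a d) (b d) (c d))"
  define \<beta> where "\<beta> = (\<lambda>d. B2 (e d) (a d) (b d) (c d))"
  define Z where "Z = (\<lambda>d. Z2 (e d) (a d) (b d) (c d))"
  define T where "T = (\<lambda>d. T2 (e d) (a d) (b d) (c d))"
  define X where "X = (\<lambda>d. X2 (e d) (a d) (b d) (c d))"
  define Y where "Y = (\<lambda>d. Y2 (e d) (a d) (b d) (c d))"
  note lims = a b c e0
  have \<alpha>3: "\<alpha>3 \<longlonglongrightarrow> 1" and \<beta>3: "\<beta>3 \<longlonglongrightarrow> 1"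
    unfolding \<alpha>3_def \<beta>3_def A3_def B3_def by (rule tendsto_eq_intros lims refl | simp)+
  have \<alpha>: "\<alpha> \<longlonglongrightarrow> 1" and \<beta>: "\<beta> \<longlonglongrightarrow> 1"
    unfolding \<alpha>_def \<beta>_def A2_def B2_def using \<alpha>3 \<beta>3 unfolding \<alpha>3_def \<beta>3_def
    by (auto intro!: tendsto_eq_intros lims)
  have Z: "Z \<longlonglongrightarrow> 3"
    using \<alpha> \<beta> unfolding Z_def Z2_def \<alpha>_def \<beta>_def by (auto intro!: tendsto_eq_intros)
  have T: "T \<longlonglongrightarrow> 2"
    using \<alpha> Z unfolding T_def T2_def \<alpha>_def Z_def by (auto intro!: tendsto_eq_intros lims)
  have X: "X \<longlonglongrightarrow> 1"
    using \<alpha> T unfolding X_def X2_def \<alpha>_def T_def by (auto intro!: tendsto_eq_intros lims)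
  have Y: "Y \<longlonglongrightarrow> 1"
    using Z \<alpha>3 T unfolding Y_def Y2_def \<alpha>3_def T_def Z_def by (auto intro!: tendsto_eq_intros lims)
  \<comment> \<open>\<open>u\<close> and \<open>w\<close> are successive divided remainders,
    \<open>c = 1 + e u\<close> and \<open>u = - 1 + e w\<close>; the second holds because
    substituting \<open>c = 1 + e u\<close> into \<open>u = - c + e X\<close> gives
    \<open>u + 1 = e (X - u)\<close>.\<close>
  define u where "u = (\<lambda>d. - c d + e d * X d)"
  define w where "w = (\<lambda>d. - u d + X d)"
  have u: "u \<longlonglongrightarrow> - 1"
    unfolding u_def by (rule tendsto_eq_intros lims X refl | simp)+
  have w: "w \<longlonglongrightarrow> 2"
    unfolding w_def by (rule tendsto_eq_intros u X refl | simp)+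
  have C1: "\<forall>\<^sub>F d in sequentially. c d = 1 + e d * u d"
    using sys by eventually_elim (simp add: reduced_system_def u_def X_def)
  have C2: "\<forall>\<^sub>F d in sequentially. c d = 1 - e d + (e d)\<^sup>2 * w d"
    using C1
  proof eventually_elim
    case (elim d)
    then have "u d + 1 = e d * w d" unfolding u_def w_def by (simp add: algebra_simps)
    then have "u d = - 1 + e d * w d" by simp
    with elim show ?case by (simp add: power2_eq_square algebra_simps)
  qed
  have bl: "(\<lambda>d. (b d + 1) * real d) \<longlonglongrightarrow> 7"
  proof (rule Lim_transform_eventually)
    show "(\<lambda>d. - u d * (c d + 1) - 3 * a d - e d * Y d) \<longlonglongrightarrow> 7"
      by (rule tendsto_eq_intros lims u Y refl | simp)+
    show "\<forall>\<^sub>F d in sequentially. - u d * (c d + 1) - 3 * a d - e d * Y d = (b d + 1) * real d"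
      using sys C1 epos
    proof eventually_elim
      case (elim d)
      have B: "b d = - (c d)\<^sup>2 - 3 * e d * a d - (e d)\<^sup>2 * Y d"
        using elim(1) by (simp add: reduced_system_def Y_def)
      have "b d + 1 = e d * (- u d * (c d + 1) - 3 * a d - e d * Y d)"
        using B elim(2) by algebra
      moreover have "e d * real d = 1" using elim(3) by (simp add: e_def)
      ultimately show ?case by algebra
    qed
  qed
  \<comment> \<open>\<open>x\<close> is \<open>(X - 1) / e\<close> written without division: up to
    terms with a factor \<open>e\<close>, \<open>X\<close> is \<open>3 c^2 - 2 c^3\<close>, and this
    differs from 1 by \<open>- (c - 1)^2 (2 c + 1)\<close>.\<close>
  define x where "x = (\<lambda>d. - u d * (c d - 1) * (2 * c d + 1) + 2 * a d - 4 * a d * (1 - e d) * c d + 2 * (c d) ^ 3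
     + e d * (e d * \<alpha>3 d - (2 * e d * \<alpha>3 d + Z d) * (1 - e d) * c d - 2 * (a d + b d) * c d))"
  have x: "x \<longlonglongrightarrow> 16 / 3"
    unfolding x_def by (rule tendsto_eq_intros lims u \<alpha>3 Z refl | simp)+
  have X1: "\<forall>\<^sub>F d in sequentially. X d = 1 + e d * x d"
    using C1
  proof eventually_elim
    case (elim d)
    have al: "\<alpha> d = (c d)\<^sup>2 + 2 * e d * a d + e d ^ 3 * \<alpha>3 d" and T: "T d = 2 * \<alpha> d + (e d)\<^sup>2 * Z d"
      and X: "X d = 2 * (c d)\<^sup>2 + \<alpha> d - T d * (1 - e d) * c d - 2 * (e d)\<^sup>2 * (a d + b d) * c d"
      by (simp_all add: \<alpha>_def \<alpha>3_def T_def X_def Z_def A2_def T2_def X2_def)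
    show ?case unfolding x_def X T al using elim by algebra
  qed
  have wl: "(\<lambda>d. (w d - 2) * real d) \<longlonglongrightarrow> 10 / 3"
  proof (rule Lim_transform_eventually)
    show "(\<lambda>d. - w d + x d) \<longlonglongrightarrow> 10 / 3"
      by (rule tendsto_eq_intros w x refl | simp)+
    show "\<forall>\<^sub>F d in sequentially. - w d + x d = (w d - 2) * real d"
      using X1 C1 epos
    proof eventually_elim
      case (elim d)
      have "u d + 1 = e d * w d" using elim(2) unfolding u_def w_def by algebra
      then have "w d - 2 = e d * (- w d + x d)" using elim(1) unfolding w_def by algebra
      moreover have "e d * real d = 1" using elim(3) by (simp add: e_def)
      ultimately show ?case by algebra
    qed
  qed
  \<comment> \<open>Likewise \<open>\<alpha> = 1 + e y\<close> and
    \<open>\<beta> = 1 + e z\<close>.\<close>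
  define y where "y = (\<lambda>d. u d * (c d + 1) + 2 * a d + (e d)\<^sup>2 * \<alpha>3 d)"
  define z where "z = (\<lambda>d. u d * (c d + 1) + 2 * b d + (e d)\<^sup>2 * \<beta>3 d)"
  have y: "y \<longlonglongrightarrow> - 16 / 3" and z: "z \<longlonglongrightarrow> - 4"
    unfolding y_def z_def by (rule tendsto_eq_intros lims u \<alpha>3 \<beta>3 refl | simp)+
  have al: "(\<lambda>d. (a d + 5 / 3) * real d) \<longlonglongrightarrow> 9"
  proof (rule Lim_transform_eventually)
    show "(\<lambda>d. (- (u d * X d + x d) + 3 * ((b d + 1) * real d) - (y d * \<beta> d + z d) + 2 * \<alpha> d * \<beta> d
       - (2 * (\<alpha> d)\<^sup>2 - (\<beta> d)\<^sup>2 + \<beta>3 d - Y d) - e d * (4 * \<alpha>3 d - 2 * \<beta>3 d)) / 3) \<longlonglongrightarrow> 9"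
      by (rule tendsto_eq_intros lims u X x y z bl \<alpha> \<beta> \<alpha>3 \<beta>3 Y refl | simp)+
    show "\<forall>\<^sub>F d in sequentially. (- (u d * X d + x d) + 3 * ((b d + 1) * real d) - (y d * \<beta> d + z d) + 2 * \<alpha> d * \<beta> d
       - (2 * (\<alpha> d)\<^sup>2 - (\<beta> d)\<^sup>2 + \<beta>3 d - Y d) - e d * (4 * \<alpha>3 d - 2 * \<beta>3 d)) / 3 = (a d + 5 / 3) * real d"
      using sys C1 X1 epos
    proof eventually_elim
      case (elim d)
      have A: "3 * a d = - c d * X d + 3 * b d - \<beta> d * \<alpha> d * (1 - 2 * e d)
         - e d * (2 * (\<alpha> d)\<^sup>2 - (\<beta> d)\<^sup>2 + \<beta>3 d - Y d) - (e d)\<^sup>2 * (4 * \<alpha>3 d - 2 * \<beta>3 d)"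
        using elim(1) unfolding reduced_system_def F2_def X_def Y_def \<alpha>_def \<beta>_def \<alpha>3_def \<beta>3_def
        by (simp add: field_simps)
      have al: "\<alpha> d = 1 + e d * y d"
      proof -
        have "\<alpha> d = (c d)\<^sup>2 + 2 * e d * a d + e d ^ 3 * \<alpha>3 d" by (simp add: \<alpha>_def \<alpha>3_def A2_def)
        then show ?thesis using elim(2) unfolding y_def by algebra
      qed
      have be: "\<beta> d = 1 + e d * z d"
      proof -
        have "\<beta> d = (c d)\<^sup>2 + 2 * e d * b d + e d ^ 3 * \<beta>3 d" by (simp add: \<beta>_def \<beta>3_def B2_def)
        then show ?thesis using elim(2) unfolding z_def by algebra
      qed
      have ed: "e d * real d = 1" using elim(4) by (simp add: e_def)
      define B where "B = (b d + 1) * real d"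
      have B: "b d = - 1 + e d * B" unfolding B_def using ed by algebra
      have "3 * a d + 5 = e d * (- (u d * X d + x d) + 3 * B - (y d * \<beta> d + z d) + 2 * \<alpha> d * \<beta> d
       - (2 * (\<alpha> d)\<^sup>2 - (\<beta> d)\<^sup>2 + \<beta>3 d - Y d) - e d * (4 * \<alpha>3 d - 2 * \<beta>3 d))"
        using A B al be elim(2,3) by algebra
      then show ?case using ed unfolding B_def[symmetric] by (simp add: field_simps) algebra
    qed
  qed
  show ?thesis
    using sys C2 a b c w al bl wl unfolding branch_def e_def by blast
qed

section \<open>The identity matrix\<close>

lemma DI_row: "i < d \<Longrightarrow> DI d i = unit_vec i"
  by (auto simp: DI_def unit_vec_def fun_eq_iff)

lemma DI_in_Mat: "DI d \<in> Mat d d"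
  by (auto simp: DI_def Mat_def)

lemma hessian_DI:
  assumes ij: "i < d" "j < d"
  shows "hessian d (loss d) (DI d) V i j =
    36 * V i j + (if i = j then 72 * V i i else 0)
      + (18 + (if i = j then 36 else 0)) * (2 * V j j + (\<Sum>b<d. V b j))"
proof -
  have k11: "(\<Sum>b<d. kern11 d (DI d i) (DI d b) (V i) (unit_vec j)) =
      (\<Sum>b<d. if b = i then 36 * V i i * unit_vec i j + 18 * V i j else 0)
      + (\<Sum>b<d. if b = j then 18 * V i i else 0) + (\<Sum>b<d. 18 * V i b * unit_vec i j)"
    unfolding sum.distrib[symmetric]
    by (intro sum.cong refl)
      (use ij in \<open>simp add: DI_row kern11_def dot_unit_vec_left dot_unit_vec_right unit_vec_apply\<close>)
  have k12: "(\<Sum>b<d. kern12 d (DI d b) (DI d i) (V b) (unit_vec j)) =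
      (\<Sum>b<d. if b = i then 72 * V i i * unit_vec i j + 18 * V i j else 0)
      + (\<Sum>b<d. if b = j then 18 * V j j else 0) + (\<Sum>b<d. 18 * V b i * unit_vec i j)
      + (\<Sum>b<d. 9 * V b j)"
    unfolding sum.distrib[symmetric]
    by (intro sum.cong refl)
      (use ij in \<open>simp add: DI_row kern12_def dot_unit_vec_left dot_unit_vec_right unit_vec_apply\<close>)
  show ?thesis
    unfolding hessian_loss_entry[OF ij] k11 k12 sum_kern11_unit_vec[OF ij(2)]
    unfolding DI_row[OF ij(1)] sum_unit_vec
    using ij by (simp add: dot_unit_vec_left unit_vec_apply sum_distrib_left[symmetric])
qed

lemma loss_DI: "loss d (DI d) = 0"
proof -
  have "(\<Sum>i<d. \<Sum>j<d. kern d (DI d i) (DI d j)) = (\<Sum>i<d. \<Sum>j<d. kern d (unit_vec i) (unit_vec j))"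
    "(\<Sum>i<d. \<Sum>j<d. kern d (DI d i) (unit_vec j)) = (\<Sum>i<d. \<Sum>j<d. kern d (unit_vec i) (unit_vec j))"
    by (intro sum.cong refl; simp add: DI_row)+
  then show ?thesis by (simp add: loss_eq)
qed

lemma critical_point_DI: "critical_point d (loss d) (DI d)"
proof -
  have "dloss d (DI d) V = 0" for V
  proof -
    have "(\<Sum>i<d. \<Sum>j<d. kern1 d (DI d i) (DI d j) (V i)) = (\<Sum>i<d. \<Sum>j<d. kern1 d (DI d i) (unit_vec j) (V i))"
      by (intro sum.cong refl) (simp add: DI_row)
    then show ?thesis by (simp add: dloss_def)
  qed
  then show ?thesis by (simp add: critical_point_loss_iff DI_in_Mat)
qed

section \<open>Isotropy groups and orbit lengths\<close>

lemma act_apply: "act (g, h) A i j = A (inv g i) (inv h j)"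
  by (simp add: act_def)

lemma Sym_inv_apply: "g \<in> Sym m \<Longrightarrow> inv g (g i) = i"
  unfolding Sym_def using permutes_inverses(2) by fastforce

lemma Sym_apply_less: "g \<in> Sym m \<Longrightarrow> g i < m \<longleftrightarrow> i < m"
  unfolding Sym_def using permutes_in_image[of g "{..<m}" i] by simp

lemma Sym_apply_outside: "g \<in> Sym m \<Longrightarrow> m \<le> i \<Longrightarrow> g i = i"
  unfolding Sym_def using permutes_not_in[of g "{..<m}" i] by simp

lemma act_eq_iff:
  assumes "g \<in> Sym d" "h \<in> Sym d"
  shows "act (g, h) A = A \<longleftrightarrow> (\<forall>i j. A (g i) (h j) = A i j)"
proof
  assume *: "act (g, h) A = A"
  show "\<forall>i j. A (g i) (h j) = A i j"
  proof (intro allI)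
    fix i j
    have "A (g i) (h j) = act (g, h) A (g i) (h j)" using * by simp
    also have "\<dots> = A i j" using assms by (simp add: act_apply Sym_inv_apply)
    finally show "A (g i) (h j) = A i j" .
  qed
next
  assume *: "\<forall>i j. A (g i) (h j) = A i j"
  show "act (g, h) A = A"
  proof (intro ext)
    fix i j
    have "g (inv g i) = i" "h (inv h j) = j"
      using assms permutes_inverses(1) unfolding Sym_def by fastforce+
    then show "act (g, h) A i j = A i j"
      using *[rule_format, of "inv g i" "inv h j"] by (simp add: act_apply)
  qed
qed

lemma isotropy_DI: "isotropy d (DI d) = Diag (Sym d)"
proof (intro equalityI subsetI)
  fix x assume "x \<in> isotropy d (DI d)"
  then obtain g h where x: "x = (g, h)" "g \<in> Sym d" "h \<in> Sym d" "act (g, h) (DI d) = DI d"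
    by (auto simp: isotropy_def)
  have *: "DI d (g i) (h j) = DI d i j" for i j
    using x(4) act_eq_iff[OF x(2,3)] by blast
  have "g i = h i" for i
  proof (cases "i < d")
    case True
    then show ?thesis
      using *[of i i] by (simp add: DI_def split: if_splits)
  next
    case False
    then show ?thesis using Sym_apply_outside[OF x(2), of i] Sym_apply_outside[OF x(3), of i] by simp
  qed
  then have "g = h" by auto
  then show "x \<in> Diag (Sym d)" using x by (simp add: Diag_def)
next
  fix x assume "x \<in> Diag (Sym d)"
  then obtain g where g: "x = (g, g)" "g \<in> Sym d" by (auto simp: Diag_def)
  have "g i = g j \<longleftrightarrow> i = j" for i j
    using g(2) permutes_inj unfolding Sym_def by (auto simp: inj_def)
  then have "DI d (g i) (g j) = DI d i j" for i j
    using Sym_apply_less[OF g(2)] by (simp add: DI_def)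
  then show "x \<in> isotropy d (DI d)"
    using g act_eq_iff[OF g(2) g(2)] by (simp add: isotropy_def)
qed

lemma finite_Sym: "finite (Sym d)"
  by (simp add: Sym_def finite_permutations)

lemma card_Sym: "card (Sym d) = fact d"
  by (simp add: Sym_def card_permutations)

lemma Sym_comp: "g \<in> Sym d \<Longrightarrow> h \<in> Sym d \<Longrightarrow> g \<circ> h \<in> Sym d"
  by (simp add: Sym_def permutes_compose)

lemma inv_in_Sym: "g \<in> Sym d \<Longrightarrow> inv g \<in> Sym d"
  by (simp add: Sym_def permutes_inv)

text \<open>Orbit-stabilizer theorem: the fibre of \<open>g \<mapsto> act g A\<close> through \<open>g\<close> is the coset \<open>g \<circ> isotropy d A\<close>.\<close>

lemma card_orbit_isotropy: "card (orbit d A) * card (isotropy d A) = fact d * fact d"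
proof -
  let ?G = "Sym d \<times> Sym d"
  have act_comp: "act (g1 \<circ> h1, g2 \<circ> h2) A = act (g1, g2) (act (h1, h2) A)"
    if "(g1, g2) \<in> ?G" "(h1, h2) \<in> ?G" for g1 g2 h1 h2 and A :: rmat
  proof -
    have "bij g1" "bij g2" "bij h1" "bij h2"
      using that by (auto simp: Sym_def permutes_bij)
    then show ?thesis by (simp add: act_def o_inv_distrib fun_eq_iff)
  qed
  have fibre: "card {g \<in> ?G. act g A = B} = card (isotropy d A)" if "B \<in> orbit d A" for B
  proof -
    obtain g1 g2 where g: "g1 \<in> Sym d" "g2 \<in> Sym d" "B = act (g1, g2) A"
      using \<open>B \<in> orbit d A\<close> by (auto simp: orbit_def)
    have comp: "g1 \<circ> inv g1 = id" "inv g1 \<circ> g1 = id" "g2 \<circ> inv g2 = id" "inv g2 \<circ> g2 = id"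
      using g by (auto simp: Sym_def permutes_inv_o)
    have "bij_betw (\<lambda>(h1, h2). (g1 \<circ> h1, g2 \<circ> h2)) (isotropy d A) {g \<in> ?G. act g A = B}"
    proof (rule bij_betwI[where g = "\<lambda>(h1, h2). (inv g1 \<circ> h1, inv g2 \<circ> h2)"])
      show "(\<lambda>(h1, h2). (g1 \<circ> h1, g2 \<circ> h2)) \<in> isotropy d A \<rightarrow> {g \<in> ?G. act g A = B}"
        using g act_comp[of g1 g2] by (auto simp: isotropy_def Sym_comp)
      show "(\<lambda>(h1, h2). (inv g1 \<circ> h1, inv g2 \<circ> h2)) \<in> {g \<in> ?G. act g A = B} \<rightarrow> isotropy d A"
      proof (rule funcsetI)
        fix x assume "x \<in> {g \<in> ?G. act g A = B}"
        then obtain h1 h2 where h: "x = (h1, h2)" "h1 \<in> Sym d" "h2 \<in> Sym d" "act (h1, h2) A = B" by auto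
        have "act (inv g1 \<circ> h1, inv g2 \<circ> h2) A = act (inv g1, inv g2) (act (g1, g2) A)"
          using act_comp[of "inv g1" "inv g2" h1 h2 A] g h by (simp add: inv_in_Sym)
        also have "\<dots> = act (id, id) A"
          using act_comp[of "inv g1" "inv g2" g1 g2 A] g comp by (simp add: inv_in_Sym)
        also have "\<dots> = A" by (simp add: act_def)
        finally show "(case x of (h1, h2) \<Rightarrow> (inv g1 \<circ> h1, inv g2 \<circ> h2)) \<in> isotropy d A"
          using g h by (simp add: isotropy_def Sym_comp inv_in_Sym)
      qed
    qed (auto simp: o_assoc comp)
    then show ?thesis by (simp add: bij_betw_same_card)
  qed
  have fin: "finite ?G" by (simp add: finite_Sym)
  have "card ?G = (\<Sum>B\<in>orbit d A. card {g \<in> ?G. act g A = B})"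
  proof -
    have "?G = (\<Union>B\<in>orbit d A. {g \<in> ?G. act g A = B})" by (auto simp: orbit_def)
    moreover have "card (\<Union>B\<in>orbit d A. {g \<in> ?G. act g A = B}) = (\<Sum>B\<in>orbit d A. card {g \<in> ?G. act g A = B})"
      by (rule card_UN_disjoint) (use fin in \<open>auto simp: orbit_def\<close>)
    ultimately show ?thesis by simp
  qed
  then show ?thesis using fibre by (simp add: card_cartesian_product card_Sym)
qed

lemma card_Diag: "card (Diag G) = card G"
  unfolding Diag_def by (rule card_image) (simp add: inj_on_def)

lemma card_orbit_DI: "card (orbit d (DI d)) = fact d"
  using card_orbit_isotropy[of d "DI d"] by (simp add: isotropy_DI card_Diag card_Sym)

text \<open>The eigenvalues of the two by two matrix with rows \<open>(270, 54 (d - 1))\<close> and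
  \<open>(54, 18 d + 18)\<close>. It describes the Hessian on pairs (diagonal value, off-diagonal
  value): in type t on combinations of the identity and the constant matrix, in type s on
  combinations of the diagonal and the column copy. The sign \<open>s\<close> selects the
  root.\<close>

definition root_pm :: "real \<Rightarrow> nat \<Rightarrow> real"
  where "root_pm s d = 9 * real d + 144 + s * sqrt ((9 * real d + 144)\<^sup>2 - 324 * (6 * real d + 24))"

lemma root_pm_eq:
  assumes "s\<^sup>2 = 1"
  shows "(root_pm s d - 270) * (root_pm s d - (18 * real d + 18)) = 54 * (54 * (real d - 1))"
proof -
  \<comment> \<open>A quarter of the discriminant equals \<open>(9 d + 36)^2 + 108^2\<close>, so the
    roots are real and distinct.\<close>
  have eq: "(9 * real d + 144)\<^sup>2 - 324 * (6 * real d + 24) = (9 * real d + 36)\<^sup>2 + 11664"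
    by (simp add: power2_eq_square algebra_simps)
  have "0 \<le> (9 * real d + 144)\<^sup>2 - 324 * (6 * real d + 24)"
    unfolding eq by simp
  then have "sqrt ((9 * real d + 144)\<^sup>2 - 324 * (6 * real d + 24)) ^ 2 = (9 * real d + 144)\<^sup>2 - 324 * (6 * real d + 24)"
    by (rule real_sqrt_pow2)
  then show ?thesis
    using assms unfolding root_pm_def by algebra
qed

lemma root_pm_less: "root_pm (-1) d < root_pm 1 d"
proof -
  have "(9 * real d + 144)\<^sup>2 - 324 * (6 * real d + 24) = (9 * real d + 36)\<^sup>2 + 11664"
    by (simp add: power2_eq_square algebra_simps)
  also have "\<dots> > 0" by (simp add: add_nonneg_pos)
  finally show ?thesis by (simp add: root_pm_def)
qed

lemma hessian_DI_diag_col: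
  assumes u: "\<And>i. d \<le> i \<Longrightarrow> u i = 0"
  shows "hessian d (loss d) (DI d) (\<alpha> *\<^sub>R diag_s d 0 u + \<beta> *\<^sub>R diag_s d 2 u) =
    (270 * (\<alpha> + \<beta>) + 54 * (real d - 1) * \<beta> - (54 * (\<alpha> + \<beta>) + (18 * real d + 18) * \<beta>)) *\<^sub>R diag_s d 0 u
    + (54 * (\<alpha> + \<beta>) + (18 * real d + 18) * \<beta>) *\<^sub>R diag_s d 2 u"
proof (intro ext)
  fix i j
  let ?V = "\<alpha> *\<^sub>R diag_s d 0 u + \<beta> *\<^sub>R diag_s d 2 u"
  have V: "?V i j = (if i = j then \<alpha> * u i else 0) + \<beta> * u j" if "i < d" "j < d" for i j
    using that by (simp add: diag_s_apply)
  have col: "(\<Sum>b<d. ?V b j) = \<alpha> * u j + real d * \<beta> * u j" if "j < d"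
  proof -
    have "(\<Sum>b<d. ?V b j) = (\<Sum>b<d. (if b = j then \<alpha> * u b else 0) + \<beta> * u j)"
      by (intro sum.cong refl) (use V that in auto)
    then show ?thesis using that by (simp add: sum.distrib)
  qed
  show "hessian d (loss d) (DI d) ?V i j =
    ((270 * (\<alpha> + \<beta>) + 54 * (real d - 1) * \<beta> - (54 * (\<alpha> + \<beta>) + (18 * real d + 18) * \<beta>)) *\<^sub>R diag_s d 0 u
    + (54 * (\<alpha> + \<beta>) + (18 * real d + 18) * \<beta>) *\<^sub>R diag_s d 2 u) i j"
  proof (cases "i < d \<and> j < d")
    case True
    then show ?thesis
      using hessian_DI[of i d j ?V] V[of i j] V[of j j] V[of i i] col
      by (cases "i = j") (simp_all add: diag_s_apply algebra_simps)
  next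
    case False
    then show ?thesis by (auto simp: hessian_outside diag_s_apply)
  qed
qed

lemma std_rep_outside: "u \<in> std_rep m \<Longrightarrow> m \<le> i \<Longrightarrow> u i = 0"
  by (simp add: std_rep_def)

text \<open>With off-diagonal value 54 the second row of the two by two system gives the diagonal
  value \<open>l - 18 d - 18\<close>, and the coefficient of the diagonal copy is this minus 54. The
  first row is then the characteristic equation.\<close>

lemma diag_s_DI_eigen:
  assumes l: "(l - 270) * (l - (18 * real d + 18)) = 54 * (54 * (real d - 1))" and u: "u \<in> std_rep d"
  shows "hessian d (loss d) (DI d) ((l - 18 * real d - 72) *\<^sub>R diag_s d 0 u + 54 *\<^sub>R diag_s d 2 u)
    = l *\<^sub>R ((l - 18 * real d - 72) *\<^sub>R diag_s d 0 u + 54 *\<^sub>R diag_s d 2 u)"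
proof -
  let ?x = "l - 18 * real d - 72"
  have 1: "54 * (?x + 54) + (18 * real d + 18) * 54 = l * 54" by (simp add: algebra_simps)
  have 2: "270 * (?x + 54) + 54 * (real d - 1) * 54 = l * (?x + 54)" using l by algebra
  have "hessian d (loss d) (DI d) (?x *\<^sub>R diag_s d 0 u + 54 *\<^sub>R diag_s d 2 u) =
    (270 * (?x + 54) + 54 * (real d - 1) * 54 - (54 * (?x + 54) + (18 * real d + 18) * 54)) *\<^sub>R diag_s d 0 u
    + (54 * (?x + 54) + (18 * real d + 18) * 54) *\<^sub>R diag_s d 2 u"
    by (rule hessian_DI_diag_col) (rule std_rep_outside[OF u])
  also have "\<dots> = (l * ?x) *\<^sub>R diag_s d 0 u + (l * 54) *\<^sub>R diag_s d 2 u"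
    unfolding 1 2 by (simp add: algebra_simps)
  finally show ?thesis by (simp only: scaleR_add_right scaleR_scaleR)
qed

lemma hessian_DI_zero_sums:
  assumes V: "zero_sums d V" "\<And>i. V i i = 0"
  shows "hessian d (loss d) (DI d) V = 36 *\<^sub>R V"
proof (intro ext)
  fix i j
  show "hessian d (loss d) (DI d) V i j = (36 *\<^sub>R V) i j"
  proof (cases "i < d \<and> j < d")
    case True
    then have "(\<Sum>b<d. V b j) = 0" using V(1) by (simp add: zero_sums_def)
    then show ?thesis using True by (simp add: hessian_DI V(2))
  next
    case False
    then show ?thesis using V(1) by (auto simp: hessian_outside zero_sums_def Mat_def)
  qed
qed

text \<open>The coefficients are chosen so that the diagonal and all column sums vanish; of the
  Hessian only the term \<open>36 * V i j\<close> survives.\<close>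

lemma diag_s_DI_eigen_36:
  assumes u: "u \<in> std_rep d"
  shows "hessian d (loss d) (DI d) ((- real d) *\<^sub>R diag_s d 0 u + (real d - 1) *\<^sub>R diag_s d 1 u + diag_s d 2 u)
    = 36 *\<^sub>R ((- real d) *\<^sub>R diag_s d 0 u + (real d - 1) *\<^sub>R diag_s d 1 u + diag_s d 2 u)"
proof (intro ext)
  let ?V = "(- real d) *\<^sub>R diag_s d 0 u + (real d - 1) *\<^sub>R diag_s d 1 u + diag_s d 2 u"
  fix i j
  have V: "?V i j = (if i = j then - real d * u i else 0) + (real d - 1) * u i + u j" if "i < d" "j < d" for i j
    using that unfolding diag_s_apply plus_fun_apply scaleR_fun_apply by simp
  show "hessian d (loss d) (DI d) ?V i j = (36 *\<^sub>R ?V) i j"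
  proof (cases "i < d \<and> j < d")
    case True
    have "(\<Sum>b<d. ?V b j) = (\<Sum>b<d. (if b = j then - real d * u b else 0) + (real d - 1) * u b + u j)"
      by (intro sum.cong refl) (use V True in auto)
    then have "(\<Sum>b<d. ?V b j) = 0"
      using u True by (simp add: sum.distrib sum_distrib_left[symmetric] std_rep_def)
    moreover have "?V i i = 0" "?V j j = 0" using V[of i i] V[of j j] True by (simp_all add: algebra_simps)
    ultimately show ?thesis using hessian_DI[of i d j ?V] True by simp
  next
    case False
    then have "?V i j = 0" unfolding diag_s_apply plus_fun_apply scaleR_fun_apply by auto
    then show ?thesis using False by (simp add: hessian_outside)
  qed
qed

lemma spectrum_DI_s:
  assumes d: "d \<ge> 3"
  shows "spectrum_on (hessian d (loss d) (DI d)) (diag_comp_s d d)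
    [(root_pm (-1) d, d - 1), (36, d - 1), (root_pm 1 d, d - 1)]"
proof -
  let ?l = "\<lambda>l::nat. if l = 0 then root_pm (-1) d else if l = 1 then 36 else root_pm 1 d"
  let ?r = "\<lambda>s (j::nat). if j = 0 then root_pm s d - 18 * real d - 72 else if j = 1 then 0 else 54"
  let ?v = "\<lambda>l::nat. if l = 0 then ?r (-1) else if l = 1 then (\<lambda>j::nat. if j = 0 then - real d else if j = 1 then real d - 1 else 1) else ?r 1"
  have "spectrum_on (hessian d (loss d) (DI d)) (diag_comp_s d d) (map (\<lambda>l. (?l l, d - 1)) [0..<3])"
  proof (rule spectrum_on_copies[where \<Phi> = "diag_s d" and v = ?v and U = "std_rep d"])
    show "linear (hessian d (loss d) (DI d))" by (rule linear_hessian_loss)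
    show "linear (diag_s d j)" for j by (rule linear_diag_s)
    show "independent_family {1..<d} std_basis" "std_rep d = span (std_basis ` {1..<d})"
      using std_rep_basis[of d] d by auto
    show "diag_comp_s d d = {\<Sum>j<3. diag_s d j (u j) |u. \<forall>j<3. u j \<in> std_rep d}"
      by (rule diag_comp_s_eq(1)) (use d in auto)
    show "u j = 0" if "\<And>j. j < 3 \<Longrightarrow> u j \<in> std_rep d" "(\<Sum>j<3. diag_s d j (u j)) = 0" "j < 3" for u j
      by (rule diag_comp_s_eq(2)[where d = d and k = 3, OF d _ that]) auto
    show "hessian d (loss d) (DI d) (\<Sum>j<3. ?v l j *\<^sub>R diag_s d j u) = ?l l *\<^sub>R (\<Sum>j<3. ?v l j *\<^sub>R diag_s d j u)"
      if "l < 3" "u \<in> std_rep d" for l u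
    proof -
      consider "l = 0" | "l = 1" | "l = 2" using \<open>l < 3\<close> by linarith
      then show ?thesis
        using diag_s_DI_eigen[OF root_pm_eq that(2), of "-1"] diag_s_DI_eigen[OF root_pm_eq that(2), of 1]
          diag_s_DI_eigen_36[OF that(2)]
        by cases (simp_all add: sum_lessThan_3)
    qed
    show "c l = 0" if c: "\<And>j. j < 3 \<Longrightarrow> (\<Sum>l<3. c l * ?v l j) = 0" and l: "l < 3" for c l
    proof -
      have 1: "c 1 = 0" using c[of 1] d by (simp add: sum_lessThan_3)
      then have 2: "c 0 = - c 2" using c[of 2] by (simp add: sum_lessThan_3)
      have "c 2 * (root_pm 1 d - root_pm (-1) d) = 0" using c[of 0] 1 2 by (simp add: sum_lessThan_3 algebra_simps)
      then have "c 2 = 0" using root_pm_less[of d] by simp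
      moreover have "l = 0 \<or> l = 1 \<or> l = 2" using l by auto
      ultimately show ?thesis using 1 2 by auto
    qed
  qed simp_all
  then show ?thesis by (simp add: upt_rec)
qed

lemma hessian_DI_diag_ones:
  shows "hessian d (loss d) (DI d) (diag_t d 0 \<alpha> + diag_t d 1 \<beta>) =
    diag_t d 0 (270 * (\<alpha> + \<beta>) + 54 * (real d - 1) * \<beta> - (54 * (\<alpha> + \<beta>) + (18 * real d + 18) * \<beta>))
    + diag_t d 1 (54 * (\<alpha> + \<beta>) + (18 * real d + 18) * \<beta>)"
proof (intro ext)
  let ?V = "diag_t d 0 \<alpha> + diag_t d 1 \<beta>"
  let ?R = "diag_t d 0 (270 * (\<alpha> + \<beta>) + 54 * (real d - 1) * \<beta> - (54 * (\<alpha> + \<beta>) + (18 * real d + 18) * \<beta>))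
    + diag_t d 1 (54 * (\<alpha> + \<beta>) + (18 * real d + 18) * \<beta>)"
  fix i j
  have V: "?V i j = (if i = j then \<alpha> else 0) + \<beta>" if "i < d" "j < d" for i j
    using that unfolding diag_t_apply plus_fun_apply by simp
  show "hessian d (loss d) (DI d) ?V i j = ?R i j"
  proof (cases "i < d \<and> j < d")
    case True
    have "(\<Sum>b<d. ?V b j) = (\<Sum>b<d. (if b = j then \<alpha> else 0) + \<beta>)"
      by (intro sum.cong refl) (use V True in auto)
    then have "(\<Sum>b<d. ?V b j) = \<alpha> + real d * \<beta>" using True by (simp add: sum.distrib)
    moreover have "?R i j = (if i = j then 270 * (\<alpha> + \<beta>) + 54 * (real d - 1) * \<beta>
        else 54 * (\<alpha> + \<beta>) + (18 * real d + 18) * \<beta>)"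
      using True unfolding diag_t_apply plus_fun_apply by simp
    ultimately show ?thesis
      using True hessian_DI[of i d j ?V] V[of i j] V[of j j] V[of i i]
      by (cases "i = j") (simp_all add: algebra_simps)
  next
    case False
    then have "?R i j = 0" unfolding diag_t_apply plus_fun_apply by auto
    then show ?thesis using False by (simp add: hessian_outside)
  qed
qed

lemma spectrum_DI_t:
  assumes d: "d \<ge> 3"
  shows "spectrum_on (hessian d (loss d) (DI d)) (diag_comp_t d d) [(root_pm (-1) d, 1), (root_pm 1 d, 1)]"
proof -
  let ?l = "\<lambda>l::nat. if l = 0 then root_pm (-1) d else root_pm 1 d"
  let ?v = "\<lambda>l (j::nat). if j = 0 then ?l l - 18 * real d - 72 else 54"
  have scale: "c *\<^sub>R diag_t d k u = diag_t d k (c * u)" for c u :: real and k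
    using linear_scale[OF linear_diag_t[of d k], of c u] by simp
  have eig: "hessian d (loss d) (DI d) (diag_t d 0 ((l - 18 * real d - 72) * u) + diag_t d 1 (54 * u))
      = l *\<^sub>R (diag_t d 0 ((l - 18 * real d - 72) * u) + diag_t d 1 (54 * u))"
    if l: "(l - 270) * (l - (18 * real d + 18)) = 54 * (54 * (real d - 1))" for l u
  proof -
    let ?x = "l - 18 * real d - 72"
    have 1: "54 * (?x * u + 54 * u) + (18 * real d + 18) * (54 * u) = l * (54 * u)" by (simp add: algebra_simps)
    have 2: "270 * (?x * u + 54 * u) + 54 * (real d - 1) * (54 * u) - l * (54 * u) = l * (?x * u)"
      using l by algebra
    show ?thesis
      unfolding hessian_DI_diag_ones 1 2 scaleR_add_right scale ..
  qed
  have "spectrum_on (hessian d (loss d) (DI d)) (diag_comp_t d d) (map (\<lambda>l. (?l l, 1)) [0..<2])"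
  proof (rule spectrum_on_copies[where \<Phi> = "diag_t d" and v = ?v and U = "UNIV" and I = "{0::nat}" and b = "\<lambda>_. 1"])
    show "linear (hessian d (loss d) (DI d))" by (rule linear_hessian_loss)
    show "linear (diag_t d j)" for j by (rule linear_diag_t)
    show "independent_family {0::nat} (\<lambda>_. 1::real)" by (simp add: independent_family_def)
    show "(UNIV::real set) = span ((\<lambda>_. 1) ` {0::nat})" by (auto simp: span_singleton)
    show "diag_comp_t d d = {\<Sum>j<2. diag_t d j (u j) |u. \<forall>j<2. u j \<in> UNIV}"
      by (rule diag_comp_t_eq(1)) (use d in auto)
    show "u j = 0" if "(\<Sum>j<2. diag_t d j (u j)) = 0" "j < 2" for u j
      by (rule diag_comp_t_eq(2)[where d = d and k = 2, OF d _ that]) auto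
    show "hessian d (loss d) (DI d) (\<Sum>j<2. ?v l j *\<^sub>R diag_t d j u) = ?l l *\<^sub>R (\<Sum>j<2. ?v l j *\<^sub>R diag_t d j u)"
      if "l < 2" for l u
    proof -
      have "(\<Sum>j<2. ?v l j *\<^sub>R diag_t d j u) = diag_t d 0 ((?l l - 18 * real d - 72) * u) + diag_t d 1 (54 * u)"
        by (simp add: sum_lessThan_2 scale)
      moreover have "(?l l - 270) * (?l l - (18 * real d + 18)) = 54 * (54 * (real d - 1))"
        using root_pm_eq[of "-1" d] root_pm_eq[of 1 d] by simp
      ultimately show ?thesis using eig[of "?l l" u] by simp
    qed
    show "c l = 0" if c: "\<And>j. j < 2 \<Longrightarrow> (\<Sum>l<2. c l * ?v l j) = 0" and l: "l < 2" for c l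
    proof -
      have 2: "c 0 = - c 1" using c[of 1] by (simp add: sum_lessThan_2)
      have "c 1 * (root_pm 1 d - root_pm (-1) d) = 0" using c[of 0] 2 by (simp add: sum_lessThan_2 algebra_simps)
      then have "c 1 = 0" using root_pm_less[of d] by simp
      moreover have "l = 0 \<or> l = 1" using l by auto
      ultimately show ?thesis using 2 by auto
    qed
  qed simp_all
  then show ?thesis by (simp add: upt_rec)
qed

lemma spectrum_zero_diag:
  assumes "d \<ge> 3" "l = 36"
  shows "spectrum_on (hessian d (loss d) (DI d)) (diag_comp_x d d) [(l, (d - 1) * (d - 2) div 2)]"
    and "spectrum_on (hessian d (loss d) (DI d)) (diag_comp_y d d) [(l, d * (d - 3) div 2)]"
proof -
  show "spectrum_on (hessian d (loss d) (DI d)) (diag_comp_x d d) [(l, (d - 1) * (d - 2) div 2)]"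
  proof (rule spectrum_on_scalar[OF linear_hessian_loss linear_ident finite_upper_pairs ext_square_rep_basis(1,2)])
    show "diag_comp_x d d = {\<Sum>j<1. u j |u. \<forall>j<(1::nat). u j \<in> ext_square_rep d}"
      by (rule diag_comp_x_eq) (use assms in auto)
    show "hessian d (loss d) (DI d) u = l *\<^sub>R u" if "u \<in> ext_square_rep d" for u
    proof -
      have u: "zero_sums d u" "\<forall>i j. u i j + u j i = 0"
        using that unfolding ext_square_rep_basis(3) by blast+
      have "u i i = 0" for i using u(2)[rule_format, of i i] by simp
      then show ?thesis unfolding assms(2) by (rule hessian_DI_zero_sums[OF u(1)])
    qed
  qed (simp_all add: card_upper_pairs)
  show "spectrum_on (hessian d (loss d) (DI d)) (diag_comp_y d d) [(l, d * (d - 3) div 2)]"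
  proof (rule spectrum_on_scalar[OF linear_hessian_loss linear_ident _ specht2_rep_basis(1,2)[OF assms(1)]])
    show "diag_comp_y d d = {\<Sum>j<1. u j |u. \<forall>j<(1::nat). u j \<in> specht2_rep d}"
      by (rule diag_comp_y_eq) (use assms in auto)
    show "hessian d (loss d) (DI d) u = l *\<^sub>R u" if "u \<in> specht2_rep d" for u
    proof -
      have u: "zero_sums d u" "\<forall>i. u i i = 0"
        using that unfolding specht2_rep_basis(3)[OF assms(1)] by blast+
      then show ?thesis unfolding assms(2) by (intro hessian_DI_zero_sums) auto
    qed
    show "d * (d - 3) div 2 = card (upper_pairs d - {(1, 2)})"
      by (rule specht2_rep_basis(4)[OF assms(1), symmetric])
  qed simp_all
qed

lemma root_pm_asymptotics:
  "(\<lambda>d. root_pm (-1) d - 108) \<in> o(\<lambda>d. real d powr (-2/3))"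
  "(\<lambda>d. root_pm 1 d - (18 * real d + 180)) \<in> o(\<lambda>d. real d powr (-2/3))"
  unfolding root_pm_def by real_asymp+

lemma DI_asymp_spectrum:
  shows "asymp_spectrum 3 (\<lambda>d. hessian d (loss d) (DI d)) (\<lambda>d. diag_comp_t d d) (\<lambda>d. 1)
      [\<lambda>d. 108, \<lambda>d. 18 * real d + 180]"
    and "asymp_spectrum 3 (\<lambda>d. hessian d (loss d) (DI d)) (\<lambda>d. diag_comp_s d d) (\<lambda>d. d - 1)
      [\<lambda>d. 108, \<lambda>d. 36, \<lambda>d. 18 * real d + 180]"
    and "asymp_spectrum 3 (\<lambda>d. hessian d (loss d) (DI d)) (\<lambda>d. diag_comp_x d d) (\<lambda>d. (d - 1) * (d - 2) div 2)
      [\<lambda>d. 36]"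
    and "asymp_spectrum 3 (\<lambda>d. hessian d (loss d) (DI d)) (\<lambda>d. diag_comp_y d d) (\<lambda>d. d * (d - 3) div 2)
      [\<lambda>d. 36]"
proof -
  note asymp = root_pm_asymptotics
  show "asymp_spectrum 3 (\<lambda>d. hessian d (loss d) (DI d)) (\<lambda>d. diag_comp_t d d) (\<lambda>d. 1)
      [\<lambda>d. 108, \<lambda>d. 18 * real d + 180]"
    unfolding asymp_spectrum_def
    by (intro exI[of _ "[root_pm (-1), root_pm 1]"] conjI) (use asymp spectrum_DI_t in auto)
  show "asymp_spectrum 3 (\<lambda>d. hessian d (loss d) (DI d)) (\<lambda>d. diag_comp_s d d) (\<lambda>d. d - 1)
      [\<lambda>d. 108, \<lambda>d. 36, \<lambda>d. 18 * real d + 180]"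
    unfolding asymp_spectrum_def
    by (intro exI[of _ "[root_pm (-1), \<lambda>_. 36, root_pm 1]"] conjI) (use asymp spectrum_DI_s in auto)
  show "asymp_spectrum 3 (\<lambda>d. hessian d (loss d) (DI d)) (\<lambda>d. diag_comp_x d d) (\<lambda>d. (d - 1) * (d - 2) div 2)
      [\<lambda>d. 36]"
    unfolding asymp_spectrum_def
    by (intro exI[of _ "[\<lambda>_. 36]"] conjI) (use spectrum_zero_diag(1) in auto)
  show "asymp_spectrum 3 (\<lambda>d. hessian d (loss d) (DI d)) (\<lambda>d. diag_comp_y d d) (\<lambda>d. d * (d - 3) div 2)
      [\<lambda>d. 36]"
    unfolding asymp_spectrum_def
    by (intro exI[of _ "[\<lambda>_. 36]"] conjI) (use spectrum_zero_diag(2) in auto)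
qed

text \<open>The cube root is rewritten with real powers, and the constant
  \<open>75 powr (1/3) / 5\<close>, the cube root of 3/5, is split off; the rest is an expression in
  \<open>d\<close> alone that can be expanded automatically.\<close>

lemma d1c_eq:
  assumes "d \<ge> 1"
  shows "d1c d = 75 powr (1/3) / 5 * (real d powr (-2/3) * (1 + 2 / (3 * real d)) powr (1/3))"
proof -
  define K where "K = (75::real) powr (1/3)"
  have cube: "(x powr a) ^ 3 = x powr (3 * a)" if "x > 0" for x a :: real
    using powr_realpow[of "x powr a" 3] that by (simp add: powr_powr mult.commute)
  have K: "K > 0" "K ^ 3 = 75" by (simp_all add: K_def cube)
  define x where "x = K / 5 * (real d powr (-2/3) * (1 + 2 / (3 * real d)) powr (1/3))"
  have "(real d powr (-2/3)) ^ 3 = real d powr (3 * (-2/3))"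
    by (rule cube) (use assms in simp)
  also have "\<dots> = 1 / real d ^ 2"
    using assms by (simp add: powr_minus_divide)
  finally have "(real d powr (-2/3)) ^ 3 = 1 / real d ^ 2" .
  moreover have "((1 + 2 / (3 * real d)) powr (1/3)) ^ 3 = 1 + 2 / (3 * real d)"
    using assms by (simp add: cube add_pos_nonneg)
  ultimately have "x ^ 3 = 75 / 125 * (1 / real d ^ 2 * (1 + 2 / (3 * real d)))"
    unfolding x_def power_mult_distrib power_divide K(2) by simp
  also have "\<dots> = 3 / (5 * real d ^ 3) * (real d + 2/3)"
    using assms by (simp add: field_simps eval_nat_numeral)
  finally have "d1c d = root 3 (x ^ 3)" by (simp add: d1c_def)
  also have "\<dots> = x" using K(1) by (intro real_root_power_cancel) (auto simp: x_def)
  finally show ?thesis by (simp add: x_def K_def)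
qed

lemma d1c_asymptotics:
  "(\<lambda>d. d1c d * (162 * real d + 108) - (162 * 75 powr (1/3) / 5 * real d powr (1/3)
     + 144 * 75 powr (1/3) / 5 * real d powr (-2/3))) \<in> o(\<lambda>d. real d powr (-2/3))" (is ?a)
  "(\<lambda>d. d1c d * (18 * real d - 36) - (18 * 75 powr (1/3) / 5 * real d powr (1/3)
     - 32 * 75 powr (1/3) / 5 * real d powr (-2/3))) \<in> o(\<lambda>d. real d powr (-2/3))" (is ?b)
  "(\<lambda>d. - (d1c d * (72 * real d + 288) / 5) - (- (72 * 75 powr (1/3) / 25) * real d powr (1/3)
     - 304 * 75 powr (1/3) / 25 * real d powr (-2/3))) \<in> o(\<lambda>d. real d powr (-2/3))" (is ?c)
proof -
  have transfer: "f \<in> o(\<lambda>d. real d powr (-2/3))"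
    if "g \<in> o(\<lambda>d. real d powr (-2/3))" "\<And>d. d \<ge> 1 \<Longrightarrow> f d = 75 powr (1/3) / 5 * g d" for f g :: "nat \<Rightarrow> real"
  proof -
    have "(\<lambda>d. 75 powr (1/3) / 5 * g d) \<in> o(\<lambda>d. real d powr (-2/3))"
      using that(1) by simp
    moreover have "\<forall>\<^sub>F d in sequentially. 75 powr (1/3) / 5 * g d = f d"
      using eventually_ge_at_top[of 1] by eventually_elim (simp add: that(2))
    then have ev: "\<forall>\<^sub>F d in sequentially. f d = 75 powr (1/3) / 5 * g d"
      by eventually_elim simp
    ultimately show ?thesis by (subst landau_o.small.in_cong[OF ev])
  qed
  have ring: "K / 5 * X * (162 * D + 108) - (162 * K / 5 * y + 144 * K / 5 * z) = K / 5 * (X * (162 * D + 108) - (162 * y + 144 * z))"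
    "K / 5 * X * (18 * D - 36) - (18 * K / 5 * y - 32 * K / 5 * z) = K / 5 * (X * (18 * D - 36) - (18 * y - 32 * z))"
    "- (K / 5 * X * (72 * D + 288) / 5) - (- (72 * K / 25) * y - 304 * K / 25 * z)
      = K / 5 * (- (X * (72 * D + 288) / 5) - (- (72 / 5) * y - 304 / 5 * z))" for K X D y z :: real
    by (simp_all add: field_simps)
  show ?a
  proof (rule transfer)
    show "(\<lambda>d. (real d powr (-2/3) * (1 + 2 / (3 * real d)) powr (1/3)) * (162 * real d + 108) - (162 * real d powr (1/3) + 144 * real d powr (-2/3))) \<in> o(\<lambda>d. real d powr (-2/3))"
      by real_asymp
    show "d1c d * (162 * real d + 108) - (162 * 75 powr (1/3) / 5 * real d powr (1/3) + 144 * 75 powr (1/3) / 5 * real d powr (-2/3)) = 75 powr (1/3) / 5 * ((real d powr (-2/3) * (1 + 2 / (3 * real d)) powr (1/3)) * (162 * real d + 108) - (162 * real d powr (1/3) + 144 * real d powr (-2/3)))" if "d \<ge> 1" for d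
      unfolding d1c_eq[OF that] by (rule ring(1))
  qed
  show ?b
  proof (rule transfer)
    show "(\<lambda>d. (real d powr (-2/3) * (1 + 2 / (3 * real d)) powr (1/3)) * (18 * real d - 36) - (18 * real d powr (1/3) - 32 * real d powr (-2/3))) \<in> o(\<lambda>d. real d powr (-2/3))"
      by real_asymp
    show "d1c d * (18 * real d - 36) - (18 * 75 powr (1/3) / 5 * real d powr (1/3) - 32 * 75 powr (1/3) / 5 * real d powr (-2/3)) = 75 powr (1/3) / 5 * ((real d powr (-2/3) * (1 + 2 / (3 * real d)) powr (1/3)) * (18 * real d - 36) - (18 * real d powr (1/3) - 32 * real d powr (-2/3)))" if "d \<ge> 1" for d
      unfolding d1c_eq[OF that] by (rule ring(2))
  qed
  show ?c
  proof (rule transfer)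
    show "(\<lambda>d. - ((real d powr (-2/3) * (1 + 2 / (3 * real d)) powr (1/3)) * (72 * real d + 288) / 5) - (- (72 / 5) * real d powr (1/3) - 304 / 5 * real d powr (-2/3))) \<in> o(\<lambda>d. real d powr (-2/3))"
      by real_asymp
    show "- (d1c d * (72 * real d + 288) / 5) - (- (72 * 75 powr (1/3) / 25) * real d powr (1/3) - 304 * 75 powr (1/3) / 25 * real d powr (-2/3)) = 75 powr (1/3) / 5 * (- ((real d powr (-2/3) * (1 + 2 / (3 * real d)) powr (1/3)) * (72 * real d + 288) / 5) - (- (72 / 5) * real d powr (1/3) - 304 / 5 * real d powr (-2/3)))" if "d \<ge> 1" for d
      unfolding d1c_eq[OF that] by (rule ring(3))
  qed
qed

lemma D1_asymp_spectrum:
  shows "asymp_spectrum 1 (\<lambda>d. hessian d (loss d) (D1 d)) prod_comp_t (\<lambda>d. 1)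
      [\<lambda>d. 162 * 75 powr (1/3) / 5 * real d powr (1/3) + 144 * 75 powr (1/3) / 5 * real d powr (-2/3)]"
    and "asymp_spectrum 1 (\<lambda>d. hessian d (loss d) (D1 d)) prod_comp_st (\<lambda>d. d - 1) [\<lambda>d. 0]"
    and "asymp_spectrum 1 (\<lambda>d. hessian d (loss d) (D1 d)) prod_comp_ts (\<lambda>d. d - 1)
      [\<lambda>d. 18 * 75 powr (1/3) / 5 * real d powr (1/3) - 32 * 75 powr (1/3) / 5 * real d powr (-2/3)]"
    and "asymp_spectrum 1 (\<lambda>d. hessian d (loss d) (D1 d)) prod_comp_ss (\<lambda>d. (d - 1)\<^sup>2)
      [\<lambda>d. - (72 * 75 powr (1/3) / 25) * real d powr (1/3) - 304 * 75 powr (1/3) / 25 * real d powr (-2/3)]"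
proof -
  have single: "asymp_spectrum 1 H C m [a]"
    if "(\<lambda>d. l d - a d) \<in> o(\<lambda>d. real d powr (-2/3))" "\<And>d. d \<ge> 1 \<Longrightarrow> spectrum_on (H d) (C d) [(l d, m d)]"
    for H C m a l
    unfolding asymp_spectrum_def using that by (intro exI[of _ "[l]"]) simp
  show "asymp_spectrum 1 (\<lambda>d. hessian d (loss d) (D1 d)) prod_comp_t (\<lambda>d. 1)
      [\<lambda>d. 162 * 75 powr (1/3) / 5 * real d powr (1/3) + 144 * 75 powr (1/3) / 5 * real d powr (-2/3)]"
    by (rule single[OF d1c_asymptotics(1) spectrum_D1_t])
  show "asymp_spectrum 1 (\<lambda>d. hessian d (loss d) (D1 d)) prod_comp_st (\<lambda>d. d - 1) [\<lambda>d. 0]"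
    by (rule single[OF _ spectrum_D1_st]) simp_all
  show "asymp_spectrum 1 (\<lambda>d. hessian d (loss d) (D1 d)) prod_comp_ts (\<lambda>d. d - 1)
      [\<lambda>d. 18 * 75 powr (1/3) / 5 * real d powr (1/3) - 32 * 75 powr (1/3) / 5 * real d powr (-2/3)]"
    by (rule single[OF d1c_asymptotics(2) spectrum_D1_ts])
  show "asymp_spectrum 1 (\<lambda>d. hessian d (loss d) (D1 d)) prod_comp_ss (\<lambda>d. (d - 1)\<^sup>2)
      [\<lambda>d. - (72 * 75 powr (1/3) / 25) * real d powr (1/3) - 304 * 75 powr (1/3) / 25 * real d powr (-2/3)]"
    by (rule single[OF d1c_asymptotics(3) spectrum_D1_ss])
qed

section \<open>The matrices with a zero row\<close>

text \<open>Here \<open>n = d - 1\<close>, and \<open>p\<close> is the diagonal entry minus the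
  off-diagonal entry \<open>q\<close>, so that a nonzero row is \<open>p\<close> times a unit vector
  plus a vector common to all these rows. Their inner products are then a constant, with
  \<open>p^2\<close> added when the two rows coincide.\<close>

definition D2 :: "nat \<Rightarrow> real \<Rightarrow> real \<Rightarrow> real \<Rightarrow> rmat"
  where "D2 n p q r = Xi (Suc n) (p + q) q r 0 0"

lemma D2_apply:
  "b < n \<Longrightarrow> j < n \<Longrightarrow> D2 n p q r b j = (if j = b then p else 0) + q"
  "b < n \<Longrightarrow> D2 n p q r b n = r"
  "D2 n p q r n j = 0"
  "n < b \<or> n < j \<Longrightarrow> D2 n p q r b j = 0"
  by (auto simp: D2_def Xi_def)

lemma D2_last_row: "D2 n p q r n = 0"
  by (rule ext) (simp add: D2_apply)

lemma D2_in_Mat: "D2 n p q r \<in> Mat (Suc n) (Suc n)"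
  by (auto simp: Mat_def D2_def Xi_def)

lemma dot_D2:
  assumes "b < n"
  shows "dot (Suc n) (D2 n p q r b) v = p * v b + q * (\<Sum>l<n. v l) + r * v n"
    and "dot (Suc n) v (D2 n p q r b) = p * v b + q * (\<Sum>l<n. v l) + r * v n"
proof -
  have "(\<Sum>j<n. D2 n p q r b j * v j) = (\<Sum>j<n. (if j = b then p * v j else 0) + q * v j)"
    by (intro sum.cong refl) (use assms in \<open>auto simp: D2_apply algebra_simps\<close>)
  then show "dot (Suc n) (D2 n p q r b) v = p * v b + q * (\<Sum>l<n. v l) + r * v n"
    using assms by (simp add: dot_def D2_apply sum.distrib sum_distrib_left)
  then show "dot (Suc n) v (D2 n p q r b) = p * v b + q * (\<Sum>l<n. v l) + r * v n"
    by (simp add: dot_commute)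
qed

lemma sum_D2_row: "b < n \<Longrightarrow> (\<Sum>l<n. D2 n p q r b l) = p + real n * q"
  by (simp add: D2_apply sum.distrib)

lemma sum_D2_col:
  "j < n \<Longrightarrow> (\<Sum>b<n. f b * D2 n p q r b j) = p * f j + q * (\<Sum>b<n. f b)"
  "(\<Sum>b<n. f b * D2 n p q r b n) = r * (\<Sum>b<n. f b)"
proof -
  assume j: "j < n"
  have "(\<Sum>b<n. f b * D2 n p q r b j) = (\<Sum>b<n. (if b = j then p * f b else 0) + q * f b)"
    by (intro sum.cong refl) (use j in \<open>auto simp: D2_apply algebra_simps\<close>)
  then show "(\<Sum>b<n. f b * D2 n p q r b j) = p * f j + q * (\<Sum>b<n. f b)"
    using j by (simp add: sum.distrib sum_distrib_left)
next
  show "(\<Sum>b<n. f b * D2 n p q r b n) = r * (\<Sum>b<n. f b)"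
    unfolding sum_distrib_left by (intro sum.cong refl) (simp add: D2_apply)
qed

definition gram :: "nat \<Rightarrow> real \<Rightarrow> real \<Rightarrow> real \<Rightarrow> real"
  where "gram n p q r = 2 * p * q + real n * q\<^sup>2 + r\<^sup>2"

lemma dot_D2_D2:
  assumes "i < n" "b < n"
  shows "dot (Suc n) (D2 n p q r i) (D2 n p q r b) = (if b = i then p\<^sup>2 else 0) + gram n p q r"
  unfolding dot_D2(1)[OF assms(1)] sum_D2_row[OF assms(2)] D2_apply(1)[OF assms(2,1)] D2_apply(2)[OF assms(2)] gram_def
  by (cases "b = i") (simp_all add: power2_eq_square algebra_simps)

lemma sum_pick_add:
  "i < n \<Longrightarrow> (\<Sum>b<n. ((if b = i then x else 0) + y) * f b) = x * f i + y * (\<Sum>b<n. f b :: real)" for i n :: nat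
  by (simp add: distrib_right sum.distrib sum_distrib_left[symmetric] if_distrib[of "\<lambda>x. x * _"] cong: if_cong)

lemma sum_pick_add2:
  assumes "i < (n::nat)"
  shows "(\<Sum>b<n. ((if b = i then x else 0) + y)\<^sup>2 * f b) = (x\<^sup>2 + 2 * x * y) * f i + y\<^sup>2 * (\<Sum>b<n. f b :: real)"
proof -
  have "(\<Sum>b<n. ((if b = i then x else 0) + y)\<^sup>2 * f b) = (\<Sum>b<n. ((if b = i then x\<^sup>2 + 2 * x * y else 0) + y\<^sup>2) * f b)"
    by (intro sum.cong refl) (auto simp: power2_eq_square algebra_simps)
  then show ?thesis using assms by (simp add: sum_pick_add)
qed

text \<open>\<open>kern\<close> has degree three in each argument, so every second derivative
  involving the zero row still contains this row as a factor.\<close>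

lemma hessian_D2_last_row: "hessian (Suc n) (loss (Suc n)) (D2 n p q r) V n j = 0"
proof (cases "j < Suc n")
  case True
  then show ?thesis
    by (simp add: hessian_loss_entry D2_last_row kern11_def kern12_def)
next
  case False
  then show ?thesis by (simp add: hessian_outside)
qed

text \<open>Since inner products of rows are constant except at coinciding rows, each sum over rows
  splits into the term at \<open>b = i\<close> and a plain sum. The entry is thus assembled from a
  few sums that can be evaluated separately on each component.\<close>

lemma hessian_D2:
  fixes n :: nat and p q r :: real and V :: rmat
  defines "W \<equiv> D2 n p q r" and "d \<equiv> Suc n" and "B \<equiv> gram n p q r"
  defines "A \<equiv> p\<^sup>2 + B"
  assumes ij: "i < n" "j \<le> n"
  shows "hessian d (loss d) W V i j = 36 *
    ((6 * p\<^sup>2 * dot d (W i) (V i) + A * (\<Sum>b<n. dot d (W b) (V i)) + A * (\<Sum>b<n. dot d (W i) (V b))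
        + 2 * B * (\<Sum>b<n. dot d (W b) (V b)) - (\<Sum>l<d. V i l)) * W i j
     + 2 * B * (\<Sum>b<n. dot d (W b) (V i) * W b j) + 2 * B * (\<Sum>b<n. dot d (W i) (V b) * W b j)
     + A * dot d (W i) (V i) * (\<Sum>b<n. W b j) + A * (\<Sum>b<n. dot d (W b) (V b) * W b j)
     + (B\<^sup>2 + A\<^sup>2 / 2) * (\<Sum>b<n. V b j)
     + (A * (A + (real n - 1) * B) + A\<^sup>2 - B\<^sup>2 - (p + real n * q + r)) * V i j
     - 2 * W i j * V i j - dot d (W i) (V i))"
proof -
  have id: "i < d" "j < d" using ij by (auto simp: d_def)
  have Wn: "W n = 0" by (simp add: W_def D2_last_row)
  have WW: "dot d (W i) (W b) = (if b = i then p\<^sup>2 else 0) + B" "dot d (W b) (W i) = (if b = i then p\<^sup>2 else 0) + B"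
    if "b < n" for b
    using dot_D2_D2[OF ij(1) that] by (auto simp: W_def d_def B_def dot_commute)
  have Wb: "dot d (W b) (W b) = A" if "b < n" for b
    using dot_D2_D2[OF that that] by (simp add: W_def d_def B_def A_def)
  let ?k = "dot d (W i) (V i)"
  have "(\<Sum>b<d. kern11 d (W i) (W b) (V i) (unit_vec j)) = (\<Sum>b<n. kern11 d (W i) (W b) (V i) (unit_vec j))"
    by (simp add: d_def Wn kern11_def)
  also have "\<dots> = (\<Sum>b<n. ((if b = i then p\<^sup>2 else 0) + B) * (36 * (dot d (W b) (V i) * W b j))
      + 18 * A * ?k * W b j + 18 * A * W i j * dot d (W b) (V i) + ((if b = i then p\<^sup>2 else 0) + B) * (18 * A * V i j))"
    by (intro sum.cong refl)
      (use id in \<open>simp add: kern11_def WW Wb dot_unit_vec_right dot_commute[of d "V i"] algebra_simps\<close>)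
  also have "\<dots> = 36 * p\<^sup>2 * ?k * W i j + 36 * B * (\<Sum>b<n. dot d (W b) (V i) * W b j)
      + 18 * A * ?k * (\<Sum>b<n. W b j) + 18 * A * W i j * (\<Sum>b<n. dot d (W b) (V i))
      + 18 * A * (A + (real n - 1) * B) * V i j"
    unfolding sum.distrib sum_pick_add[OF ij(1)]
    by (simp only: sum_distrib_left[symmetric]) (simp add: A_def algebra_simps)
  finally have k11: "(\<Sum>b<d. kern11 d (W i) (W b) (V i) (unit_vec j)) = 36 * p\<^sup>2 * ?k * W i j
      + 36 * B * (\<Sum>b<n. dot d (W b) (V i) * W b j)
      + 18 * A * ?k * (\<Sum>b<n. W b j) + 18 * A * W i j * (\<Sum>b<n. dot d (W b) (V i))
      + 18 * A * (A + (real n - 1) * B) * V i j" .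
  have "(\<Sum>b<d. kern12 d (W b) (W i) (V b) (unit_vec j)) = (\<Sum>b<n. kern12 d (W b) (W i) (V b) (unit_vec j))"
    by (simp add: d_def Wn kern12_def)
  also have "\<dots> = (\<Sum>b<n. ((if b = i then p\<^sup>2 else 0) + B) * (36 * (dot d (W i) (V b) * W b j))
      + ((if b = i then p\<^sup>2 else 0) + B)\<^sup>2 * (18 * V b j)
      + ((if b = i then p\<^sup>2 else 0) + B) * (36 * W i j * dot d (W b) (V b))
      + 18 * A * (dot d (W b) (V b) * W b j) + 18 * A * W i j * dot d (W i) (V b) + 9 * A\<^sup>2 * V b j)"
    by (intro sum.cong refl)
      (use id ij in \<open>simp add: kern12_def WW Wb dot_unit_vec_right dot_commute[of d "V _"] power2_eq_square algebra_simps\<close>)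
  also have "\<dots> = 72 * p\<^sup>2 * ?k * W i j + 36 * B * (\<Sum>b<n. dot d (W i) (V b) * W b j)
      + 18 * (p ^ 4 + 2 * p\<^sup>2 * B) * V i j + (18 * B\<^sup>2 + 9 * A\<^sup>2) * (\<Sum>b<n. V b j)
      + 36 * B * W i j * (\<Sum>b<n. dot d (W b) (V b)) + 18 * A * (\<Sum>b<n. dot d (W b) (V b) * W b j)
      + 18 * A * W i j * (\<Sum>b<n. dot d (W i) (V b))"
    unfolding sum.distrib sum_pick_add[OF ij(1)] sum_pick_add2[OF ij(1)]
    by (simp only: sum_distrib_left[symmetric]) (simp add: power2_eq_square power4_eq_xxxx algebra_simps)
  finally have k12: "(\<Sum>b<d. kern12 d (W b) (W i) (V b) (unit_vec j)) = 72 * p\<^sup>2 * ?k * W i j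
      + 36 * B * (\<Sum>b<n. dot d (W i) (V b) * W b j)
      + 18 * (p ^ 4 + 2 * p\<^sup>2 * B) * V i j + (18 * B\<^sup>2 + 9 * A\<^sup>2) * (\<Sum>b<n. V b j)
      + 36 * B * W i j * (\<Sum>b<n. dot d (W b) (V b)) + 18 * A * (\<Sum>b<n. dot d (W b) (V b) * W b j)
      + 18 * A * W i j * (\<Sum>b<n. dot d (W i) (V b))" .
  have s: "(\<Sum>l<d. W i l) = p + real n * q + r"
    using sum_D2_row[OF ij(1), of p q r] D2_apply(2)[OF ij(1), of p q r] by (simp add: W_def d_def)
  \<comment> \<open>Written in \<open>A\<close> and \<open>B\<close>, the coefficient of
    \<open>V i j\<close> matches the first stationarity equation.\<close>
  have pB: "p ^ 4 + 2 * p\<^sup>2 * B = A\<^sup>2 - B\<^sup>2"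
    by (simp add: A_def power2_eq_square power4_eq_xxxx algebra_simps)
  show ?thesis
    unfolding hessian_loss_entry[OF id] k11 k12 sum_kern11_unit_vec[OF id(2)] s pB
    by (simp add: algebra_simps)
qed

text \<open>Only the first \<open>n\<close> rows impose conditions: at the zero row the gradient vanishes because the loss
  depends on that row to order three.\<close>

definition stationary :: "nat \<Rightarrow> real \<Rightarrow> real \<Rightarrow> real \<Rightarrow> bool"
  where "stationary n p q r \<longleftrightarrow> (let B = gram n p q r; A = p\<^sup>2 + B in
    2 * A\<^sup>2 - B\<^sup>2 + A * B * (real n - 1) = 2 * p + 2 * q + real n * q + r \<and>
    2 * (p + q) * q + (2 * B\<^sup>2 + A\<^sup>2) * (p + real n * q) = A \<and>
    2 * (p + 2 * q) * r + (2 * B\<^sup>2 + A\<^sup>2) * real n * r - 2 * r\<^sup>2 = A)"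

text \<open>Once \<open>p * V i i\<close> is expressed through the inner product of row
  \<open>i\<close> with \<open>V i\<close>, the derivative in row \<open>i\<close> is a combination
  of that inner product, the sum of the first \<open>n\<close> entries of \<open>V i\<close>, and
  \<open>V i n\<close>. The three equations of \<open>stationary\<close> say that the two sides have
  the same three coefficients.\<close>

lemma dloss_D2:
  assumes st: "stationary n p q r"
  shows "dloss (Suc n) (D2 n p q r) V = 0"
proof -
  define W where "W = D2 n p q r"
  define d where "d = Suc n"
  define B where "B = gram n p q r"
  define A where "A = p\<^sup>2 + B"
  have E1: "2 * A\<^sup>2 - B\<^sup>2 + A * B * (real n - 1) = 2 * p + 2 * q + real n * q + r"
    and E2: "2 * (p + q) * q + (2 * B\<^sup>2 + A\<^sup>2) * (p + real n * q) = A"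
    and E3: "2 * (p + 2 * q) * r + (2 * B\<^sup>2 + A\<^sup>2) * real n * r - 2 * r\<^sup>2 = A"
    using st by (simp_all add: stationary_def Let_def A_def B_def)
  have Wn: "W n = 0" by (simp add: W_def D2_last_row)
  have "(\<Sum>j<d. kern1 d (W i) (W j) (V i)) = (\<Sum>j<d. kern1 d (W i) (unit_vec j) (V i))" if i: "i < d" for i
  proof (cases "i = n")
    case True
    then show ?thesis by (simp add: Wn kern1_def)
  next
    case False
    then have i: "i < n" using i by (simp add: d_def)
    have WW: "dot d (W i) (W b) = (if b = i then p\<^sup>2 else 0) + B" if "b < n" for b
      using dot_D2_D2[OF i that] by (simp add: W_def d_def B_def)
    have Wb: "dot d (W b) (W b) = A" if "b < n" for b
      using dot_D2_D2[OF that that] by (simp add: W_def d_def B_def A_def)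
    let ?k = "dot d (W i) (V i)"
    let ?S = "\<Sum>l<n. V i l"
    have sW: "(\<Sum>b<n. dot d (W b) (V i)) = (p + real n * q) * ?S + real n * r * V i n"
      by (simp add: W_def d_def dot_D2 sum.distrib sum_distrib_left[symmetric] algebra_simps)
    have "(\<Sum>j<d. kern1 d (W i) (W j) (V i)) = (\<Sum>j<n. kern1 d (W i) (W j) (V i))"
      by (simp add: d_def Wn kern1_def)
    also have "\<dots> = (\<Sum>b<n. ((if b = i then p\<^sup>2 else 0) + B)\<^sup>2 * (18 * dot d (W b) (V i))
        + ((if b = i then p\<^sup>2 else 0) + B) * (18 * A * ?k) + 9 * A\<^sup>2 * dot d (W b) (V i))"
      by (intro sum.cong refl) (use i in \<open>simp add: kern1_def WW Wb power2_eq_square algebra_simps\<close>)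
    also have "\<dots> = 18 * (p ^ 4 + 2 * p\<^sup>2 * B) * ?k + (18 * B\<^sup>2 + 9 * A\<^sup>2) * (\<Sum>b<n. dot d (W b) (V i))
        + 18 * A * (p\<^sup>2 + real n * B) * ?k"
      unfolding sum.distrib sum_pick_add[OF i] sum_pick_add2[OF i]
      by (simp only: sum_distrib_left[symmetric]) (simp add: power2_eq_square power4_eq_xxxx algebra_simps)
    finally have L: "(\<Sum>j<d. kern1 d (W i) (W j) (V i)) = 18 * (p ^ 4 + 2 * p\<^sup>2 * B) * ?k
        + (18 * B\<^sup>2 + 9 * A\<^sup>2) * ((p + real n * q) * ?S + real n * r * V i n) + 18 * A * (p\<^sup>2 + real n * B) * ?k"
      unfolding sW .
    have sq: "(\<Sum>b<d. (18 * (W i b)\<^sup>2 + 9 * dot d (W i) (W i)) * V i b)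
      = 18 * ((p\<^sup>2 + 2 * p * q) * V i i + q\<^sup>2 * ?S + r\<^sup>2 * V i n) + 9 * A * (?S + V i n)"
    proof -
      have "(\<Sum>b<n. (18 * (W i b)\<^sup>2 + 9 * A) * V i b)
         = (\<Sum>b<n. ((if b = i then p else 0) + q)\<^sup>2 * (18 * V i b) + 9 * A * V i b)"
        by (intro sum.cong refl) (use i in \<open>simp add: W_def D2_apply algebra_simps\<close>)
      also have "\<dots> = 18 * ((p\<^sup>2 + 2 * p * q) * V i i + q\<^sup>2 * ?S) + 9 * A * ?S"
        unfolding sum.distrib sum_pick_add2[OF i] sum_distrib_left[symmetric] by (simp add: algebra_simps)
      finally show ?thesis
        using i Wb[OF i] by (simp add: d_def W_def D2_apply algebra_simps)
    qed
    have s: "(\<Sum>l<d. W i l) = p + real n * q + r"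
      using sum_D2_row[OF i, of p q r] D2_apply(2)[OF i, of p q r] by (simp add: W_def d_def)
    have k: "?k = p * V i i + q * ?S + r * V i n"
      using i by (simp add: W_def d_def dot_D2)
    have AB: "A = p\<^sup>2 + B" by (simp add: A_def)
    show ?thesis
      unfolding L kern1_unit_vec_sum sq s k using E1 E2 E3 AB by algebra
  qed
  then have "(\<Sum>i<d. \<Sum>j<d. kern1 d (W i) (W j) (V i)) = (\<Sum>i<d. \<Sum>j<d. kern1 d (W i) (unit_vec j) (V i))"
    by (rule sum.cong[OF refl]) simp
  then show ?thesis by (simp add: dloss_def W_def d_def)
qed

lemma critical_point_D2: "stationary n p q r \<Longrightarrow> critical_point (Suc n) (loss (Suc n)) (D2 n p q r)"
  by (simp add: critical_point_loss_iff D2_in_Mat dloss_D2)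

text \<open>\<open>kern\<close> is homogeneous of degree three in each argument, so stationarity
  along a row itself is Euler's relation: the kernel sum of the row against all rows equals the one
  against all unit vectors, both being \<open>?R\<close>. The loss is then the common total, minus
  twice this total, plus \<open>15 * d\<close>.\<close>

lemma loss_D2:
  assumes st: "stationary n p q r"
  shows "loss (Suc n) (D2 n p q r) = 15 * (real n + 1)
    - real n * (6 * ((p + q) ^ 3 + (real n - 1) * q ^ 3 + r ^ 3) + 9 * (p\<^sup>2 + gram n p q r) * (p + real n * q + r))"
proof -
  define W where "W = D2 n p q r"
  define d where "d = Suc n"
  define B where "B = gram n p q r"
  define A where "A = p\<^sup>2 + B"
  have E1: "2 * A\<^sup>2 - B\<^sup>2 + A * B * (real n - 1) = 2 * p + 2 * q + real n * q + r"
    and E2: "2 * (p + q) * q + (2 * B\<^sup>2 + A\<^sup>2) * (p + real n * q) = A"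
    and E3: "2 * (p + 2 * q) * r + (2 * B\<^sup>2 + A\<^sup>2) * real n * r - 2 * r\<^sup>2 = A"
    using st by (simp_all add: stationary_def Let_def A_def B_def)
  have Wn: "W n = 0" by (simp add: W_def D2_last_row)
  have WW: "dot d (W i) (W b) = (if b = i then p\<^sup>2 else 0) + B" if "i < n" "b < n" for i b
    using dot_D2_D2[OF that] by (simp add: W_def d_def B_def)
  have Wb: "dot d (W b) (W b) = A" if "b < n" for b
    using dot_D2_D2[OF that that] by (simp add: W_def d_def B_def A_def)
  let ?R = "6 * ((p + q) ^ 3 + (real n - 1) * q ^ 3 + r ^ 3) + 9 * A * (p + real n * q + r)"
  have a: "(\<Sum>j<d. kern d (W i) (W j)) = ?R" if i: "i < n" for i
  proof -
    have "(\<Sum>j<d. kern d (W i) (W j)) = (\<Sum>j<n. kern d (W i) (W j))"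
      by (simp add: d_def Wn kern_def)
    also have "\<dots> = (\<Sum>b<n. (if b = i then 15 * A ^ 3 - (6 * B ^ 3 + 9 * A\<^sup>2 * B) else 0) + (6 * B ^ 3 + 9 * A\<^sup>2 * B))"
      by (intro sum.cong refl) (use i in \<open>simp add: kern_def WW Wb, simp add: A_def power2_eq_square power3_eq_cube algebra_simps\<close>)
    also have "\<dots> = 15 * A ^ 3 + (real n - 1) * (6 * B ^ 3 + 9 * A\<^sup>2 * B)"
      using i by (simp add: sum.distrib algebra_simps)
    also have "\<dots> = ?R"
      using E1 E2 E3 A_def B_def[unfolded gram_def] by algebra
    finally show ?thesis .
  qed
  have b: "6 * (\<Sum>b<d. W i b ^ 3) + 9 * dot d (W i) (W i) * (\<Sum>b<d. W i b) = ?R" if i: "i < n" for i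
  proof -
    have "(\<Sum>b<n. W i b ^ 3) = (\<Sum>b<n. (if b = i then (p + q) ^ 3 - q ^ 3 else 0) + q ^ 3)"
      by (intro sum.cong refl) (use i in \<open>auto simp: W_def D2_apply\<close>)
    also have "\<dots> = (p + q) ^ 3 + (real n - 1) * q ^ 3"
      using i by (simp add: sum.distrib algebra_simps)
    finally show ?thesis
      using Wb[OF i] sum_D2_row[OF i, of p q r] D2_apply(2)[OF i, of p q r] by (simp add: d_def W_def)
  qed
  have "(\<Sum>i<d. \<Sum>j<d. kern d (W i) (W j)) = (\<Sum>i<n. ?R)"
    using a by (simp add: d_def Wn kern_def)
  moreover have "(\<Sum>i<d. 6 * (\<Sum>b<d. W i b ^ 3) + 9 * dot d (W i) (W i) * (\<Sum>b<d. W i b)) = (\<Sum>i<n. ?R)"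
    using b by (simp add: d_def Wn)
  ultimately have "loss d W = (\<Sum>i<n. ?R) - 2 * (\<Sum>i<n. ?R) + 15 * real d"
    unfolding loss_eq' by simp
  then show ?thesis by (simp add: W_def d_def A_def B_def algebra_simps)
qed

text \<open>The copy in the last row is omitted because it lies in the kernel of the Hessian, which
  leaves four coordinates for a fixed \<open>u\<close>. For the same reason \<open>emb_t\<close>
  omits the last row together with the corner.\<close>

definition emb_s :: "nat \<Rightarrow> rvec \<Rightarrow> real \<times> real \<times> real \<times> real \<Rightarrow> rmat"
  where "emb_s n u = (\<lambda>(\<alpha>, \<beta>, \<gamma>, \<delta>).
    \<alpha> *\<^sub>R diag_s n 0 u + \<beta> *\<^sub>R diag_s n 1 u + \<gamma> *\<^sub>R diag_s n 2 u + \<delta> *\<^sub>R diag_s n 3 u)"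

definition emb_t :: "nat \<Rightarrow> real \<times> real \<times> real \<Rightarrow> rmat"
  where "emb_t n = (\<lambda>(\<alpha>, \<beta>, \<delta>). diag_t n 0 \<alpha> + diag_t n 1 \<beta> + diag_t n 2 \<delta>)"

lemma emb_s_apply:
  "emb_s n u (\<alpha>, \<beta>, \<gamma>, \<delta>) i j = (if i < n \<and> j < n then (if i = j then \<alpha> * u i else 0) + \<beta> * u i + \<gamma> * u j
    else if i < n \<and> j = n then \<delta> * u i else 0)"
  unfolding emb_s_def prod.case plus_fun_apply scaleR_fun_apply diag_s_apply by auto

lemma emb_t_apply:
  "emb_t n (\<alpha>, \<beta>, \<delta>) i j = (if i < n \<and> j < n then (if i = j then \<alpha> else 0) + \<beta>
    else if i < n \<and> j = n then \<delta> else 0)"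
  unfolding emb_t_def prod.case plus_fun_apply diag_t_apply by auto

text \<open>The Hessian divided by \<open>36\<close> in the coordinates of \<open>emb_s\<close> and \<open>emb_t\<close>; \<open>N\<close> stands for \<open>n\<close>, \<open>A\<close> for
  the squared length of the nonzero rows and \<open>B\<close> for their mutual inner product.\<close>

definition hess_s :: "real \<Rightarrow> real \<Rightarrow> real \<Rightarrow> real \<Rightarrow> real \<Rightarrow> real \<Rightarrow>
    real \<times> real \<times> real \<times> real \<Rightarrow> real \<times> real \<times> real \<times> real"
  where "hess_s N p q r A B = (\<lambda>(\<alpha>, \<beta>, \<gamma>, \<delta>).
    let \<kappa> = p * (\<alpha> + \<beta> + \<gamma>) + q * (\<alpha> + N * \<beta>) + r * \<delta>;
        \<tau> = p * \<beta> + q * (\<alpha> + N * \<beta>) + r * \<delta>;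
        C = 6 * (A - B) * \<kappa> + 4 * B * p * \<alpha> + A * (N * \<tau> + p * \<alpha>) + A * (p * \<alpha> + N * p * \<gamma>) - (\<alpha> + N * \<beta> + \<delta>);
        D = 2 * B * \<tau> + A * \<kappa> + 2 * B * p * \<gamma>;
        E = 2 * B * p\<^sup>2 * \<gamma> + 2 * B * p * \<tau> + (B\<^sup>2 + A\<^sup>2 / 2) * (\<alpha> + N * \<gamma>) + A * \<kappa> * p
    in (p * \<alpha> + p * C - 2 * p * (\<alpha> + \<beta> + \<gamma>), p * \<beta> + q * C + (p + N * q) * D - \<kappa>,
      p * \<gamma> + E, (p + 2 * q - 2 * r) * \<delta> + r * C + N * r * D - \<kappa>))"

definition hess_t :: "real \<Rightarrow> real \<Rightarrow> real \<Rightarrow> real \<Rightarrow> real \<Rightarrow> real \<Rightarrow> real \<times> real \<times> real \<Rightarrow> real \<times> real \<times> real"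
  where "hess_t N p q r A B = (\<lambda>(\<alpha>, \<beta>, \<delta>).
    let \<kappa> = p * (\<alpha> + \<beta>) + q * (\<alpha> + N * \<beta>) + r * \<delta>;
        \<tau> = p * \<beta> + q * (\<alpha> + N * \<beta>) + r * \<delta>;
        C = 6 * (A - B) * \<kappa> + 4 * B * p * \<alpha> + 2 * A * (N * \<tau> + p * \<alpha>) + 2 * B * N * \<kappa> - (\<alpha> + N * \<beta> + \<delta>);
        D = 4 * B * \<tau> + 2 * A * \<kappa>;
        E = B\<^sup>2 + A\<^sup>2 / 2
    in (p * \<alpha> + p * C - 2 * p * (\<alpha> + \<beta>),
      p * \<beta> + q * C + (p + N * q) * D + E * (\<alpha> + N * \<beta>) - \<kappa>,
      (p + 2 * q - 2 * r) * \<delta> + r * C + N * r * D + E * N * \<delta> - \<kappa>))"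

text \<open>The first stationarity equation replaces the coefficient of \<open>V i j\<close>, which
  contains \<open>n\<close>, by \<open>p + 2 * q\<close>.\<close>

lemma hessian_D2_stationary:
  fixes n :: nat and p q r :: real and V :: rmat
  defines "W \<equiv> D2 n p q r" and "d \<equiv> Suc n" and "B \<equiv> gram n p q r"
  defines "A \<equiv> p\<^sup>2 + B"
  assumes st: "stationary n p q r" and ij: "i < n" "j \<le> n"
  shows "hessian d (loss d) W V i j = 36 *
    ((6 * (A - B) * dot d (W i) (V i) + A * (\<Sum>b<n. dot d (W b) (V i)) + A * (\<Sum>b<n. dot d (W i) (V b))
        + 2 * B * (\<Sum>b<n. dot d (W b) (V b)) - (\<Sum>l<d. V i l)) * W i j
     + 2 * B * (\<Sum>b<n. dot d (W b) (V i) * W b j) + 2 * B * (\<Sum>b<n. dot d (W i) (V b) * W b j)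
     + A * dot d (W i) (V i) * (\<Sum>b<n. W b j) + A * (\<Sum>b<n. dot d (W b) (V b) * W b j)
     + (B\<^sup>2 + A\<^sup>2 / 2) * (\<Sum>b<n. V b j)
     + (p + 2 * q) * V i j - 2 * W i j * V i j - dot d (W i) (V i))"
proof -
  have "A * (A + (real n - 1) * B) + A\<^sup>2 - B\<^sup>2 - (p + real n * q + r) = p + 2 * q"
    using st by (simp add: stationary_def Let_def A_def B_def power2_eq_square algebra_simps)
  moreover have "p\<^sup>2 = A - B" by (simp add: A_def)
  ultimately show ?thesis
    using hessian_D2[OF ij, of p q r V] unfolding W_def d_def B_def A_def by simp
qed

lemma sum_pick_mult: "i < n \<Longrightarrow> (\<Sum>b<n. (if b = i then f b else 0) * g b) = f i * (g i :: real)" for i n :: nat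
  by (simp add: if_distrib[of "\<lambda>x. x * _"] cong: if_cong)

lemma hessian_D2_s:
  assumes st: "stationary n p q r" and u: "u \<in> std_rep n"
  defines "B \<equiv> gram n p q r"
  shows "hessian (Suc n) (loss (Suc n)) (D2 n p q r) (emb_s n u x) = 36 *\<^sub>R emb_s n u (hess_s n p q r (p\<^sup>2 + B) B x)"
proof (intro ext)
  fix i j
  obtain \<alpha> \<beta> \<gamma> \<delta> where x: "x = (\<alpha>, \<beta>, \<gamma>, \<delta>)" by (cases x)
  define V where "V = emb_s n u x"
  define W where "W = D2 n p q r"
  define A where "A = p\<^sup>2 + B"
  have V: "V i j = (if i = j then \<alpha> * u i else 0) + \<beta> * u i + \<gamma> * u j" if "i < n" "j < n" for i j
    using that by (simp add: V_def x emb_s_apply)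
  have Vn: "V i n = \<delta> * u i" if "i < n" for i using that by (simp add: V_def x emb_s_apply)
  have u0: "(\<Sum>l<n. u l) = 0" using u by (simp add: std_rep_def)
  have row: "(\<Sum>l<n. V i l) = (\<alpha> + n * \<beta>) * u i" if "i < n" for i
  proof -
    have "(\<Sum>l<n. V i l) = (\<Sum>l<n. (if l = i then \<alpha> * u l else 0) + \<beta> * u i + \<gamma> * u l)"
      by (rule sum.cong) (use V that in auto)
    then show ?thesis using that u0 by (simp add: sum.distrib sum_distrib_left[symmetric] algebra_simps)
  qed
  have col: "(\<Sum>b<n. V b j) = (\<alpha> + n * \<gamma>) * u j" if "j < n" for j
  proof -
    have "(\<Sum>b<n. V b j) = (\<Sum>b<n. (if b = j then \<alpha> * u b else 0) + \<beta> * u b + \<gamma> * u j)"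
      by (rule sum.cong) (use V that in auto)
    then show ?thesis using that u0 by (simp add: sum.distrib sum_distrib_left[symmetric] algebra_simps)
  qed
  have coln: "(\<Sum>b<n. V b n) = 0" using u0 by (simp add: Vn sum_distrib_left[symmetric])
  define \<tau> where "\<tau> = p * \<beta> + q * (\<alpha> + n * \<beta>) + r * \<delta>"
  define \<kappa> where "\<kappa> = p * (\<alpha> + \<beta> + \<gamma>) + q * (\<alpha> + n * \<beta>) + r * \<delta>"
  have dot1: "dot (Suc n) (W b) (V i) = (if b = i then p * \<alpha> * u i else 0) + \<tau> * u i + p * \<gamma> * u b"
    if "b < n" "i < n" for b i
    using that unfolding W_def dot_D2(1)[OF that(1)] row[OF that(2)] Vn[OF that(2)] V[OF that(2,1)] \<tau>_def
    by (auto simp: algebra_simps)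
  have dot2: "dot (Suc n) (W i) (V i) = \<kappa> * u i" if "i < n" for i
    using dot1[OF that that] by (simp add: \<kappa>_def \<tau>_def algebra_simps)
  have hs: "hess_s n p q r (p\<^sup>2 + B) B x =
    (let C = 6 * ((p\<^sup>2 + B) - B) * \<kappa> + 4 * B * p * \<alpha> + (p\<^sup>2 + B) * (n * \<tau> + p * \<alpha>) + (p\<^sup>2 + B) * (p * \<alpha> + n * p * \<gamma>) - (\<alpha> + n * \<beta> + \<delta>);
        D = 2 * B * \<tau> + (p\<^sup>2 + B) * \<kappa> + 2 * B * p * \<gamma>;
        E = 2 * B * p\<^sup>2 * \<gamma> + 2 * B * p * \<tau> + (B\<^sup>2 + (p\<^sup>2 + B)\<^sup>2 / 2) * (\<alpha> + n * \<gamma>) + (p\<^sup>2 + B) * \<kappa> * p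
    in (p * \<alpha> + p * C - 2 * p * (\<alpha> + \<beta> + \<gamma>), p * \<beta> + q * C + (p + n * q) * D - \<kappa>,
      p * \<gamma> + E, (p + 2 * q - 2 * r) * \<delta> + r * C + n * r * D - \<kappa>))"
    by (simp only: hess_s_def x Let_def prod.case \<tau>_def \<kappa>_def)
  show "hessian (Suc n) (loss (Suc n)) (D2 n p q r) (emb_s n u x) i j
    = (36 *\<^sub>R emb_s n u (hess_s n p q r (p\<^sup>2 + B) B x)) i j"
  proof (cases "i < n \<and> j \<le> n")
    case False
    then have "i = n \<or> \<not> (i < Suc n \<and> j < Suc n)" by auto
    then have "hessian (Suc n) (loss (Suc n)) (D2 n p q r) (emb_s n u x) i j = 0"
      using hessian_D2_last_row hessian_outside by blast
    moreover have "emb_s n u y i j = 0" for y using False by (cases y) (auto simp: emb_s_apply)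
    ultimately show ?thesis by simp
  next
    case True
    then have i: "i < n" and j: "j \<le> n" by auto
    have s1: "(\<Sum>b<n. dot (Suc n) (W b) (V i)) = (p * \<alpha> + n * \<tau>) * u i"
    proof -
      have "(\<Sum>b<n. dot (Suc n) (W b) (V i)) = (\<Sum>b<n. (if b = i then p * \<alpha> * u i else 0) + \<tau> * u i + p * \<gamma> * u b)"
        by (rule sum.cong) (use i dot1 in auto)
      then show ?thesis using i u0 by (simp add: sum.distrib sum_distrib_left[symmetric] algebra_simps)
    qed
    have s2: "(\<Sum>b<n. dot (Suc n) (W i) (V b)) = (p * \<alpha> + n * (p * \<gamma>)) * u i"
    proof -
      have "(\<Sum>b<n. dot (Suc n) (W i) (V b)) = (\<Sum>b<n. (if b = i then p * \<alpha> * u i else 0) + \<tau> * u b + p * \<gamma> * u i)"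
        by (rule sum.cong) (use i dot1 in auto)
      then show ?thesis using i u0 by (simp add: sum.distrib sum_distrib_left[symmetric] algebra_simps)
    qed
    have s3: "(\<Sum>b<n. dot (Suc n) (W b) (V b)) = 0"
      using u0 by (simp add: dot2 sum_distrib_left[symmetric])
    have s4: "(\<Sum>l<Suc n. V i l) = (\<alpha> + n * \<beta> + \<delta>) * u i"
      using i by (simp add: row Vn algebra_simps)
    have t1: "(\<Sum>b<n. dot (Suc n) (W b) (V i) * f b) = p * \<alpha> * u i * f i + \<tau> * u i * (\<Sum>b<n. f b) + p * \<gamma> * (\<Sum>b<n. u b * f b)" for f
    proof -
      have "(\<Sum>b<n. dot (Suc n) (W b) (V i) * f b) = (\<Sum>b<n. (if b = i then p * \<alpha> * u i else 0) * f b + \<tau> * u i * f b + p * \<gamma> * (u b * f b))"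
        by (rule sum.cong) (use i dot1 in \<open>auto simp: algebra_simps\<close>)
      then show ?thesis using i by (simp only: sum.distrib sum_pick_mult[OF i] sum_distrib_left[symmetric])
    qed
    have t2: "(\<Sum>b<n. dot (Suc n) (W i) (V b) * f b) = p * \<alpha> * u i * f i + \<tau> * (\<Sum>b<n. u b * f b) + p * \<gamma> * u i * (\<Sum>b<n. f b)" for f
    proof -
      have "(\<Sum>b<n. dot (Suc n) (W i) (V b) * f b) = (\<Sum>b<n. (if b = i then p * \<alpha> * u i else 0) * f b + \<tau> * (u b * f b) + p * \<gamma> * u i * f b)"
        by (rule sum.cong) (use i dot1 in \<open>auto simp: algebra_simps\<close>)
      then show ?thesis using i by (simp only: sum.distrib sum_pick_mult[OF i] sum_distrib_left[symmetric])
    qed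
    have t3: "(\<Sum>b<n. dot (Suc n) (W b) (V b) * f b) = \<kappa> * (\<Sum>b<n. u b * f b)" for f
      unfolding sum_distrib_left by (rule sum.cong) (simp_all add: dot2)
    note H = hessian_D2_stationary[OF st i j, of V, folded B_def W_def, unfolded dot2[OF i] s1 s2 s3 s4 t1 t2 t3]
    have one: "(\<Sum>b<n. W b j) = (\<Sum>b<n. 1 * W b j)" by simp
    show ?thesis
    proof (cases "j = n")
      case True
      have w: "(\<Sum>b<n. u b * W b j) = 0" "(\<Sum>b<n. W b j) = n * r" "W i j = r" "V i j = \<delta> * u i" "(\<Sum>b<n. V b j) = 0"
        unfolding one unfolding True W_def sum_D2_col(2)
        using u0 i coln by (simp_all add: Vn D2_apply)
      show ?thesis
        unfolding V_def[symmetric] W_def[symmetric] H w hs A_def using i True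
        by (simp add: emb_s_apply Let_def power2_eq_square algebra_simps)
    next
      case False
      then have j: "j < n" using j by simp
      have w: "(\<Sum>b<n. u b * W b j) = p * u j" "(\<Sum>b<n. W b j) = p + n * q" "(\<Sum>b<n. V b j) = (\<alpha> + n * \<gamma>) * u j"
        unfolding one unfolding W_def sum_D2_col(1)[OF j]
        using u0 j col by simp_all
      have w2: "W i j = (if i = j then p else 0) + q" using i j by (auto simp: W_def D2_apply)
      show ?thesis
        unfolding V_def[symmetric] W_def[symmetric] H w w2 V[OF i j] hs A_def using i j
        by (cases "i = j") (simp_all add: emb_s_apply Let_def power2_eq_square algebra_simps)
    qed
  qed
qed

lemma hessian_D2_t:
  assumes st: "stationary n p q r"
  defines "B \<equiv> gram n p q r"
  shows "hessian (Suc n) (loss (Suc n)) (D2 n p q r) (emb_t n x) = 36 *\<^sub>R emb_t n (hess_t n p q r (p\<^sup>2 + B) B x)"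
proof (intro ext)
  fix i j
  obtain \<alpha> \<beta> \<delta> where x: "x = (\<alpha>, \<beta>, \<delta>)" by (cases x)
  define V where "V = emb_t n x"
  define W where "W = D2 n p q r"
  define A where "A = p\<^sup>2 + B"
  have V: "V i j = (if j = i then \<alpha> else 0) + \<beta>" if "i < n" "j < n" for i j
    using that by (simp add: V_def x emb_t_apply)
  have Vn: "V i n = \<delta>" if "i < n" for i using that by (simp add: V_def x emb_t_apply)
  have row: "(\<Sum>l<n. V i l) = \<alpha> + n * \<beta>" if "i < n" for i
  proof -
    have "(\<Sum>l<n. V i l) = (\<Sum>l<n. (if l = i then \<alpha> else 0) + \<beta>)"
      by (rule sum.cong) (use V that in auto)
    then show ?thesis using that by (simp add: sum.distrib)
  qed
  have col: "(\<Sum>b<n. V b j) = \<alpha> + n * \<beta>" if "j < n" for j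
  proof -
    have "(\<Sum>b<n. V b j) = (\<Sum>b<n. (if b = j then \<alpha> else 0) + \<beta>)"
      by (rule sum.cong) (use V that in auto)
    then show ?thesis using that by (simp add: sum.distrib)
  qed
  have coln: "(\<Sum>b<n. V b n) = n * \<delta>" by (simp add: Vn)
  define \<tau> where "\<tau> = p * \<beta> + q * (\<alpha> + n * \<beta>) + r * \<delta>"
  define \<kappa> where "\<kappa> = p * (\<alpha> + \<beta>) + q * (\<alpha> + n * \<beta>) + r * \<delta>"
  have dot1: "dot (Suc n) (W b) (V i) = (if b = i then p * \<alpha> else 0) + \<tau>"
    if "b < n" "i < n" for b i
    using that unfolding W_def dot_D2(1)[OF that(1)] row[OF that(2)] Vn[OF that(2)] V[OF that(2,1)] \<tau>_def
    by (auto simp: algebra_simps)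
  have dot2: "dot (Suc n) (W i) (V i) = \<kappa>" if "i < n" for i
    using dot1[OF that that] by (simp add: \<kappa>_def \<tau>_def algebra_simps)
  have hs: "hess_t n p q r (p\<^sup>2 + B) B x =
    (let C = 6 * ((p\<^sup>2 + B) - B) * \<kappa> + 4 * B * p * \<alpha> + 2 * (p\<^sup>2 + B) * (n * \<tau> + p * \<alpha>) + 2 * B * n * \<kappa> - (\<alpha> + n * \<beta> + \<delta>);
        D = 4 * B * \<tau> + 2 * (p\<^sup>2 + B) * \<kappa>;
        E = B\<^sup>2 + (p\<^sup>2 + B)\<^sup>2 / 2
    in (p * \<alpha> + p * C - 2 * p * (\<alpha> + \<beta>),
      p * \<beta> + q * C + (p + n * q) * D + E * (\<alpha> + n * \<beta>) - \<kappa>,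
      (p + 2 * q - 2 * r) * \<delta> + r * C + n * r * D + E * n * \<delta> - \<kappa>))"
    by (simp only: hess_t_def x Let_def prod.case \<tau>_def \<kappa>_def)
  show "hessian (Suc n) (loss (Suc n)) (D2 n p q r) (emb_t n x) i j
    = (36 *\<^sub>R emb_t n (hess_t n p q r (p\<^sup>2 + B) B x)) i j"
  proof (cases "i < n \<and> j \<le> n")
    case False
    then have "i = n \<or> \<not> (i < Suc n \<and> j < Suc n)" by auto
    then have "hessian (Suc n) (loss (Suc n)) (D2 n p q r) (emb_t n x) i j = 0"
      using hessian_D2_last_row hessian_outside by blast
    moreover have "emb_t n y i j = 0" for y using False by (cases y) (auto simp: emb_t_apply)
    ultimately show ?thesis by simp
  next
    case True
    then have i: "i < n" and j: "j \<le> n" by auto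
    have s1: "(\<Sum>b<n. dot (Suc n) (W b) (V i)) = p * \<alpha> + n * \<tau>"
    proof -
      have "(\<Sum>b<n. dot (Suc n) (W b) (V i)) = (\<Sum>b<n. (if b = i then p * \<alpha> else 0) + \<tau>)"
        by (rule sum.cong) (use i dot1 in auto)
      then show ?thesis using i by (simp add: sum.distrib)
    qed
    have s2: "(\<Sum>b<n. dot (Suc n) (W i) (V b)) = p * \<alpha> + n * \<tau>"
    proof -
      have "(\<Sum>b<n. dot (Suc n) (W i) (V b)) = (\<Sum>b<n. (if b = i then p * \<alpha> else 0) + \<tau>)"
        by (rule sum.cong) (use i dot1 in auto)
      then show ?thesis using i by (simp add: sum.distrib)
    qed
    have s3: "(\<Sum>b<n. dot (Suc n) (W b) (V b)) = n * \<kappa>" by (simp add: dot2)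
    have s4: "(\<Sum>l<Suc n. V i l) = \<alpha> + n * \<beta> + \<delta>" using i by (simp add: row Vn)
    have t1: "(\<Sum>b<n. dot (Suc n) (W b) (V i) * f b) = p * \<alpha> * f i + \<tau> * (\<Sum>b<n. f b)" for f
    proof -
      have "(\<Sum>b<n. dot (Suc n) (W b) (V i) * f b) = (\<Sum>b<n. ((if b = i then p * \<alpha> else 0) + \<tau>) * f b)"
        by (rule sum.cong) (use i dot1 in auto)
      then show ?thesis by (simp only: sum_pick_add[OF i])
    qed
    have t2: "(\<Sum>b<n. dot (Suc n) (W i) (V b) * f b) = p * \<alpha> * f i + \<tau> * (\<Sum>b<n. f b)" for f
    proof -
      have "(\<Sum>b<n. dot (Suc n) (W i) (V b) * f b) = (\<Sum>b<n. ((if b = i then p * \<alpha> else 0) + \<tau>) * f b)"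
        by (rule sum.cong) (use i dot1 in auto)
      then show ?thesis by (simp only: sum_pick_add[OF i])
    qed
    have t3: "(\<Sum>b<n. dot (Suc n) (W b) (V b) * f b) = \<kappa> * (\<Sum>b<n. f b)" for f
      unfolding sum_distrib_left by (rule sum.cong) (simp_all add: dot2)
    note H = hessian_D2_stationary[OF st i j, of V, folded B_def W_def, unfolded dot2[OF i] s1 s2 s3 s4 t1 t2 t3]
    have one: "(\<Sum>b<n. W b j) = (\<Sum>b<n. 1 * W b j)" by simp
    show ?thesis
    proof (cases "j = n")
      case True
      have w: "(\<Sum>b<n. W b j) = n * r" "W i j = r" "V i j = \<delta>" "(\<Sum>b<n. V b j) = n * \<delta>"
        unfolding one unfolding True W_def sum_D2_col(2)
        using i coln by (simp_all add: Vn D2_apply)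
      show ?thesis
        unfolding V_def[symmetric] W_def[symmetric] H w hs A_def using i True
        by (simp add: emb_t_apply Let_def power2_eq_square algebra_simps)
    next
      case False
      then have j: "j < n" using j by simp
      have w: "(\<Sum>b<n. W b j) = p + n * q" "(\<Sum>b<n. V b j) = \<alpha> + n * \<beta>"
        unfolding one unfolding W_def sum_D2_col(1)[OF j]
        using j col by simp_all
      have w2: "W i j = (if i = j then p else 0) + q" using i j by (auto simp: W_def D2_apply)
      show ?thesis
        unfolding V_def[symmetric] W_def[symmetric] H w w2 V[OF i j] hs A_def using i j
        by (cases "i = j") (simp_all add: emb_t_apply Let_def power2_eq_square field_simps)
    qed
  qed
qed

text \<open>With vanishing diagonal and sums, besides \<open>p * V i j\<close> only two terms with
  \<open>B\<close> remain, one proportional to \<open>V i j\<close> and one to \<open>V j i\<close>;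
  they add up for symmetric and cancel for antisymmetric \<open>V\<close>.\<close>

lemma hessian_D2_zero_sums:
  assumes st: "stationary n p q r" and V: "zero_sums n V" "\<And>i. V i i = 0" "\<And>i j. V j i = s * V i j"
  defines "B \<equiv> gram n p q r"
  shows "hessian (Suc n) (loss (Suc n)) (D2 n p q r) V = (36 * (p + 2 * B * p\<^sup>2 * (1 + s))) *\<^sub>R V"
proof (intro ext)
  fix i j
  define W where "W = D2 n p q r"
  have out: "V i j = 0" if "\<not> (i < n \<and> j < n)" for i j
    using V(1) that by (auto simp: zero_sums_def Mat_def)
  have row: "(\<Sum>l<n. V i l) = 0" and col: "(\<Sum>b<n. V b j) = 0" for i j
    using V(1) out[of i] out[of _ j] by (cases "i < n"; cases "j < n"; simp add: zero_sums_def)+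
  have dot: "dot (Suc n) (W b) (V i) = p * V i b" if "b < n" for b i
    using that unfolding W_def dot_D2(1)[OF that] by (simp add: row out)
  show "hessian (Suc n) (loss (Suc n)) (D2 n p q r) V i j = ((36 * (p + 2 * B * p\<^sup>2 * (1 + s))) *\<^sub>R V) i j"
  proof (cases "i < n \<and> j \<le> n")
    case False
    then have "i = n \<or> \<not> (i < Suc n \<and> j < Suc n)" by auto
    then have "hessian (Suc n) (loss (Suc n)) (D2 n p q r) V i j = 0"
      using hessian_D2_last_row hessian_outside by blast
    moreover have "V i j = 0" using False by (intro out) auto
    ultimately show ?thesis by simp
  next
    case True
    then have i: "i < n" and j: "j \<le> n" by auto
    have s: "(\<Sum>b<n. dot (Suc n) (W b) (V i)) = 0" "(\<Sum>b<n. dot (Suc n) (W i) (V b)) = 0"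
      "(\<Sum>b<n. dot (Suc n) (W b) (V b)) = 0" "(\<Sum>l<Suc n. V i l) = 0" "dot (Suc n) (W i) (V i) = 0"
      "(\<Sum>b<n. dot (Suc n) (W b) (V b) * W b j) = 0"
      using i by (simp_all add: dot V(2) row col out sum_distrib_left[symmetric])
    have t: "(\<Sum>b<n. dot (Suc n) (W b) (V i) * W b j) = p * (\<Sum>b<n. V i b * W b j)"
      "(\<Sum>b<n. dot (Suc n) (W i) (V b) * W b j) = p * (\<Sum>b<n. V b i * W b j)"
      unfolding sum_distrib_left using i by (auto intro!: sum.cong simp: dot)
    note H = hessian_D2_stationary[OF st i j, of V, folded B_def W_def, unfolded s t col]
    show ?thesis
    proof (cases "j = n")
      case True
      then show ?thesis
        unfolding W_def[symmetric] H by (simp add: W_def sum_D2_col(2) row col out)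
    next
      case False
      then have j: "j < n" using j by simp
      have w: "(\<Sum>b<n. V i b * W b j) = p * V i j" "(\<Sum>b<n. V b i * W b j) = p * V j i"
        by (simp_all add: W_def sum_D2_col(1)[OF j] row col)
      show ?thesis
      proof (cases "i = j")
        case True
        then show ?thesis unfolding W_def[symmetric] H w using V(2) by simp
      next
        case False
        then have "W i j = q" using i j by (simp add: W_def D2_apply)
        then show ?thesis
          unfolding W_def[symmetric] H w V(3)[of j i] by (simp add: power2_eq_square algebra_simps)
      qed
    qed
  qed
qed

text \<open>The zero row carries no second-order term of the loss, so directions supported in it are
  annihilated.\<close>

lemma hessian_D2_kernel:
  "hessian (Suc n) (loss (Suc n)) (D2 n p q r) (diag_s n 4 u) = 0"
  "hessian (Suc n) (loss (Suc n)) (D2 n p q r) (diag_t n 3 c) = 0"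
  "hessian (Suc n) (loss (Suc n)) (D2 n p q r) (diag_t n 4 c) = 0"
proof -
  have *: "hessian (Suc n) (loss (Suc n)) (D2 n p q r) V = 0" if V: "\<And>i j. i \<noteq> n \<Longrightarrow> V i j = 0" for V
  proof (intro ext)
    fix i j
    have dot0: "dot (Suc n) w (V b) = 0" if "b < n" for w b
      using V[of b] that by (simp add: dot_def)
    show "hessian (Suc n) (loss (Suc n)) (D2 n p q r) V i j = (0 :: rmat) i j"
    proof (cases "i < n \<and> j \<le> n")
      case False
      then have "i = n \<or> \<not> (i < Suc n \<and> j < Suc n)" by auto
      then have "hessian (Suc n) (loss (Suc n)) (D2 n p q r) V i j = 0"
        using hessian_D2_last_row hessian_outside by blast
      then show ?thesis by simp
    next
      case True
      then have i: "i < n" and j: "j \<le> n" by auto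
      show ?thesis unfolding hessian_D2[OF i j] using i V by (simp add: dot0)
    qed
  qed
  show "hessian (Suc n) (loss (Suc n)) (D2 n p q r) (diag_s n 4 u) = 0"
    by (rule *) (simp add: diag_s_apply)
  show "hessian (Suc n) (loss (Suc n)) (D2 n p q r) (diag_t n 3 c) = 0"
    by (rule *) (simp add: diag_t_apply)
  show "hessian (Suc n) (loss (Suc n)) (D2 n p q r) (diag_t n 4 c) = 0"
    by (rule *) (simp add: diag_t_apply)
qed

section \<open>Reduction to spaces of dimension three and four\<close>

text \<open>The Frobenius inner product in the coordinates of \<open>emb_s\<close> and \<open>emb_t\<close>, up to a positive factor.\<close>

definition form_s :: "real \<Rightarrow> real \<times> real \<times> real \<times> real \<Rightarrow> real \<times> real \<times> real \<times> real \<Rightarrow> real"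
  where "form_s N = (\<lambda>(\<alpha>, \<beta>, \<gamma>, \<delta>) (\<alpha>', \<beta>', \<gamma>', \<delta>').
    \<alpha> * \<alpha>' + \<alpha> * (\<beta>' + \<gamma>') + (\<beta> + \<gamma>) * \<alpha>' + N * \<beta> * \<beta>' + N * \<gamma> * \<gamma>' + \<delta> * \<delta>')"

definition form_t :: "real \<Rightarrow> real \<times> real \<times> real \<Rightarrow> real \<times> real \<times> real \<Rightarrow> real"
  where "form_t N = (\<lambda>(\<alpha>, \<beta>, \<delta>) (\<alpha>', \<beta>', \<delta>').
    \<alpha> * \<alpha>' + \<alpha> * \<beta>' + \<beta> * \<alpha>' + N * \<beta> * \<beta>' + \<delta> * \<delta>')"

text \<open>The squares exhibit positivity for \<open>N > 2\<close>; lower bounds for approximate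
  eigenvectors come from dropping some of them.\<close>

lemma form_s_square:
  "form_s N (\<alpha>, \<beta>, \<gamma>, \<delta>) (\<alpha>, \<beta>, \<gamma>, \<delta>) = (\<alpha> + \<beta> + \<gamma>)\<^sup>2 + (N - 2) * (\<beta>\<^sup>2 + \<gamma>\<^sup>2) + (\<beta> - \<gamma>)\<^sup>2 + \<delta>\<^sup>2"
  by (simp add: form_s_def power2_eq_square algebra_simps)

lemma form_t_square:
  "form_t N (\<alpha>, \<beta>, \<delta>) (\<alpha>, \<beta>, \<delta>) = (\<alpha> + \<beta>)\<^sup>2 + (N - 1) * \<beta>\<^sup>2 + \<delta>\<^sup>2"
  by (simp add: form_t_def power2_eq_square algebra_simps)

lemma inner_form_s:
  assumes N: "N > 2"
  shows "inner_form (form_s N)"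
proof
  show "bilinear (form_s N)"
    by (auto simp: bilinear_def form_s_def split_beta algebra_simps intro!: linearI)
  show "form_s N x y = form_s N y x" for x y
    by (cases x; cases y) (simp add: form_s_def algebra_simps)
  show "form_s N x x > 0" if "x \<noteq> 0" for x
  proof -
    obtain \<alpha> \<beta> \<gamma> \<delta> where x: "x = (\<alpha>, \<beta>, \<gamma>, \<delta>)" by (cases x)
    have nn: "(N - 2) * (\<beta>\<^sup>2 + \<gamma>\<^sup>2) \<ge> 0" using N by simp
    show ?thesis
    proof (cases "\<beta> = 0 \<and> \<gamma> = 0")
      case True
      then have "\<alpha> \<noteq> 0 \<or> \<delta> \<noteq> 0" using that x by (auto simp: zero_prod_def)
      then show ?thesis unfolding x form_s_square using True by (simp add: sum_power2_gt_zero_iff)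
    next
      case False
      then have "(N - 2) * (\<beta>\<^sup>2 + \<gamma>\<^sup>2) > 0" using N by (simp add: sum_power2_gt_zero_iff)
      moreover have "(\<alpha> + \<beta> + \<gamma>)\<^sup>2 \<ge> 0" "(\<beta> - \<gamma>)\<^sup>2 \<ge> 0" "\<delta>\<^sup>2 \<ge> 0" by simp_all
      ultimately show ?thesis unfolding x form_s_square by linarith
    qed
  qed
qed

lemma inner_form_t:
  assumes N: "N > 1"
  shows "inner_form (form_t N)"
proof
  show "bilinear (form_t N)"
    by (auto simp: bilinear_def form_t_def split_beta algebra_simps intro!: linearI)
  show "form_t N x y = form_t N y x" for x y
    by (cases x; cases y) (simp add: form_t_def algebra_simps)
  show "form_t N x x > 0" if "x \<noteq> 0" for x
  proof -
    obtain \<alpha> \<beta> \<delta> where x: "x = (\<alpha>, \<beta>, \<delta>)" by (cases x)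
    show ?thesis
    proof (cases "\<beta> = 0")
      case True
      then have "\<alpha> \<noteq> 0 \<or> \<delta> \<noteq> 0" using that x by (auto simp: zero_prod_def)
      then show ?thesis unfolding x form_t_square using True by (simp add: sum_power2_gt_zero_iff)
    next
      case False
      then have "(N - 1) * \<beta>\<^sup>2 > 0" using N by simp
      moreover have "(\<alpha> + \<beta>)\<^sup>2 \<ge> 0" "\<delta>\<^sup>2 \<ge> 0" by simp_all
      ultimately show ?thesis unfolding x form_t_square by linarith
    qed
  qed
qed

lemma linear_hess_s: "linear (hess_s N p q r A B)"
  by (rule linearI) (simp_all add: hess_s_def Let_def split_beta field_simps)

lemma linear_hess_t: "linear (hess_t N p q r A B)"
  by (rule linearI) (simp_all add: hess_t_def Let_def split_beta field_simps)

lemma hess_s_adjoint: "form_s N (hess_s N p q r A B x) y = form_s N x (hess_s N p q r A B y)"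
proof -
  define Z where "Z = B\<^sup>2 + A\<^sup>2 / 2"
  show ?thesis
    unfolding hess_s_def Z_def[symmetric]
    by (cases x; cases y) (simp add: form_s_def Let_def power2_eq_square algebra_simps)
qed

lemma hess_t_adjoint: "form_t N (hess_t N p q r A B x) y = form_t N x (hess_t N p q r A B y)"
proof -
  define Z where "Z = B\<^sup>2 + A\<^sup>2 / 2"
  show ?thesis
    unfolding hess_t_def Z_def[symmetric]
    by (cases x; cases y) (simp add: form_t_def Let_def power2_eq_square algebra_simps)
qed

lemma self_adjoint_hess_s: "N > 2 \<Longrightarrow> inner_form.self_adjoint (form_s N) (hess_s N p q r A B)"
  by (simp add: inner_form.self_adjoint_def inner_form_s linear_hess_s hess_s_adjoint)

lemma self_adjoint_hess_t: "N > 1 \<Longrightarrow> inner_form.self_adjoint (form_t N) (hess_t N p q r A B)"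
  by (simp add: inner_form.self_adjoint_def inner_form_t linear_hess_t hess_t_adjoint)

fun coord_s :: "real \<times> real \<times> real \<times> real \<Rightarrow> nat \<Rightarrow> real"
  where "coord_s (\<alpha>, \<beta>, \<gamma>, \<delta>) j = (if j = 0 then \<alpha> else if j = 1 then \<beta> else if j = 2 then \<gamma> else if j = 3 then \<delta> else 0)"

fun coord_t :: "real \<times> real \<times> real \<Rightarrow> nat \<Rightarrow> real"
  where "coord_t (\<alpha>, \<beta>, \<delta>) j = (if j = 0 then \<alpha> else if j = 1 then \<beta> else if j = 2 then \<delta> else 0)"

lemma linear_coord_s: "linear (\<lambda>x. coord_s x j)"
  by (rule linearI) (auto simp: split: prod.splits)

lemma linear_coord_t: "linear (\<lambda>x. coord_t x j)"
  by (rule linearI) (auto simp: split: prod.splits)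

lemma coord_s_eq_0:
  assumes "\<And>j. j < 4 \<Longrightarrow> coord_s x j = 0"
  shows "x = 0"
  using assms[of 0] assms[of 1] assms[of 2] assms[of 3] by (cases x) (simp add: zero_prod_def)

lemma spectrum_D2_s:
  assumes st: "stationary n p q r" and n: "n \<ge> 3"
    and e: "inner_form.orthonormal (form_s n) 4 e"
    and l: "\<And>i. i < 4 \<Longrightarrow> hess_s n p q r (p\<^sup>2 + gram n p q r) (gram n p q r) (e i) = l i *\<^sub>R e i"
  shows "spectrum_on (hessian (Suc n) (loss (Suc n)) (D2 n p q r)) (diag_comp_s (Suc n) n)
    [(0, n - 1), (36 * l 0, n - 1), (36 * l 1, n - 1), (36 * l 2, n - 1), (36 * l 3, n - 1)]"
proof -
  let ?H = "hessian (Suc n) (loss (Suc n)) (D2 n p q r)"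
  \<comment> \<open>Index 0 is the copy in the zero row, with eigenvalue 0; the eigenvectors of the
    four-dimensional problem follow, shifted by one.\<close>
  let ?v = "\<lambda>k. if k = 0 then (\<lambda>j. if j = 4 then 1 else 0) else coord_s (e (k - 1))"
  let ?l = "\<lambda>k. if k = 0 then 0 else 36 * l (k - 1)"
  have "spectrum_on ?H (diag_comp_s (Suc n) n) (map (\<lambda>k. (?l k, n - 1)) [0..<5])"
  proof (rule spectrum_on_copies[where \<Phi> = "diag_s n" and v = ?v and U = "std_rep n"])
    show "linear ?H" by (rule linear_hessian_loss)
    show "linear (diag_s n j)" for j by (rule linear_diag_s)
    show "independent_family {1..<n} std_basis" "std_rep n = span (std_basis ` {1..<n})"
      using std_rep_basis[of n] n by auto
    show "diag_comp_s (Suc n) n = {\<Sum>j<5. diag_s n j (u j) |u. \<forall>j<5. u j \<in> std_rep n}"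
      by (rule diag_comp_s_eq(1)) (use n in auto)
    show "u j = 0" if "\<And>j. j < 5 \<Longrightarrow> u j \<in> std_rep n" "(\<Sum>j<5. diag_s n j (u j)) = 0" "j < 5" for u j
      by (rule diag_comp_s_eq(2)[where d = "Suc n" and k = 5, OF n _ that]) auto
    show "?H (\<Sum>j<5. ?v k j *\<^sub>R diag_s n j u) = ?l k *\<^sub>R (\<Sum>j<5. ?v k j *\<^sub>R diag_s n j u)"
      if "k < 5" "u \<in> std_rep n" for k u
    proof (cases "k = 0")
      case True
      then show ?thesis by (simp add: sum_lessThan_5 hessian_D2_kernel)
    next
      case False
      have emb: "(\<Sum>j<5. coord_s x j *\<^sub>R diag_s n j u) = emb_s n u x" for x
        by (cases x) (simp add: sum_lessThan_5 emb_s_def)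
      have scale: "emb_s n u (c *\<^sub>R x) = c *\<^sub>R emb_s n u x" for c x
        by (cases x) (simp add: emb_s_def scaleR_add_right)
      show ?thesis
        using False \<open>k < 5\<close> by (simp add: emb hessian_D2_s[OF st that(2)] l scale)
    qed
    show "c k = 0" if c: "\<And>j. j < 5 \<Longrightarrow> (\<Sum>k<5. c k * ?v k j) = 0" and k: "k < 5" for c k
    proof -
      have split: "(\<Sum>k<5. f k) = f 0 + (\<Sum>k<4. f (Suc k))" for f :: "nat \<Rightarrow> real"
        by (simp add: eval_nat_numeral)
      have c0: "c 0 = 0"
      proof -
        have "coord_s x 4 = 0" for x by (cases x) simp
        then show ?thesis using c[of 4] by (simp add: split)
      qed
      have "(\<Sum>k<4. c (Suc k) *\<^sub>R e k) = 0"
      proof (rule coord_s_eq_0)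
        fix j :: nat assume "j < 4"
        then show "coord_s (\<Sum>k<4. c (Suc k) *\<^sub>R e k) j = 0"
          using c[of j] c0 by (simp add: linear_sum[OF linear_coord_s] linear_cmul[OF linear_coord_s] split)
      qed
      then have "c (Suc k) = 0" if "k < 4" for k
        using independent_familyD[OF inner_form.orthonormal_independent(1)[OF inner_form_s e]] n that by auto
      then show ?thesis using c0 k by (cases k) auto
    qed
  qed simp_all
  then show ?thesis by (simp add: upt_rec numeral_eq_Suc)
qed

lemma coord_t_eq_0:
  assumes "\<And>j. j < 3 \<Longrightarrow> coord_t x j = 0"
  shows "x = 0"
  using assms[of 0] assms[of 1] assms[of 2] by (cases x) (simp add: zero_prod_def)

lemma spectrum_D2_t:
  assumes st: "stationary n p q r" and n: "n \<ge> 3"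
    and e: "inner_form.orthonormal (form_t n) 3 e"
    and l: "\<And>i. i < 3 \<Longrightarrow> hess_t n p q r (p\<^sup>2 + gram n p q r) (gram n p q r) (e i) = l i *\<^sub>R e i"
  shows "spectrum_on (hessian (Suc n) (loss (Suc n)) (D2 n p q r)) (diag_comp_t (Suc n) n)
    [(0, 1), (0, 1), (36 * l 0, 1), (36 * l 1, 1), (36 * l 2, 1)]"
proof -
  let ?H = "hessian (Suc n) (loss (Suc n)) (D2 n p q r)"
  \<comment> \<open>Indices 0 and 1 are the last row and the corner, both in the kernel; the
    three-dimensional problem follows, shifted by two.\<close>
  let ?v = "\<lambda>k j. if k = 0 then (if j = 3 then 1 else 0) else if k = 1 then (if j = 4 then 1 else 0) else coord_t (e (k - 2)) j"
  let ?l = "\<lambda>k. if k = 0 \<or> k = 1 then 0 else 36 * l (k - 2)"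
  have scale: "c *\<^sub>R diag_t n j u = diag_t n j (c * u)" for c u :: real and j
    using linear_scale[OF linear_diag_t[of n j], of c u] by simp
  have "spectrum_on ?H (diag_comp_t (Suc n) n) (map (\<lambda>k. (?l k, 1)) [0..<5])"
  proof (rule spectrum_on_copies[where \<Phi> = "diag_t n" and v = ?v and U = "UNIV" and I = "{0::nat}" and b = "\<lambda>_. 1"])
    show "linear ?H" by (rule linear_hessian_loss)
    show "linear (diag_t n j)" for j by (rule linear_diag_t)
    show "independent_family {0::nat} (\<lambda>_. 1::real)" by (simp add: independent_family_def)
    show "(UNIV::real set) = span ((\<lambda>_. 1) ` {0::nat})" by (auto simp: span_singleton)
    show "diag_comp_t (Suc n) n = {\<Sum>j<5. diag_t n j (u j) |u. \<forall>j<5. u j \<in> UNIV}"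
      by (rule diag_comp_t_eq(1)) (use n in auto)
    show "u j = 0" if "(\<Sum>j<5. diag_t n j (u j)) = 0" "j < 5" for u j
      by (rule diag_comp_t_eq(2)[where d = "Suc n" and k = 5, OF n _ that]) auto
    show "?H (\<Sum>j<5. ?v k j *\<^sub>R diag_t n j u) = ?l k *\<^sub>R (\<Sum>j<5. ?v k j *\<^sub>R diag_t n j u)" if "k < 5" for k u
    proof -
      consider "k = 0" | "k = 1" | "k \<ge> 2" by linarith
      then show ?thesis
      proof cases
        case 3
        have emb: "(\<Sum>j<5. coord_t x j *\<^sub>R diag_t n j u) = emb_t n (u *\<^sub>R x)" for x
          by (cases x) (simp add: sum_lessThan_5 emb_t_def scale mult.commute linear_0[OF linear_diag_t])
        have emb_scale: "emb_t n (c *\<^sub>R x) = c *\<^sub>R emb_t n x" for c x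
          by (cases x) (simp add: emb_t_def scaleR_add_right scale)
        have "?H (emb_t n (u *\<^sub>R e (k - 2))) = 36 *\<^sub>R emb_t n (u *\<^sub>R l (k - 2) *\<^sub>R e (k - 2))"
          unfolding hessian_D2_t[OF st] linear_scale[OF linear_hess_t] using 3 that l by simp
        then have "?H (emb_t n (u *\<^sub>R e (k - 2))) = (36 * l (k - 2)) *\<^sub>R emb_t n (u *\<^sub>R e (k - 2))"
          by (simp add: emb_scale mult_ac)
        then show ?thesis using 3 by (simp add: emb)
      qed (simp_all add: sum_lessThan_5 hessian_D2_kernel scale linear_0[OF linear_diag_t])
    qed
    show "c k = 0" if c: "\<And>j. j < 5 \<Longrightarrow> (\<Sum>k<5. c k * ?v k j) = 0" and k: "k < 5" for c k
    proof -
      have split: "(\<Sum>k<5. f k) = f 0 + f 1 + (\<Sum>k<3. f (k + 2))" for f :: "nat \<Rightarrow> real"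
        by (simp add: eval_nat_numeral)
      have "coord_t x 3 = 0" "coord_t x 4 = 0" for x by (cases x, simp)+
      then have c0: "c 0 = 0" "c 1 = 0" using c[of 3] c[of 4] by (simp_all add: split)
      have "(\<Sum>k<3. c (k + 2) *\<^sub>R e k) = 0"
      proof (rule coord_t_eq_0)
        fix j :: nat assume "j < 3"
        then show "coord_t (\<Sum>k<3. c (k + 2) *\<^sub>R e k) j = 0"
          using c[of j] c0 by (simp add: linear_sum[OF linear_coord_t] linear_cmul[OF linear_coord_t] split)
      qed
      then have "c (k + 2) = 0" if "k < 3" for k
        using independent_familyD[OF inner_form.orthonormal_independent(1)[OF inner_form_t e], of "\<lambda>k. c (k + 2)"] n that by auto
      moreover have "k = 0 \<or> k = 1 \<or> (\<exists>i<3. k = i + 2)" using k by presburger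
      ultimately show ?thesis using c0 by auto
    qed
  qed simp_all
  then show ?thesis by (simp add: upt_rec numeral_eq_Suc)
qed

lemma spectrum_D2_x:
  assumes st: "stationary n p q r" and n: "n \<ge> 3" and l: "l = 36 * p"
  shows "spectrum_on (hessian (Suc n) (loss (Suc n)) (D2 n p q r)) (diag_comp_x (Suc n) n) [(l, (n - 1) * (n - 2) div 2)]"
proof (rule spectrum_on_scalar[OF linear_hessian_loss linear_ident finite_upper_pairs ext_square_rep_basis(1,2)])
  show "diag_comp_x (Suc n) n = {\<Sum>j<1. u j |u. \<forall>j<(1::nat). u j \<in> ext_square_rep n}"
    by (rule diag_comp_x_eq) (use n in auto)
  show "hessian (Suc n) (loss (Suc n)) (D2 n p q r) u = l *\<^sub>R u" if "u \<in> ext_square_rep n" for u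
  proof -
    have u: "zero_sums n u" "\<forall>i j. u i j + u j i = 0"
      using that unfolding ext_square_rep_basis(3) by blast+
    have "u i i = 0" for i using u(2)[rule_format, of i i] by simp
    moreover have "u j i = - 1 * u i j" for i j using u(2)[rule_format, of i j] by linarith
    ultimately have "hessian (Suc n) (loss (Suc n)) (D2 n p q r) u = (36 * (p + 2 * gram n p q r * p\<^sup>2 * (1 + - 1))) *\<^sub>R u"
      by (rule hessian_D2_zero_sums[OF st u(1)])
    then show ?thesis by (simp add: l)
  qed
qed (simp_all add: card_upper_pairs)

lemma spectrum_D2_y:
  assumes st: "stationary n p q r" and n: "n \<ge> 3" and l: "l = 36 * (p + 4 * gram n p q r * p\<^sup>2)"
  shows "spectrum_on (hessian (Suc n) (loss (Suc n)) (D2 n p q r)) (diag_comp_y (Suc n) n) [(l, n * (n - 3) div 2)]"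
proof (rule spectrum_on_scalar[OF linear_hessian_loss linear_ident _ specht2_rep_basis(1,2)[OF n]])
  show "diag_comp_y (Suc n) n = {\<Sum>j<1. u j |u. \<forall>j<(1::nat). u j \<in> specht2_rep n}"
    by (rule diag_comp_y_eq) (use n in auto)
  show "hessian (Suc n) (loss (Suc n)) (D2 n p q r) u = l *\<^sub>R u" if "u \<in> specht2_rep n" for u
  proof -
    have u: "zero_sums n u" "\<forall>i j. u j i = u i j" "\<forall>i. u i i = 0"
      using that unfolding specht2_rep_basis(3)[OF n] by blast+
    have "hessian (Suc n) (loss (Suc n)) (D2 n p q r) u = (36 * (p + 2 * gram n p q r * p\<^sup>2 * (1 + 1))) *\<^sub>R u"
    proof (rule hessian_D2_zero_sums[OF st u(1)])
      show "u j i = 1 * u i j" for i j using u(2)[rule_format, of i j] by linarith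
    qed (use u(3) in blast)
    then show ?thesis by (simp add: l algebra_simps)
  qed
  show "n * (n - 3) div 2 = card (upper_pairs n - {(1, 2)})"
    by (rule specht2_rep_basis(4)[OF n, symmetric])
qed simp_all

text \<open>\<open>N\<close> is of order \<open>1 / e\<close> and enters only multiplied by
  \<open>q\<close>, \<open>r\<close>, \<beta> or \<gamma>. Passing these products as separate
  parameters removes \<open>N\<close>, so that the residual formulas become polynomial identities in
  \<open>e\<close>.\<close>

lemma hess_s_cleared:
  assumes "N * q = q'" "N * r = r'" "N * \<beta> = \<beta>'" "N * \<gamma> = \<gamma>'"
  shows "hess_s N p q r A B (\<alpha>, \<beta>, \<gamma>, \<delta>) = (
    let \<kappa> = p * (\<alpha> + \<beta> + \<gamma>) + q * (\<alpha> + \<beta>') + r * \<delta>;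
        \<tau> = p * \<beta> + q * (\<alpha> + \<beta>') + r * \<delta>;
        \<tau>' = p * \<beta>' + q' * (\<alpha> + \<beta>') + r' * \<delta>;
        C = 6 * (A - B) * \<kappa> + 4 * B * p * \<alpha> + A * (\<tau>' + p * \<alpha>) + A * (p * \<alpha> + p * \<gamma>') - (\<alpha> + \<beta>' + \<delta>);
        D = 2 * B * \<tau> + A * \<kappa> + 2 * B * p * \<gamma>;
        E = 2 * B * p\<^sup>2 * \<gamma> + 2 * B * p * \<tau> + (B\<^sup>2 + A\<^sup>2 / 2) * (\<alpha> + \<gamma>') + A * \<kappa> * p
    in (p * \<alpha> + p * C - 2 * p * (\<alpha> + \<beta> + \<gamma>), p * \<beta> + q * C + (p + q') * D - \<kappa>,
      p * \<gamma> + E, (p + 2 * q - 2 * r) * \<delta> + r * C + r' * D - \<kappa>))"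
proof -
  have "N * (p * \<beta> + q * (\<alpha> + \<beta>') + r * \<delta>) = p * \<beta>' + q' * (\<alpha> + \<beta>') + r' * \<delta>" "N * p * \<gamma> = p * \<gamma>'"
    unfolding assms[symmetric] by (simp_all add: algebra_simps)
  then show ?thesis by (simp only: hess_s_def Let_def prod.case assms)
qed

text \<open>Unlike in type s, sums over the rows do not cancel here, so \<open>N * \<alpha>\<close>
  and \<open>N * \<delta>\<close> occur as well.\<close>

lemma hess_t_cleared:
  assumes "N * q = q'" "N * r = r'" "N * \<beta> = \<beta>'" "N * \<alpha> = \<alpha>'" "N * \<delta> = \<delta>'"
  shows "hess_t N p q r A B (\<alpha>, \<beta>, \<delta>) = (
    let \<kappa> = p * (\<alpha> + \<beta>) + q * (\<alpha> + \<beta>') + r * \<delta>;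
        \<tau> = p * \<beta> + q * (\<alpha> + \<beta>') + r * \<delta>;
        \<tau>' = p * \<beta>' + q' * (\<alpha> + \<beta>') + r' * \<delta>;
        \<kappa>' = p * \<alpha>' + \<tau>' ;
        C = 6 * (A - B) * \<kappa> + 4 * B * p * \<alpha> + 2 * A * (\<tau>' + p * \<alpha>) + 2 * B * \<kappa>' - (\<alpha> + \<beta>' + \<delta>);
        D = 4 * B * \<tau> + 2 * A * \<kappa>;
        E = B\<^sup>2 + A\<^sup>2 / 2
    in (p * \<alpha> + p * C - 2 * p * (\<alpha> + \<beta>),
      p * \<beta> + q * C + (p + q') * D + E * (\<alpha> + \<beta>') - \<kappa>,
      (p + 2 * q - 2 * r) * \<delta> + r * C + r' * D + E * \<delta>' - \<kappa>))"
proof -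
  have "N * (p * \<beta> + q * (\<alpha> + \<beta>') + r * \<delta>) = p * \<beta>' + q' * (\<alpha> + \<beta>') + r' * \<delta>"
    "2 * B * N * (p * (\<alpha> + \<beta>) + q * (\<alpha> + \<beta>') + r * \<delta>) = 2 * B * (p * \<alpha>' + (p * \<beta>' + q' * (\<alpha> + \<beta>') + r' * \<delta>))"
    "(B\<^sup>2 + A\<^sup>2 / 2) * N * \<delta> = (B\<^sup>2 + A\<^sup>2 / 2) * \<delta>'"
    unfolding assms[symmetric] by (simp_all add: algebra_simps)
  then show ?thesis by (simp only: hess_t_def Let_def prod.case assms)
qed

text \<open>The vectors below are eigenvectors expanded in powers of \<open>e = 1 / d\<close>, so that the residuals are
  small; of the polynomials on the right only the power of \<open>e\<close> in front matters.\<close>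

lemma hess_residual_s1:
  fixes N e a b c g h :: real
  assumes N: "N * e = 1 - e"
  shows "hess_s N (1 + e ^ 3 * a) (e ^ 3 * b) (e - e\<^sup>2 + e ^ 3 * c) (1 + e\<^sup>2 * g) (e\<^sup>2 * h) (0, 0, - 2 * e ^ 2, 1)
      - 1 *\<^sub>R (0, 0, - 2 * e ^ 2, 1) =
    (e * (2 + e * (- 11 + g + c + e * (- 6 * h + g * 2 + c * 5 + e * (18 * h + g * (- 15) + c * g + e * (c * (- 6 * h + g * 5)
      + a * (- 21 + g + c) + e * (a * (- 6 * h + c * 5) + e * (a * (30 * h + g * (- 25) + c * g + a * (- 2)) + e * (a * (c * (- 6 * h
      + g * 5) + a * (- 10)) + e * (- 2 * a ^ 2 * g + e * (a ^ 2 * (12 * h + g * (- 10)))))))))))),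
     e ^ 2 * (e * (2 * h + g + b + e * (- 6 * h + g * (- 3) + b * (- 2) + a + e * (c * (2 * h + g) + b * (- 12 + h * 2 + g * 2 + c * 2)
      + a * (- 3) + e * (b * (- 14 * h + g * (- 2) + c * 4) + a * (2 * h + g + c) + e * (b * (24 * h + g * (- 12) + c * (2 * h + g * 2))
      + a * (- 10 * h + g * (- 5) + b * (- 4)) + e * (b * (c * (- 8 * h + g * 4)) + a * (c * (2 * h + g) + b * (- 8) + a * (- 2))
      + e * (a * (b * (- 4 * h + g * (- 4))) + e * (a * (b * (16 * h + g * (- 8)) + a * (- 4 * h + g * (- 2)))))))))))),
     e ^ 2 * (- 2 + e * (2 * h + g * (- 1) + c + e * (- 6 * h + g * (- 1) + a + e * (- 2 * h ^ 2 + g ^ 2 * (- 1) + c * (2 * h + g)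
      + a * (- 7) + e * (2 * h ^ 2 + g ^ 2 + a * (2 * h + g + c) + e * (a * (- 10 * h + g * (- 5)) + e * (a * (c * (2 * h + g)
      + a * (- 2)) + e ^ 2 * (a ^ 2 * (- 4 * h + g * (- 2)))))))))),
     e * (- 2 + e * (2 + e * (- 10 + h * 2 + g * 2 + b * 2 + a + e * (12 + h * (- 16) + g * (- 4) + e * (38 * h + g * (- 10) + c * (- 16
      + h * 4 + g * 4 + c * 2) + a * (- 2) + e * (- 24 * h + g * 12 + c * (- 24 * h + c * 4) + a * (- 4) + e * (c * (32 * h + g * (- 16)
      + c * (2 * h + g * 2)) + a * (8 + h * (- 4) + g * (- 4) + c * (- 4)) + e * (c ^ 2 * (- 8 * h + g * 4) + a * (20 * h + g * (- 4)
      + c * (- 8)) + e * (a * (- 16 * h + g * 8 + c * (- 4 * h + g * (- 4))) + e * (a * (c * (16 * h + g * (- 8))))))))))))))"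
  proof -
  have cl: "N * (e ^ 3 * b) = e ^ 2 * b * (1 - e)" "N * (e - e\<^sup>2 + e ^ 3 * c) = (1 - e) * (1 - e
      + e ^ 2 * c)" "N * (0) = 0" "N * (- 2 * e ^ 2) = - 2 * e * (1 - e)"
    using N by (algebra | simp)+
  show ?thesis
    unfolding hess_s_cleared[OF cl]
    unfolding scaleR_Pair diff_Pair Let_def prod.inject real_scaleR_def
    by (intro conjI) (algebra, algebra, algebra, algebra)
qed

lemma hess_residual_s2:
  fixes N e a b c g h :: real
  assumes N: "N * e = 1 - e"
  shows "hess_s N (1 + e ^ 3 * a) (e ^ 3 * b) (e - e\<^sup>2 + e ^ 3 * c) (1 + e\<^sup>2 * g) (e\<^sup>2 * h) (- e, e, e ^ 2, 0)
      - 1 *\<^sub>R (- e, e, e ^ 2, 0) =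
    (e ^ 2 * (3 + g + b + e * (- 4 * h + g * (- 2) + b * 3 + a + e * (- 6 * h + g * 5 + b * (- 10 + g) + a * (- 3) + e * (b * (- 6 * h
      + g * 3) + a * (8 + g * 2 + b) + e * (b * (12 * h + g * (- 10)) + a * (- 8 * h + g * (- 4) + b * 3 + a) + e * (a * (- 12 * h
      + g * 10 + b * (- 10 + g) + a * (- 2)) + e * (a * (b * (- 6 * h + g * 3) + a * (5 + g)) + e * (a * (b * (12 * h + g * (- 10))
      + a * (- 4 * h + g * (- 2))) + e * (a ^ 2 * (- 6 * h + g * 5)))))))))),
     e ^ 2 * (e * (2 * h + e * (2 * h + g + b + a + e * (b * (4 + h * 4 + g * 2 + b * 2) + a + e * (b * (- 8 * h + g * (- 3))
      + a * (4 * h + b * 2) + e * (b * (- 8 * h + g * 4 + b * (- 8 + h * 2 + g * 2)) + a * (4 * h + g * 2 + b * (- 3))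
      + e * (- 12 * b ^ 2 * h + a * (b * (4 + h * 4 + g * 2) + a) + e * (b ^ 2 * (16 * h + g * (- 8)) + a * (b * (- 8 * h + g * (- 3))
      + a * 2 * h) + e * (a * (b * (- 8 * h + g * 4) + a * (2 * h + g))))))))))),
     e ^ 2 * (1/2 + e * (2 * h + b + e * (2 * h + b * (- 2) + e * (b * (2 * h + g) + a * 3 + e * (- (h ^ 2) + g ^ 2 * (- 1/2)
      + b * (- 4 * h + g * (- 2)) + a * (4 * h + b) + e * (a * (4 * h + g * 2 + b * (- 2)) + e * (a * (b * (2 * h + g) + a)
      + e * (a * (b * (- 4 * h + g * (- 2)) + a * 2 * h) + e * (a ^ 2 * (2 * h + g)))))))))),
     e ^ 2 * (e * (3 + h * 2 + g + b + e * (- 4 + h * (- 6) + g * (- 2) + c + a + e * (- 4 * h + g * 5 + c * (4 + h * 2 + g) + b * (- 8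
      + h * 2 + g * 2 + c * 2) + a * (- 3) + e * (8 * h + g * (- 4) + c * (- 4 * h + g * (- 1)) + b * (8 + h * (- 14) + g * (- 2))
      + a * (5 + h * 2 + g + c) + e * (c * (- 8 * h + g * 4) + b * (28 * h + g * (- 8) + c * (- 8 + h * 2 + g * 2)) + a * (- 4
      + h * (- 6) + g * (- 2) + c * (- 1)) + e * (b * (- 16 * h + g * 8 + c * (- 12 * h)) + a * (- 4 * h + g * 5 + c * (4 + h * 2 + g))
      + e * (b * (c * (16 * h + g * (- 8))) + a * (8 * h + g * (- 4) + c * (- 4 * h + g * (- 1))) + e * (a * (c * (- 8 * h + g * 4))))))))))))"
  proof -
  have cl: "N * (e ^ 3 * b) = e ^ 2 * b * (1 - e)" "N * (e - e\<^sup>2 + e ^ 3 * c) = (1 - e) * (1 - e + e ^ 2 * c)" "N * (e) = (1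
      - e)" "N * (e ^ 2) = e * (1 - e)"
    using N by (algebra | simp)+
  show ?thesis
    unfolding hess_s_cleared[OF cl]
    unfolding scaleR_Pair diff_Pair Let_def prod.inject real_scaleR_def
    by (intro conjI) (algebra, algebra, algebra, algebra)
qed

lemma hess_residual_s3:
  fixes N e a b c g h :: real
  assumes N: "N * e = 1 - e"
  shows "hess_s N (1 + e ^ 3 * a) (e ^ 3 * b) (e - e\<^sup>2 + e ^ 3 * c) (1 + e\<^sup>2 * g) (e\<^sup>2 * h) (1, 0, - 3 * e
      - 9 * e ^ 2, 0) - 3 *\<^sub>R (1, 0, - 3 * e - 9 * e ^ 2, 0) =
    (e * (- 18 + e * (- 27 + h * (- 2) + g * 5 + b + e * (18 * h + g * (- 24) + b * 5 + a * 8 + e * (54 * h + g * (- 45) + b * g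
      + a * (- 42) + e * (b * (- 6 * h + g * 5) + a * (- 72 + h * (- 4) + g * 10 + b) + e * (a * (36 * h + g * (- 48) + b * 5 + a * 5)
      + e * (a * (108 * h + g * (- 90) + b * g + a * (- 24)) + e * (a * (b * (- 6 * h + g * 5) + a * (- 45 + h * (- 2) + g * 5))
      + e * (a ^ 2 * (18 * h + g * (- 24)) + e * (a ^ 2 * (54 * h + g * (- 45)))))))))))),
     e ^ 2 * (g + b + e * (- 6 * h + g * (- 3) + a + e * (- 18 * h + g * (- 9) + b * (- 30 + g) + a * (- 3) + e * (b * (- 36 + h * (- 6)
      + g * 2 + b * 2) + a * (- 9 + g * 2 + b) + e * (b * (6 * h + g * (- 30) + b * 4) + a * (- 12 * h + g * (- 6) + b * 2 + a)
      + e * (b * (72 * h + g * (- 36) + b * (2 * h + g * 2)) + a * (- 36 * h + g * (- 18) + b * (- 30 + g) + a * (- 3))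
      + e * (b ^ 2 * (- 8 * h + g * 4) + a * (b * (- 36 + h * (- 6) + g * 2) + a * (- 9 + g)) + e * (a * (b * (6 * h + g * (- 30))
      + a * (- 6 * h + g * (- 3))) + e * (a * (b * (72 * h + g * (- 36)) + a * (- 18 * h + g * (- 9)))))))))))),
     e ^ 2 * (27/2 + g * (- 1) + e * (- 6 * h + g * (- 9) + b + a * 2 + e * (h * (- 18 + h * (- 2)) + g ^ 2 * (- 1) + a * (- 9)
      + e * (- 6 * h ^ 2 + g ^ 2 * (- 3) + b * (2 * h + g) + a * (- 27 + g * 2) + e * (9 * h ^ 2 + g ^ 2 * (9/2) + a * (- 12 * h
      + g * (- 6) + b + a) + e * (a * (- 36 * h + g * (- 18) + a * (- 3)) + e * (a * (b * (2 * h + g) + a * (- 9 + g))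
      + e * (a ^ 2 * (- 6 * h + g * (- 3)) + e * (a ^ 2 * (- 18 * h + g * (- 9))))))))))),
     e * (2 + e * (- 21 + g + c + e * (- 6 + h * (- 8) + b + e * (36 + h * 14 + g * (- 31) + c * (- 30 + g) + b * 2 + a * 3 + e * (66 * h
      + g * (- 6) + c * (- 36 + h * (- 8) + g) + b * (- 4 + h * 2 + g * 2 + c * 2) + a * (- 22 + g + c) + e * (- 72 * h + g * 36
      + c * (6 * h + g * (- 30)) + b * (- 10 * h + g * 2 + c * 4) + a * (- 6 + h * (- 8) + c) + e * (c * (72 * h + g * (- 36))
      + b * (8 * h + g * (- 4) + c * (2 * h + g * 2)) + a * (36 + h * 14 + g * (- 31) + c * (- 30 + g)) + e * (b * (c * (- 8 * h
      + g * 4)) + a * (66 * h + g * (- 6) + c * (- 36 + h * (- 8) + g)) + e * (a * (- 72 * h + g * 36 + c * (6 * h + g * (- 30)))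
      + e * (a * (c * (72 * h + g * (- 36))))))))))))))"
  proof -
  have cl: "N * (e ^ 3 * b) = e ^ 2 * b * (1 - e)" "N * (e - e\<^sup>2 + e ^ 3 * c) = (1 - e) * (1 - e
      + e ^ 2 * c)" "N * (0) = 0" "N * (- 3 * e - 9 * e ^ 2) = (- 3 - 9 * e) * (1 - e)"
    using N by (algebra | simp)+
  show ?thesis
    unfolding hess_s_cleared[OF cl]
    unfolding scaleR_Pair diff_Pair Let_def prod.inject real_scaleR_def
    by (intro conjI) (algebra, algebra, algebra, algebra)
qed

lemma hess_residual_s4:
  fixes N e a b c g h :: real
  assumes N: "N * e = 1 - e"
  shows "hess_s N (1 + e ^ 3 * a) (e ^ 3 * b) (e - e\<^sup>2 + e ^ 3 * c) (1 + e\<^sup>2 * g) (e\<^sup>2 * h) (2 * e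
      + 12 * e ^ 2, 0, e, 2 * e ^ 2) - (N / 2 + 5) *\<^sub>R (2 * e + 12 * e ^ 2, 0, e, 2 * e ^ 2) =
    (e ^ 2 * (18 + g + e * (8 + h * (- 10) + g * 21 + b * 2 + a * 2 + e * (- 10 + h * (- 24) + g * 98 + c * 2 + b * 22 + a * 36
      + e * (- 12 * h + g * 8 + c * 10 + b * (60 + g * 2) + a * (168 + g * 2) + e * (12 * h + g * (- 10) + c * 2 * g + b * (- 12 * h
      + g * 22) + a * (8 + h * (- 20) + g * 42 + b * 2 + a) + e * (c * (- 12 * h + g * 10) + b * (- 72 * h + g * 60) + a * (- 10
      + h * (- 48) + g * 194 + c * 2 + b * 22 + a * 21) + e * (a * (- 12 * h + g * 8 + c * 10 + b * (60 + g * 2) + a * (96 + g))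
      + e * (a * (12 * h + g * (- 10) + c * 2 * g + b * (- 12 * h + g * 22) + a * (- 10 * h + g * 21)) + e * (a * (c * (- 12 * h
      + g * 10) + b * (- 72 * h + g * 60) + a * (- 24 * h + g * 96))))))))))),
     e ^ 2 * (e * (2 * h + g * 3 + b * 4 + e * (12 * g + b * 28 + a * 3 + e * (4 * h + g * 2 + b * (74 + h * 2 + g * 4) + a * 12
      + e * (- 4 * h + g * (- 2) + b * (4 + h * (- 8) + g * 32 + b * 4) + a * (2 + h * 4 + g * 6 + b * 4) + e * (c * (4 * h + g * 2)
      + b * (- 8 + h * 4 + g * 100 + c * 4 + b * 32) + a * (- 2 + g * 24 + b * 32 + a * 3) + e * (b * (- 20 * h + g * 4 + c * 8 + b * (48
      + h * 4 + g * 4)) + a * (4 * h + g * 2 + c * 2 + b * (96 + h * 2 + g * 4) + a * 12) + e * (b * (16 * h + g * (- 8) + c * (4 * h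
      + g * 4) + b * (8 * h + g * 32)) + a * (- 4 * h + g * (- 2) + b * (- 8 * h + g * 32) + a * (2 * h + g * 3))
      + e * (b * (c * (- 16 * h + g * 8) + b * (- 96 * h + g * 48)) + a * (c * (4 * h + g * 2) + b * 96 * g + a * 12 * g)))))))))),
     e ^ 2 * (18 + g + e * (2 + h * 2 + g * 4 + e * (- 2 + h ^ 2 + g * (24 + g * (1/2)) + b * 2 + a * 7 + e * (h * (4 + h) + g * (2
      + g * (1/2)) + c * 2 + b * 12 + a * 24 + e * (h * (- 4 + h * 12) + g * (- 2 + g * 6) + b * (4 * h + g * 2) + a * (2 + h * 4 + g * 6)
      + e * (c * (4 * h + g * 2) + b * (24 * h + g * 12) + a * (- 2 + g * 24 + b * 2 + a * 3) + e * (a * (4 * h + g * 2 + c * 2 + b * 12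
      + a * 12) + e * (a * (- 4 * h + g * (- 2) + b * (4 * h + g * 2) + a * (2 * h + g * 3)) + e * (a * (c * (4 * h + g * 2)
      + b * (24 * h + g * 12) + a * 12 * g)))))))))),
     e ^ 2 * (5 + e * (40 + h * 2 + g * 4 + c * 4 + e * (- 64 + h * (- 14) + g * 26 + c * 28 + b * 2 + a + e * (- 12 + h * (- 8) + g * 58
      + c * (72 + h * 2 + g * 4) + b * 20 + a * 16 + e * (8 + g * (- 84) + c * (8 + h * (- 12) + g * 30) + b * (16 + h * 4 + g * 4
      + c * 4) + a * (54 + h * 2 + g * 4 + c * 4) + e * (36 * h + g * (- 12) + c * (- 16 + h * (- 16) + g * 92 + c * 4) + b * (- 48
      + h * 4 + g * 28 + c * 32) + a * (- 84 + h * (- 14) + g * 26 + c * 30) + e * (- 16 * h + g * 8 + c * (- 40 * h + g * 8 + c * 8)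
      + b * (- 104 * h + g * 16 + c * (48 + h * 4 + g * 4)) + a * (- 12 * h + g * 54 + c * (84 + h * 2 + g * 4)) + e * (c * (32 * h
      + g * (- 16) + c * (4 * h + g * 4)) + b * (96 * h + g * (- 48) + c * (8 * h + g * 32)) + a * (24 * h + g * (- 84) + c * (- 12 * h
      + g * 30)) + e * (c ^ 2 * (- 16 * h + g * 8) + b * (c * (- 96 * h + g * 48)) + a * (c * (- 24 * h + g * 84))))))))))))"
  proof -
  have cl: "N * (e ^ 3 * b) = e ^ 2 * b * (1 - e)" "N * (e - e\<^sup>2 + e ^ 3 * c) = (1 - e) * (1 - e + e ^ 2 * c)" "N * (0) = 0" "N * (e) = (1 - e)"
    using N by (algebra | simp)+
  \<comment> \<open>The shift corresponds to \<open>36 * (N / 2 + 5) = 18 * d + 162\<close>. Every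
    coordinate of the vector contains a factor \<open>e\<close>, so \<open>N * e = 1 - e\<close>
    makes the product polynomial.\<close>
  have mu: "(N / 2 + 5) *\<^sub>R (2 * e + 12 * e ^ 2, 0, e, 2 * e ^ 2) = ((2 + 12 * e) * (1 / 2 + 9 / 2 * e), 0, (1 / 2
      + 9 / 2 * e), 2 * e * (1 / 2 + 9 / 2 * e))"
    unfolding scaleR_Pair prod.inject real_scaleR_def by (intro conjI) (use N in \<open>(algebra | simp)+\<close>)
  show ?thesis
    unfolding hess_s_cleared[OF cl] mu
    unfolding scaleR_Pair diff_Pair Let_def prod.inject real_scaleR_def
    by (intro conjI) (simp add: algebra_simps add_divide_distrib diff_divide_distrib power2_eq_square power3_eq_cube)+
qed

lemma hess_residual_t1:
  fixes N e a b c g h :: real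
  assumes N: "N * e = 1 - e"
  shows "hess_t N (1 + e ^ 3 * a) (e ^ 3 * b) (e - e\<^sup>2 + e ^ 3 * c) (1 + e\<^sup>2 * g) (e\<^sup>2 * h) (e, - 3 * e ^ 2
      - 9 * e ^ 3, - 2 * e ^ 2) - 3 *\<^sub>R (e, - 3 * e ^ 2 - 9 * e ^ 3, - 2 * e ^ 2) =
    (e ^ 2 * (- 20 + h * 2 + e * (- 31 + h * (- 10) + g * 2 + b * (- 4) + e * (8 + h * 2 + g * (- 34) + c * (- 4) + b * (- 20) + a * 5
      + e * (92 * h + g * (- 40) + c * (- 8) + b * (- 6 + h * (- 4) + g * (- 4)) + a * (- 50 + h * 4) + e * (- 16 * h + g * 8
      + c * (- 4 * h + g * (- 4)) + b * (36 + h * 4 + g * (- 20)) + a * (- 67 + h * (- 20) + g * 4 + b * (- 4)) + e * (c * (16 * h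
      + g * (- 8)) + b * (66 * h + g * (- 6)) + a * (8 + h * 8 + g * (- 64) + c * (- 4) + b * (- 20) + a * 2) + e * (b * (- 72 * h
      + g * 36) + a * (164 * h + g * (- 76) + c * (- 8) + b * (- 6 + h * (- 4) + g * (- 4)) + a * (- 30 + h * 2)) + e * (a * (- 16 * h
      + g * 8 + c * (- 4 * h + g * (- 4)) + b * (36 + h * 4 + g * (- 20)) + a * (- 36 + h * (- 10) + g * 2)) + e * (a * (c * (16 * h
      + g * (- 8)) + b * (66 * h + g * (- 6)) + a * (6 * h + g * (- 30))) + e * (a * (b * (- 72 * h + g * 36) + a * (72 * h + g * (- 36))))))))))))),
     e ^ 3 * (23/2 + b * 2 + e * (2 + h * (- 12) + g * (- 12) + b * (- 6) + a * 3 + e * (h * (- 44 + h * (- 2)) + g * (- 13 + g * (- 1))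
      + c * (- 2) + b * (- 48 + h * 2 + g * 2) + a * (- 12) + e * (h * (8 + h * (- 6)) + g * (4 + g * (- 3)) + b * (- 14 + h * (- 30)
      + g * (- 10) + b * (- 8)) + a * (- 40 + g * 4 + b * 2) + e * (9 * h ^ 2 + g ^ 2 * (9/2) + c * (- 8 * h + g * (- 4)) + b * (4
      + h * (- 54) + g * (- 62) + c * (- 8) + b * (- 28)) + a * (4 + h * (- 24) + g * (- 12) + b * (- 10) + a * 2) + e * (b * (180 * h
      + g * 4 + c * (- 4) + b * (24 + h * (- 12) + g * (- 8))) + a * (- 80 * h + g * (- 40) + c * (- 4) + b * (- 54 + h * 2 + g * 2)
      + a * (- 6)) + e * (b * (- 24 * h + g * 4 + c * (- 12 * h + g * (- 8)) + b * (18 + h * (- 12) + g * (- 28))) + a * (8 * h + g * 4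
      + b * (- 30 * h + g * (- 10)) + a * (- 18 + g * 2)) + e * (b * (c * (24 * h + g * (- 4)) + b * (126 * h + g * 24))
      + a * (c * (- 8 * h + g * (- 4)) + b * (- 42 * h + g * (- 54)) + a * (- 12 * h + g * (- 6))) + e * (b ^ 2 * (- 108 * h + g * 18)
      + a * (144 * b * h + a * (- 36 * h + g * (- 18)))))))))))),
     e ^ 2 * (2 + e * (- 23 + h * 2 + c * 2 + e * (13 + h * (- 24) + g * (- 6) + c * (- 4) + b * (- 6) + a + e * (27 + h * (- 8
      + h * (- 2)) + g * (- 44 + g * (- 1)) + c * (- 44 + h * 2 + g * 2) + b * (- 18) + a * (- 7) + e * (- 4 + h * (174 + h * 2)
      + g * (36 + g) + c * (- 19 + h * (- 22) + g * (- 6)) + b * (43 + h * (- 12) + g * (- 8) + c * (- 8)) + a * (- 27 + h * 2 + g * 2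
      + c * 2) + e * (- 168 * h + g * 18 + c * (8 + h * (- 42) + g * (- 58) + c * (- 8)) + b * (- 6 + g * (- 20) + c * (- 28)) + a * (24
      + h * (- 24) + g * (- 8) + c * (- 6)) + e * (24 * h + g * (- 4) + c * (180 * h + g * (- 10) + c * (- 4)) + b * (- 18 + h * 138
      + g * 52 + c * (24 + h * (- 12) + g * (- 8))) + a * (18 + h * 4 + g * (- 36) + c * (- 42 + h * 2 + g * 2)) + e * (c * (- 48 * h
      + g * 8 + c * (- 12 * h + g * (- 8))) + b * (- 234 * h + g * (- 6) + c * (18 + h * (- 12) + g * (- 28))) + a * (126 * h + g * 24
      + c * (- 18 + h * (- 22) + g * (- 6))) + e * (c ^ 2 * (24 * h + g * (- 4)) + b * (108 * h + g * (- 18) + c * (126 * h + g * 24))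
      + a * (- 108 * h + g * 18 + c * (- 18 * h + g * (- 42))) + e * (b * (c * (- 108 * h + g * 18)) + a * (c * (108 * h + g * (- 18))))))))))))))"
  proof -
  have cl: "N * (e ^ 3 * b) = e ^ 2 * b * (1 - e)" "N * (e - e\<^sup>2 + e ^ 3 * c) = (1 - e) * (1 - e + e ^ 2 * c)" "N * (- 3 * e ^ 2
      - 9 * e ^ 3) = (- 3 * e - 9 * e ^ 2) * (1 - e)" "N * (e) = (1 - e)" "N * (- 2 * e ^ 2) = - 2 * e * (1 - e)"
    using N by (algebra | simp)+
  show ?thesis
    unfolding hess_t_cleared[OF cl]
    unfolding scaleR_Pair diff_Pair Let_def prod.inject real_scaleR_def
    by (intro conjI) (simp add: algebra_simps add_divide_distrib diff_divide_distrib power2_eq_square power3_eq_cube)+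
qed

lemma hess_residual_t2:
  fixes N e a b c g h :: real
  assumes N: "N * e = 1 - e"
  shows "hess_t N (1 + e ^ 3 * a) (e ^ 3 * b) (e - e\<^sup>2 + e ^ 3 * c) (1 + e\<^sup>2 * g) (e\<^sup>2 * h) (0, - (e ^ 2), e) - (N / 2
      + 1) *\<^sub>R (0, - (e ^ 2), e) =
    (e ^ 2 * (- 1 + e * (- 4 + c * 2 + b * (- 2) + e * (- 2 * h + g * (- 2) + c * 4 + b * (- 2) + a * (- 2) + e * (8 * h + g * (- 4)
      + c * (2 * h + g * 2) + b * (4 + h * (- 2) + g * (- 2)) + a * (- 5) + e * (c * (- 8 * h + g * 4) + b * (10 * h + g * (- 2))
      + a * (- 4 + h * (- 2) + g * (- 2) + c * 2 + b * (- 2)) + e * (b * (- 8 * h + g * 4) + a * (6 * h + g * (- 6) + c * 4 + b * (- 2)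
      + a * (- 2)) + e * (a * (8 * h + g * (- 4) + c * (2 * h + g * 2) + b * (4 + h * (- 2) + g * (- 2)) + a * (- 4))
      + e * (a * (c * (- 8 * h + g * 4) + b * (10 * h + g * (- 2)) + a * (- 2 * h + g * (- 2))) + e * (a * (b * (- 8 * h + g * 4)
      + a * (8 * h + g * (- 4)))))))))))),
     e ^ 3 * (- 1 + g * (- 1) + e * (g + c + b * (- 1) + e * (h * (- 4 + h * (- 1)) + g * (- 2 + g * (- 1/2)) + b * (- 4) + a * (- 2)
      + e * (h ^ 2 + g ^ 2 * (1/2) + c * (4 * h + g * 2) + b * (- 2 + h * (- 4) + g * (- 2) + c * 4 + b * (- 4)) + a * (- 2)
      + e * (b * (- 2 * h + g * (- 2) + c * 2 + b * 2) + a * (- 4 * h + g * (- 2) + c * 2 + b * (- 6)) + e * (b * (12 * h + g * (- 2)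
      + c * (6 * h + g * 4) + b * (2 + h * (- 6) + g * (- 4))) + a * (- 4 * h + g * (- 2) + a * (- 2)) + e * (b * (c * (- 12 * h + g * 2)
      + b * (18 * h + g * 2)) + a * (c * (4 * h + g * 2) + b * (- 10 * h + g * (- 6))) + e * (b ^ 2 * (- 12 * h + g * 2)
      + a * (16 * b * h + a * (- 4 * h + g * (- 2))))))))))),
     e ^ 2 * (- 2 + g + e * (- 2 + g * (- 1) + e * (3 + h ^ 2 + g ^ 2 * (1/2) + c + b * (- 1) + a + e * (2 + h * (- 6 + h * (- 1))
      + g * (- 4 + g * (- 1/2)) + c * (- 7) + b * 5 + a * (- 3) + e * (18 * h + g * 2 + c * (- 4 + h * 6 + g * 4 + c * 4) + b * (- 6 * h
      + g * (- 4) + c * (- 4)) + a * 2 + e * (- 12 * h + g * 2 + c * (- 24 * h + g * (- 6) + c * 2) + b * (- 2 + h * 24 + g * 6 + c * 2)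
      + a * (2 + h * (- 6) + g * (- 4) + c * (- 4)) + e * (c * (24 * h + g * (- 4) + c * (6 * h + g * 4)) + b * (- 30 * h + c * (2
      + h * (- 6) + g * (- 4))) + a * (18 * h + g * 2 + c * (- 2)) + e * (c ^ 2 * (- 12 * h + g * 2) + b * (12 * h + g * (- 2)
      + c * (18 * h + g * 2)) + a * (- 12 * h + g * 2 + c * (- 6 * h + g * (- 4))) + e * (b * (c * (- 12 * h + g * 2)) + a * (c * (12 * h
      + g * (- 2)))))))))))))"
  proof -
  have cl: "N * (e ^ 3 * b) = e ^ 2 * b * (1 - e)" "N * (e - e\<^sup>2 + e ^ 3 * c) = (1 - e) * (1 - e + e ^ 2 * c)" "N * (- (e ^ 2)) =
      - e * (1 - e)" "N * (0) = 0" "N * (e) = (1 - e)"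
    using N by (algebra | simp)+
  \<comment> \<open>This shift corresponds to \<open>36 * (N / 2 + 1) = 18 * d + 18\<close>.\<close>
  have mu: "(N / 2 + 1) *\<^sub>R (0, - (e ^ 2), e) = (0, - e * (1 / 2 + 1 / 2 * e), (1 / 2 + 1 / 2 * e))"
    unfolding scaleR_Pair prod.inject real_scaleR_def by (intro conjI) (use N in \<open>(algebra | simp)+\<close>)
  show ?thesis
    unfolding hess_t_cleared[OF cl] mu
    unfolding scaleR_Pair diff_Pair Let_def prod.inject real_scaleR_def
    by (intro conjI) (simp add: algebra_simps add_divide_distrib diff_divide_distrib power2_eq_square power3_eq_cube)+
qed

lemma hess_residual_t3:
  fixes N e a b c g h :: real
  assumes N: "N * e = 1 - e"
  shows "hess_t N (1 + e ^ 3 * a) (e ^ 3 * b) (e - e\<^sup>2 + e ^ 3 * c) (1 + e\<^sup>2 * g) (e\<^sup>2 * h) (2 * e + 14 * e ^ 2, e, e)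
      - (N / 2 + 5) *\<^sub>R (2 * e + 14 * e ^ 2, e, e) =
    (e ^ 2 * (23 + h * 6 + g * 2 + b * 2 + e * (- 4 + h * 14 + g * 22 + c * 2 + b * 6 + a * 3 + e * (- 66 * h + g * 114 + c * 4 + b * (32
      + h * 2 + g * 2) + a * 36 + e * (8 * h + g * (- 4) + c * (2 * h + g * 2) + b * (56 + h * (- 6) + g * 6) + a * (198 + h * 12 + g * 4
      + b * 2) + e * (c * (- 8 * h + g * 4) + b * (20 * h + g * 32) + a * (- 4 + h * 26 + g * 42 + c * 2 + b * 6 + a * 2)
      + e * (b * (- 112 * h + g * 56) + a * (- 122 * h + g * 226 + c * 4 + b * (32 + h * 2 + g * 2) + a * 20) + e * (a * (8 * h
      + g * (- 4) + c * (2 * h + g * 2) + b * (56 + h * (- 6) + g * 6) + a * (112 + h * 6 + g * 2)) + e * (a * (c * (- 8 * h + g * 4)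
      + b * (20 * h + g * 32) + a * (12 * h + g * 20)) + e * (a * (b * (- 112 * h + g * 56) + a * (- 56 * h + g * 112))))))))))),
     e ^ 2 * (22 + g + e * (- 1 + h * 4 + g * 7 + b * 8 + e * (h * (4 + h) + g * (44 + g * (1/2)) + c + b * 45 + a * 10 + e * (h * (- 4
      + h) + g * (- 2 + g * (1/2)) + b * (82 + h * 14 + g * 10 + b * 4) + a * 44 + e * (14 * h ^ 2 + g ^ 2 * 7 + c * (4 * h + g * 2)
      + b * (- 2 + h * 18 + g * 48 + c * 4 + b * 6) + a * (- 2 + h * 8 + g * 12 + b * 10) + e * (b * (- 18 * h + g * 110 + c * 2
      + b * (58 + h * 6 + g * 4)) + a * (4 * h + g * 58 + c * 2 + b * 44 + a * 6) + e * (b * (12 * h + g * (- 2) + c * (6 * h + g * 4)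
      + b * (28 + h * (- 6) + g * 6)) + a * (- 4 * h + g * (- 2) + b * (112 + h * 14 + g * 10) + a * 28) + e * (b * (c * (- 12 * h
      + g * 2) + b * (72 * h + g * 58)) + a * (c * (4 * h + g * 2) + b * (12 * h + g * 44) + a * (4 * h + g * 6))
      + e * (b ^ 2 * (- 168 * h + g * 28) + a * (112 * b * g + a * 28 * g)))))))))),
     e ^ 2 * (20 + g + e * (27 + h * 10 + g * 7 + c * 7 + b * 3 + e * (- 70 + h * (4 + h) + g * (38 + g * (1/2)) + c * 45 + b * 3 + a * 6
      + e * (2 + h * (- 88 + h * (- 1)) + g * (36 + g * (- 1/2)) + c * (66 + h * 10 + g * 8) + b * (38 + h * 6 + g * 4 + c * 4) + a * 20
      + e * (86 * h + g * (- 84) + c * (- 4 + h * 20 + g * 50 + c * 4) + b * (- 30 + h * (- 12) + g * 2 + c * 6) + a * (42 + h * 10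
      + g * 8 + c * 8) + e * (- 12 * h + g * 2 + c * (- 92 * h + g * 80 + c * 2) + b * (- 28 + h * 78 + g * 52 + c * (58 + h * 6
      + g * 4)) + a * (- 84 + h * (- 2) + g * 34 + c * 42) + e * (c * (24 * h + g * (- 4) + c * (6 * h + g * 4)) + b * (- 240 * h
      + g * (- 30) + c * (28 + h * (- 6) + g * 6)) + a * (- 64 * h + g * 42 + c * (84 + h * 10 + g * 8)) + e * (c ^ 2 * (- 12 * h
      + g * 2) + b * (168 * h + g * (- 28) + c * (72 * h + g * 58)) + a * (56 * h + g * (- 84) + c * (8 * h + g * 42))
      + e * (b * (c * (- 168 * h + g * 28)) + a * (c * (- 56 * h + g * 84))))))))))))"
  proof -
  have cl: "N * (e ^ 3 * b) = e ^ 2 * b * (1 - e)" "N * (e - e\<^sup>2 + e ^ 3 * c) = (1 - e) * (1 - e + e ^ 2 * c)" "N * (e) = (1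
      - e)" "N * (2 * e + 14 * e ^ 2) = (2 + 14 * e) * (1 - e)" "N * (e) = (1 - e)"
    using N by (algebra | simp)+
  have mu: "(N / 2 + 5) *\<^sub>R (2 * e + 14 * e ^ 2, e, e) = ((2 + 14 * e) * (1 / 2 + 9 / 2 * e), (1 / 2 + 9 / 2 * e), (1 / 2 + 9 / 2 * e))"
    unfolding scaleR_Pair prod.inject real_scaleR_def by (intro conjI) (use N in \<open>(algebra | simp)+\<close>)
  show ?thesis
    unfolding hess_t_cleared[OF cl] mu
    unfolding scaleR_Pair diff_Pair Let_def prod.inject real_scaleR_def
    by (intro conjI) (simp add: algebra_simps add_divide_distrib diff_divide_distrib power2_eq_square power3_eq_cube)+
qed

text \<open>In \<open>form_s\<close> the coordinates \<beta> and \<gamma> carry weight about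
  \<open>N\<close>, the other two weight 1. \<open>Y0\<close> stands for a part of the vector of
  length \<open>Y0\<close>, \<open>Y1\<close> for a part of length about \<open>sqrt N * Y1\<close>.
  The residual of the first part must therefore be smaller by a factor \<open>e\<close> in \<beta>
  and \<gamma>, and this pays for the weight because \<open>N * e^2\<close> is small.\<close>

lemma form_s_residual_le:
  assumes e: "0 < e" "e \<le> 1/12" and N: "N = 1 / e - 1" and nn: "M \<ge> 0" "Y0 \<ge> 0" "Y1 \<ge> 0"
    and b: "\<bar>\<alpha>\<bar> \<le> M * e * (Y0 + Y1)" "\<bar>\<beta>\<bar> \<le> M * e * (e * Y0 + Y1)" "\<bar>\<gamma>\<bar> \<le> M * e * (e * Y0 + Y1)" "\<bar>\<delta>\<bar> \<le> M * e * (Y0 + Y1)"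
  shows "form_s N (\<alpha>, \<beta>, \<gamma>, \<delta>) (\<alpha>, \<beta>, \<gamma>, \<delta>) \<le> 16 * (M * e)\<^sup>2 * (Y0\<^sup>2 + (N - 2) * Y1\<^sup>2)"
proof -
  let ?K = "(M * e)\<^sup>2"
  have N11: "N \<ge> 11" "N * e = 1 - e" using e by (simp_all add: N field_simps)
  have sq: "x\<^sup>2 \<le> ?K * y\<^sup>2" if "\<bar>x\<bar> \<le> M * e * y" for x y
    using abs_le_square_iff[of x "M * e * y"] that by (simp add: power_mult_distrib)
  have dbl: "(u + v)\<^sup>2 \<le> 2 * (u\<^sup>2 + v\<^sup>2)" for u v :: real
    using zero_le_power2[of "u - v"] by (simp add: power2_eq_square algebra_simps)
  have A: "x\<^sup>2 \<le> 2 * ?K * (Y0\<^sup>2 + Y1\<^sup>2)" if "\<bar>x\<bar> \<le> M * e * (Y0 + Y1)" for x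
    using order_trans[OF sq[OF that] mult_left_mono[OF dbl[of Y0 Y1] zero_le_power2]] by (simp only: mult.left_commute mult.assoc)
  have B: "(N + 3) * x\<^sup>2 \<le> ?K * (Y0\<^sup>2 + 4 * N * Y1\<^sup>2)" if "\<bar>x\<bar> \<le> M * e * (e * Y0 + Y1)" for x
  proof -
    have "x\<^sup>2 \<le> 2 * ?K * ((e * Y0)\<^sup>2 + Y1\<^sup>2)"
      using order_trans[OF sq[OF that] mult_left_mono[OF dbl[of "e * Y0" Y1] zero_le_power2]] by (simp only: mult.left_commute mult.assoc)
    then have "(N + 3) * x\<^sup>2 \<le> (N + 3) * (2 * ?K * ((e * Y0)\<^sup>2 + Y1\<^sup>2))"
      using N11 by (intro mult_left_mono) auto
    also have "\<dots> = ?K * (2 * ((N + 3) * e * e) * Y0\<^sup>2 + 2 * (N + 3) * Y1\<^sup>2)"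
      by (simp add: power_mult_distrib power2_eq_square[of e] algebra_simps)
    also have "\<dots> \<le> ?K * (1 * Y0\<^sup>2 + (4 * N) * Y1\<^sup>2)"
    proof (intro mult_left_mono add_mono mult_right_mono)
      have "(N + 3) * e * e = (1 + 2 * e) * e" using N11(2) by algebra
      also have "\<dots> \<le> (1 + 2 * 1) * (1/12)" using e by (intro mult_mono) auto
      finally show "2 * ((N + 3) * e * e) \<le> 1" by simp
      show "2 * (N + 3) \<le> 4 * N" using N11 by simp
    qed auto
    finally show ?thesis by simp
  qed
  have "form_s N (\<alpha>, \<beta>, \<gamma>, \<delta>) (\<alpha>, \<beta>, \<gamma>, \<delta>) \<le> 3 * \<alpha>\<^sup>2 + (N + 3) * \<beta>\<^sup>2 + (N + 3) * \<gamma>\<^sup>2 + \<delta>\<^sup>2"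
  proof -
    have "(\<alpha> + \<beta> + \<gamma>)\<^sup>2 \<le> 3 * (\<alpha>\<^sup>2 + \<beta>\<^sup>2 + \<gamma>\<^sup>2)"
      using zero_le_power2[of "\<alpha> - \<beta>"] zero_le_power2[of "\<alpha> - \<gamma>"] zero_le_power2[of "\<beta> - \<gamma>"]
      by (simp add: power2_eq_square algebra_simps)
    moreover have "(\<beta> - \<gamma>)\<^sup>2 \<le> 2 * (\<beta>\<^sup>2 + \<gamma>\<^sup>2)" using dbl[of \<beta> "- \<gamma>"] by simp
    ultimately show ?thesis unfolding form_s_square by (simp add: algebra_simps)
  qed
  also have "\<dots> \<le> ?K * (10 * Y0\<^sup>2 + (8 + 8 * N) * Y1\<^sup>2)"
    using A[OF b(1)] A[OF b(4)] B[OF b(2)] B[OF b(3)] by (simp add: algebra_simps)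
  also have "\<dots> \<le> ?K * (16 * Y0\<^sup>2 + (16 * (N - 2)) * Y1\<^sup>2)"
    using N11 by (intro mult_left_mono add_mono mult_right_mono) auto
  finally show ?thesis by (simp add: algebra_simps)
qed

lemma form_t_residual_le:
  assumes e: "0 < e" "e \<le> 1/12" and N: "N = 1 / e - 1" and nn: "M \<ge> 0" "Y0 \<ge> 0" "Y1 \<ge> 0"
    and b: "\<bar>\<alpha>\<bar> \<le> M * e * (Y0 + Y1)" "\<bar>\<beta>\<bar> \<le> M * e * (e * Y0 + Y1)" "\<bar>\<delta>\<bar> \<le> M * e * (Y0 + Y1)"
  shows "form_t N (\<alpha>, \<beta>, \<delta>) (\<alpha>, \<beta>, \<delta>) \<le> 16 * (M * e)\<^sup>2 * (Y0\<^sup>2 + (N - 2) * Y1\<^sup>2)"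
proof -
  have "form_t N (\<alpha>, \<beta>, \<delta>) (\<alpha>, \<beta>, \<delta>) = form_s N (\<alpha>, \<beta>, 0, \<delta>) (\<alpha>, \<beta>, 0, \<delta>)"
    by (simp add: form_t_def form_s_def)
  also have "\<dots> \<le> 16 * (M * e)\<^sup>2 * (Y0\<^sup>2 + (N - 2) * Y1\<^sup>2)"
    by (rule form_s_residual_le[OF e N nn b(1,2) _ b(3)]) (use e nn in simp)
  finally show ?thesis .
qed

text \<open>Distinct targets among 1, 3 and \<open>N / 2 + 5\<close> are at least 2 apart, which
  exceeds twice the error \<open>8 * M * e\<close>. The target 1 occurs twice, so its residual is
  bounded on all combinations of two vectors; the scales \<open>Y0\<close> and \<open>Y1\<close> of
  \<open>main\<close> keep track of their different lengths.\<close>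

lemma approximate_spectrum_s:
  assumes sa: "inner_form.self_adjoint (form_s N) f"
    and e: "0 < e" "e \<le> 1/12" and N: "N = 1 / e - 1" and M: "\<And>i j. \<bar>x i j\<bar> \<le> M" and Me: "8 * M * e < 1"
    and r0: "f (0, 0, - 2 * e ^ 2, 1) - 1 *\<^sub>R (0, 0, - 2 * e ^ 2, 1) = (e * x 0 0, e ^ 2 * x 0 1, e ^ 2 * x 0 2, e * x 0 3)"
    and r1: "f (- e, e, e ^ 2, 0) - 1 *\<^sub>R (- e, e, e ^ 2, 0) = (e ^ 2 * x 1 0, e ^ 2 * x 1 1, e ^ 2 * x 1 2, e ^ 2 * x 1 3)"
    and r2: "f (1, 0, - 3 * e - 9 * e ^ 2, 0) - 3 *\<^sub>R (1, 0, - 3 * e - 9 * e ^ 2, 0) = (e * x 2 0, e ^ 2 * x 2 1, e ^ 2 * x 2 2, e * x 2 3)"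
    and r3: "f (2 * e + 12 * e ^ 2, 0, e, 2 * e ^ 2) - (N / 2 + 5) *\<^sub>R (2 * e + 12 * e ^ 2, 0, e, 2 * e ^ 2)
      = (e ^ 2 * x 3 0, e ^ 2 * x 3 1, e ^ 2 * x 3 2, e ^ 2 * x 3 3)"
  defines "a \<equiv> \<lambda>i::nat. if i = 0 \<or> i = 1 then 1 else if i = 2 then 3 else N / 2 + 5"
  shows "\<exists>b l. inner_form.orthonormal (form_s N) 4 b \<and> (\<forall>i<4. f (b i) = l i *\<^sub>R b i \<and> \<bar>l i - a i\<bar> \<le> 8 * M * e)"
proof -
  have N11: "N \<ge> 11" "N * e = 1 - e" using e by (simp_all add: N field_simps)
  have M0: "M \<ge> 0" using M[of 0 0] by (rule order_trans[OF abs_ge_zero])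
  interpret inner_form "form_s N" by (rule inner_form_s) (use N11 in simp)
  have lin: "linear f" using sa by (simp add: self_adjoint_def)
  have D: "DIM(real \<times> real \<times> real \<times> real) = 4" by simp
  define v where "v = (\<lambda>i::nat. if i = 0 then (0, 0, - 2 * e ^ 2, 1) else if i = 1 then (- e, e, e ^ 2, 0)
    else if i = 2 then (1, 0, - 3 * e - 9 * e ^ 2, 0) else (2 * e + 12 * e ^ 2, 0, e, 2 * e ^ 2))"
  have e2: "e ^ 2 \<le> e / 12" using e mult_left_mono[of e "1/12" e] by (simp add: power2_eq_square)
  have J: "{j. j < 4 \<and> a j = a i} = (if i < 2 then {0, 1} else {i})" if "i < 4" for i
    using that N11 by (auto simp: a_def less_Suc_eq numeral_eq_Suc)
  have mul: "\<bar>y * (s * X)\<bar> \<le> \<bar>y\<bar> * (s * M)" if "\<bar>X\<bar> \<le> M" "s \<ge> 0" for X s y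
    using that by (simp add: abs_mult mult_left_mono)
  have main: "form_s N (f z - c *\<^sub>R z) (f z - c *\<^sub>R z) \<le> (8 * M * e)\<^sup>2 * form_s N z z"
    if "f z - c *\<^sub>R z = (\<alpha>, \<beta>, \<gamma>, \<delta>)" "Y0 \<ge> 0" "Y1 \<ge> 0"
      and b: "\<bar>\<alpha>\<bar> \<le> M * e * (Y0 + Y1)" "\<bar>\<beta>\<bar> \<le> M * e * (e * Y0 + Y1)" "\<bar>\<gamma>\<bar> \<le> M * e * (e * Y0 + Y1)" "\<bar>\<delta>\<bar> \<le> M * e * (Y0 + Y1)"
      and z: "Y0\<^sup>2 + (N - 2) * Y1\<^sup>2 \<le> 4 * form_s N z z" for z c \<alpha> \<beta> \<gamma> \<delta> Y0 Y1
  proof -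
    have "form_s N (f z - c *\<^sub>R z) (f z - c *\<^sub>R z) \<le> 16 * (M * e)\<^sup>2 * (Y0\<^sup>2 + (N - 2) * Y1\<^sup>2)"
      unfolding that(1) by (rule form_s_residual_le[OF e N M0 that(2,3) b])
    also have "\<dots> \<le> 16 * (M * e)\<^sup>2 * (4 * form_s N z z)" by (rule mult_left_mono[OF z]) simp
    finally show ?thesis by (simp add: power_mult_distrib mult_ac)
  qed
  have "\<exists>b l. orthonormal DIM(real \<times> real \<times> real \<times> real) b \<and>
    (\<forall>i<DIM(real \<times> real \<times> real \<times> real). f (b i) = l i *\<^sub>R b i \<and> \<bar>l i - a i\<bar> \<le> 8 * M * e)"
  proof (rule approximate_spectral_theorem[OF sa, where x = v])
    show "8 * M * e \<ge> 0" using M0 e by simp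
    show "\<bar>a i - a j\<bar> > 2 * (8 * M * e)" if "a i \<noteq> a j" for i j
    proof -
      have "\<bar>a i - a j\<bar> \<ge> 2" using that N11 by (auto simp: a_def split: if_splits)
      then show ?thesis using Me by simp
    qed
    fix i assume "i < DIM(real \<times> real \<times> real \<times> real)"
    then have i: "i < 4" by simp
    show "independent_family {j. j < DIM(real \<times> real \<times> real \<times> real) \<and> a j = a i} v"
      unfolding D J[OF i] independent_family_def
      using e i by (auto simp: v_def zero_prod_def split: if_splits)
    fix y :: "nat \<Rightarrow> real"
    define z where "z = (\<Sum>j | j < DIM(real \<times> real \<times> real \<times> real) \<and> a j = a i. y j *\<^sub>R v j)"
    have fz: "f (t *\<^sub>R w) - c *\<^sub>R (t *\<^sub>R w) = t *\<^sub>R (f w - c *\<^sub>R w)" for t c w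
      by (simp add: linear_scale[OF lin] scaleR_diff_right scaleR_left_commute)
    have "form_s N (f z - a i *\<^sub>R z) (f z - a i *\<^sub>R z) \<le> (8 * M * e)\<^sup>2 * form_s N z z"
    proof -
      consider "i < 2" | "i = 2" | "i = 3" using i by linarith
      then show ?thesis
      proof cases
        case 1
        define s where "s = y 0"
        define t where "t = y 1"
        have z: "z = s *\<^sub>R (0, 0, - 2 * e ^ 2, 1) + t *\<^sub>R (- e, e, e ^ 2, 0)"
          unfolding z_def D J[OF i] using 1 by (simp add: v_def s_def t_def)
        then have z': "z = (- (t * e), t * e, - (s * (2 * e ^ 2)) + t * e ^ 2, s)" by simp
        have "f z - 1 *\<^sub>R z = s *\<^sub>R (f (0, 0, - 2 * e ^ 2, 1) - 1 *\<^sub>R (0, 0, - 2 * e ^ 2, 1))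
            + t *\<^sub>R (f (- e, e, e ^ 2, 0) - 1 *\<^sub>R (- e, e, e ^ 2, 0))"
          unfolding z linear_add[OF lin] linear_scale[OF lin] scaleR_add_right scaleR_diff_right scaleR_one by (simp only: add_diff_add)
        also have "\<dots> = (s * (e * x 0 0) + t * (e ^ 2 * x 1 0), s * (e ^ 2 * x 0 1) + t * (e ^ 2 * x 1 1),
            s * (e ^ 2 * x 0 2) + t * (e ^ 2 * x 1 2), s * (e * x 0 3) + t * (e ^ 2 * x 1 3))"
          unfolding r0 r1 by simp
        finally have R: "f z - 1 *\<^sub>R z = (s * (e * x 0 0) + t * (e ^ 2 * x 1 0), s * (e ^ 2 * x 0 1) + t * (e ^ 2 * x 1 1),
            s * (e ^ 2 * x 0 2) + t * (e ^ 2 * x 1 2), s * (e * x 0 3) + t * (e ^ 2 * x 1 3))" .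
        have "a i = 1" using 1 by (auto simp: a_def)
        moreover have "form_s N (f z - 1 *\<^sub>R z) (f z - 1 *\<^sub>R z) \<le> (8 * M * e)\<^sup>2 * form_s N z z"
        proof (rule main[OF R, of "\<bar>s\<bar>" "\<bar>t\<bar> * e"])
          have P: "\<bar>s * (e * X) + t * (e ^ 2 * Y)\<bar> \<le> M * e * (\<bar>s\<bar> + \<bar>t\<bar> * e)" if "\<bar>X\<bar> \<le> M" "\<bar>Y\<bar> \<le> M" for X Y
            using abs_triangle_ineq[of "s * (e * X)" "t * (e ^ 2 * Y)"] mul[OF that(1), of e s] mul[OF that(2), of "e ^ 2" t] e
            by (simp add: power2_eq_square algebra_simps)
          have Q: "\<bar>s * (e ^ 2 * X) + t * (e ^ 2 * Y)\<bar> \<le> M * e * (e * \<bar>s\<bar> + \<bar>t\<bar> * e)" if "\<bar>X\<bar> \<le> M" "\<bar>Y\<bar> \<le> M" for X Y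
            using abs_triangle_ineq[of "s * (e ^ 2 * X)" "t * (e ^ 2 * Y)"] mul[OF that(1), of "e ^ 2" s] mul[OF that(2), of "e ^ 2" t] e
            by (simp add: power2_eq_square algebra_simps)
          show "\<bar>s * (e * x 0 0) + t * (e ^ 2 * x 1 0)\<bar> \<le> M * e * (\<bar>s\<bar> + \<bar>t\<bar> * e)"
            "\<bar>s * (e * x 0 3) + t * (e ^ 2 * x 1 3)\<bar> \<le> M * e * (\<bar>s\<bar> + \<bar>t\<bar> * e)"
            by (rule P[OF M M])+
          show "\<bar>s * (e ^ 2 * x 0 1) + t * (e ^ 2 * x 1 1)\<bar> \<le> M * e * (e * \<bar>s\<bar> + \<bar>t\<bar> * e)"
            "\<bar>s * (e ^ 2 * x 0 2) + t * (e ^ 2 * x 1 2)\<bar> \<le> M * e * (e * \<bar>s\<bar> + \<bar>t\<bar> * e)"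
            by (rule Q[OF M M])+
          \<comment> \<open>Only the squares of \<beta> and \<delta> are kept: the first vector has
            no \<beta> coordinate and the second no \<delta> coordinate, so \<open>s\<close> and
            \<open>t * e\<close> appear unmixed.\<close>
          have g: "form_s N (\<alpha>, \<beta>, \<gamma>, \<delta>) (\<alpha>, \<beta>, \<gamma>, \<delta>) \<ge> (N - 2) * \<beta>\<^sup>2 + \<delta>\<^sup>2" for \<alpha> \<beta> \<gamma> \<delta>
          proof -
            have "(\<alpha> + \<beta> + \<gamma>)\<^sup>2 \<ge> 0" "(N - 2) * \<gamma>\<^sup>2 \<ge> 0" "(\<beta> - \<gamma>)\<^sup>2 \<ge> 0" using N11 by simp_all
            then show ?thesis unfolding form_s_square distrib_left by linarith
          qed
          have "\<bar>s\<bar>\<^sup>2 + (N - 2) * (\<bar>t\<bar> * e)\<^sup>2 \<le> form_s N z z"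
            unfolding z' by (rule order_trans[OF _ g]) (simp add: power_mult_distrib)
          then show "\<bar>s\<bar>\<^sup>2 + (N - 2) * (\<bar>t\<bar> * e)\<^sup>2 \<le> 4 * form_s N z z"
            using nonneg[of z] by linarith
        qed (use e in auto)
        ultimately show ?thesis by (simp only:)
      next
        case 2
        define t where "t = y 2"
        have z: "z = t *\<^sub>R (1, 0, - 3 * e - 9 * e ^ 2, 0)"
          unfolding z_def D J[OF i] using 2 by (simp add: v_def t_def)
        have R: "f z - 3 *\<^sub>R z = (t * (e * x 2 0), t * (e ^ 2 * x 2 1), t * (e ^ 2 * x 2 2), t * (e * x 2 3))"
          unfolding z fz r2 by simp
        have "a i = 3" using 2 by (auto simp: a_def)
        moreover have "form_s N (f z - 3 *\<^sub>R z) (f z - 3 *\<^sub>R z) \<le> (8 * M * e)\<^sup>2 * form_s N z z"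
        proof (rule main[OF R, of "\<bar>t\<bar>" 0])
          show "\<bar>t * (e * x 2 0)\<bar> \<le> M * e * (\<bar>t\<bar> + 0)" "\<bar>t * (e * x 2 3)\<bar> \<le> M * e * (\<bar>t\<bar> + 0)"
            using mul[OF M, of e t] e by (simp_all add: mult_ac)
          show "\<bar>t * (e ^ 2 * x 2 1)\<bar> \<le> M * e * (e * \<bar>t\<bar> + 0)" "\<bar>t * (e ^ 2 * x 2 2)\<bar> \<le> M * e * (e * \<bar>t\<bar> + 0)"
            using mul[OF M, of "e ^ 2" t] by (simp_all add: power2_eq_square mult_ac)
          \<comment> \<open>The sum of the first three coordinates of the vector stays above 1/2 for
            \<open>e \<le> 1/12\<close>, so its squared length is at least 1/4; this accounts for
            the factor 4 in \<open>main\<close>.\<close>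
          have "1 / 2 \<le> 1 - 3 * e - 9 * e ^ 2" using e e2 by simp
          then have "(1 / 2)\<^sup>2 \<le> (1 - 3 * e - 9 * e ^ 2)\<^sup>2" by (rule power_mono) simp
          then have "t\<^sup>2 * 1 \<le> t\<^sup>2 * (4 * (1 - 3 * e - 9 * e ^ 2)\<^sup>2)" by (intro mult_left_mono) (simp_all add: power2_eq_square)
          moreover have "form_s N z z = t\<^sup>2 * form_s N (1, 0, - 3 * e - 9 * e ^ 2, 0) (1, 0, - 3 * e - 9 * e ^ 2, 0)"
            unfolding z scale_left scale_right by (simp add: power2_eq_square)
          moreover have "form_s N (1, 0, - 3 * e - 9 * e ^ 2, 0) (1, 0, - 3 * e - 9 * e ^ 2, 0) \<ge> (1 - 3 * e - 9 * e ^ 2)\<^sup>2"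
          proof -
            have "(N - 2) * (0\<^sup>2 + (- 3 * e - 9 * e ^ 2)\<^sup>2) \<ge> 0" "(0 - (- 3 * e - 9 * e ^ 2))\<^sup>2 \<ge> 0" using N11 by simp_all
            moreover have "(1 + 0 + (- 3 * e - 9 * e ^ 2))\<^sup>2 = (1 - 3 * e - 9 * e ^ 2)\<^sup>2" by (simp add: algebra_simps)
            ultimately show ?thesis unfolding form_s_square by simp
          qed
          then have "t\<^sup>2 * form_s N (1, 0, - 3 * e - 9 * e ^ 2, 0) (1, 0, - 3 * e - 9 * e ^ 2, 0) \<ge> t\<^sup>2 * (1 - 3 * e - 9 * e ^ 2)\<^sup>2"
            by (rule mult_left_mono) simp
          ultimately show "\<bar>t\<bar>\<^sup>2 + (N - 2) * 0\<^sup>2 \<le> 4 * form_s N z z" by simp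
        qed auto
        ultimately show ?thesis by (simp only:)
      next
        case 3
        define t where "t = y 3"
        have z: "z = t *\<^sub>R (2 * e + 12 * e ^ 2, 0, e, 2 * e ^ 2)"
          unfolding z_def D J[OF i] using 3 by (simp add: v_def t_def)
        have R: "f z - (N / 2 + 5) *\<^sub>R z = (t * (e ^ 2 * x 3 0), t * (e ^ 2 * x 3 1), t * (e ^ 2 * x 3 2), t * (e ^ 2 * x 3 3))"
          unfolding z fz r3 by simp
        have "a i = N / 2 + 5" using 3 by (auto simp: a_def)
        moreover have "form_s N (f z - (N / 2 + 5) *\<^sub>R z) (f z - (N / 2 + 5) *\<^sub>R z) \<le> (8 * M * e)\<^sup>2 * form_s N z z"
        proof (rule main[OF R, of 0 "\<bar>t\<bar> * e"])
          show "\<bar>t * (e ^ 2 * x 3 0)\<bar> \<le> M * e * (0 + \<bar>t\<bar> * e)" "\<bar>t * (e ^ 2 * x 3 3)\<bar> \<le> M * e * (0 + \<bar>t\<bar> * e)"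
            "\<bar>t * (e ^ 2 * x 3 1)\<bar> \<le> M * e * (e * 0 + \<bar>t\<bar> * e)" "\<bar>t * (e ^ 2 * x 3 2)\<bar> \<le> M * e * (e * 0 + \<bar>t\<bar> * e)"
            using mul[OF M, of "e ^ 2" t] by (simp_all add: power2_eq_square mult_ac)
          have "(N - 2) * e\<^sup>2 \<le> form_s N (2 * e + 12 * e ^ 2, 0, e, 2 * e ^ 2) (2 * e + 12 * e ^ 2, 0, e, 2 * e ^ 2)"
            unfolding form_s_square by simp
          then have "t\<^sup>2 * ((N - 2) * e\<^sup>2) \<le> t\<^sup>2 * form_s N (2 * e + 12 * e ^ 2, 0, e, 2 * e ^ 2) (2 * e + 12 * e ^ 2, 0, e, 2 * e ^ 2)"
            by (rule mult_left_mono) simp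
          also have "\<dots> = form_s N z z"
            unfolding z scale_left scale_right by (simp add: power2_eq_square)
          finally show "0\<^sup>2 + (N - 2) * (\<bar>t\<bar> * e)\<^sup>2 \<le> 4 * form_s N z z"
            using nonneg[of z] by (simp add: power_mult_distrib mult_ac)
        qed (use e in auto)
        ultimately show ?thesis by (simp only:)
      qed
    qed
    then show "let z = (\<Sum>j | j < DIM(real \<times> real \<times> real \<times> real) \<and> a j = a i. y j *\<^sub>R v j) in
      form_s N (f z - a i *\<^sub>R z) (f z - a i *\<^sub>R z) \<le> (8 * M * e)\<^sup>2 * form_s N z z"
      unfolding Let_def z_def .
  qed
  then show ?thesis by (simp only: D)
qed

text \<open>The three targets are distinct, the two large ones differing by the constant 4, so
  single vectors suffice. The first two vectors have length about \<open>e\<close> and need a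
  \<beta> residual of order \<open>e^3\<close> against the weight \<open>N\<close>; the third has
  length about \<open>sqrt N * e\<close>, and \<open>e^2\<close> is enough.\<close>

lemma approximate_spectrum_t:
  assumes sa: "inner_form.self_adjoint (form_t N) f"
    and e: "0 < e" "e \<le> 1/12" and N: "N = 1 / e - 1" and M: "\<And>i j. \<bar>x i j\<bar> \<le> M" and Me: "8 * M * e < 1"
    and r0: "f (e, - 3 * e ^ 2 - 9 * e ^ 3, - 2 * e ^ 2) - 3 *\<^sub>R (e, - 3 * e ^ 2 - 9 * e ^ 3, - 2 * e ^ 2) = (e ^ 2 * x 0 0, e ^ 3 * x 0 1, e ^ 2 * x 0 2)"
    and r1: "f (0, - (e ^ 2), e) - (N / 2 + 1) *\<^sub>R (0, - (e ^ 2), e) = (e ^ 2 * x 1 0, e ^ 3 * x 1 1, e ^ 2 * x 1 2)"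
    and r2: "f (2 * e + 14 * e ^ 2, e, e) - (N / 2 + 5) *\<^sub>R (2 * e + 14 * e ^ 2, e, e) = (e ^ 2 * x 2 0, e ^ 2 * x 2 1, e ^ 2 * x 2 2)"
  defines "a \<equiv> \<lambda>i::nat. if i = 0 then 3 else if i = 1 then N / 2 + 1 else N / 2 + 5"
  shows "\<exists>b l. inner_form.orthonormal (form_t N) 3 b \<and> (\<forall>i<3. f (b i) = l i *\<^sub>R b i \<and> \<bar>l i - a i\<bar> \<le> 8 * M * e)"
proof -
  have N11: "N \<ge> 11" "N * e = 1 - e" using e by (simp_all add: N field_simps)
  have M0: "M \<ge> 0" using M[of 0 0] by (rule order_trans[OF abs_ge_zero])
  interpret inner_form "form_t N" by (rule inner_form_t) (use N11 in simp)
  have lin: "linear f" using sa by (simp add: self_adjoint_def)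
  have D: "DIM(real \<times> real \<times> real) = 3" by simp
  define v where "v = (\<lambda>i::nat. if i = 0 then (e, - 3 * e ^ 2 - 9 * e ^ 3, - 2 * e ^ 2) else if i = 1 then (0, - (e ^ 2), e)
    else (2 * e + 14 * e ^ 2, e, e))"
  have e2: "e ^ 2 \<le> e / 12" using e mult_left_mono[of e "1/12" e] by (simp add: power2_eq_square)
  have J: "{j. j < 3 \<and> a j = a i} = {i}" if "i < 3" for i
    using that N11 by (auto simp: a_def less_Suc_eq numeral_eq_Suc)
  have mul: "\<bar>y * (s * X)\<bar> \<le> \<bar>y\<bar> * (s * M)" if "\<bar>X\<bar> \<le> M" "s \<ge> 0" for X s y
    using that by (simp add: abs_mult mult_left_mono)
  have main: "form_t N (f z - c *\<^sub>R z) (f z - c *\<^sub>R z) \<le> (8 * M * e)\<^sup>2 * form_t N z z"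
    if zt: "z = t *\<^sub>R w" and R: "f w - c *\<^sub>R w = (\<alpha>, \<beta>, \<delta>)" "Y0 \<ge> 0" "Y1 \<ge> 0"
      and b: "\<bar>t * \<alpha>\<bar> \<le> M * e * (Y0 + Y1)" "\<bar>t * \<beta>\<bar> \<le> M * e * (e * Y0 + Y1)" "\<bar>t * \<delta>\<bar> \<le> M * e * (Y0 + Y1)"
      and w: "Y0\<^sup>2 + (N - 2) * Y1\<^sup>2 \<le> t\<^sup>2 * (4 * form_t N w w)" for z w c t \<alpha> \<beta> \<delta> Y0 Y1
  proof -
    have "f z - c *\<^sub>R z = t *\<^sub>R (f w - c *\<^sub>R w)"
      by (simp add: zt linear_scale[OF lin] scaleR_diff_right scaleR_left_commute)
    then have R': "f z - c *\<^sub>R z = (t * \<alpha>, t * \<beta>, t * \<delta>)" by (simp add: R)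
    have "form_t N (f z - c *\<^sub>R z) (f z - c *\<^sub>R z) \<le> 16 * (M * e)\<^sup>2 * (Y0\<^sup>2 + (N - 2) * Y1\<^sup>2)"
      unfolding R' by (rule form_t_residual_le[OF e N M0 R(2,3) b])
    also have "\<dots> \<le> 16 * (M * e)\<^sup>2 * (t\<^sup>2 * (4 * form_t N w w))" by (rule mult_left_mono[OF w]) simp
    also have "\<dots> = (8 * M * e)\<^sup>2 * form_t N z z"
      unfolding zt scale_left scale_right by (simp add: power_mult_distrib power2_eq_square mult_ac)
    finally show ?thesis .
  qed
  have "\<exists>b l. orthonormal DIM(real \<times> real \<times> real) b \<and>
    (\<forall>i<DIM(real \<times> real \<times> real). f (b i) = l i *\<^sub>R b i \<and> \<bar>l i - a i\<bar> \<le> 8 * M * e)"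
  proof (rule approximate_spectral_theorem[OF sa, where x = v])
    show "8 * M * e \<ge> 0" using M0 e by simp
    show "\<bar>a i - a j\<bar> > 2 * (8 * M * e)" if "a i \<noteq> a j" for i j
    proof -
      have "\<bar>a i - a j\<bar> \<ge> 2" using that N11 by (auto simp: a_def split: if_splits)
      then show ?thesis using Me by simp
    qed
    fix i assume "i < DIM(real \<times> real \<times> real)"
    then have i: "i < 3" by simp
    show "independent_family {j. j < DIM(real \<times> real \<times> real) \<and> a j = a i} v"
      unfolding D J[OF i] independent_family_def
      using e i by (auto simp: v_def zero_prod_def split: if_splits)
    fix y :: "nat \<Rightarrow> real"
    define t where "t = y i"
    define z where "z = (\<Sum>j | j < DIM(real \<times> real \<times> real) \<and> a j = a i. y j *\<^sub>R v j)"
    have z: "z = t *\<^sub>R v i" unfolding z_def D J[OF i] by (simp add: t_def)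
    have mul2: "\<bar>t * (e ^ 2 * X)\<bar> \<le> M * e * (\<bar>t\<bar> * e)" "\<bar>t * (e ^ 3 * X)\<bar> \<le> M * e * (e * (\<bar>t\<bar> * e))" if "\<bar>X\<bar> \<le> M" for X
      using mul[OF that, of "e ^ 2" t] mul[OF that, of "e ^ 3" t] e by (simp_all add: power2_eq_square power3_eq_cube mult_ac)
    have "form_t N (f z - a i *\<^sub>R z) (f z - a i *\<^sub>R z) \<le> (8 * M * e)\<^sup>2 * form_t N z z"
    proof -
      consider "i = 0" | "i = 1" | "i = 2" using i by linarith
      then show ?thesis
      proof cases
        case 1
        have c: "v i = (e, - 3 * e ^ 2 - 9 * e ^ 3, - 2 * e ^ 2)" "a i = 3" using 1 by (simp_all add: v_def a_def)
        show ?thesis unfolding c(2)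
        proof (rule main[OF z[unfolded c(1)] r0, of "\<bar>t\<bar> * e" 0])
          have "1 / 2 \<le> 1 - 3 * e - 9 * e ^ 2" using e e2 by simp
          then have "e * (1 / 2) \<le> e * (1 - 3 * e - 9 * e ^ 2)" using e by (intro mult_left_mono) auto
          then have "e / 2 \<le> e + (- 3 * e ^ 2 - 9 * e ^ 3)" by (simp add: power2_eq_square power3_eq_cube algebra_simps)
          then have "(e / 2)\<^sup>2 \<le> (e + (- 3 * e ^ 2 - 9 * e ^ 3))\<^sup>2" using e by (intro power_mono) auto
          then have "e\<^sup>2 / 4 \<le> (e + (- 3 * e ^ 2 - 9 * e ^ 3))\<^sup>2" by (simp add: power_divide)
          moreover have "(N - 1) * (- 3 * e ^ 2 - 9 * e ^ 3)\<^sup>2 \<ge> 0" "(- 2 * e ^ 2)\<^sup>2 \<ge> 0" using N11 by simp_all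
          ultimately have "e\<^sup>2 / 4 + 0 + 0 \<le> form_t N (e, - 3 * e ^ 2 - 9 * e ^ 3, - 2 * e ^ 2) (e, - 3 * e ^ 2 - 9 * e ^ 3, - 2 * e ^ 2)"
            unfolding form_t_square by (intro add_mono)
          then have "e\<^sup>2 \<le> 4 * form_t N (e, - 3 * e ^ 2 - 9 * e ^ 3, - 2 * e ^ 2) (e, - 3 * e ^ 2 - 9 * e ^ 3, - 2 * e ^ 2)"
            by simp
          from mult_left_mono[OF this, of "t\<^sup>2"]
          show "(\<bar>t\<bar> * e)\<^sup>2 + (N - 2) * 0\<^sup>2 \<le> t\<^sup>2 * (4 * form_t N (e, - 3 * e ^ 2 - 9 * e ^ 3, - 2 * e ^ 2) (e, - 3 * e ^ 2 - 9 * e ^ 3, - 2 * e ^ 2))"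
            by (simp add: power_mult_distrib)
        qed (use e mul2[OF M] in simp_all)
      next
        case 2
        have c: "v i = (0, - (e ^ 2), e)" "a i = N / 2 + 1" using 2 by (simp_all add: v_def a_def)
        show ?thesis unfolding c(2)
        proof (rule main[OF z[unfolded c(1)] r1, of "\<bar>t\<bar> * e" 0])
          have "0 + 0 + e\<^sup>2 / 4 \<le> form_t N (0, - (e ^ 2), e) (0, - (e ^ 2), e)"
            unfolding form_t_square using N11 by (intro add_mono) auto
          then have "e\<^sup>2 \<le> 4 * form_t N (0, - (e ^ 2), e) (0, - (e ^ 2), e)" by simp
          from mult_left_mono[OF this, of "t\<^sup>2"]
          show "(\<bar>t\<bar> * e)\<^sup>2 + (N - 2) * 0\<^sup>2 \<le> t\<^sup>2 * (4 * form_t N (0, - (e ^ 2), e) (0, - (e ^ 2), e))"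
            by (simp add: power_mult_distrib)
        qed (use e mul2[OF M] in simp_all)
      next
        case 3
        have c: "v i = (2 * e + 14 * e ^ 2, e, e)" "a i = N / 2 + 5" using 3 by (simp_all add: v_def a_def)
        show ?thesis unfolding c(2)
        proof (rule main[OF z[unfolded c(1)] r2, of 0 "\<bar>t\<bar> * e"])
          have "0 + (N - 2) / 4 * e\<^sup>2 + 0 \<le> form_t N (2 * e + 14 * e ^ 2, e, e) (2 * e + 14 * e ^ 2, e, e)"
            unfolding form_t_square using N11 by (intro add_mono mult_right_mono) auto
          then have "(N - 2) * e\<^sup>2 \<le> 4 * form_t N (2 * e + 14 * e ^ 2, e, e) (2 * e + 14 * e ^ 2, e, e)" by simp
          from mult_left_mono[OF this, of "t\<^sup>2"]
          show "0\<^sup>2 + (N - 2) * (\<bar>t\<bar> * e)\<^sup>2 \<le> t\<^sup>2 * (4 * form_t N (2 * e + 14 * e ^ 2, e, e) (2 * e + 14 * e ^ 2, e, e))"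
            by (simp add: power_mult_distrib mult_ac)
        qed (use e mul2[OF M] in simp_all)
      qed
    qed
    then show "let z = (\<Sum>j | j < DIM(real \<times> real \<times> real) \<and> a j = a i. y j *\<^sub>R v j) in
      form_t N (f z - a i *\<^sub>R z) (f z - a i *\<^sub>R z) \<le> (8 * M * e)\<^sup>2 * form_t N z z"
      unfolding Let_def z_def .
  qed
  then show ?thesis by (simp only: D)
qed

text \<open>The last row is the only zero row, and \<open>r \<noteq> 0\<close> detects it, so
  \<open>g\<close> fixes \<open>n\<close>. If \<open>h\<close> moved the last column into the block,
  a block column would be constant, equal to \<open>r\<close>, which \<open>p \<noteq> 0\<close>
  excludes because \<open>n \<ge> 2\<close> provides an off-diagonal entry. The diagonal entries
  \<open>p + q\<close> then force \<open>g = h\<close>.\<close>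

lemma isotropy_D2:
  assumes n: "n \<ge> 2" and p: "p \<noteq> 0" and r: "r \<noteq> 0"
  shows "isotropy (Suc n) (D2 n p q r) = Diag (Sym_fix_last (Suc n))"
proof (intro equalityI subsetI)
  fix x assume "x \<in> isotropy (Suc n) (D2 n p q r)"
  then obtain g h where x: "x = (g, h)" and gh: "g \<in> Sym (Suc n)" "h \<in> Sym (Suc n)"
    and "act (g, h) (D2 n p q r) = D2 n p q r"
    by (auto simp: isotropy_def)
  then have inv: "D2 n p q r (g i) (h j) = D2 n p q r i j" for i j
    by (simp add: act_eq_iff)
  have range: "g i < Suc n" "h i < Suc n" if "i < Suc n" for i
    using Sym_apply_less gh that by auto
  have gn: "g n = n"
  proof (rule ccontr)
    assume "g n \<noteq> n"
    then have "g n < n" using range(1)[of n] by simp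
    obtain j where "h j = n"
      using permutes_surj[of h "{..<Suc n}"] gh(2) by (auto simp: Sym_def dest!: surjD[of h n])
    then have "D2 n p q r n j = r" using inv[of n j] \<open>g n < n\<close> by (simp add: D2_apply)
    then show False using r by (simp add: D2_apply)
  qed
  have g: "g i < n" if "i < n" for i
  proof -
    have "inj g" using gh(1) permutes_inj by (auto simp: Sym_def)
    then have "g i \<noteq> n" using gn that injD[of g i n] by auto
    then show ?thesis using range(1)[of i] that by simp
  qed
  have hn: "h n = n"
  proof (rule ccontr)
    assume "h n \<noteq> n"
    then have hn: "h n < n" using range(2)[of n] by simp
    have surj: "\<exists>i<n. g i = k" if "k < n" for k
    proof -
      obtain i where i: "g i = k"
        using permutes_surj[of g "{..<Suc n}"] gh(1) by (auto simp: Sym_def dest!: surjD[of g k])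
      have "i < Suc n" using i that Sym_apply_outside[OF gh(1), of i] by (cases "i < Suc n") auto
      moreover have "i \<noteq> n" using i gn that by auto
      ultimately show ?thesis using i by (intro exI[of _ i]) auto
    qed
    have val: "D2 n p q r k (h n) = r" if k: "k < n" for k
    proof -
      obtain i where "i < n" "g i = k" using surj[OF k] by blast
      then show ?thesis using inv[of i n] by (simp add: D2_apply)
    qed
    define k where "k = (if h n = 0 then 1 else 0 :: nat)"
    have k: "k < n" "k \<noteq> h n" using n by (auto simp: k_def)
    have "p + q = r" using val[OF hn] hn by (simp add: D2_apply)
    moreover have "q = r" using val[OF k(1)] k hn by (simp add: D2_apply)
    ultimately show False using p by simp
  qed
  have h: "h i < n" if "i < n" for i
  proof -
    have "inj h" using gh(2) permutes_inj by (auto simp: Sym_def)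
    then have "h i \<noteq> n" using hn that injD[of h i n] by auto
    then show ?thesis using range(2)[of i] that by simp
  qed
  have "g i = h i" for i
  proof -
    consider "i < n" | "i = n" | "\<not> i < Suc n" by linarith
    then show ?thesis
    proof cases
      case 1
      then have "(if h i = g i then p else 0) + q = p + q"
        using inv[of i i] g[OF 1] h[OF 1] by (simp add: D2_apply)
      then show ?thesis using p by (auto split: if_splits)
    next
      case 3
      then show ?thesis using Sym_apply_outside[OF gh(1)] Sym_apply_outside[OF gh(2)] by simp
    qed (simp add: gn hn)
  qed
  then have "g = h" by blast
  then show "x \<in> Diag (Sym_fix_last (Suc n))"
    using gh hn by (simp add: x Diag_def Sym_fix_last_def)
next
  fix x assume "x \<in> Diag (Sym_fix_last (Suc n))"
  then obtain g where x: "x = (g, g)" and g: "g \<in> Sym (Suc n)" "g n = n"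
    by (auto simp: Diag_def Sym_fix_last_def)
  have inj: "g i = g j \<longleftrightarrow> i = j" for i j
    using permutes_inj[of g "{..<Suc n}"] g(1) by (simp add: Sym_def inj_eq)
  have lt: "g i < n \<longleftrightarrow> i < n" for i
  proof (cases "i < Suc n")
    case True
    then have "g i < Suc n" using Sym_apply_less[OF g(1)] by blast
    moreover have "g i = n \<longleftrightarrow> i = n" using inj[of i n] g(2) by simp
    ultimately show ?thesis using True by linarith
  next
    case False
    then show ?thesis using Sym_apply_outside[OF g(1)] by simp
  qed
  have eqn: "g i = n \<longleftrightarrow> i = n" for i using inj[of i n] g(2) by simp
  have "D2 n p q r (g i) (g j) = D2 n p q r i j" for i j
  proof -
    have D: "D2 n p q r i j = (if i < n \<and> j < n then (if j = i then p else 0) + q else if i < n \<and> j = n then r else 0)" for i j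
      by (auto simp: D2_def Xi_def)
    show ?thesis unfolding D lt eqn inj ..
  qed
  then show "x \<in> isotropy (Suc n) (D2 n p q r)"
    using g by (simp add: x isotropy_def act_eq_iff)
qed

lemma card_orbit_D2:
  assumes "n \<ge> 2" "p \<noteq> 0" "r \<noteq> 0"
  shows "card (orbit (Suc n) (D2 n p q r)) = Suc n * fact (Suc n)"
proof -
  have "card (Diag (Sym_fix_last (Suc n))) = fact n"
    by (simp add: card_Diag Sym_fix_last_eq card_Sym)
  then have "card (orbit (Suc n) (D2 n p q r)) * fact n = fact (Suc n) * fact (Suc n)"
    using card_orbit_isotropy[of "Suc n" "D2 n p q r"] by (simp add: isotropy_D2[OF assms] del: fact_Suc)
  also have "\<dots> = (Suc n * fact (Suc n)) * fact n" by (simp add: algebra_simps)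
  finally show ?thesis by simp
qed

text \<open>The table of residual coefficients is finite; filling it up with zeros lets one constant
  serve all indices, the form in which the approximate spectra use it.\<close>

lemma uniform_bound:
  fixes x :: "nat \<Rightarrow> nat \<Rightarrow> nat \<Rightarrow> real"
  assumes B: "\<And>i j. Bseq (\<lambda>d. x d i j)" and 0: "\<And>d i j. k \<le> i \<or> k \<le> j \<Longrightarrow> x d i j = 0"
  shows "\<exists>M>0. \<forall>d i j. \<bar>x d i j\<bar> \<le> M"
proof -
  have "\<forall>i j. \<exists>K. \<forall>d. \<bar>x d i j\<bar> \<le> K"
  proof (intro allI)
    show "\<exists>K. \<forall>d. \<bar>x d i j\<bar> \<le> K" for i j using B[of i j] by (auto simp: Bseq_def)
  qed
  then obtain K where K: "\<And>d i j. \<bar>x d i j\<bar> \<le> K i j" by metis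
  have nn: "0 \<le> K i j" for i j using K[of 0 i j] by linarith
  have "\<bar>x d i j\<bar> \<le> 1 + (\<Sum>i<k. \<Sum>j<k. K i j)" for d i j
  proof (cases "i < k \<and> j < k")
    case True
    have "K i j \<le> (\<Sum>j<k. K i j)" by (rule member_le_sum) (use True nn in auto)
    also have "\<dots> \<le> (\<Sum>i<k. \<Sum>j<k. K i j)"
      by (rule member_le_sum[where f = "\<lambda>i. \<Sum>j<k. K i j"]) (use True nn in \<open>auto intro: sum_nonneg\<close>)
    finally show ?thesis using K[of d i j] by linarith
  next
    case False
    then show ?thesis using 0[of i j d] by (simp add: nn sum_nonneg not_less add_nonneg_nonneg)
  qed
  moreover have "1 + (\<Sum>i<k. \<Sum>j<k. K i j) > 0" using nn by (simp add: add_pos_nonneg sum_nonneg)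
  ultimately show ?thesis by blast
qed

text \<open>The sequences are the ones that occur in the residual formulas. For the third family,
  \<open>a\<close> stands for the difference of the rescaled diagonal and off-diagonal entries,
  \<open>c\<close> for the remainder \<open>w\<close>, and \<open>g\<close>, \<open>h\<close> for
  the rescaled inner products of the rows.\<close>

lemma eventually_spectrum_s:
  fixes e a b c g h N :: "nat \<Rightarrow> real"
  assumes lim: "e \<longlonglongrightarrow> 0" "a \<longlonglongrightarrow> a0" "b \<longlonglongrightarrow> b0" "c \<longlonglongrightarrow> c0" "g \<longlonglongrightarrow> g0" "h \<longlonglongrightarrow> h0"
    and e: "\<forall>\<^sub>F d in sequentially. e d > 0" and N: "\<And>d. N d = 1 / e d - 1"
  defines "f \<equiv> \<lambda>d. hess_s (N d) (1 + e d ^ 3 * a d) (e d ^ 3 * b d) (e d - (e d)\<^sup>2 + e d ^ 3 * c d) (1 + (e d)\<^sup>2 * g d) ((e d)\<^sup>2 * h d)"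
  shows "\<exists>K. \<forall>\<^sub>F d in sequentially. \<exists>v l. inner_form.orthonormal (form_s (N d)) 4 v \<and>
    (\<forall>i<4. f d (v i) = l i *\<^sub>R v i \<and> \<bar>l i - [1, 1, 3, N d / 2 + 5] ! i\<bar> \<le> K * e d)"
proof -
  \<comment> \<open>The witnesses are the bracketed polynomials of \<open>hess_residual_s1\<close>,
    found by unification. Being polynomials in convergent sequences, they are bounded. The same
    device handles the other vectors.\<close>
  have "\<exists>Q0 Q1 Q2 Q3. (\<forall>d. N d * e d = 1 - e d \<longrightarrow> f d (0, 0, - 2 * e d ^ 2, 1) - 1 *\<^sub>R (0, 0, - 2 * e d ^ 2, 1) =
      (e d * Q0 d, e d ^ 2 * Q1 d, e d ^ 2 * Q2 d, e d * Q3 d)) \<and> Bseq Q0 \<and> Bseq Q1 \<and> Bseq Q2 \<and> Bseq Q3"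
    unfolding f_def
    by (intro exI conjI allI impI, rule hess_residual_s1, assumption) ((rule convergent_imp_Bseq, rule convergentI, (rule tendsto_const lim tendsto_add tendsto_diff tendsto_mult tendsto_power tendsto_minus)+)+)
  then obtain Q00 Q01 Q02 Q03 where
    r0: "\<And>d. N d * e d = 1 - e d \<Longrightarrow> f d (0, 0, - 2 * e d ^ 2, 1) - 1 *\<^sub>R (0, 0, - 2 * e d ^ 2, 1) =
      (e d * Q00 d, e d ^ 2 * Q01 d, e d ^ 2 * Q02 d, e d * Q03 d)"
    and B0: "Bseq Q00" "Bseq Q01" "Bseq Q02" "Bseq Q03" by blast
  have "\<exists>Q0 Q1 Q2 Q3. (\<forall>d. N d * e d = 1 - e d \<longrightarrow> f d (- e d, e d, e d ^ 2, 0) - 1 *\<^sub>R (- e d, e d, e d ^ 2, 0) =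
      (e d ^ 2 * Q0 d, e d ^ 2 * Q1 d, e d ^ 2 * Q2 d, e d ^ 2 * Q3 d)) \<and> Bseq Q0 \<and> Bseq Q1 \<and> Bseq Q2 \<and> Bseq Q3"
    unfolding f_def
    by (intro exI conjI allI impI, rule hess_residual_s2, assumption) ((rule convergent_imp_Bseq, rule convergentI, (rule tendsto_const lim tendsto_add tendsto_diff tendsto_mult tendsto_power tendsto_minus)+)+)
  then obtain Q10 Q11 Q12 Q13 where
    r1: "\<And>d. N d * e d = 1 - e d \<Longrightarrow> f d (- e d, e d, e d ^ 2, 0) - 1 *\<^sub>R (- e d, e d, e d ^ 2, 0) =
      (e d ^ 2 * Q10 d, e d ^ 2 * Q11 d, e d ^ 2 * Q12 d, e d ^ 2 * Q13 d)"
    and B1: "Bseq Q10" "Bseq Q11" "Bseq Q12" "Bseq Q13" by blast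
  have "\<exists>Q0 Q1 Q2 Q3. (\<forall>d. N d * e d = 1 - e d \<longrightarrow> f d (1, 0, - 3 * e d - 9 * e d ^ 2, 0) - 3 *\<^sub>R (1, 0, - 3 * e d - 9 * e d ^ 2, 0) =
      (e d * Q0 d, e d ^ 2 * Q1 d, e d ^ 2 * Q2 d, e d * Q3 d)) \<and> Bseq Q0 \<and> Bseq Q1 \<and> Bseq Q2 \<and> Bseq Q3"
    unfolding f_def
    by (intro exI conjI allI impI, rule hess_residual_s3, assumption) ((rule convergent_imp_Bseq, rule convergentI, (rule tendsto_const lim tendsto_add tendsto_diff tendsto_mult tendsto_power tendsto_minus)+)+)
  then obtain Q20 Q21 Q22 Q23 where
    r2: "\<And>d. N d * e d = 1 - e d \<Longrightarrow> f d (1, 0, - 3 * e d - 9 * e d ^ 2, 0) - 3 *\<^sub>R (1, 0, - 3 * e d - 9 * e d ^ 2, 0) =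
      (e d * Q20 d, e d ^ 2 * Q21 d, e d ^ 2 * Q22 d, e d * Q23 d)"
    and B2: "Bseq Q20" "Bseq Q21" "Bseq Q22" "Bseq Q23" by blast
  have "\<exists>Q0 Q1 Q2 Q3. (\<forall>d. N d * e d = 1 - e d \<longrightarrow> f d (2 * e d + 12 * e d ^ 2, 0, e d, 2 * e d ^ 2) - (N d / 2 + 5) *\<^sub>R (2 * e d + 12 * e d ^ 2, 0, e d, 2 * e d ^ 2) =
      (e d ^ 2 * Q0 d, e d ^ 2 * Q1 d, e d ^ 2 * Q2 d, e d ^ 2 * Q3 d)) \<and> Bseq Q0 \<and> Bseq Q1 \<and> Bseq Q2 \<and> Bseq Q3"
    unfolding f_def
    by (intro exI conjI allI impI, rule hess_residual_s4, assumption) ((rule convergent_imp_Bseq, rule convergentI, (rule tendsto_const lim tendsto_add tendsto_diff tendsto_mult tendsto_power tendsto_minus)+)+)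
  then obtain Q30 Q31 Q32 Q33 where
    r3: "\<And>d. N d * e d = 1 - e d \<Longrightarrow> f d (2 * e d + 12 * e d ^ 2, 0, e d, 2 * e d ^ 2) - (N d / 2 + 5) *\<^sub>R (2 * e d + 12 * e d ^ 2, 0, e d, 2 * e d ^ 2) =
      (e d ^ 2 * Q30 d, e d ^ 2 * Q31 d, e d ^ 2 * Q32 d, e d ^ 2 * Q33 d)"
    and B3: "Bseq Q30" "Bseq Q31" "Bseq Q32" "Bseq Q33" by blast
  define x where "x = (\<lambda>d i j. if i < 4 \<and> j < 4 then [[Q00 d, Q01 d, Q02 d, Q03 d], [Q10 d, Q11 d, Q12 d, Q13 d], [Q20 d, Q21 d, Q22 d, Q23 d], [Q30 d, Q31 d, Q32 d, Q33 d]] ! i ! j else 0)"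
  have "\<exists>M>0. \<forall>d i j. \<bar>x d i j\<bar> \<le> M"
  proof (rule uniform_bound)
    show "x d i j = 0" if "4 \<le> i \<or> 4 \<le> j" for d i j using that by (auto simp: x_def)
    show "Bseq (\<lambda>d. x d i j)" for i j
    proof (cases "i < 4 \<and> j < 4")
      case True
      then have "i = 0 \<or> i = 1 \<or> i = 2 \<or> i = 3" by linarith
      moreover have "j = 0 \<or> j = 1 \<or> j = 2 \<or> j = 3" using True by linarith
      ultimately show ?thesis using B0 B1 B2 B3 by (elim disjE) (simp_all add: x_def numeral_eq_Suc)
    next
      case False
      then have "(\<lambda>d. x d i j) = (\<lambda>d. 0)" by (auto simp: x_def)
      then show ?thesis by (simp add: Bseq_def exI[of _ 1])
    qed
  qed
  then obtain M where M: "M > 0" "\<And>d i j. \<bar>x d i j\<bar> \<le> M" by blast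
  have "\<forall>\<^sub>F d in sequentially. e d < min (1/12) (1 / (8 * M))"
    using lim(1) by (rule order_tendstoD) (use M in simp)
  then have "\<forall>\<^sub>F d in sequentially. \<exists>v l. inner_form.orthonormal (form_s (N d)) 4 v \<and>
    (\<forall>i<4. f d (v i) = l i *\<^sub>R v i \<and> \<bar>l i - [1, 1, 3, N d / 2 + 5] ! i\<bar> \<le> 8 * M * e d)"
    using e
  proof eventually_elim
    case (elim d)
    then have ed: "e d > 0" "e d \<le> 1/12" "8 * M * e d < 1" using M(1) by (auto simp: field_simps)
    have Ne: "N d * e d = 1 - e d" using ed by (simp add: N field_simps)
    have x: "Q00 d = x d 0 0" "Q01 d = x d 0 1" "Q02 d = x d 0 2" "Q03 d = x d 0 3" "Q10 d = x d 1 0" "Q11 d = x d 1 1" "Q12 d = x d 1 2" "Q13 d = x d 1 3" "Q20 d = x d 2 0" "Q21 d = x d 2 1" "Q22 d = x d 2 2" "Q23 d = x d 2 3" "Q30 d = x d 3 0" "Q31 d = x d 3 1" "Q32 d = x d 3 2" "Q33 d = x d 3 3"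
      by (simp_all add: x_def numeral_eq_Suc)
    have "N d > 2" using ed by (simp add: N field_simps)
    then have sa: "inner_form.self_adjoint (form_s (N d)) (f d)" unfolding f_def by (rule self_adjoint_hess_s)
    obtain v l where vl: "inner_form.orthonormal (form_s (N d)) 4 v"
      "\<And>i. i < 4 \<Longrightarrow> f d (v i) = l i *\<^sub>R v i \<and> \<bar>l i - (if i = 0 \<or> i = 1 then 1 else if i = 2 then 3 else N d / 2 + 5)\<bar> \<le> 8 * M * e d"
      using approximate_spectrum_s[OF sa ed(1,2) N M(2) ed(3) r0[OF Ne, unfolded x] r1[OF Ne, unfolded x] r2[OF Ne, unfolded x] r3[OF Ne, unfolded x]] by blast
    have "(if i = 0 \<or> i = 1 then 1 else if i = 2 then 3 else N d / 2 + 5) = [1, 1, 3, N d / 2 + 5] ! i" if "i < 4" for i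
      using that by (auto simp: less_Suc_eq numeral_eq_Suc)
    then show ?case using vl by (intro exI[of _ v] exI[of _ l]) auto
  qed
  then show ?thesis by blast
qed

lemma eventually_spectrum_t:
  fixes e a b c g h N :: "nat \<Rightarrow> real"
  assumes lim: "e \<longlonglongrightarrow> 0" "a \<longlonglongrightarrow> a0" "b \<longlonglongrightarrow> b0" "c \<longlonglongrightarrow> c0" "g \<longlonglongrightarrow> g0" "h \<longlonglongrightarrow> h0"
    and e: "\<forall>\<^sub>F d in sequentially. e d > 0" and N: "\<And>d. N d = 1 / e d - 1"
  defines "f \<equiv> \<lambda>d. hess_t (N d) (1 + e d ^ 3 * a d) (e d ^ 3 * b d) (e d - (e d)\<^sup>2 + e d ^ 3 * c d) (1 + (e d)\<^sup>2 * g d) ((e d)\<^sup>2 * h d)"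
  shows "\<exists>K. \<forall>\<^sub>F d in sequentially. \<exists>v l. inner_form.orthonormal (form_t (N d)) 3 v \<and>
    (\<forall>i<3. f d (v i) = l i *\<^sub>R v i \<and> \<bar>l i - [3, N d / 2 + 1, N d / 2 + 5] ! i\<bar> \<le> K * e d)"
proof -
  have "\<exists>Q0 Q1 Q2. (\<forall>d. N d * e d = 1 - e d \<longrightarrow> f d (e d, - 3 * e d ^ 2 - 9 * e d ^ 3, - 2 * e d ^ 2) - 3 *\<^sub>R (e d, - 3 * e d ^ 2 - 9 * e d ^ 3, - 2 * e d ^ 2) =
      (e d ^ 2 * Q0 d, e d ^ 3 * Q1 d, e d ^ 2 * Q2 d)) \<and> Bseq Q0 \<and> Bseq Q1 \<and> Bseq Q2"
    unfolding f_def
    by (intro exI conjI allI impI, rule hess_residual_t1, assumption) ((rule convergent_imp_Bseq, rule convergentI, (rule tendsto_const lim tendsto_add tendsto_diff tendsto_mult tendsto_power tendsto_minus)+)+)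
  then obtain Q00 Q01 Q02 where
    r0: "\<And>d. N d * e d = 1 - e d \<Longrightarrow> f d (e d, - 3 * e d ^ 2 - 9 * e d ^ 3, - 2 * e d ^ 2) - 3 *\<^sub>R (e d, - 3 * e d ^ 2 - 9 * e d ^ 3, - 2 * e d ^ 2) =
      (e d ^ 2 * Q00 d, e d ^ 3 * Q01 d, e d ^ 2 * Q02 d)"
    and B0: "Bseq Q00" "Bseq Q01" "Bseq Q02" by blast
  have "\<exists>Q0 Q1 Q2. (\<forall>d. N d * e d = 1 - e d \<longrightarrow> f d (0, - (e d ^ 2), e d) - (N d / 2 + 1) *\<^sub>R (0, - (e d ^ 2), e d) =
      (e d ^ 2 * Q0 d, e d ^ 3 * Q1 d, e d ^ 2 * Q2 d)) \<and> Bseq Q0 \<and> Bseq Q1 \<and> Bseq Q2"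
    unfolding f_def
    by (intro exI conjI allI impI, rule hess_residual_t2, assumption) ((rule convergent_imp_Bseq, rule convergentI, (rule tendsto_const lim tendsto_add tendsto_diff tendsto_mult tendsto_power tendsto_minus)+)+)
  then obtain Q10 Q11 Q12 where
    r1: "\<And>d. N d * e d = 1 - e d \<Longrightarrow> f d (0, - (e d ^ 2), e d) - (N d / 2 + 1) *\<^sub>R (0, - (e d ^ 2), e d) =
      (e d ^ 2 * Q10 d, e d ^ 3 * Q11 d, e d ^ 2 * Q12 d)"
    and B1: "Bseq Q10" "Bseq Q11" "Bseq Q12" by blast
  have "\<exists>Q0 Q1 Q2. (\<forall>d. N d * e d = 1 - e d \<longrightarrow> f d (2 * e d + 14 * e d ^ 2, e d, e d) - (N d / 2 + 5) *\<^sub>R (2 * e d + 14 * e d ^ 2, e d, e d) =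
      (e d ^ 2 * Q0 d, e d ^ 2 * Q1 d, e d ^ 2 * Q2 d)) \<and> Bseq Q0 \<and> Bseq Q1 \<and> Bseq Q2"
    unfolding f_def
    by (intro exI conjI allI impI, rule hess_residual_t3, assumption) ((rule convergent_imp_Bseq, rule convergentI, (rule tendsto_const lim tendsto_add tendsto_diff tendsto_mult tendsto_power tendsto_minus)+)+)
  then obtain Q20 Q21 Q22 where
    r2: "\<And>d. N d * e d = 1 - e d \<Longrightarrow> f d (2 * e d + 14 * e d ^ 2, e d, e d) - (N d / 2 + 5) *\<^sub>R (2 * e d + 14 * e d ^ 2, e d, e d) =
      (e d ^ 2 * Q20 d, e d ^ 2 * Q21 d, e d ^ 2 * Q22 d)"
    and B2: "Bseq Q20" "Bseq Q21" "Bseq Q22" by blast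
  define x where "x = (\<lambda>d i j. if i < 3 \<and> j < 3 then [[Q00 d, Q01 d, Q02 d], [Q10 d, Q11 d, Q12 d], [Q20 d, Q21 d, Q22 d]] ! i ! j else 0)"
  have "\<exists>M>0. \<forall>d i j. \<bar>x d i j\<bar> \<le> M"
  proof (rule uniform_bound)
    show "x d i j = 0" if "3 \<le> i \<or> 3 \<le> j" for d i j using that by (auto simp: x_def)
    show "Bseq (\<lambda>d. x d i j)" for i j
    proof (cases "i < 3 \<and> j < 3")
      case True
      then have "i = 0 \<or> i = 1 \<or> i = 2" by linarith
      moreover have "j = 0 \<or> j = 1 \<or> j = 2" using True by linarith
      ultimately show ?thesis using B0 B1 B2 by (elim disjE) (simp_all add: x_def numeral_eq_Suc)
    next
      case False
      then have "(\<lambda>d. x d i j) = (\<lambda>d. 0)" by (auto simp: x_def)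
      then show ?thesis by (simp add: Bseq_def exI[of _ 1])
    qed
  qed
  then obtain M where M: "M > 0" "\<And>d i j. \<bar>x d i j\<bar> \<le> M" by blast
  have "\<forall>\<^sub>F d in sequentially. e d < min (1/12) (1 / (8 * M))"
    using lim(1) by (rule order_tendstoD) (use M in simp)
  then have "\<forall>\<^sub>F d in sequentially. \<exists>v l. inner_form.orthonormal (form_t (N d)) 3 v \<and>
    (\<forall>i<3. f d (v i) = l i *\<^sub>R v i \<and> \<bar>l i - [3, N d / 2 + 1, N d / 2 + 5] ! i\<bar> \<le> 8 * M * e d)"
    using e
  proof eventually_elim
    case (elim d)
    then have ed: "e d > 0" "e d \<le> 1/12" "8 * M * e d < 1" using M(1) by (auto simp: field_simps)
    have Ne: "N d * e d = 1 - e d" using ed by (simp add: N field_simps)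
    have x: "Q00 d = x d 0 0" "Q01 d = x d 0 1" "Q02 d = x d 0 2" "Q10 d = x d 1 0" "Q11 d = x d 1 1" "Q12 d = x d 1 2" "Q20 d = x d 2 0" "Q21 d = x d 2 1" "Q22 d = x d 2 2"
      by (simp_all add: x_def numeral_eq_Suc)
    have "N d > 1" using ed by (simp add: N field_simps)
    then have sa: "inner_form.self_adjoint (form_t (N d)) (f d)" unfolding f_def by (rule self_adjoint_hess_t)
    obtain v l where vl: "inner_form.orthonormal (form_t (N d)) 3 v"
      "\<And>i. i < 3 \<Longrightarrow> f d (v i) = l i *\<^sub>R v i \<and> \<bar>l i - (if i = 0 then 3 else if i = 1 then N d / 2 + 1 else N d / 2 + 5)\<bar> \<le> 8 * M * e d"
      using approximate_spectrum_t[OF sa ed(1,2) N M(2) ed(3) r0[OF Ne, unfolded x] r1[OF Ne, unfolded x] r2[OF Ne, unfolded x]] by blast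
    have "(if i = 0 then 3 else if i = 1 then N d / 2 + 1 else N d / 2 + 5) = [3, N d / 2 + 1, N d / 2 + 5] ! i" if "i < 3" for i
      using that by (auto simp: less_Suc_eq numeral_eq_Suc)
    then show ?case using vl by (intro exI[of _ v] exI[of _ l]) auto
  qed
  then show ?thesis by blast
qed

section \<open>Asymptotics of the third family\<close>

lemma tendsto_imp_smallo:
  fixes f :: "nat \<Rightarrow> real"
  assumes "(\<lambda>d. f d * real d ^ k) \<longlonglongrightarrow> 0"
  shows "f \<in> o(\<lambda>d. 1 / real d ^ k)"
proof (rule smalloI_tendsto)
  show "(\<lambda>d. f d / (1 / real d ^ k)) \<longlonglongrightarrow> 0" using assms by simp
  show "\<forall>\<^sub>F d in sequentially. 1 / real d ^ k \<noteq> 0"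
    using eventually_gt_at_top[of 0] by eventually_elim simp
qed

lemma bigo_imp_smallo_spectral:
  fixes f :: "nat \<Rightarrow> real"
  assumes "f \<in> O(\<lambda>d. 1 / real d)"
  shows "f \<in> o(\<lambda>d. real d powr (-2/3))"
  by (rule landau_o.big_small_trans[OF assms]) real_asymp

text \<open>\<open>p\<close> contains \<open>a - b\<close> because it is the diagonal minus the
  off-diagonal entry; thus \<open>p + q = 1 + e^3 * a\<close>, the form in which the reduced system
  is stated.\<close>

lemma stationary_reduced:
  fixes a b c :: real
  assumes d: "d \<ge> 2" and sys: "reduced_system (1 / real d) a b c"
  defines "e \<equiv> 1 / real d"
  defines "p \<equiv> 1 + e ^ 3 * (a - b)" and "q \<equiv> e ^ 3 * b" and "r \<equiv> e * c"
  shows "stationary (d - 1) p q r" "gram (d - 1) p q r = e\<^sup>2 * B2 e a b c"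
    "p\<^sup>2 + gram (d - 1) p q r = 1 + e\<^sup>2 * A2 e a b c"
proof -
  have e: "e \<noteq> 0" using d by (simp add: e_def)
  have n: "real (d - 1) = 1 / e - 1" using d by (simp add: e_def of_nat_diff)
  have x1: "1 + e ^ 3 * a = p + q" by (simp add: p_def q_def algebra_simps)
  note sys = reduced_system_imp[OF e sys[folded e_def], unfolded x1, folded q_def r_def n]
  show B: "gram (d - 1) p q r = e\<^sup>2 * B2 e a b c"
    using sys(2) unfolding gram_def by algebra
  show A: "p\<^sup>2 + gram (d - 1) p q r = 1 + e\<^sup>2 * A2 e a b c"
    using sys(1) unfolding gram_def by algebra
  show "stationary (d - 1) p q r"
    unfolding stationary_def Let_def unfolding A unfolding B using sys(3-5) by (simp add: algebra_simps)
qed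

text \<open>The left side is \<open>15 * (N + 1) - N * (15 + e * U) = 15 - (1 - e) * U\<close>, and
  \<open>U\<close> starts with 9, which leaves the constant 6. The term
  \<open>9 * e * (b + g)\<close> is kept apart because \<open>b + g\<close> tends to
  \<open>- 1 + 1 = 0\<close> along the branch, so the first-order coefficient of the loss is
  18.\<close>

lemma loss_expansion:
  fixes N e a b w g :: real
  assumes N: "N * e = 1 - e"
  defines "x1 \<equiv> 1 + e ^ 3 * a" and "x2 \<equiv> e ^ 3 * b" and "x3 \<equiv> e * (1 - e + e\<^sup>2 * w)" and "A \<equiv> 1 + e\<^sup>2 * g"
  shows "15 * (N + 1) - N * (6 * (x1 ^ 3 + (N - 1) * x2 ^ 3 + x3 ^ 3) + 9 * A * (x1 + (N - 1) * x2 + x3)) =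
    6 + 18 * e - 9 * e * (b + g) + e\<^sup>2 * (- 15 + w * (- 9) + b * 27 + a * (- 27) + e * (24 + w * 9 + g * 18 + b * (- 18 + g * (- 9)) + a * 27 + e * (- 36
        + w * (- 18) + g * (- 9 + w * (- 9)) + b * 27 * g + a * (- 9 * g) + e * (24 + w * 54 + g * 9 * w
        + b * (- 18 * g) + a * (9 * g + a * (- 18)) + e * (- 6 + w * (- 54 + w * (- 18)) + a ^ 2 * 18
        + e * (w * (18 + w * 36) + b ^ 3 * (- 6) + e * (w ^ 2 * (- 18 + w * (- 6)) + b ^ 3 * 18 + a ^ 3 * (- 6)
        + e * (6 * w ^ 3 + b ^ 3 * (- 12) + a ^ 3 * 6))))))))"
    (is "_ = _ + e\<^sup>2 * ?R")
proof -
  define U where "U = 9 + e * (- 9 + g * 9 + b * 9 + e * (6 + w * 9 + g * 9 + b * (- 18) + a * 27 + e * (- 18 + g * (- 9) + b * 9 * g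
        + e * (18 + w * 18 + g * 9 * w + b * (- 18 * g) + a * 9 * g + e * (- 6 + w * (- 36) + a ^ 2 * 18
        + e * (w * (18 + w * 18) + e * (- 18 * w ^ 2 + b ^ 3 * 6 + e * (6 * w ^ 3 + b ^ 3 * (- 12) + a ^ 3 * 6))))))))"
  have n: "(N - 1) * x2 ^ 3 = e ^ 8 * b ^ 3 * (1 - 2 * e)" "(N - 1) * x2 = e\<^sup>2 * b * (1 - 2 * e)"
    unfolding x2_def using N by algebra+
  have "6 * (x1 ^ 3 + (N - 1) * x2 ^ 3 + x3 ^ 3) + 9 * A * (x1 + (N - 1) * x2 + x3) = 15 + e * U"
    unfolding n unfolding x1_def x3_def A_def U_def by algebra
  then have "15 * (N + 1) - N * (6 * (x1 ^ 3 + (N - 1) * x2 ^ 3 + x3 ^ 3) + 9 * A * (x1 + (N - 1) * x2 + x3)) = 15 - N * e * U"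
    by (simp add: algebra_simps)
  also have "\<dots> = 6 + 18 * e - 9 * e * (b + g) + e\<^sup>2 * ?R"
    unfolding N U_def by algebra
  finally show ?thesis .
qed

lemma smallo_bound_spectral:
  fixes f :: "nat \<Rightarrow> real"
  assumes "\<forall>\<^sub>F d in sequentially. \<bar>f d\<bar> \<le> K * (1 / real d)"
  shows "f \<in> o(\<lambda>d. real d powr (-2/3))"
proof (rule bigo_imp_smallo_spectral, rule bigoI[of _ K])
  show "\<forall>\<^sub>F d in sequentially. norm (f d) \<le> K * norm (1 / real d)" using assms by simp
qed

lemma family_D2:
  "\<exists>(\<xi>\<^sub>1 :: nat \<Rightarrow> real) (\<xi>\<^sub>2 :: nat \<Rightarrow> real) (\<xi>\<^sub>3 :: nat \<Rightarrow> real)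
     (\<xi>\<^sub>4 :: nat \<Rightarrow> real) (\<xi>\<^sub>5 :: nat \<Rightarrow> real) (d0 :: nat).
     let D2 = (\<lambda>d. Xi d (\<xi>\<^sub>1 d) (\<xi>\<^sub>2 d) (\<xi>\<^sub>3 d) (\<xi>\<^sub>4 d) (\<xi>\<^sub>5 d));
         H = (\<lambda>d. hessian d (loss d) (D2 d))
     in (\<lambda>d. \<xi>\<^sub>1 d - (1 - 5 / (3 * real d ^ 3) + 9 / real d ^ 4)) \<in> o(\<lambda>d. 1 / real d ^ 4) \<and>
        (\<lambda>d. \<xi>\<^sub>2 d - (- 1 / real d ^ 3 + 7 / real d ^ 4)) \<in> o(\<lambda>d. 1 / real d ^ 4) \<and>
        (\<lambda>d. \<xi>\<^sub>3 d - (1 / real d - 1 / real d ^ 2 + 2 / real d ^ 3 + 10 / (3 * real d ^ 4)))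
          \<in> o(\<lambda>d. 1 / real d ^ 4) \<and>
        \<xi>\<^sub>4 \<in> o(\<lambda>d. 1 / real d ^ 4) \<and>
        \<xi>\<^sub>5 \<in> o(\<lambda>d. 1 / real d ^ 4) \<and>
        (\<forall>d\<ge>d0.
           critical_point d (loss d) (D2 d) \<and>
           isotropy d (D2 d) = Diag (Sym_fix_last d) \<and>
           card (orbit d (D2 d)) = d * fact d) \<and>
        (\<lambda>d. loss d (D2 d) - (6 + 18 / real d)) \<in> o(\<lambda>d. 1 / real d) \<and>
        asymp_spectrum d0 H (\<lambda>d. diag_comp_t d (d - 1)) (\<lambda>d. 1)
          [\<lambda>d. 0, \<lambda>d. 0, \<lambda>d. 108, \<lambda>d. 18 * real d + 18, \<lambda>d. 18 * real d + 162] \<and>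
        asymp_spectrum d0 H (\<lambda>d. diag_comp_s d (d - 1)) (\<lambda>d. d - 2)
          [\<lambda>d. 0, \<lambda>d. 36, \<lambda>d. 36, \<lambda>d. 108, \<lambda>d. 18 * real d + 162] \<and>
        asymp_spectrum d0 H (\<lambda>d. diag_comp_x d (d - 1)) (\<lambda>d. (d - 2) * (d - 3) div 2)
          [\<lambda>d. 36] \<and>
        asymp_spectrum d0 H (\<lambda>d. diag_comp_y d (d - 1)) (\<lambda>d. (d - 1) * (d - 4) div 2)
          [\<lambda>d. 36]"
proof -
  obtain a b c w where br: "branch a b c w" using branch_exists by blast
  have sys: "\<forall>\<^sub>F d in sequentially. reduced_system (1 / real d) (a d) (b d) (c d)"
    and cw: "\<forall>\<^sub>F d in sequentially. c d = 1 - 1 / real d + (1 / real d)\<^sup>2 * w d"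
    and lim: "a \<longlonglongrightarrow> - 5 / 3" "b \<longlonglongrightarrow> - 1" "c \<longlonglongrightarrow> 1" "w \<longlonglongrightarrow> 2"
    and lim': "(\<lambda>d. (a d + 5 / 3) * real d) \<longlonglongrightarrow> 9" "(\<lambda>d. (b d + 1) * real d) \<longlonglongrightarrow> 7"
      "(\<lambda>d. (w d - 2) * real d) \<longlonglongrightarrow> 10 / 3"
    using br unfolding branch_def by blast+
  define e where "e = (\<lambda>d::nat. 1 / real d)"
  define N where "N = (\<lambda>d. 1 / e d - 1)"
  define g where "g = (\<lambda>d. A2 (e d) (a d) (b d) (c d))"
  define h where "h = (\<lambda>d. B2 (e d) (a d) (b d) (c d))"
  define p where "p = (\<lambda>d. 1 + e d ^ 3 * (a d - b d))"
  define q where "q = (\<lambda>d. e d ^ 3 * b d)"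
  define r where "r = (\<lambda>d. e d * c d)"
  \<comment> \<open>\<open>f3\<close> is the diagonal entry \<open>p + q\<close>. The last row of
    \<open>D\<close> is zero exactly, so \<open>\<xi>\<^sub>4\<close> and
    \<open>\<xi>\<^sub>5\<close> are the zero functions.\<close>
  define f3 where "f3 = (\<lambda>d. 1 + e d ^ 3 * a d)"
  define D where "D = (\<lambda>d. Xi d (f3 d) (q d) (r d) 0 0)"
  define H where "H = (\<lambda>d. hessian d (loss d) (D d))"
  have e0: "e \<longlonglongrightarrow> 0" unfolding e_def by (rule tendsto_one_over_nat)
  have g1: "g \<longlonglongrightarrow> 1" and h1: "h \<longlonglongrightarrow> 1"
    unfolding g_def h_def A2_def B2_def A3_def B3_def by (rule tendsto_eq_intros refl e0 lim | simp)+
  have epos: "\<forall>\<^sub>F d in sequentially. e d > 0"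
    using eventually_gt_at_top[of 0] by eventually_elim (simp add: e_def)
  have Nd: "N d = real d - 1" for d by (simp add: N_def e_def)
  have ab: "(\<lambda>d. a d - b d) \<longlonglongrightarrow> - 5 / 3 - - 1" by (intro tendsto_diff lim)
  have N: "\<And>d. N d = 1 / e d - 1" by (simp add: N_def)
  note sp = e0 ab lim(2) lim(4) g1 h1 epos
  obtain Ks where Ks: "\<forall>\<^sub>F d in sequentially. \<exists>v l. inner_form.orthonormal (form_s (N d)) 4 v \<and>
    (\<forall>i<4. hess_s (N d) (1 + e d ^ 3 * (a d - b d)) (e d ^ 3 * b d) (e d - (e d)\<^sup>2 + e d ^ 3 * w d)
        (1 + (e d)\<^sup>2 * g d) ((e d)\<^sup>2 * h d) (v i) = l i *\<^sub>R v i \<and> \<bar>l i - [1, 1, 3, N d / 2 + 5] ! i\<bar> \<le> Ks * e d)"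
    using eventually_spectrum_s[OF sp N] by blast
  obtain Kt where Kt: "\<forall>\<^sub>F d in sequentially. \<exists>v l. inner_form.orthonormal (form_t (N d)) 3 v \<and>
    (\<forall>i<3. hess_t (N d) (1 + e d ^ 3 * (a d - b d)) (e d ^ 3 * b d) (e d - (e d)\<^sup>2 + e d ^ 3 * w d)
        (1 + (e d)\<^sup>2 * g d) ((e d)\<^sup>2 * h d) (v i) = l i *\<^sub>R v i \<and> \<bar>l i - [3, N d / 2 + 1, N d / 2 + 5] ! i\<bar> \<le> Kt * e d)"
    using eventually_spectrum_t[OF sp N] by blast
  have "(\<lambda>d. p d) \<longlonglongrightarrow> 1" unfolding p_def by (rule tendsto_eq_intros refl e0 lim | simp)+
  then have pp: "\<forall>\<^sub>F d in sequentially. p d > 0" by (rule order_tendstoD) simp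
  have cp: "\<forall>\<^sub>F d in sequentially. c d > 0" using lim(3) by (rule order_tendstoD) simp
  \<comment> \<open>All facts about individual \<open>d\<close> are gathered in one predicate
    because a single threshold \<open>d0\<close> has to serve every assertion.
    \<open>d \<ge> 4\<close> makes the block size at least 3, as the component lemmas
    require.\<close>
  define good where "good = (\<lambda>d. stationary (d - 1) (p d) (q d) (r d) \<and> gram (d - 1) (p d) (q d) (r d) = (e d)\<^sup>2 * h d \<and>
    (p d)\<^sup>2 + gram (d - 1) (p d) (q d) (r d) = 1 + (e d)\<^sup>2 * g d \<and> p d \<noteq> 0 \<and> r d \<noteq> 0 \<and>
    c d = 1 - e d + (e d)\<^sup>2 * w d \<and> d \<ge> 4 \<and>
    (\<exists>l. spectrum_on (H d) (diag_comp_s d (d - 1)) [(0, d - 2), (36 * l 0, d - 2), (36 * l 1, d - 2), (36 * l 2, d - 2), (36 * l 3, d - 2)]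
      \<and> (\<forall>i<4. \<bar>l i - [1, 1, 3, N d / 2 + 5] ! i\<bar> \<le> Ks * e d)) \<and>
    (\<exists>l. spectrum_on (H d) (diag_comp_t d (d - 1)) [(0, 1), (0, 1), (36 * l 0, 1), (36 * l 1, 1), (36 * l 2, 1)]
      \<and> (\<forall>i<3. \<bar>l i - [3, N d / 2 + 1, N d / 2 + 5] ! i\<bar> \<le> Kt * e d)))"
  have D_eq: "D d = D2 (d - 1) (p d) (q d) (r d)" if "d \<ge> 1" for d
    using that by (simp add: D_def D2_def f3_def p_def q_def algebra_simps)
  have "\<forall>\<^sub>F d in sequentially. good d"
    using sys cw Ks Kt pp cp eventually_ge_at_top[of 4]
  proof eventually_elim
    case (elim d)
    have d: "d \<ge> 2" "d = Suc (d - 1)" "d - 1 \<ge> 3" "real (d - 1) = N d" "d - 1 - 1 = d - 2"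
      using elim(7) by (auto simp: Nd of_nat_diff)
    have st: "stationary (d - 1) (p d) (q d) (r d)" "gram (d - 1) (p d) (q d) (r d) = (e d)\<^sup>2 * h d"
      "(p d)\<^sup>2 + gram (d - 1) (p d) (q d) (r d) = 1 + (e d)\<^sup>2 * g d"
      using stationary_reduced[OF d(1) elim(1)] unfolding p_def q_def r_def g_def h_def e_def by blast+
    have cd: "c d = 1 - e d + (e d)\<^sup>2 * w d" using elim(2) by (simp add: e_def)
    have rd: "r d = e d - (e d)\<^sup>2 + e d ^ 3 * w d"
      unfolding r_def cd by (simp add: power2_eq_square power3_eq_cube algebra_simps)
    have pd: "1 + e d ^ 3 * (a d - b d) = p d" "e d ^ 3 * b d = q d" by (simp_all add: p_def q_def)
    have Hd: "H d = hessian (Suc (d - 1)) (loss (Suc (d - 1))) (D2 (d - 1) (p d) (q d) (r d))"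
      using d(1) by (simp add: H_def D_eq)
    have "\<exists>l. spectrum_on (H d) (diag_comp_s d (d - 1)) [(0, d - 2), (36 * l 0, d - 2), (36 * l 1, d - 2), (36 * l 2, d - 2), (36 * l 3, d - 2)]
      \<and> (\<forall>i<4. \<bar>l i - [1, 1, 3, N d / 2 + 5] ! i\<bar> \<le> Ks * e d)"
    proof -
      obtain v l where vl: "inner_form.orthonormal (form_s (N d)) 4 v"
        "\<And>i. i < 4 \<Longrightarrow> hess_s (N d) (p d) (q d) (r d) (1 + (e d)\<^sup>2 * g d) ((e d)\<^sup>2 * h d) (v i) = l i *\<^sub>R v i"
        "\<And>i. i < 4 \<Longrightarrow> \<bar>l i - [1, 1, 3, N d / 2 + 5] ! i\<bar> \<le> Ks * e d"
        using elim(3) unfolding pd rd[symmetric] by blast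
      have eig: "hess_s (real (d - 1)) (p d) (q d) (r d) ((p d)\<^sup>2 + gram (d - 1) (p d) (q d) (r d)) (gram (d - 1) (p d) (q d) (r d)) (v i) = l i *\<^sub>R v i"
        if "i < 4" for i
        unfolding d(4) st(3) unfolding st(2) by (rule vl(2)[OF that])
      have orth: "inner_form.orthonormal (form_s (real (d - 1))) 4 v" unfolding d(4) by (rule vl(1))
      have "spectrum_on (H d) (diag_comp_s d (d - 1)) [(0, d - 2), (36 * l 0, d - 2), (36 * l 1, d - 2), (36 * l 2, d - 2), (36 * l 3, d - 2)]"
        using spectrum_D2_s[OF st(1) d(3) orth eig] unfolding Hd d(2)[symmetric] d(5) by simp
      then show ?thesis using vl(3) by blast
    qed
    moreover have "\<exists>l. spectrum_on (H d) (diag_comp_t d (d - 1)) [(0, 1), (0, 1), (36 * l 0, 1), (36 * l 1, 1), (36 * l 2, 1)]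
      \<and> (\<forall>i<3. \<bar>l i - [3, N d / 2 + 1, N d / 2 + 5] ! i\<bar> \<le> Kt * e d)"
    proof -
      obtain v l where vl: "inner_form.orthonormal (form_t (N d)) 3 v"
        "\<And>i. i < 3 \<Longrightarrow> hess_t (N d) (p d) (q d) (r d) (1 + (e d)\<^sup>2 * g d) ((e d)\<^sup>2 * h d) (v i) = l i *\<^sub>R v i"
        "\<And>i. i < 3 \<Longrightarrow> \<bar>l i - [3, N d / 2 + 1, N d / 2 + 5] ! i\<bar> \<le> Kt * e d"
        using elim(4) unfolding pd rd[symmetric] by blast
      have eig: "hess_t (real (d - 1)) (p d) (q d) (r d) ((p d)\<^sup>2 + gram (d - 1) (p d) (q d) (r d)) (gram (d - 1) (p d) (q d) (r d)) (v i) = l i *\<^sub>R v i"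
        if "i < 3" for i
        unfolding d(4) st(3) unfolding st(2) by (rule vl(2)[OF that])
      have orth: "inner_form.orthonormal (form_t (real (d - 1))) 3 v" unfolding d(4) by (rule vl(1))
      have "spectrum_on (H d) (diag_comp_t d (d - 1)) [(0, 1), (0, 1), (36 * l 0, 1), (36 * l 1, 1), (36 * l 2, 1)]"
        using spectrum_D2_t[OF st(1) d(3) orth eig] unfolding Hd d(2)[symmetric] by simp
      then show ?thesis using vl(3) by blast
    qed
    moreover have "p d \<noteq> 0" "r d \<noteq> 0" using elim(5,6,7) by (simp_all add: r_def e_def)
    ultimately show ?case using st cd elim(7) unfolding good_def by blast
  qed
  then obtain d0 where d0: "\<And>d. d \<ge> d0 \<Longrightarrow> good d" by (auto simp: eventually_sequentially)
  have ev: "\<forall>\<^sub>F d in sequentially. good d" using d0 by (auto simp: eventually_sequentially)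
  have ev_d0: "\<forall>\<^sub>F d in sequentially. d \<ge> d0" by (rule eventually_ge_at_top)
  have single: "f \<in> o(\<lambda>d. 1 / real d ^ k)"
    if "\<forall>\<^sub>F d in sequentially. f d * real d ^ k = F d" "F \<longlonglongrightarrow> 0" for f F :: "nat \<Rightarrow> real" and k
    using tendsto_imp_smallo[of f k] that tendsto_cong[of "\<lambda>d. f d * real d ^ k" F sequentially 0] by blast
  have ev1: "\<forall>\<^sub>F d in sequentially. (d::nat) \<ge> 1" by (rule eventually_ge_at_top)
  have xi1: "(\<lambda>d. f3 d - (1 - 5 / (3 * real d ^ 3) + 9 / real d ^ 4)) \<in> o(\<lambda>d. 1 / real d ^ 4)"
  proof (rule single)
    show "\<forall>\<^sub>F d in sequentially. (f3 d - (1 - 5 / (3 * real d ^ 3) + 9 / real d ^ 4)) * real d ^ 4 = (a d + 5 / 3) * real d - 9"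
      using ev1 by eventually_elim (simp add: f3_def e_def field_simps eval_nat_numeral)
    show "(\<lambda>d. (a d + 5 / 3) * real d - 9) \<longlonglongrightarrow> 0" using tendsto_diff[OF lim'(1) tendsto_const[of 9]] by simp
  qed
  have xi2: "(\<lambda>d. q d - (- 1 / real d ^ 3 + 7 / real d ^ 4)) \<in> o(\<lambda>d. 1 / real d ^ 4)"
  proof (rule single)
    show "\<forall>\<^sub>F d in sequentially. (q d - (- 1 / real d ^ 3 + 7 / real d ^ 4)) * real d ^ 4 = (b d + 1) * real d - 7"
      using ev1 by eventually_elim (simp add: q_def e_def field_simps eval_nat_numeral)
    show "(\<lambda>d. (b d + 1) * real d - 7) \<longlonglongrightarrow> 0" using tendsto_diff[OF lim'(2) tendsto_const[of 7]] by simp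
  qed
  have xi3: "(\<lambda>d. r d - (1 / real d - 1 / real d ^ 2 + 2 / real d ^ 3 + 10 / (3 * real d ^ 4))) \<in> o(\<lambda>d. 1 / real d ^ 4)"
  proof (rule single)
    show "\<forall>\<^sub>F d in sequentially. (r d - (1 / real d - 1 / real d ^ 2 + 2 / real d ^ 3 + 10 / (3 * real d ^ 4))) * real d ^ 4 = (w d - 2) * real d - 10 / 3"
      using ev1 cw
    proof eventually_elim
      case (elim d)
      then show ?case unfolding r_def elim(2) by (simp add: e_def field_simps eval_nat_numeral)
    qed
    show "(\<lambda>d. (w d - 2) * real d - 10 / 3) \<longlonglongrightarrow> 0" using tendsto_diff[OF lim'(3) tendsto_const[of "10 / 3"]] by simp
  qed
  have xi4: "(\<lambda>d. 0) \<in> o(\<lambda>d. 1 / real d ^ 4)" by simp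
  have crit: "critical_point d (loss d) (D d) \<and> isotropy d (D d) = Diag (Sym_fix_last d) \<and> card (orbit d (D d)) = d * fact d"
    if "d \<ge> d0" for d
  proof -
    have *: "stationary (d - 1) (p d) (q d) (r d)" "p d \<noteq> 0" "r d \<noteq> 0" "d \<ge> 4"
      using d0[OF that] unfolding good_def by blast+
    then have d: "Suc (d - 1) = d" "d - 1 \<ge> 2" "d \<ge> 1" by auto
    show ?thesis
      unfolding D_eq[OF d(3)]
      using critical_point_D2[OF *(1)] isotropy_D2[OF d(2) *(2,3), of "q d"] card_orbit_D2[OF d(2) *(2,3), of "q d"]
      unfolding d(1) by blast
  qed
  have lossD: "(\<lambda>d. loss d (D d) - (6 + 18 / real d)) \<in> o(\<lambda>d. 1 / real d ^ 1)"
  proof -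
    \<comment> \<open>The witness is the last bracket of \<open>loss_expansion\<close>, found by
      unification; only its convergence is used afterwards.\<close>
    have "\<exists>R. (\<forall>d. N d * e d = 1 - e d \<longrightarrow>
      15 * (N d + 1) - N d * (6 * ((1 + e d ^ 3 * a d) ^ 3 + (N d - 1) * (e d ^ 3 * b d) ^ 3 + (e d * (1 - e d + (e d)\<^sup>2 * w d)) ^ 3)
        + 9 * (1 + (e d)\<^sup>2 * g d) * ((1 + e d ^ 3 * a d) + (N d - 1) * (e d ^ 3 * b d) + e d * (1 - e d + (e d)\<^sup>2 * w d)))
      = 6 + 18 * e d - 9 * e d * (b d + g d) + (e d)\<^sup>2 * R d) \<and> convergent R"
      by (intro exI conjI allI impI, rule loss_expansion, assumption)
        (rule convergentI, (rule tendsto_const e0 lim g1 tendsto_add tendsto_diff tendsto_mult tendsto_power tendsto_minus)+)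
    then obtain R where R: "\<And>d. N d * e d = 1 - e d \<Longrightarrow>
      15 * (N d + 1) - N d * (6 * ((1 + e d ^ 3 * a d) ^ 3 + (N d - 1) * (e d ^ 3 * b d) ^ 3 + (e d * (1 - e d + (e d)\<^sup>2 * w d)) ^ 3)
        + 9 * (1 + (e d)\<^sup>2 * g d) * ((1 + e d ^ 3 * a d) + (N d - 1) * (e d ^ 3 * b d) + e d * (1 - e d + (e d)\<^sup>2 * w d)))
      = 6 + 18 * e d - 9 * e d * (b d + g d) + (e d)\<^sup>2 * R d" and Rlim: "convergent R"
      by blast
    show ?thesis
    proof (rule single)
      show "\<forall>\<^sub>F d in sequentially. (loss d (D d) - (6 + 18 / real d)) * real d ^ 1 = - 9 * (b d + g d) + e d * R d"
        using ev
      proof eventually_elim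
        case (elim d)
        then have *: "stationary (d - 1) (p d) (q d) (r d)" "(p d)\<^sup>2 + gram (d - 1) (p d) (q d) (r d) = 1 + (e d)\<^sup>2 * g d"
          "c d = 1 - e d + (e d)\<^sup>2 * w d" "d \<ge> 4"
          unfolding good_def by blast+
        have d: "Suc (d - 1) = d" "real (d - 1) = N d" "d \<ge> 1" using *(4) by (auto simp: Nd of_nat_diff)
        have ed: "e d * real d = 1" "N d * e d = 1 - e d" using d(3) by (simp_all add: e_def Nd field_simps)
        have pq: "p d + q d = 1 + e d ^ 3 * a d" by (simp add: p_def q_def algebra_simps)
        have pN: "p d + N d * q d + r d = (1 + e d ^ 3 * a d) + (N d - 1) * (e d ^ 3 * b d) + e d * c d"
          by (simp add: p_def q_def r_def algebra_simps)
        have "loss d (D d) = 15 * (N d + 1) - N d * (6 * ((1 + e d ^ 3 * a d) ^ 3 + (N d - 1) * (e d ^ 3 * b d) ^ 3 + (e d * c d) ^ 3)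
          + 9 * (1 + (e d)\<^sup>2 * g d) * ((1 + e d ^ 3 * a d) + (N d - 1) * (e d ^ 3 * b d) + e d * c d))"
          using loss_D2[OF *(1)] unfolding D_eq[OF d(3)] d(1,2) *(2) pq pN unfolding q_def r_def .
        also have "\<dots> = 6 + 18 * e d - 9 * e d * (b d + g d) + (e d)\<^sup>2 * R d"
          unfolding *(3) by (rule R[OF ed(2)])
        finally have "(loss d (D d) - (6 + 18 * e d)) * real d = (- 9 * (b d + g d) + e d * R d) * (e d * real d)"
          by algebra
        then show ?case unfolding ed by (simp add: e_def)
      qed
      obtain R0 where "R \<longlonglongrightarrow> R0" using Rlim by (auto simp: convergent_def)
      then have "(\<lambda>d. - 9 * (b d + g d) + e d * R d) \<longlonglongrightarrow> - 9 * (- 1 + 1) + 0 * R0"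
        by (intro tendsto_intros lim g1 e0)
      then show "(\<lambda>d. - 9 * (b d + g d) + e d * R d) \<longlonglongrightarrow> 0" by simp
    qed
  qed
  have spec_s: "asymp_spectrum d0 H (\<lambda>d. diag_comp_s d (d - 1)) (\<lambda>d. d - 2)
          [\<lambda>d. 0, \<lambda>d. 36, \<lambda>d. 36, \<lambda>d. 108, \<lambda>d. 18 * real d + 162]"
  proof -
    \<comment> \<open>The eigenvalues exist for each \<open>d\<close> separately, and choice turns
      them into sequences. Their order is that of the targets, so each sequence is compared with one
      fixed target.\<close>
    have "\<forall>d. \<exists>l. d \<ge> d0 \<longrightarrow> spectrum_on (H d) (diag_comp_s d (d - 1)) [(0, d - 2), (36 * l 0, d - 2), (36 * l 1, d - 2), (36 * l 2, d - 2), (36 * l 3, d - 2)]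
      \<and> (\<forall>i<4. \<bar>l i - [1, 1, 3, N d / 2 + 5] ! i\<bar> \<le> Ks * e d)"
      using d0 unfolding good_def by blast
    then obtain L where L: "\<And>d. d \<ge> d0 \<Longrightarrow> spectrum_on (H d) (diag_comp_s d (d - 1)) [(0, d - 2), (36 * L d 0, d - 2), (36 * L d 1, d - 2), (36 * L d 2, d - 2), (36 * L d 3, d - 2)]"
      "\<And>d i. d \<ge> d0 \<Longrightarrow> i < 4 \<Longrightarrow> \<bar>L d i - [1, 1, 3, N d / 2 + 5] ! i\<bar> \<le> Ks * e d"
      by metis
    have o: "(\<lambda>d. 36 * L d i - A d) \<in> o(\<lambda>d. real d powr (-2/3))"
      if "i < 4" "\<And>d. A d = 36 * [1, 1, 3, N d / 2 + 5] ! i" for i A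
    proof (rule smallo_bound_spectral[where K = "36 * Ks"])
      show "\<forall>\<^sub>F d in sequentially. \<bar>36 * L d i - A d\<bar> \<le> 36 * Ks * (1 / real d)"
        using ev_d0
      proof eventually_elim
        case (elim d)
        have "36 * L d i - A d = 36 * (L d i - [1, 1, 3, N d / 2 + 5] ! i)" by (simp only: that(2) right_diff_distrib)
        then show ?case using L(2)[OF elim that(1)] by (simp add: e_def abs_mult)
      qed
    qed
    show ?thesis
      unfolding asymp_spectrum_def
    proof (intro exI[of _ "[\<lambda>d. 0, \<lambda>d. 36 * L d 0, \<lambda>d. 36 * L d 1, \<lambda>d. 36 * L d 2, \<lambda>d. 36 * L d 3]"] conjI allI impI)
      show "list_all2 (\<lambda>l a. (\<lambda>d. l d - a d) \<in> o(\<lambda>d. real d powr (-2/3)))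
        [\<lambda>d. 0, \<lambda>d. 36 * L d 0, \<lambda>d. 36 * L d 1, \<lambda>d. 36 * L d 2, \<lambda>d. 36 * L d 3]
        [\<lambda>d. 0, \<lambda>d. 36, \<lambda>d. 36, \<lambda>d. 108, \<lambda>d. 18 * real d + 162]"
        unfolding list_all2_Cons by (intro conjI o) (simp_all add: Nd numeral_eq_Suc field_simps)
    qed (use L(1) in simp)
  qed
  have spec_t: "asymp_spectrum d0 H (\<lambda>d. diag_comp_t d (d - 1)) (\<lambda>d. 1)
          [\<lambda>d. 0, \<lambda>d. 0, \<lambda>d. 108, \<lambda>d. 18 * real d + 18, \<lambda>d. 18 * real d + 162]"
  proof -
    have "\<forall>d. \<exists>l. d \<ge> d0 \<longrightarrow> spectrum_on (H d) (diag_comp_t d (d - 1)) [(0, 1), (0, 1), (36 * l 0, 1), (36 * l 1, 1), (36 * l 2, 1)]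
      \<and> (\<forall>i<3. \<bar>l i - [3, N d / 2 + 1, N d / 2 + 5] ! i\<bar> \<le> Kt * e d)"
      using d0 unfolding good_def by blast
    then obtain L where L: "\<And>d. d \<ge> d0 \<Longrightarrow> spectrum_on (H d) (diag_comp_t d (d - 1)) [(0, 1), (0, 1), (36 * L d 0, 1), (36 * L d 1, 1), (36 * L d 2, 1)]"
      "\<And>d i. d \<ge> d0 \<Longrightarrow> i < 3 \<Longrightarrow> \<bar>L d i - [3, N d / 2 + 1, N d / 2 + 5] ! i\<bar> \<le> Kt * e d"
      by metis
    have o: "(\<lambda>d. 36 * L d i - A d) \<in> o(\<lambda>d. real d powr (-2/3))"
      if "i < 3" "\<And>d. A d = 36 * [3, N d / 2 + 1, N d / 2 + 5] ! i" for i A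
    proof (rule smallo_bound_spectral[where K = "36 * Kt"])
      show "\<forall>\<^sub>F d in sequentially. \<bar>36 * L d i - A d\<bar> \<le> 36 * Kt * (1 / real d)"
        using ev_d0
      proof eventually_elim
        case (elim d)
        have "36 * L d i - A d = 36 * (L d i - [3, N d / 2 + 1, N d / 2 + 5] ! i)" by (simp only: that(2) right_diff_distrib)
        then show ?case using L(2)[OF elim that(1)] by (simp add: e_def abs_mult)
      qed
    qed
    show ?thesis
      unfolding asymp_spectrum_def
    proof (intro exI[of _ "[\<lambda>d. 0, \<lambda>d. 0, \<lambda>d. 36 * L d 0, \<lambda>d. 36 * L d 1, \<lambda>d. 36 * L d 2]"] conjI allI impI)
      show "list_all2 (\<lambda>l a. (\<lambda>d. l d - a d) \<in> o(\<lambda>d. real d powr (-2/3)))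
        [\<lambda>d. 0, \<lambda>d. 0, \<lambda>d. 36 * L d 0, \<lambda>d. 36 * L d 1, \<lambda>d. 36 * L d 2]
        [\<lambda>d. 0, \<lambda>d. 0, \<lambda>d. 108, \<lambda>d. 18 * real d + 18, \<lambda>d. 18 * real d + 162]"
        unfolding list_all2_Cons by (intro conjI o) (simp_all add: Nd numeral_eq_Suc field_simps)
    qed (use L(1) in simp)
  qed
  \<comment> \<open>In types x and y the eigenvalues \<open>36 * p\<close> and
    \<open>36 * (p + 4 * B * p^2)\<close>, with \<open>B\<close> the inner product of two distinct
    nonzero rows, are explicit, and a factor \<open>e\<close> splits off from their deviation from
    36.\<close>
  have near_36: "(\<lambda>d. 36 * (1 + e d * x d) - 36) \<in> o(\<lambda>d. real d powr (-2/3))" if conv: "convergent x" for x :: "nat \<Rightarrow> real"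
  proof -
    obtain K where K: "\<And>d. \<bar>x d\<bar> \<le> K"
      using convergent_imp_Bseq[OF conv] by (auto simp: Bseq_def)
    show ?thesis
    proof (rule smallo_bound_spectral[where K = "36 * K"])
      show "\<forall>\<^sub>F d in sequentially. \<bar>36 * (1 + e d * x d) - 36\<bar> \<le> 36 * K * (1 / real d)"
        using K by (auto simp: e_def abs_mult intro!: always_eventually divide_right_mono)
    qed
  qed
  have spec_x: "asymp_spectrum d0 H (\<lambda>d. diag_comp_x d (d - 1)) (\<lambda>d. (d - 2) * (d - 3) div 2) [\<lambda>d. 36]"
    unfolding asymp_spectrum_def
  proof (intro exI[of _ "[\<lambda>d. 36 * (1 + e d * ((e d)\<^sup>2 * (a d - b d)))]"] conjI allI impI)
    have "(\<lambda>d. 36 * (1 + e d * ((e d)\<^sup>2 * (a d - b d))) - 36) \<in> o(\<lambda>d. real d powr (-2/3))"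
      by (rule near_36, rule convergentI, (rule tendsto_const e0 lim tendsto_diff tendsto_mult tendsto_power)+)
    then show "list_all2 (\<lambda>l a. (\<lambda>d. l d - a d) \<in> o(\<lambda>d. real d powr (-2/3)))
      [\<lambda>d. 36 * (1 + e d * ((e d)\<^sup>2 * (a d - b d)))] [\<lambda>d. 36]" by simp
    fix d assume "d \<ge> d0"
    then have *: "stationary (d - 1) (p d) (q d) (r d)" "d \<ge> 4" using d0 unfolding good_def by blast+
    then have d: "Suc (d - 1) = d" "d - 1 \<ge> 3" "d - 1 - 1 = d - 2" "d - 1 - 2 = d - 3" "d \<ge> 1" by auto
    have "36 * (1 + e d * ((e d)\<^sup>2 * (a d - b d))) = 36 * p d"
      by (simp add: p_def power2_eq_square power3_eq_cube)
    from spectrum_D2_x[OF *(1) d(2) this]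
    show "spectrum_on (H d) (diag_comp_x d (d - 1)) (map (\<lambda>l. (l d, (d - 2) * (d - 3) div 2)) [\<lambda>d. 36 * (1 + e d * ((e d)\<^sup>2 * (a d - b d)))])"
      unfolding d by (simp add: H_def D_eq[OF d(5)])
  qed
  have spec_y: "asymp_spectrum d0 H (\<lambda>d. diag_comp_y d (d - 1)) (\<lambda>d. (d - 1) * (d - 4) div 2) [\<lambda>d. 36]"
    unfolding asymp_spectrum_def
  proof (intro exI[of _ "[\<lambda>d. 36 * (1 + e d * ((e d)\<^sup>2 * (a d - b d) + 4 * (e d * h d) * (p d)\<^sup>2))]"] conjI allI impI)
    have "(\<lambda>d. 36 * (1 + e d * ((e d)\<^sup>2 * (a d - b d) + 4 * (e d * h d) * (p d)\<^sup>2)) - 36) \<in> o(\<lambda>d. real d powr (-2/3))"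
      by (rule near_36, unfold p_def, rule convergentI, (rule tendsto_const e0 lim h1 tendsto_add tendsto_diff tendsto_mult tendsto_power)+)
    then show "list_all2 (\<lambda>l a. (\<lambda>d. l d - a d) \<in> o(\<lambda>d. real d powr (-2/3)))
      [\<lambda>d. 36 * (1 + e d * ((e d)\<^sup>2 * (a d - b d) + 4 * (e d * h d) * (p d)\<^sup>2))] [\<lambda>d. 36]" by simp
    fix d assume "d \<ge> d0"
    then have *: "stationary (d - 1) (p d) (q d) (r d)" "d \<ge> 4" "gram (d - 1) (p d) (q d) (r d) = (e d)\<^sup>2 * h d"
      using d0 unfolding good_def by blast+
    then have d: "Suc (d - 1) = d" "d - 1 \<ge> 3" "d - 1 - 3 = d - 4" "d \<ge> 1" by auto
    have "1 + e d * ((e d)\<^sup>2 * (a d - b d) + 4 * (e d * h d) * (p d)\<^sup>2) = (1 + e d ^ 3 * (a d - b d)) + 4 * ((e d)\<^sup>2 * h d) * (p d)\<^sup>2"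
      by (simp add: power2_eq_square power3_eq_cube algebra_simps)
    then have "36 * (1 + e d * ((e d)\<^sup>2 * (a d - b d) + 4 * (e d * h d) * (p d)\<^sup>2)) = 36 * (p d + 4 * gram (d - 1) (p d) (q d) (r d) * (p d)\<^sup>2)"
      unfolding *(3) by (simp add: p_def)
    from spectrum_D2_y[OF *(1) d(2) this]
    show "spectrum_on (H d) (diag_comp_y d (d - 1)) (map (\<lambda>l. (l d, (d - 1) * (d - 4) div 2)) [\<lambda>d. 36 * (1 + e d * ((e d)\<^sup>2 * (a d - b d) + 4 * (e d * h d) * (p d)\<^sup>2))])"
      unfolding d by (simp add: H_def D_eq[OF d(4)])
  qed
  have crit': "\<forall>d\<ge>d0. critical_point d (loss d) (D d) \<and> isotropy d (D d) = Diag (Sym_fix_last d) \<and> card (orbit d (D d)) = d * fact d"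
    using crit by blast
  show ?thesis
    by (rule exI[of _ f3], rule exI[of _ q], rule exI[of _ r], rule exI[of _ "\<lambda>_. 0"], rule exI[of _ "\<lambda>_. 0"],
        rule exI[of _ d0], unfold Let_def)
      (intro conjI xi1 xi2 xi3 xi4 crit'[unfolded D_def] lossD[unfolded D_def power_one_right]
        spec_t[unfolded H_def D_def] spec_s[unfolded H_def D_def] spec_x[unfolded H_def D_def] spec_y[unfolded H_def D_def])
qed

theorem theorem2:
  shows
    "(\<forall>d. \<forall>W\<in>Mat d d. \<forall>A\<in>Mat d d. \<forall>B\<in>Mat d d.
        frob d (hessian d (loss d) W A) B = frob d A (hessian d (loss d) W B))
     \<and>
     ((\<forall>d\<ge>1.
         critical_point d (loss d) (D1 d) \<and>
         isotropy d (D1 d) = Sym d \<times> Sym d \<and>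
         loss d (D1 d) = 48 * real d / 5 - 36 / 5 - 12 / (5 * real d) \<and>
         card (orbit d (D1 d)) = 1) \<and>
      (let H = (\<lambda>d. hessian d (loss d) (D1 d));
           b0 = (\<lambda>d. 0);
           b1 = (\<lambda>d. 18 * 75 powr (1/3) / 5 * real d powr (1/3)
                    - 32 * 75 powr (1/3) / 5 * real d powr (-2/3))
       in asymp_spectrum 1 H prod_comp_t (\<lambda>d. 1)
            [\<lambda>d. 162 * 75 powr (1/3) / 5 * real d powr (1/3)
                 + 144 * 75 powr (1/3) / 5 * real d powr (-2/3)] \<and>
          (asymp_spectrum 1 H prod_comp_st (\<lambda>d. d - 1) [b0] \<and>
           asymp_spectrum 1 H prod_comp_ts (\<lambda>d. d - 1) [b1]
           \<or>
           asymp_spectrum 1 H prod_comp_st (\<lambda>d. d - 1) [b1] \<and>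
           asymp_spectrum 1 H prod_comp_ts (\<lambda>d. d - 1) [b0]) \<and>
          asymp_spectrum 1 H prod_comp_ss (\<lambda>d. (d - 1)\<^sup>2)
            [\<lambda>d. - (72 * 75 powr (1/3) / 25) * real d powr (1/3)
                 - 304 * 75 powr (1/3) / 25 * real d powr (-2/3)]))
     \<and>
     ((\<forall>d\<ge>1.
         critical_point d (loss d) (DI d) \<and>
         isotropy d (DI d) = Diag (Sym d) \<and>
         loss d (DI d) = 0 \<and>
         card (orbit d (DI d)) = fact d) \<and>
      (let H = (\<lambda>d. hessian d (loss d) (DI d))
       in asymp_spectrum 3 H (\<lambda>d. diag_comp_t d d) (\<lambda>d. 1)
            [\<lambda>d. 108, \<lambda>d. 18 * real d + 180] \<and>
          asymp_spectrum 3 H (\<lambda>d. diag_comp_s d d) (\<lambda>d. d - 1)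
            [\<lambda>d. 108, \<lambda>d. 36, \<lambda>d. 18 * real d + 180] \<and>
          asymp_spectrum 3 H (\<lambda>d. diag_comp_x d d) (\<lambda>d. (d - 1) * (d - 2) div 2)
            [\<lambda>d. 36] \<and>
          asymp_spectrum 3 H (\<lambda>d. diag_comp_y d d) (\<lambda>d. d * (d - 3) div 2)
            [\<lambda>d. 36]))
     \<and>
     (\<exists>(\<xi>\<^sub>1 :: nat \<Rightarrow> real) (\<xi>\<^sub>2 :: nat \<Rightarrow> real) (\<xi>\<^sub>3 :: nat \<Rightarrow> real)
        (\<xi>\<^sub>4 :: nat \<Rightarrow> real) (\<xi>\<^sub>5 :: nat \<Rightarrow> real) (d0 :: nat).
        let D2 = (\<lambda>d. Xi d (\<xi>\<^sub>1 d) (\<xi>\<^sub>2 d) (\<xi>\<^sub>3 d) (\<xi>\<^sub>4 d) (\<xi>\<^sub>5 d));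
            H = (\<lambda>d. hessian d (loss d) (D2 d))
        in (\<lambda>d. \<xi>\<^sub>1 d - (1 - 5 / (3 * real d ^ 3) + 9 / real d ^ 4)) \<in> o(\<lambda>d. 1 / real d ^ 4) \<and>
           (\<lambda>d. \<xi>\<^sub>2 d - (- 1 / real d ^ 3 + 7 / real d ^ 4)) \<in> o(\<lambda>d. 1 / real d ^ 4) \<and>
           (\<lambda>d. \<xi>\<^sub>3 d - (1 / real d - 1 / real d ^ 2 + 2 / real d ^ 3 + 10 / (3 * real d ^ 4)))
             \<in> o(\<lambda>d. 1 / real d ^ 4) \<and>
           \<xi>\<^sub>4 \<in> o(\<lambda>d. 1 / real d ^ 4) \<and>
           \<xi>\<^sub>5 \<in> o(\<lambda>d. 1 / real d ^ 4) \<and>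
           (\<forall>d\<ge>d0.
              critical_point d (loss d) (D2 d) \<and>
              isotropy d (D2 d) = Diag (Sym_fix_last d) \<and>
              card (orbit d (D2 d)) = d * fact d) \<and>
           (\<lambda>d. loss d (D2 d) - (6 + 18 / real d)) \<in> o(\<lambda>d. 1 / real d) \<and>
           asymp_spectrum d0 H (\<lambda>d. diag_comp_t d (d - 1)) (\<lambda>d. 1)
             [\<lambda>d. 0, \<lambda>d. 0, \<lambda>d. 108, \<lambda>d. 18 * real d + 18, \<lambda>d. 18 * real d + 162] \<and>
           asymp_spectrum d0 H (\<lambda>d. diag_comp_s d (d - 1)) (\<lambda>d. d - 2)
             [\<lambda>d. 0, \<lambda>d. 36, \<lambda>d. 36, \<lambda>d. 108, \<lambda>d. 18 * real d + 162] \<and>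
           asymp_spectrum d0 H (\<lambda>d. diag_comp_x d (d - 1)) (\<lambda>d. (d - 2) * (d - 3) div 2)
             [\<lambda>d. 36] \<and>
           asymp_spectrum d0 H (\<lambda>d. diag_comp_y d (d - 1)) (\<lambda>d. (d - 1) * (d - 4) div 2)
             [\<lambda>d. 36])"
proof (intro conjI)
  show "\<forall>d. \<forall>W\<in>Mat d d. \<forall>A\<in>Mat d d. \<forall>B\<in>Mat d d.
      frob d (hessian d (loss d) W A) B = frob d A (hessian d (loss d) W B)"
    using hessian_loss_self_adjoint by blast
next
  show "\<forall>d\<ge>1. critical_point d (loss d) (D1 d) \<and> isotropy d (D1 d) = Sym d \<times> Sym d \<and>
      loss d (D1 d) = 48 * real d / 5 - 36 / 5 - 12 / (5 * real d) \<and> card (orbit d (D1 d)) = 1"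
      proof (intro allI impI conjI)
    show "critical_point d (loss d) (D1 d)" if "d \<ge> 1" for d
      unfolding D1_eq by (rule critical_point_const_mat) (use d1c_cube that in \<open>simp_all\<close>)
  qed (simp_all add: isotropy_D1 loss_D1 card_orbit_D1)
next
  show "\<forall>d\<ge>1. critical_point d (loss d) (DI d) \<and> isotropy d (DI d) = Diag (Sym d) \<and>
      loss d (DI d) = 0 \<and> card (orbit d (DI d)) = fact d"
    using critical_point_DI isotropy_DI loss_DI card_orbit_DI by blast
\<comment> \<open>Of the two alternatives for the constant matrix the first holds: the eigenvalue 0
  belongs to the component on which the row permutations act by the standard representation.\<close>
qed (use D1_asymp_spectrum DI_asymp_spectrum family_D2 in \<open>simp_all only: Let_def simp_thms\<close>)

end
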